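(* Consider a finite-state, finite-action SMDP satisfying model assumption (M) below that is weakly communicating, and let $f:\mathbb{R}^d\to\mathbb{R}$ satisfy condition (F) below. Run the RVI Q-learning algorithm described below under the algorithmic requirements (R). Then, almost surely: (i) the sequence $\{Q_n\}$ converges to a compact connected subset of $\mathcal{Q}_f$, and $f(Q_n)\to r^*$; (ii) for every $\delta>0$ and every convergent subsequence $\{Q_{n_k}\}$, with limit $q^*\in\mathcal{Q}_f$, we have, as $k\to\infty$, $$\tau_{\delta,k}:=\min\{|s| : \|\bar x(\tilde t(n_k)+s)-q^*\|>\delta,\ s\in\mathbb{R}\}\to\infty,$$ where $\bar x(\cdot)$ and $\tilde t(\cdot)$ are the interpolated trajectory and ODE-times defined below.
   Context: SMDP setting. $\mathcal{S}$ is a finite state set, $\mathcal{A}$ a finite action set, and $d=|\mathcal{S}\times\mathcal{A}|$; vectors in $\mathbb{R}^d$ are indexed by pairs $(s,a)$, and $\mathbf{1}$ is the all-ones vector. For each $(s,a)$, $\mathbb{P}_{sa}$ is a Borel probability measure on $\mathcal{S}\times\mathbb{R}_+\times\mathbb{R}$. It gives the joint law of the next state $S$, holding time $\tau$ and reward $R$ when action $a$ is taken in state $s$; $\mathbb{E}_{sa}$ denotes expectation under $\mathbb{P}_{sa}$. Model assumption (M): (i) there is $\epsilon>0$ with $\mathbb{P}_{sa}(\tau\le\epsilon)<1$ for all $(s,a)$; (ii) $\mathbb{E}_{sa}[\tau^2]<\infty$ and $\mathbb{E}_{sa}[R^2]<\infty$ for all $(s,a)$. Let $r_{sa}=\mathbb{E}_{sa}[R]$,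 $t_{sa}=\mathbb{E}_{sa}[\tau]>0$, and $p^a_{ss'}=\mathbb{P}_{sa}(S=s')$. Policies are (possibly randomized, history-dependent) rules selecting actions at time $0$ and at each transition epoch. The average reward rate of a policy $\pi$ from initial state $s$ is $$r(\pi,s)=\liminf_{t\to\infty}t^{-1}\,\mathbb{E}^\pi_s\Big[\sum_{n=1}^{N_t}R_n\Big],\qquad N_t=\max\{n:\tau_1+\dots+\tau_n\le t\}.$$ The optimal reward rate is $r^*(s)=\sup_\pi r(\pi,s)$. The SMDP is weakly communicating if it has a unique closed communicating class $C$ and every other state is transient under every policy. Here $C$ is a set of states such that, starting in $C$, every state of $C$ is reachable with positive probability under some policy, while no state outside $C$ is ever visited under any policy. In a weakly communicating SMDP satisfying (M), $r^*(\cdot)$ is a constant, denoted $r^*$. $\mathcal{Q}$ is the set of $q\in\mathbb{R}^d$ solving the average-reward optimality equation $$q(s,a)=r_{sa}-t_{sa}r^*+\sum_{s'}p^a_{ss'}\max_{a'\in\mathcal{A}}q(s',a')\quad\text{for all }(s,a).$$ Condition (F). A function $g:\mathbb{R}^d\to\mathbb{R}$ is SISTr at $x$ if $c\in\mathbb{R}\mapsto g(x+c\mathbf{1})$ is strictly increasing and maps $\mathbb{R}$ onto $\mathbb{R}$; $g$ is SISTr if it is SISTr at every $x$. Condition (F) on $f$ requires: (i) $f$ is Lipschitz continuous and SISTr; (ii) as $c\uparrow\infty$, $f(cx)/c\to f_\infty(x)$ pointwise for some $f_\infty:\mathbb{R}^d\to\mathbb{R}$, and $f_\infty$ is SISTr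 at the origin. Let $\mathcal{Q}_f=\{q\in\mathcal{Q}:f(q)=r^*\}$. Algorithm. Given arbitrary $Q_0\in\mathbb{R}^d$ and $T_0\in\mathbb{R}^d_{\ge0}$, deterministic stepsizes $\alpha_k>0$ and $\beta_k$, and positive scalars $\eta_n$, iterate for $n\ge0$ as follows. - A random nonempty set $Y_n\subset\mathcal{S}\times\mathcal{A}$ is selected. - For each $(s,a)\in Y_n$, a fresh sample $(S^{sa}_{n+1},\tau^{sa}_{n+1},R^{sa}_{n+1})$ with law $\mathbb{P}_{sa}$ is generated, conditionally on the past. - Let $\nu(n,(s,a))=\sum_{k=0}^{n-1}\mathbb{1}\{(s,a)\in Y_k\}$. - For $(s,a)\notin Y_n$, the $(s,a)$ components of $Q$ and $T$ are unchanged. - For $(s,a)\in Y_n$: $$Q_{n+1}(s,a)=Q_n(s,a)+\alpha_{\nu(n,(s,a))}\Big(\frac{R^{sa}_{n+1}+\max_{a'}Q_n(S^{sa}_{n+1},a')-Q_n(s,a)}{T_n(s,a)\vee\eta_n}-f(Q_n)\Big),$$ $$T_{n+1}(s,a)=T_n(s,a)+\beta_{\nu(n,(s,a))}(\tau^{sa}_{n+1}-T_n(s,a)).$$ Requirements (R): (R-i) $\sum\alpha_n=\infty$, $\sum\alpha_n^2<\infty$, and $\alpha_{n+1}\le\alpha_n$ for all large $n$. Moreover, for each $x\in(0,1)$, $\sup_n\alpha_{[xn]}/\alpha_n<\infty$ and $\sum_{k=0}^{[yn]}\alpha_k/\sum_{k=0}^n\alpha_k\to1$ uniformly in $y\in[x,1]$.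 In addition: for some deterministic $\Delta>0$, $\liminf_n\nu(n,i)/n\ge\Delta$ a.s. for all $i\in\mathcal{S}\times\mathcal{A}$; and for each $x>0$ and all $i,j$, the limit $$\lim_n\frac{\sum_{k=\nu(n,i)}^{\nu(N(n,x),i)}\alpha_k}{\sum_{k=\nu(n,j)}^{\nu(N(n,x),j)}\alpha_k}$$ exists a.s., where $N(n,x)=\min\{m>n:\sum_{k=n}^m\alpha_k\ge x\}$. (R-ii) $\beta_n\in[0,1]$, $\sum\beta_n=\infty$, and $\sum\beta_n^2<\infty$. (R-iii) $\eta_n>0$ and $\eta_n\to0$. Trajectory. Let $\tilde\alpha_n=\sum_{i\in Y_n}\alpha_{\nu(n,i)}$ and $\tilde t(n)=\sum_{k=0}^{n-1}\tilde\alpha_k$, with $\tilde t(0)=0$. Define $\bar x(\tilde t(n))=Q_n$, let $\bar x$ be linear on each $[\tilde t(n),\tilde t(n+1)]$, and set $\bar x(t)=Q_0$ for $t<0$. *)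

theory Defs
  imports "HOL-Probability.Probability"
begin

text \<open>A sample (next state, holding time, reward) lives in S x R x R.\<close>
definition sample_M :: "('s \<times> real \<times> real) measure" where
  "sample_M = count_space UNIV \<Otimes>\<^sub>M (borel \<Otimes>\<^sub>M borel)"

text \<open>One transition of the controlled process: (action taken, next state, holding time, reward).\<close>
definition step_M :: "('a \<times> 's \<times> real \<times> real) measure" where
  "step_M = count_space UNIV \<Otimes>\<^sub>M sample_M"

definition hist_M :: "nat \<Rightarrow> (nat \<Rightarrow> 'a \<times> 's \<times> real \<times> real) measure" where
  "hist_M n = PiM {..<n} (\<lambda>_. step_M)"

definition traj_M :: "(nat \<Rightarrow> 'a \<times> 's \<times> real \<times> real) measure" where
  "traj_M = PiM UNIV (\<lambda>_. step_M)"

definition state_at :: "'s \<Rightarrow> nat \<Rightarrow> (nat \<Rightarrow> 'a \<times> 's \<times> real \<times> real) \<Rightarrow> 's" where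
  "state_at s0 n h = (if n = 0 then s0 else fst (snd (h (n - 1))))"

definition is_policy :: "(nat \<Rightarrow> 's \<Rightarrow> (nat \<Rightarrow> 'a \<times> 's \<times> real \<times> real) \<Rightarrow> 'a pmf) \<Rightarrow> bool" where
  "is_policy \<pi> \<longleftrightarrow> (\<forall>n s0 a. (\<lambda>h. pmf (\<pi> n s0 h) a) \<in> borel_measurable (hist_M n))"

primrec hist_law ::
  "('s \<times> 'a \<Rightarrow> ('s \<times> real \<times> real) measure) \<Rightarrow>
   (nat \<Rightarrow> 's \<Rightarrow> (nat \<Rightarrow> 'a \<times> 's \<times> real \<times> real) \<Rightarrow> 'a pmf) \<Rightarrow> 's \<Rightarrow> nat \<Rightarrow>
   (nat \<Rightarrow> 'a \<times> 's \<times> real \<times> real) measure" where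
  "hist_law P \<pi> s0 0 = return (hist_M 0) (\<lambda>_. undefined)"
| "hist_law P \<pi> s0 (Suc n) =
     bind (hist_law P \<pi> s0 n) (\<lambda>h. bind (measure_pmf (\<pi> n s0 h)) (\<lambda>a.
       distr (P (state_at s0 n h, a)) (hist_M (Suc n)) (\<lambda>x. h(n := (a, x)))))"

text \<open>mu is the law of the whole trajectory under policy pi from s0 (Ionescu-Tulcea measure):
  a probability measure on trajectory space whose finite-dimensional marginals are hist_law.\<close>
definition policy_measure where
  "policy_measure P \<pi> s0 \<mu> \<longleftrightarrow> prob_space \<mu> \<and> sets \<mu> = sets traj_M \<and>
     (\<forall>n. distr \<mu> (hist_M n) (\<lambda>\<omega>. restrict \<omega> {..<n}) = hist_law P \<pi> s0 n)"

definition epochs :: "real \<Rightarrow> (nat \<Rightarrow> 'a \<times> 's \<times> real \<times> real) \<Rightarrow> nat" where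
  "epochs t \<omega> = Max {n. (\<Sum>k<n. fst (snd (snd (\<omega> k)))) \<le> t}"

definition avg_rate where
  "avg_rate P \<pi> s0 = (let \<mu> = (THE \<mu>. policy_measure P \<pi> s0 \<mu>) in
     Liminf at_top (\<lambda>t::real. ereal ((\<integral>\<omega>. (\<Sum>k<epochs t \<omega>. snd (snd (snd (\<omega> k)))) \<partial>\<mu>) / t)))"

definition opt_rate where
  "opt_rate P s = (SUP \<pi> \<in> {\<pi>. is_policy \<pi>}. avg_rate P \<pi> s)"

text \<open>In the weakly communicating case opt_rate is constant; r* is its (common, finite) value.\<close>
definition rstar where
  "rstar P = real_of_ereal (opt_rate P (SOME s. True))"

definition closed_comm_class where
  "closed_comm_class P C \<longleftrightarrow> C \<noteq> {} \<and>
     (\<forall>s\<in>C. \<forall>s'\<in>C. \<exists>\<pi> \<mu>. is_policy \<pi> \<and> policy_measure P \<pi> s \<mu> \<and>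
         measure \<mu> {\<omega> \<in> space \<mu>. \<exists>n. state_at s n \<omega> = s'} > 0) \<and>
     (\<forall>s\<in>C. \<forall>\<pi> \<mu>. is_policy \<pi> \<and> policy_measure P \<pi> s \<mu> \<longrightarrow>
         (AE \<omega> in \<mu>. \<forall>n. state_at s n \<omega> \<in> C))"

definition weakly_communicating where
  "weakly_communicating P \<longleftrightarrow> (\<exists>!C. closed_comm_class P C) \<and>
     (\<forall>C. closed_comm_class P C \<longrightarrow> (\<forall>s. s \<notin> C \<longrightarrow>
        (\<forall>s0 \<pi> \<mu>. is_policy \<pi> \<and> policy_measure P \<pi> s0 \<mu> \<longrightarrow>
           (AE \<omega> in \<mu>. finite {n. state_at s0 n \<omega> = s}))))"

definition smdp_model :: "('s \<times> 'a \<Rightarrow> ('s \<times> real \<times> real) measure) \<Rightarrow> bool" where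
  "smdp_model P \<longleftrightarrow> (\<forall>sa. prob_space (P sa) \<and> sets (P sa) = sets sample_M \<and>
      (AE x in P sa. 0 \<le> fst (snd x)))"

definition assumption_M :: "('s \<times> 'a \<Rightarrow> ('s \<times> real \<times> real) measure) \<Rightarrow> bool" where
  "assumption_M P \<longleftrightarrow>
     (\<exists>\<epsilon>>0. \<forall>sa. measure (P sa) {x \<in> space (P sa). fst (snd x) \<le> \<epsilon>} < 1) \<and>
     (\<forall>sa. integrable (P sa) (\<lambda>x. (fst (snd x))\<^sup>2) \<and> integrable (P sa) (\<lambda>x. (snd (snd x))\<^sup>2))"

definition rbar where "rbar P sa = (\<integral>x. snd (snd x) \<partial>P sa)"
definition tbar where "tbar P sa = (\<integral>x. fst (snd x) \<partial>P sa)"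
definition ptrans where "ptrans P sa s' = measure (P sa) {x \<in> space (P sa). fst x = s'}"

definition optQ :: "('s::finite \<times> 'a::finite \<Rightarrow> ('s \<times> real \<times> real) measure) \<Rightarrow> ('s \<times> 'a \<Rightarrow> real) set" where
  "optQ P = {q. \<forall>s a. q (s, a) = rbar P (s, a) - tbar P (s, a) * rstar P +
       (\<Sum>s'\<in>UNIV. ptrans P (s, a) s' * Max (range (\<lambda>a'. q (s', a'))))}"

definition sistr_at :: "(('i \<Rightarrow> real) \<Rightarrow> real) \<Rightarrow> ('i \<Rightarrow> real) \<Rightarrow> bool" where
  "sistr_at g x \<longleftrightarrow> strict_mono (\<lambda>c::real. g (\<lambda>i. x i + c)) \<and> surj (\<lambda>c::real. g (\<lambda>i. x i + c))"

definition supnorm :: "('i::finite \<Rightarrow> real) \<Rightarrow> real" where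
  "supnorm x = Max (range (\<lambda>i. \<bar>x i\<bar>))"

definition condition_F :: "(('i::finite \<Rightarrow> real) \<Rightarrow> real) \<Rightarrow> bool" where
  "condition_F f \<longleftrightarrow>
     (\<exists>L. \<forall>x y. \<bar>f x - f y\<bar> \<le> L * supnorm (\<lambda>i. x i - y i)) \<and> (\<forall>x. sistr_at f x) \<and>
     (\<exists>finf. (\<forall>x. ((\<lambda>c. f (\<lambda>i. c * x i) / c) \<longlongrightarrow> finf x) at_top) \<and> sistr_at finf (\<lambda>_. 0))"

definition optQ_f where
  "optQ_f P f = {q \<in> optQ P. f q = rstar P}"

definition nu :: "(nat \<Rightarrow> 'i set) \<Rightarrow> nat \<Rightarrow> 'i \<Rightarrow> nat" where
  "nu Y n i = card {k. k < n \<and> i \<in> Y k}"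

text \<open>Given the selected sets Y and samples X n (s,a) = (S, tau, R) used at iteration n,
  compute (Q_n, T_n).\<close>
primrec rvi ::
  "((('s::finite \<times> 'a::finite) \<Rightarrow> real) \<Rightarrow> real) \<Rightarrow> (nat \<Rightarrow> real) \<Rightarrow> (nat \<Rightarrow> real) \<Rightarrow> (nat \<Rightarrow> real) \<Rightarrow>
   ('s \<times> 'a \<Rightarrow> real) \<Rightarrow> ('s \<times> 'a \<Rightarrow> real) \<Rightarrow> (nat \<Rightarrow> ('s \<times> 'a) set) \<Rightarrow>
   (nat \<Rightarrow> 's \<times> 'a \<Rightarrow> 's \<times> real \<times> real) \<Rightarrow> nat \<Rightarrow> ('s \<times> 'a \<Rightarrow> real) \<times> ('s \<times> 'a \<Rightarrow> real)" where
  "rvi f \<alpha> \<beta> \<eta> Q0 T0 Y X 0 = (Q0, T0)"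
| "rvi f \<alpha> \<beta> \<eta> Q0 T0 Y X (Suc n) =
     (let Q = fst (rvi f \<alpha> \<beta> \<eta> Q0 T0 Y X n); T = snd (rvi f \<alpha> \<beta> \<eta> Q0 T0 Y X n) in
      ((\<lambda>i. if i \<in> Y n then
              Q i + \<alpha> (nu Y n i) *
                ((snd (snd (X n i)) + Max (range (\<lambda>a'. Q (fst (X n i), a'))) - Q i) / max (T i) (\<eta> n)
                 - f Q)
            else Q i),
       (\<lambda>i. if i \<in> Y n then T i + \<beta> (nu Y n i) * (fst (snd (X n i)) - T i) else T i)))"

definition alpha_tilde :: "(nat \<Rightarrow> real) \<Rightarrow> (nat \<Rightarrow> ('i::finite) set) \<Rightarrow> nat \<Rightarrow> real" where
  "alpha_tilde \<alpha> Y n = (\<Sum>i\<in>Y n. \<alpha> (nu Y n i))"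

definition t_tilde :: "(nat \<Rightarrow> real) \<Rightarrow> (nat \<Rightarrow> ('i::finite) set) \<Rightarrow> nat \<Rightarrow> real" where
  "t_tilde \<alpha> Y n = (\<Sum>k<n. alpha_tilde \<alpha> Y k)"

definition xbar :: "(nat \<Rightarrow> real) \<Rightarrow> (nat \<Rightarrow> ('i::finite) set) \<Rightarrow> (nat \<Rightarrow> ('i \<Rightarrow> real)) \<Rightarrow> real \<Rightarrow> ('i \<Rightarrow> real)" where
  "xbar \<alpha> Y Qs t = (if t < 0 then Qs 0 else
     (let n = (LEAST n. t < t_tilde \<alpha> Y (Suc n)) in
       (\<lambda>i. Qs n i + (t - t_tilde \<alpha> Y n) / alpha_tilde \<alpha> Y n * (Qs (Suc n) i - Qs n i))))"

definition Nx :: "(nat \<Rightarrow> real) \<Rightarrow> nat \<Rightarrow> real \<Rightarrow> nat" where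
  "Nx \<alpha> n x = (LEAST m. m > n \<and> (\<Sum>k=n..m. \<alpha> k) \<ge> x)"

definition req_alpha_det :: "(nat \<Rightarrow> real) \<Rightarrow> bool" where
  "req_alpha_det \<alpha> \<longleftrightarrow> (\<forall>n. \<alpha> n > 0) \<and>
     filterlim (\<lambda>n. \<Sum>k<n. \<alpha> k) at_top sequentially \<and> summable (\<lambda>n. (\<alpha> n)\<^sup>2) \<and>
     (\<forall>\<^sub>F n in sequentially. \<alpha> (Suc n) \<le> \<alpha> n) \<and>
     (\<forall>x\<in>{0<..<1}. \<exists>B. \<forall>n. \<alpha> (nat \<lfloor>x * real n\<rfloor>) / \<alpha> n \<le> B) \<and>
     (\<forall>x\<in>{0<..<1}. \<forall>e>0. \<exists>N. \<forall>n\<ge>N. \<forall>y\<in>{x..1}.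
        \<bar>(\<Sum>k\<le>nat \<lfloor>y * real n\<rfloor>. \<alpha> k) / (\<Sum>k\<le>n. \<alpha> k) - 1\<bar> < e)"

definition req_beta :: "(nat \<Rightarrow> real) \<Rightarrow> bool" where
  "req_beta \<beta> \<longleftrightarrow> (\<forall>n. 0 \<le> \<beta> n \<and> \<beta> n \<le> 1) \<and>
     filterlim (\<lambda>n. \<Sum>k<n. \<beta> k) at_top sequentially \<and> summable (\<lambda>n. (\<beta> n)\<^sup>2)"

definition req_eta :: "(nat \<Rightarrow> real) \<Rightarrow> bool" where
  "req_eta \<eta> \<longleftrightarrow> (\<forall>n. \<eta> n > 0) \<and> \<eta> \<longlonglongrightarrow> 0"

end

theory Submission
  imports Defs "HOL-Library.Diagonal_Subsequence"
begin

text \<open>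
  Weak communication is used only in the form that every absorbing set of states meets every set in
  which some stationary rule can remain. This makes the functions that are harmonic for the
  maximising operator constant. It yields a solution of the optimality equation (vanishing discount),
  whose constant is \<open>r*\<close> by a verification argument. It also yields a Liouville property: with \<open>H\<close>
  the relative value operator, a solution of \<open>y' = H y - f y\<close> that is bounded on the whole negative
  half line satisfies \<open>H (y s) = r*\<close> throughout and \<open>f (y 0) = r*\<close>.

  The iterates are compared with this equation without any stability estimate. In a clock in which
  the asynchronous step sizes balance, shifted (and, if necessary, rescaled) iterates converge
  along a subsequence to backward solutions. If the iterates were unbounded, rescaling at record
  times would give a limit of sup norm one solving the scaled equation, whose only bounded backward
  solution is zero. So the iterates are bounded, every limit point lies in the solution set, the
  drift tends to zero, and the trajectory moves arbitrarily slowly.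
\<close>

section \<open>Maximisation operator and sup norm\<close>

text \<open>Dividing by the running maximum \<open>envelope\<close> makes its weights square
  summable; summation by parts puts the factor back, and every error is then small relative to the
  envelope. Time runs backwards for the same reason: the envelope at an index bounds all earlier
  iterates and says nothing about later ones, so a limit of shifted iterates is controlled exactly
  on the negative half line. Differential equations enter only through a second-order estimate on
  increments, which passes to pointwise limits. The Liouville property takes the place of a global
  stability analysis: one-sided nonexpansiveness of H forbids persistent growth out of the past, and
  strict monotonicity of f along constants fixes the level. The estimated holding times enter as
  reciprocals capped at \<open>2 / t\<close>, which bounds the noise weights by constants; the cap
  becomes inactive once the estimates are close to t.\<close>

declare split_paired_All [simp del] split_paired_Ex [simp del]

definition vmax :: "('s \<times> 'a::finite \<Rightarrow> real) \<Rightarrow> 's \<Rightarrow> real" where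
  "vmax q s = Max (range (\<lambda>a. q (s, a)))"

lemma vmax_ge: "q (s, a) \<le> vmax q s"
  unfolding vmax_def by (rule Max_ge) auto

lemma vmax_le_iff: "vmax q s \<le> c \<longleftrightarrow> (\<forall>a. q (s, a) \<le> c)"
  unfolding vmax_def by (subst Max_le_iff) auto

lemma vmax_attained: "\<exists>a. vmax q s = q (s, a)"
proof -
  have "vmax q s \<in> range (\<lambda>a. q (s, a))"
    unfolding vmax_def by (rule Max_in) auto
  then show ?thesis by auto
qed

text \<open>Monotonicity of the maximum and its commuting with constants, packed into one upper
  bound. The comparison arguments work with one-sided bounds throughout, so no absolute value
  appears.\<close>

lemma vmax_diff_le:
  assumes "\<And>j. u j - w j \<le> c"
  shows "vmax u s - vmax w s \<le> c"
proof -
  have "vmax u s \<le> vmax w s + c"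
    unfolding vmax_le_iff
  proof
    fix a show "u (s, a) \<le> vmax w s + c"
      using assms[of "(s, a)"] vmax_ge[of w s a] by simp
  qed
  then show ?thesis by simp
qed

lemma vmax_const [simp]: "vmax (\<lambda>_. c) s = c"
  unfolding vmax_def by simp

lemma vmax_shift: "vmax (\<lambda>i. u i + c) s = vmax u s + c"
  using vmax_diff_le[of "\<lambda>i. u i + c" u c s] vmax_diff_le[of u "\<lambda>i. u i + c" "- c" s] by simp

lemma vmax_scale: "0 \<le> c \<Longrightarrow> vmax (\<lambda>i. c * u i) s = c * vmax u s"
proof (rule antisym)
  assume c: "0 \<le> c"
  show "vmax (\<lambda>i. c * u i) s \<le> c * vmax u s"
    unfolding vmax_le_iff using c vmax_ge[of u s] by (auto intro: mult_left_mono)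
  obtain a where "vmax u s = u (s, a)" using vmax_attained[of u s] by blast
  then show "c * vmax u s \<le> vmax (\<lambda>i. c * u i) s"
    using vmax_ge[of "\<lambda>i. c * u i" s a] by simp
qed

section \<open>The sup norm and coordinatewise convergence\<close>

lemma supnorm_ge: "\<bar>x i\<bar> \<le> supnorm x"
  unfolding supnorm_def by (rule Max_ge) auto

lemma supnorm_le_iff: "supnorm x \<le> c \<longleftrightarrow> (\<forall>i. \<bar>x i\<bar> \<le> c)"
  unfolding supnorm_def by (subst Max_le_iff) auto

lemma supnorm_nonneg: "0 \<le> supnorm x"
  using supnorm_ge[of x undefined] by linarith

lemma supnorm_attained: "\<exists>i. supnorm x = \<bar>x i\<bar>"
proof -
  have "supnorm x \<in> range (\<lambda>i. \<bar>x i\<bar>)"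
    unfolding supnorm_def by (rule Max_in) auto
  then show ?thesis by auto
qed

lemma supnorm_le_sum: "supnorm x \<le> (\<Sum>i\<in>UNIV. \<bar>x i\<bar>)"
  unfolding supnorm_le_iff by (auto intro: member_le_sum)

lemma abs_vmax_le: "\<bar>vmax q s\<bar> \<le> supnorm q"
  for q :: "'s::finite \<times> 'a::finite \<Rightarrow> real"
proof -
  obtain a where "vmax q s = q (s, a)" using vmax_attained[of q s] by blast
  then show ?thesis using supnorm_ge[of q "(s, a)"] by simp
qed

lemma tendsto_supnorm_diff:
  fixes x :: "'b \<Rightarrow> 'i::finite \<Rightarrow> real"
  assumes "\<And>i. ((\<lambda>k. x k i) \<longlongrightarrow> y i) F"
  shows "((\<lambda>k. supnorm (\<lambda>i. x k i - y i)) \<longlongrightarrow> 0) F"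
proof (rule tendsto_sandwich[of "\<lambda>_. 0" _ _ "\<lambda>k. \<Sum>i\<in>UNIV. \<bar>x k i - y i\<bar>"])
  show "((\<lambda>k. \<Sum>i\<in>UNIV. \<bar>x k i - y i\<bar>) \<longlongrightarrow> 0) F"
  proof (rule tendsto_null_sum)
    fix i
    show "((\<lambda>k. \<bar>x k i - y i\<bar>) \<longlongrightarrow> 0) F"
      using assms[of i] by (simp add: tendsto_rabs_zero LIM_zero)
  qed
qed (auto simp: supnorm_nonneg supnorm_le_sum)

text \<open>Bolzano-Weierstrass in all coordinates at once, by passing to the Euclidean type
  \<open>real ^ 'i\<close>.\<close>

lemma pointwise_bounded_subseq:
  fixes x :: "nat \<Rightarrow> 'i::finite \<Rightarrow> real"
  assumes "\<And>n i. \<bar>x n i\<bar> \<le> K"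
  obtains r y where "strict_mono (r :: nat \<Rightarrow> nat)" "\<And>i. (\<lambda>k. x (r k) i) \<longlonglongrightarrow> y i"
proof -
  define X where "X n = (\<chi> i. x n i)" for n
  have "norm (X n) \<le> real CARD('i) * K" for n
  proof -
    have "norm (X n) \<le> (\<Sum>i\<in>UNIV. \<bar>X n $ i\<bar>)" by (rule norm_le_l1_cart)
    also have "\<dots> \<le> (\<Sum>i\<in>(UNIV::'i set). K)"
      by (intro sum_mono) (simp add: X_def assms)
    finally show ?thesis by simp
  qed
  then have "bounded (range X)" by (auto intro: boundedI)
  then obtain l r where r: "strict_mono (r :: nat \<Rightarrow> nat)" "(X \<circ> r) \<longlonglongrightarrow> l"
    using bounded_imp_convergent_subsequence by blast
  have "(\<lambda>k. x (r k) i) \<longlonglongrightarrow> l $ i" for i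
    using tendsto_vec_nth[OF r(2), of i] by (simp add: X_def)
  with r(1) show thesis by (rule that)
qed

section \<open>Lipschitz functionals and the relative value operator\<close>

definition supnorm_lipschitz :: "(('i::finite \<Rightarrow> real) \<Rightarrow> real) \<Rightarrow> real \<Rightarrow> bool" where
  "supnorm_lipschitz g L \<longleftrightarrow> 0 \<le> L \<and> (\<forall>x y. \<bar>g x - g y\<bar> \<le> L * supnorm (\<lambda>i. x i - y i))"

text \<open>Truncating the constant at 0 avoids deriving its sign from the inequality; a nonnegative
  constant may multiply any upper bound of the norm.\<close>

lemma supnorm_lipschitzI:
  assumes "\<And>x y. \<bar>g x - g y\<bar> \<le> L * supnorm (\<lambda>i. x i - y i)"
  shows "supnorm_lipschitz g (max 0 L)"
proof -
  have "\<bar>g x - g y\<bar> \<le> max 0 L * supnorm (\<lambda>i. x i - y i)" for x y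
    using assms[of x y] mult_right_mono[of L "max 0 L" "supnorm (\<lambda>i. x i - y i)"]
      supnorm_nonneg[of "\<lambda>i. x i - y i"] by linarith
  then show ?thesis unfolding supnorm_lipschitz_def by auto
qed

lemma supnorm_lipschitzD:
  assumes "supnorm_lipschitz g L" "\<And>i. \<bar>x i - y i\<bar> \<le> c"
  shows "\<bar>g x - g y\<bar> \<le> L * c"
proof -
  have "supnorm (\<lambda>i. x i - y i) \<le> c" using assms(2) by (simp add: supnorm_le_iff)
  then show ?thesis
    using assms(1) mult_left_mono[of "supnorm (\<lambda>i. x i - y i)" c L]
    unfolding supnorm_lipschitz_def by (meson order_trans)
qed

lemma supnorm_lipschitz_tendsto:
  assumes g: "supnorm_lipschitz g L" and x: "\<And>i. ((\<lambda>k. x k i) \<longlongrightarrow> y i) F"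
  shows "((\<lambda>k. g (x k)) \<longlongrightarrow> g y) F"
proof -
  have "((\<lambda>k. g (x k) - g y) \<longlongrightarrow> 0) F"
  proof (rule Lim_null_comparison)
    show "((\<lambda>k. L * supnorm (\<lambda>i. x k i - y i)) \<longlongrightarrow> 0) F"
      using tendsto_mult_left[OF tendsto_supnorm_diff[OF x], of L] by simp
    show "\<forall>\<^sub>F k in F. norm (g (x k) - g y) \<le> L * supnorm (\<lambda>i. x k i - y i)"
      using g unfolding supnorm_lipschitz_def by simp
  qed
  then show ?thesis by (simp add: LIM_zero_iff)
qed

text \<open>The temporal difference per unit of holding time. The optimality equation with rate
  \<rho> says precisely that this vector is constantly \<rho>, and the drift of the algorithm is
  this vector minus \<open>f\<close>.\<close>

definition relval :: "('s::finite \<times> 'a::finite \<Rightarrow> real) \<Rightarrow> ('s \<times> 'a \<Rightarrow> real) \<Rightarrow>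
    ('s \<times> 'a \<Rightarrow> 's \<Rightarrow> real) \<Rightarrow> ('s \<times> 'a \<Rightarrow> real) \<Rightarrow> 's \<times> 'a \<Rightarrow> real" where
  "relval r t p x i = (r i + (\<Sum>s\<in>UNIV. p i s * vmax x s) - x i) / t i"

definition stoch_kernel :: "('i \<Rightarrow> 's::finite \<Rightarrow> real) \<Rightarrow> bool" where
  "stoch_kernel p \<longleftrightarrow> (\<forall>i s. 0 \<le> p i s) \<and> (\<forall>i. (\<Sum>s\<in>UNIV. p i s) = 1)"

lemma stoch_kernel_nonneg: "stoch_kernel p \<Longrightarrow> 0 \<le> p i s"
  unfolding stoch_kernel_def by blast

lemma stoch_kernel_sum: "stoch_kernel p \<Longrightarrow> (\<Sum>s\<in>UNIV. p i s) = 1"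
  unfolding stoch_kernel_def by blast

lemma stoch_kernel_avg_const: "stoch_kernel p \<Longrightarrow> (\<Sum>s\<in>UNIV. p i s * c) = c"
  by (simp add: stoch_kernel_sum flip: sum_distrib_right)

lemma stoch_kernel_avg_diff_le:
  assumes "stoch_kernel p" "\<And>s. v s - w s \<le> c"
  shows "(\<Sum>s\<in>UNIV. p i s * v s) - (\<Sum>s\<in>UNIV. p i s * w s) \<le> (c::real)"
proof -
  have "(\<Sum>s\<in>UNIV. p i s * v s) - (\<Sum>s\<in>UNIV. p i s * w s) = (\<Sum>s\<in>UNIV. p i s * (v s - w s))"
    by (simp add: sum_subtractf right_diff_distrib)
  also have "\<dots> \<le> (\<Sum>s\<in>UNIV. p i s * c)"
    using assms unfolding stoch_kernel_def by (intro sum_mono mult_left_mono) auto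
  also have "\<dots> = c"
    by (rule stoch_kernel_avg_const[OF assms(1)])
  finally show ?thesis .
qed

text \<open>The averaged maxima differ by at most c, and the term \<open>- x i\<close> contributes
  the gap at i itself. Where \<open>u - w\<close> attains its bound c the right side is 0, so there
  the field cannot widen the gap; this is the maximum principle behind every comparison
  below.\<close>

lemma relval_nonexp:
  assumes p: "stoch_kernel p" and t: "\<And>i. 0 < t i" and uw: "\<And>j. u j - w j \<le> c"
  shows "relval r t p u i - relval r t p w i \<le> (c - (u i - w i)) / t i"
proof -
  have "relval r t p u i - relval r t p w i
      = ((\<Sum>s\<in>UNIV. p i s * vmax u s) - (\<Sum>s\<in>UNIV. p i s * vmax w s) - (u i - w i)) / t i"
    unfolding relval_def by (simp add: diff_divide_distrib add_divide_distrib)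
  also have "\<dots> \<le> (c - (u i - w i)) / t i"
  proof (rule divide_right_mono)
    show "(\<Sum>s\<in>UNIV. p i s * vmax u s) - (\<Sum>s\<in>UNIV. p i s * vmax w s) - (u i - w i) \<le> c - (u i - w i)"
      using stoch_kernel_avg_diff_le[OF p, of "vmax u" "vmax w" c i] vmax_diff_le[of u w c] uw by simp
    show "0 \<le> t i" using t[of i] by simp
  qed
  finally show ?thesis .
qed

text \<open>A constant passes through maximum and average and cancels against \<open>- x i\<close>.
  The equation therefore determines a solution along constants only through
  \<open>f\<close>.\<close>

lemma relval_shift:
  assumes "stoch_kernel p"
  shows "relval r t p (\<lambda>i. x i + c) i = relval r t p x i"
proof -
  have "(\<Sum>s\<in>UNIV. p i s * c) = c"
    by (rule stoch_kernel_avg_const[OF assms])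
  then show ?thesis
    unfolding relval_def vmax_shift by (simp add: distrib_left sum.distrib)
qed

text \<open>Homogeneity up to the reward, which is divided by c. As c grows, the reward-free
  operator is left.\<close>

lemma relval_scale:
  assumes "0 < c"
  shows "relval r t p (\<lambda>i. c * x i) i / c = relval (\<lambda>i. r i / c) t p x i"
  using assms unfolding relval_def
  by (simp add: vmax_scale field_simps sum_distrib_left)

text \<open>The factor 2 counts one unit for the averaged maximum and one for the term
  \<open>- x i\<close>.\<close>

lemma relval_lipschitz:
  assumes p: "stoch_kernel p" and t: "\<And>i. 0 < t i"
  shows "supnorm_lipschitz (\<lambda>x. relval r t p x i) (2 / t i)"
proof -
  have *: "relval r t p x i - relval r t p y i \<le> 2 / t i * supnorm (\<lambda>i. x i - y i)" for x y
  proof -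
    have "x j - y j \<le> supnorm (\<lambda>i. x i - y i)" for j
      using supnorm_ge[of "\<lambda>i. x i - y i" j] by simp
    then have "relval r t p x i - relval r t p y i \<le> (supnorm (\<lambda>i. x i - y i) - (x i - y i)) / t i"
      by (rule relval_nonexp[OF p t])
    also have "\<dots> \<le> (2 * supnorm (\<lambda>i. x i - y i)) / t i"
      using supnorm_ge[of "\<lambda>i. x i - y i" i] t[of i] by (intro divide_right_mono) auto
    finally show ?thesis by simp
  qed
  have "\<bar>relval r t p x i - relval r t p y i\<bar> \<le> 2 / t i * supnorm (\<lambda>i. x i - y i)" for x y
    using *[of x y] *[of y x]
    by (simp add: supnorm_def abs_minus_commute abs_le_iff)
  then show ?thesis
    unfolding supnorm_lipschitz_def using t[of i] by simp
qed

lemma relval_bound: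
  assumes p: "stoch_kernel p" and t: "\<And>i. 0 < t i"
  shows "\<bar>relval r t p x i\<bar> \<le> \<bar>r i\<bar> / t i + 2 / t i * supnorm x"
proof -
  have "\<bar>relval r t p x i - relval r t p (\<lambda>_. 0) i\<bar> \<le> 2 / t i * supnorm x"
    by (rule supnorm_lipschitzD[OF relval_lipschitz[OF p t]]) (simp add: supnorm_ge)
  moreover have "\<bar>relval r t p (\<lambda>_. 0) i\<bar> = \<bar>r i\<bar> / t i"
    using t[of i] by (simp add: relval_def)
  ultimately show ?thesis by linarith
qed

section \<open>Bounded backward solutions are stationary\<close>

text \<open>The one-sided estimate is invariant under the reflection of
  \<open>nonexp_field_reflect\<close>, so each upper bound proved from it yields the matching lower
  bound.\<close>

locale nonexp_field =
  fixes H :: "('i::finite \<Rightarrow> real) \<Rightarrow> 'i \<Rightarrow> real" and t :: "'i \<Rightarrow> real"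
  assumes nonexp: "\<And>u w c i. (\<And>j. u j - w j \<le> c) \<Longrightarrow> H u i - H w i \<le> (c - (u i - w i)) / t i"
    and t_pos: "\<And>i. 0 < t i"
begin

text \<open>Forward comparison for the flow \<open>u' = H u - \<rho>\<close>; the flow enters only through the
  second-order estimate, which is what survives in the limit of the iterates.\<close>

lemma comparison:
  assumes u: "\<And>s s' i. a \<le> s \<Longrightarrow> s \<le> s' \<Longrightarrow> s' \<le> b \<Longrightarrow>
      \<bar>u s' i - u s i - (s' - s) * (H (u s) i - \<rho>)\<bar> \<le> C * (s' - s)\<^sup>2"
    and w: "\<And>s s' i. a \<le> s \<Longrightarrow> s \<le> s' \<Longrightarrow> s' \<le> b \<Longrightarrow>
      \<bar>w s' i - w s i - (s' - s) * (H (w s) i - \<rho>)\<bar> \<le> C * (s' - s)\<^sup>2"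
    and ab: "a \<le> b" and init: "\<And>i. u a i - w a i \<le> c"
  shows "u b i - w b i \<le> c"
proof (rule field_le_epsilon)
  fix e :: real assume e: "0 < e"
  define m where "m = Min (range t)"
  have m: "0 < m" "m \<le> t i" for i
    unfolding m_def using t_pos by (auto simp: Min_gr_iff)
  \<comment> \<open>The step length h must be at most every \<open>t i\<close>, so that
    \<open>1 - h / t i\<close> is nonnegative and an Euler step preserves the bound; and the n local
    errors of size \<open>2 * C * h^2\<close> must add up to at most e.\<close>
  obtain n :: nat where n: "n > 0" "(b - a) / m \<le> n" "2 * C * (b - a)\<^sup>2 / e \<le> n"
    using real_arch_simple[of "max 1 (max ((b - a) / m) (2 * C * (b - a)\<^sup>2 / e))"]
    by (metis max.bounded_iff of_nat_0_less_iff less_le_trans zero_less_one)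
  define h where "h = (b - a) / n"
  have h: "0 \<le> h" "h \<le> m" "n * h = b - a"
    using ab n m by (auto simp: h_def field_simps)
  have step: "k \<le> n \<Longrightarrow> u (a + k * h) i - w (a + k * h) i \<le> c + k * (2 * C * h\<^sup>2)" for k i
  proof (induction k arbitrary: i)
    case 0 then show ?case using init by simp
  next
    case (Suc k)
    define s where "s = a + k * h"
    define c' where "c' = c + k * (2 * C * h\<^sup>2)"
    have IH: "u s j - w s j \<le> c'" for j
      using Suc unfolding s_def c'_def by simp
    have "Suc k * h \<le> n * h" using Suc.prems h by (intro mult_right_mono) auto
    then have sb: "s + h \<le> b" "a \<le> s"
      using h by (auto simp: s_def algebra_simps)
    have "u (s + h) i - w (s + h) i \<le> (u s i - w s i) + h * (H (u s) i - H (w s) i) + 2 * C * h\<^sup>2"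
      using u[of s "s + h" i] w[of s "s + h" i] sb h by (simp add: abs_le_iff algebra_simps)
    also have "h * (H (u s) i - H (w s) i) \<le> h * ((c' - (u s i - w s i)) / t i)"
      by (intro mult_left_mono nonexp IH h)
    also have "(u s i - w s i) + h * ((c' - (u s i - w s i)) / t i)
        = c' - (1 - h / t i) * (c' - (u s i - w s i))"
      using t_pos[of i] by (simp add: field_simps)
    also have "\<dots> \<le> c'"
    proof -
      have "h / t i \<le> 1" using h m(2)[of i] t_pos[of i] by simp
      then have "0 \<le> (1 - h / t i) * (c' - (u s i - w s i))" using IH[of i] by simp
      then show ?thesis by simp
    qed
    finally show ?case by (simp add: s_def c'_def algebra_simps)
  qed
  have "u b i - w b i \<le> c + n * (2 * C * h\<^sup>2)"
    using step[of n i] h(3) by (simp add: algebra_simps)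
  also have "n * (2 * C * h\<^sup>2) = 2 * C * (b - a)\<^sup>2 / n"
    using n(1) by (simp add: h_def power2_eq_square)
  also have "\<dots> \<le> e" using n e by (simp add: field_simps)
  finally show "u b i - w b i \<le> c + e" by simp
qed

text \<open>Strictly negative times are exactly those with admissible neighbours on both sides; at 0
  only a one-sided derivative is available, and continuity is used there instead.\<close>

lemma has_derivative_of_quadratic:
  assumes quad: "\<And>s s'. s \<le> 0 \<Longrightarrow> s' \<le> 0 \<Longrightarrow> \<bar>x s' - x s - (s' - s) * d s\<bar> \<le> C * (s' - s)\<^sup>2"
    and s: "s < (0::real)"
  shows "(x has_real_derivative d s) (at s)"
proof -
  have "((\<lambda>s'. (x s' - x s) / (s' - s) - d s) \<longlongrightarrow> 0) (at s)"
  proof (rule Lim_null_comparison)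
    show "((\<lambda>s'. C * \<bar>s' - s\<bar>) \<longlongrightarrow> 0) (at s)" by (rule tendsto_eq_intros refl | simp)+
    have "\<forall>\<^sub>F s' in at s. s' < 0"
      by (rule order_tendstoD(2)[OF tendsto_ident_at s])
    moreover have "\<forall>\<^sub>F s' in at s. s' \<noteq> s"
      by (simp add: eventually_neq_at_within)
    ultimately have "\<forall>\<^sub>F s' in at s. s' < 0 \<and> s' \<noteq> s"
      by (rule eventually_conj)
    then show "\<forall>\<^sub>F s' in at s. norm ((x s' - x s) / (s' - s) - d s) \<le> C * \<bar>s' - s\<bar>"
    proof (rule eventually_mono)
      fix s' assume s': "s' < 0 \<and> s' \<noteq> s"
      have "(x s' - x s) / (s' - s) - d s = (x s' - x s - (s' - s) * d s) / (s' - s)"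
        using s' by (simp add: field_simps)
      then show "norm ((x s' - x s) / (s' - s) - d s) \<le> C * \<bar>s' - s\<bar>"
        using quad[of s s'] s s' by (simp add: abs_divide divide_le_eq power2_eq_square mult.assoc)
    qed
  qed
  then show ?thesis
    by (simp add: has_field_derivative_iff LIM_zero_iff)
qed

text \<open>Let G be the supremum of the increments over a lag d, and suppose it is positive. An
  increment of coordinate i close to G was preceded by large ones, because its deficit
  \<open>psi\<close> below G can have been larger in the past by at most an exponential factor. Over
  K lags coordinate i has then risen by more than twice the oscillation bound, so every coordinate
  has risen. This contradicts comparison with the stationary q, under which the maximum of
  \<open>u - q\<close> cannot increase.\<close>

lemma no_backward_growth:
  fixes u :: "real \<Rightarrow> 'i \<Rightarrow> real"
  assumes quad: "\<And>s s' i. s \<le> 0 \<Longrightarrow> s' \<le> 0 \<Longrightarrow>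
      \<bar>u s' i - u s i - (s' - s) * (H (u s) i - \<rho>)\<bar> \<le> C * (s' - s)\<^sup>2"
    and lip: "\<And>s s' i. s \<le> 0 \<Longrightarrow> s' \<le> 0 \<Longrightarrow> \<bar>u s' i - u s i\<bar> \<le> L * \<bar>s' - s\<bar>"
    and osc: "\<And>s i j. s \<le> 0 \<Longrightarrow> \<bar>u s i - u s j\<bar> \<le> B"
    and q: "\<And>i. H q i = \<rho>"
    and d: "0 < d" and s: "s \<le> 0"
  shows "u s i \<le> u (s - d) i"
proof -
  define S where "S = {u s i - u (s - d) i | s i. s \<le> 0}"
  define G where "G = Sup S"
  have S: "u s i - u (s - d) i \<in> S" if "s \<le> 0" for s i
    using that unfolding S_def by blast
  have bdd: "bdd_above S"
    unfolding S_def
  proof (rule bdd_aboveI)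
    fix x assume "x \<in> {u s i - u (s - d) i | s i. s \<le> 0}"
    then obtain s i where "x = u s i - u (s - d) i" "s \<le> 0" by blast
    then show "x \<le> L * d" using lip[of "s - d" s i] d by auto
  qed
  have G: "u s i - u (s - d) i \<le> G" if "s \<le> 0" for s i
    unfolding G_def by (rule cSup_upper[OF S[OF that] bdd])
  have C0: "0 \<le> C"
    using order_trans[OF abs_ge_zero quad[of 0 "-1" undefined]] by simp
  have "G \<le> 0"
  proof (rule ccontr)
    assume "\<not> G \<le> 0"
    then have G0: "0 < G" by simp
    \<comment> \<open>K lags with increments of at least \<open>G / 2\<close> have to beat the
      oscillation bound B taken at both ends.\<close>
    obtain K :: nat where K: "2 * B < K * (G / 2)"
      using reals_Archimedean3[of "G / 2"] G0 by fastforce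
    define m where "m = Min (range t)"
    have m: "0 < m" "m \<le> t i" for i
      unfolding m_def using t_pos by (auto simp: Min_gr_iff)
    \<comment> \<open>This prefactor cancels the largest growth \<open>exp (K * d / m)\<close> of
      the deficit over K lags, so that a deficit of at most \<open>G / 2\<close> remains.\<close>
    define e where "e = exp (- (K * d / m)) * (G / 2)"
    have "0 < e" using G0 by (simp add: e_def)
    then have "\<exists>x\<in>S. G - e < x"
      unfolding G_def by (intro less_cSupD) (use S[of 0] in auto)
    then obtain s0 i where s0: "s0 \<le> 0" "G - e < u s0 i - u (s0 - d) i"
      unfolding S_def by blast
    define psi where "psi s = G - (u s i - u (s - d) i)" for s
    \<comment> \<open>Gronwall backwards: all coordinates have increments at most G, so
      nonexpansiveness bounds the derivative of the increment of coordinate i by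
      \<open>psi / t i\<close>, and \<open>exp (s / t i)\<close> is the integrating factor.\<close>
    have mono: "exp (s / t i) * psi s \<le> exp (s0 / t i) * psi s0" if "s \<le> s0" for s
    proof (cases "s < s0")
      case True
      show ?thesis
      proof (rule DERIV_nonneg_imp_increasing_open[of s s0])
        show "s \<le> s0" by fact
        fix x assume x: "s < x" "x < s0"
        have xs: "x < 0" "x - d < 0" using x s0 d by auto
        have d1: "((\<lambda>s. u s i) has_real_derivative H (u x) i - \<rho>) (at x)"
          by (rule has_derivative_of_quadratic[of "\<lambda>s. u s i" "\<lambda>s. H (u s) i - \<rho>" C])
             (use quad xs in auto)
        have "((\<lambda>s. u s i) has_real_derivative H (u (x - d)) i - \<rho>) (at (x - d))"
          by (rule has_derivative_of_quadratic[of "\<lambda>s. u s i" "\<lambda>s. H (u s) i - \<rho>" C])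
             (use quad xs in auto)
        then have d2: "((\<lambda>s. u (s - d) i) has_real_derivative H (u (x - d)) i - \<rho>) (at x)"
          using DERIV_shift[of "\<lambda>s. u s i" "H (u (x - d)) i - \<rho>" x "- d"] by simp
        have "((\<lambda>s. exp (s / t i) * psi s) has_real_derivative
            exp (x / t i) * (psi x / t i - (H (u x) i - H (u (x - d)) i))) (at x)"
          unfolding psi_def
          by (rule derivative_eq_intros d1 d2 refl | use t_pos[of i] in \<open>simp add: field_simps\<close>)+
        moreover have "H (u x) i - H (u (x - d)) i \<le> psi x / t i"
          unfolding psi_def by (rule nonexp) (use G[of x] xs in auto)
        ultimately show "\<exists>y. ((\<lambda>s. exp (s / t i) * psi s) has_real_derivative y) (at x) \<and> 0 \<le> y"
          by (intro exI conjI) auto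
      next
        \<comment> \<open>The right end s0 may be 0, where the two-sided derivative is missing; the
          open-interval monotonicity rule asks only for continuity there.\<close>
        have cont: "continuous_on {..0} (\<lambda>s. u s i)"
        proof (rule continuous_onI)
          fix x e assume "x \<in> {..0::real}" and e: "0 < (e::real)"
          then show "\<exists>da>0. \<forall>x'\<in>{..0}. dist x' x < da \<longrightarrow> dist (u x' i) (u x i) \<le> e"
          proof (intro exI[of _ "e / (\<bar>L\<bar> + 1)"] conjI ballI impI)
            show "0 < e / (\<bar>L\<bar> + 1)" using e by simp
            fix x' assume x': "x' \<in> {..0::real}" "dist x' x < e / (\<bar>L\<bar> + 1)"
            have "\<bar>u x' i - u x i\<bar> \<le> L * \<bar>x' - x\<bar>" using lip x' \<open>x \<in> {..0}\<close> by auto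
            also have "\<dots> \<le> (\<bar>L\<bar> + 1) * \<bar>x' - x\<bar>" by (intro mult_right_mono) auto
            also have "\<dots> \<le> e" using x'(2) by (simp add: dist_real_def field_simps)
            finally show "dist (u x' i) (u x i) \<le> e" by (simp add: dist_real_def)
          qed
        qed
        have "continuous_on {s..s0} (\<lambda>s. u s i)"
          by (rule continuous_on_subset[OF cont]) (use s0 in auto)
        moreover have "continuous_on {s..s0} (\<lambda>s. u (s - d) i)"
          by (rule continuous_on_compose2[OF cont]) (use s0 d in \<open>auto intro!: continuous_intros\<close>)
        ultimately show "continuous_on {s..s0} (\<lambda>s. exp (s / t i) * psi s)"
          unfolding psi_def using t_pos[of i] by (intro continuous_intros) auto
      qed
    qed (use that in auto)
    have large: "G / 2 \<le> u s i - u (s - d) i" if s: "s \<le> s0" "s0 - K * d \<le> s" for s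
    proof -
      have "psi s \<le> exp ((s0 - s) / t i) * psi s0"
        using mono[OF s(1)] by (simp add: diff_divide_distrib exp_diff field_simps)
      also have "\<dots> \<le> exp (K * d / m) * e"
      proof (rule mult_mono)
        have "(s0 - s) / t i \<le> K * d / m"
          using s m(1) m(2)[of i] d by (intro frac_le) auto
        then show "exp ((s0 - s) / t i) \<le> exp (K * d / m)" by simp
        show "psi s0 \<le> e" using s0 by (simp add: psi_def)
        show "0 \<le> psi s0" using G[of s0 i] s0 by (simp add: psi_def)
      qed simp
      also have "\<dots> = G / 2" by (simp add: e_def exp_minus field_simps)
      finally show ?thesis by (simp add: psi_def)
    qed
    have "k \<le> K \<Longrightarrow> k * (G / 2) \<le> u s0 i - u (s0 - k * d) i" for k
    proof (induction k)
      case (Suc k)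
      have "s0 - k * d \<le> s0" "s0 - K * d \<le> s0 - k * d"
        using Suc.prems d by (auto intro!: mult_right_mono)
      from large[OF this] Suc show ?case by (simp add: algebra_simps add_divide_distrib)
    qed simp
    from this[of K] have inc: "K * (G / 2) \<le> u s0 i - u (s0 - K * d) i" by simp
    define s1 where "s1 = s0 - K * d"
    have "0 \<le> K * d" using d by simp
    then have s1: "s1 \<le> s0" "s1 \<le> 0" using s0(1) unfolding s1_def by linarith+
    have inc': "u s1 j < u s0 j" for j
      using inc K osc[OF s0(1), of i j] osc[OF s1(2), of i j]
      unfolding s1_def[symmetric] abs_le_iff by linarith
    obtain j where j: "\<And>k. u s1 k - q k \<le> u s1 j - q j"
    proof -
      have "Max (range (\<lambda>k. u s1 k - q k)) \<in> range (\<lambda>k. u s1 k - q k)" by (rule Max_in) auto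
      then obtain j where "Max (range (\<lambda>k. u s1 k - q k)) = u s1 j - q j" by (elim rangeE)
      then have "u s1 k - q k \<le> u s1 j - q j" for k
        using Max_ge[of "range (\<lambda>k. u s1 k - q k)" "u s1 k - q k"] by simp
      then show thesis by (rule that)
    qed
    have "u s0 j - q j \<le> u s1 j - q j"
      by (rule comparison[of s1 s0 u \<rho> C "\<lambda>_. q"])
         (use quad s0 s1 q j C0 in auto)
    with inc'[of j] show False by simp
  qed
  then show ?thesis using G[OF s, of i] by simp
qed

end

lemma nonexp_field_reflect:
  assumes "nonexp_field H t"
  shows "nonexp_field (\<lambda>u i. - H (\<lambda>j. - u j) i) t"
proof -
  interpret nonexp_field H t by fact
  show ?thesis
  proof
    fix u w :: "'a \<Rightarrow> real" and c i assume "\<And>j. u j - w j \<le> c"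
    then show "- H (\<lambda>j. - u j) i - - H (\<lambda>j. - w j) i \<le> (c - (u i - w i)) / t i"
      using nonexp[of "\<lambda>j. - w j" "\<lambda>j. - u j" c i] by (simp add: algebra_simps)
  qed (rule t_pos)
qed

text \<open>Absence of backward growth for u and for its reflection makes every increment vanish.
  The second-order estimate then bounds \<open>H (u s) i - \<rho>\<close> by a multiple of the lag,
  which is arbitrary.\<close>

lemma (in nonexp_field) backward_solution_constant:
  fixes u :: "real \<Rightarrow> 'i \<Rightarrow> real"
  assumes quad: "\<And>s s' i. s \<le> 0 \<Longrightarrow> s' \<le> 0 \<Longrightarrow>
      \<bar>u s' i - u s i - (s' - s) * (H (u s) i - \<rho>)\<bar> \<le> C * (s' - s)\<^sup>2"
    and lip: "\<And>s s' i. s \<le> 0 \<Longrightarrow> s' \<le> 0 \<Longrightarrow> \<bar>u s' i - u s i\<bar> \<le> L * \<bar>s' - s\<bar>"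
    and osc: "\<And>s i j. s \<le> 0 \<Longrightarrow> \<bar>u s i - u s j\<bar> \<le> B"
    and q: "\<And>i. H q i = \<rho>" and s: "s \<le> 0"
  shows "u s i = u 0 i" "H (u s) i = \<rho>"
proof -
  interpret R: nonexp_field "\<lambda>u i. - H (\<lambda>j. - u j) i" t
    by (rule nonexp_field_reflect) unfold_locales
  have eq: "u s i = u (s - d) i" if "0 < d" "s \<le> 0" for s d i
  proof (rule antisym)
    show "u s i \<le> u (s - d) i"
      by (rule no_backward_growth[OF quad lip osc q that])
    have "- u s i \<le> - u (s - d) i"
    proof (rule R.no_backward_growth[of "\<lambda>s i. - u s i" "- \<rho>" C L B "\<lambda>i. - q i"])
      fix s s' :: real and i assume "s \<le> 0" "s' \<le> 0"
      then show "\<bar>- u s' i - (- u s i) - (s' - s) * (- H (\<lambda>j. - (- u s j)) i - (- \<rho>))\<bar> \<le> C * (s' - s)\<^sup>2"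
        using quad[of s s' i] by (simp add: abs_le_iff algebra_simps)
    next
      fix s s' :: real and i assume "s \<le> 0" "s' \<le> 0"
      then show "\<bar>- u s' i - - u s i\<bar> \<le> L * \<bar>s' - s\<bar>"
        using lip[of s s' i] by (simp add: abs_minus_commute abs_le_iff)
    next
      fix s :: real and i j assume "s \<le> 0"
      then show "\<bar>- u s i - - u s j\<bar> \<le> B" using osc[of s j i] by simp
    qed (use q that in auto)
    then show "u (s - d) i \<le> u s i" by simp
  qed
  show c: "u s i = u 0 i"
    using eq[of "- s" 0 i] s by (cases "s = 0") auto
  have "\<bar>H (u s) i - \<rho>\<bar> \<le> e" if "0 < e" for e
  proof -
    define d where "d = e / (\<bar>C\<bar> + 1)"
    have d: "0 < d" using that by (simp add: d_def)
    have "d * \<bar>H (u s) i - \<rho>\<bar> \<le> C * d\<^sup>2"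
      using quad[of s "s - d" i] eq[OF d s, of i] s d by (simp add: abs_mult)
    also have "\<dots> \<le> (\<bar>C\<bar> + 1) * d\<^sup>2" by (intro mult_right_mono) auto
    also have "\<dots> = d * e" by (simp add: d_def power2_eq_square)
    finally show ?thesis using d by simp
  qed
  then have "\<bar>H (u s) i - \<rho>\<bar> \<le> 0"
    using field_le_epsilon[of "\<bar>H (u s) i - \<rho>\<bar>" 0] by simp
  then show "H (u s) i = \<rho>" by simp
qed

text \<open>Subtracting \<open>g\<close> from all components only moves a solution along the constant direction,
  along which \<open>H\<close> is invariant.\<close>

lemma (in nonexp_field) backward_solution_stationary:
  fixes y :: "real \<Rightarrow> 'i \<Rightarrow> real"
  assumes quad: "\<And>s s' i. s \<le> 0 \<Longrightarrow> s' \<le> 0 \<Longrightarrow>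
      \<bar>y s' i - y s i - (s' - s) * (H (y s) i - g (y s))\<bar> \<le> C * (s' - s)\<^sup>2"
    and lip: "\<And>s s' i. s \<le> 0 \<Longrightarrow> s' \<le> 0 \<Longrightarrow> \<bar>y s' i - y s i\<bar> \<le> L * \<bar>s' - s\<bar>"
    and bd: "\<And>s i. s \<le> 0 \<Longrightarrow> \<bar>y s i\<bar> \<le> K"
    and shift: "\<And>x c i. H (\<lambda>j. x j + c) i = H x i"
    and g: "supnorm_lipschitz g M"
    and q: "\<And>i. H q i = \<rho>" and s: "s \<le> 0"
  shows "H (y s) i = \<rho>" "y s i - y s j = y 0 i - y 0 j"
proof -
  \<comment> \<open>Frozen at its value at 0 for positive times, phi is continuous on the whole line
    and has an antiderivative that is differentiable also at 0.\<close>
  define phi where "phi s = g (y (min s 0)) - \<rho>" for s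
  have phi_lip: "\<bar>phi s' - phi s\<bar> \<le> (M * L) * \<bar>s' - s\<bar>" for s s'
  proof -
    have "\<bar>y (min s' 0) i - y (min s 0) i\<bar> \<le> L * \<bar>s' - s\<bar>" for i
    proof -
      have "0 \<le> L" using order_trans[OF abs_ge_zero lip[of 0 "-1" i]] by simp
      then have "L * \<bar>min s' 0 - min s 0\<bar> \<le> L * \<bar>s' - s\<bar>"
        by (intro mult_left_mono) (auto simp: min_def abs_if)
      then show ?thesis using lip[of "min s 0" "min s' 0" i] by simp
    qed
    from supnorm_lipschitzD[OF g this] show ?thesis by (simp add: phi_def mult.assoc)
  qed
  have phi_cont: "isCont phi s" for s
  proof -
    have "((\<lambda>s'. phi s' - phi s) \<longlongrightarrow> 0) (at s)"
    proof (rule Lim_null_comparison)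
      show "((\<lambda>s'. M * L * \<bar>s' - s\<bar>) \<longlongrightarrow> 0) (at s)" by (rule tendsto_eq_intros refl | simp)+
    qed (use phi_lip in auto)
    then show ?thesis by (simp add: isCont_def LIM_zero_iff)
  qed
  obtain z where z: "(z has_real_derivative phi s) (at s)" for s
    using einterval_antiderivative[of "-\<infinity>" \<infinity> phi] phi_cont
    by (auto simp: has_real_derivative_iff_has_vector_derivative)
  have LM0: "0 \<le> M * L"
    using order_trans[OF abs_ge_zero phi_lip[of 0 1]] by simp
  have phi_bd: "\<bar>phi s\<bar> \<le> \<bar>phi 0\<bar> + M * 2 * K" for s
  proof -
    have "\<bar>g (y (min s 0)) - g (y 0)\<bar> \<le> M * (2 * K)"
    proof (rule supnorm_lipschitzD[OF g])
      fix i show "\<bar>y (min s 0) i - y 0 i\<bar> \<le> 2 * K"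
        using bd[of "min s 0" i] bd[of 0 i] by (simp add: abs_le_iff) 
    qed
    then show ?thesis by (simp add: phi_def)
  qed
  have mvt: "\<exists>x. \<bar>x - s\<bar> \<le> \<bar>s' - s\<bar> \<and> z s' - z s = (s' - s) * phi x" for s s'
  proof (cases s s' rule: linorder_cases)
    case less
    from MVT2[OF less z] obtain x where "s < x" "x < s'" "z s' - z s = (s' - s) * phi x" by blast
    then show ?thesis by (intro exI[of _ x]) auto
  next
    case greater
    from MVT2[OF greater z] obtain x where x: "s' < x" "x < s" "z s - z s' = (s - s') * phi x" by blast
    then show ?thesis by (intro exI[of _ x]) (auto simp: algebra_simps)
  qed auto
  have z_quad: "\<bar>z s' - z s - (s' - s) * phi s\<bar> \<le> M * L * (s' - s)\<^sup>2" for s s'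
  proof -
    obtain x where x: "\<bar>x - s\<bar> \<le> \<bar>s' - s\<bar>" "z s' - z s = (s' - s) * phi x" using mvt by blast
    have "\<bar>z s' - z s - (s' - s) * phi s\<bar> = \<bar>s' - s\<bar> * \<bar>phi x - phi s\<bar>"
      unfolding x(2) by (simp add: abs_mult[symmetric] algebra_simps)
    also have "\<dots> \<le> \<bar>s' - s\<bar> * (M * L * \<bar>s' - s\<bar>)"
      using phi_lip[of x s] mult_left_mono[OF x(1) LM0] by (intro mult_left_mono) auto
    finally show ?thesis by (simp add: power2_eq_square mult_ac)
  qed
  \<comment> \<open>Since z has derivative \<open>g (y s) - \<rho>\<close>, adding it turns the
    drift \<open>H y - g y\<close> into \<open>H u - \<rho>\<close>. The function u may be
    unbounded, but its oscillation over coordinates is that of y, and that is what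
    \<open>backward_solution_constant\<close> asks for.\<close>
  define u where "u s i = y s i + (z s - z 0)" for s i
  have Hu: "H (u s) i = H (y s) i" for s i
    unfolding u_def by (rule shift)
  have u_quad: "\<bar>u s' i - u s i - (s' - s) * (H (u s) i - \<rho>)\<bar> \<le> (C + M * L) * (s' - s)\<^sup>2"
    if "s \<le> 0" "s' \<le> 0" for s s' i
  proof -
    have p: "g (y s) = phi s + \<rho>" using that by (simp add: phi_def min_def)
    have "u s' i - u s i - (s' - s) * (H (u s) i - \<rho>) =
      (y s' i - y s i - (s' - s) * (H (y s) i - g (y s))) + (z s' - z s - (s' - s) * phi s)"
      unfolding Hu p by (simp add: u_def algebra_simps)
    then show ?thesis
      using quad[OF that, of i] z_quad[of s' s] by (simp add: distrib_right abs_le_iff)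
  qed
  have u_lip: "\<bar>u s' i - u s i\<bar> \<le> (L + (\<bar>phi 0\<bar> + M * 2 * K)) * \<bar>s' - s\<bar>"
    if "s \<le> 0" "s' \<le> 0" for s s' i
  proof -
    obtain x where x: "z s' - z s = (s' - s) * phi x" using mvt by blast
    have "\<bar>z s' - z s\<bar> \<le> \<bar>s' - s\<bar> * (\<bar>phi 0\<bar> + M * 2 * K)"
      unfolding x abs_mult by (intro mult_left_mono phi_bd) auto
    then show ?thesis
      using lip[OF that, of i] by (simp add: u_def algebra_simps abs_le_iff)
  qed
  have u_osc: "\<bar>u s i - u s j\<bar> \<le> 2 * K" if "s \<le> 0" for s i j
    using bd[OF that, of i] bd[OF that, of j] by (simp add: u_def abs_le_iff)
  note const = backward_solution_constant[OF u_quad u_lip u_osc q s]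
  show "H (y s) i = \<rho>" using const(2)[of i] Hu by simp
  show "y s i - y s j = y 0 i - y 0 j"
    using const(1)[of i] const(1)[of j] by (simp add: u_def)
qed

text \<open>The solution moves along constants only, so it reduces to a scalar equation with drift
  \<open>\<rho> - f z\<close> for a strictly increasing f whose level \<rho> is taken at c0. The
  point c0 attracts forwards and repels backwards: if the value 0 of z at time 0 differs from c0,
  the squared distance E grows into the past at a linear rate, against boundedness. Hence c0 is
  0.\<close>

lemma backward_solution_level:
  fixes y :: "real \<Rightarrow> 'i::finite \<Rightarrow> real"
  assumes quad: "\<And>s s' i. s \<le> 0 \<Longrightarrow> s' \<le> 0 \<Longrightarrow>
      \<bar>y s' i - y s i - (s' - s) * (\<rho> - g (y s))\<bar> \<le> C * (s' - s)\<^sup>2"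
    and lip: "\<And>s s' i. s \<le> 0 \<Longrightarrow> s' \<le> 0 \<Longrightarrow> \<bar>y s' i - y s i\<bar> \<le> L * \<bar>s' - s\<bar>"
    and bd: "\<And>s i. s \<le> 0 \<Longrightarrow> \<bar>y s i\<bar> \<le> K"
    and par: "\<And>s i j. s \<le> 0 \<Longrightarrow> y s i - y s j = y 0 i - y 0 j"
    and g: "sistr_at g (y 0)"
  shows "g (y 0) = \<rho>"
proof -
  define i0 :: 'i where "i0 = undefined"
  define f where "f c = g (\<lambda>i. y 0 i + c)" for c
  have f: "strict_mono f" "surj f" using g unfolding sistr_at_def f_def by auto
  obtain c0 where c0: "f c0 = \<rho>" using f(2) by (metis surjD)
  define z where "z s = y s i0 - y 0 i0" for s
  have yz: "y s = (\<lambda>i. y 0 i + z s)" if "s \<le> 0" for s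
    using par[OF that, of _ i0] by (auto simp: z_def algebra_simps)
  have z0: "z 0 = 0" by (simp add: z_def)
  have "c0 = 0"
  proof (rule ccontr)
    assume c0_ne: "c0 \<noteq> 0"
    define e where "e = \<bar>c0\<bar>"
    have e: "0 < e" using c0_ne by (simp add: e_def)
    \<comment> \<open>A lower bound for the strength of the drift at distance at least e from c0,
      positive by strict monotonicity.\<close>
    define k where "k = min (f (c0 + e) - \<rho>) (\<rho> - f (c0 - e))"
    have k: "0 < k" using f(1) e c0 unfolding k_def
      by (auto simp: strict_mono_def)
    define E where "E s = (z s - c0)\<^sup>2" for s
    have dz: "(z has_real_derivative \<rho> - f (z x)) (at x)" if "x < 0" for x
    proof -
      have "(z has_real_derivative \<rho> - g (y x)) (at x)"
      proof (rule nonexp_field.has_derivative_of_quadratic[of "\<lambda>u i. 0" "\<lambda>_. 1" z "\<lambda>s. \<rho> - g (y s)" C])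
        show "nonexp_field (\<lambda>u i. 0) (\<lambda>_. 1)" by unfold_locales auto
      qed (use quad that in \<open>auto simp: z_def\<close>)
      then show ?thesis using yz[of x] that by (simp add: f_def)
    qed
    have dE: "(E has_real_derivative 2 * (z x - c0) * (\<rho> - f (z x))) (at x)" if "x < 0" for x
      unfolding E_def by (rule derivative_eq_intros dz that refl | simp)+
    have contz: "continuous_on {..0} z"
    proof (rule continuous_onI)
      fix x e assume x: "x \<in> {..0::real}" and e: "0 < (e::real)"
      show "\<exists>da>0. \<forall>x'\<in>{..0}. dist x' x < da \<longrightarrow> dist (z x') (z x) \<le> e"
      proof (intro exI[of _ "e / (\<bar>L\<bar> + 1)"] conjI ballI impI)
        show "0 < e / (\<bar>L\<bar> + 1)" using e by simp
        fix x' assume x': "x' \<in> {..0::real}" "dist x' x < e / (\<bar>L\<bar> + 1)"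
        have "\<bar>z x' - z x\<bar> \<le> L * \<bar>x' - x\<bar>" using lip[of x x' i0] x' x by (auto simp: z_def)
        also have "\<dots> \<le> (\<bar>L\<bar> + 1) * \<bar>x' - x\<bar>" by (intro mult_right_mono) auto
        also have "\<dots> \<le> e" using x'(2) by (simp add: dist_real_def field_simps)
        finally show "dist (z x') (z x) \<le> e" by (simp add: dist_real_def)
      qed
    qed
    have contE: "continuous_on {s..0} E" for s
      unfolding E_def by (intro continuous_intros continuous_on_subset[OF contz]) auto
    have nonpos: "2 * (z x - c0) * (\<rho> - f (z x)) \<le> 0" for x
    proof (cases "z x \<le> c0")
      case True
      then have "f (z x) \<le> \<rho>" using f(1) c0 by (metis strict_mono_less_eq)
      then show ?thesis using True by (simp add: mult_nonpos_nonneg)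
    next
      case False
      then have "\<rho> \<le> f (z x)" using f(1) c0 by (metis strict_mono_less_eq linear)
      then show ?thesis using False by (simp add: mult_nonneg_nonpos)
    qed
    have E_ge: "e\<^sup>2 \<le> E s" if "s \<le> 0" for s
    proof -
      have "E 0 \<le> E s"
        by (rule DERIV_nonpos_imp_decreasing_open[OF that]) (use dE nonpos contE in blast)+
      then show ?thesis by (simp add: E_def z0 e_def)
    qed
    have z_far: "e \<le> \<bar>z s - c0\<bar>" if "s \<le> 0" for s
      using E_ge[OF that] e unfolding E_def by (metis abs_le_square_iff abs_of_pos)
    have drift: "2 * (z x - c0) * (\<rho> - f (z x)) \<le> - (2 * e * k)" if "x \<le> 0" for x
    proof (cases "z x \<le> c0")
      case True
      then have "z x \<le> c0 - e" using z_far[OF that] by simp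
      then have "f (z x) \<le> f (c0 - e)" using f(1) by (simp add: strict_mono_less_eq)
      then have "k \<le> \<rho> - f (z x)" by (simp add: k_def min_def split: if_splits)
      then have "e * k \<le> (c0 - z x) * (\<rho> - f (z x))"
        using \<open>z x \<le> c0 - e\<close> e k by (intro mult_mono) auto
      then show ?thesis by (simp add: algebra_simps)
    next
      case False
      then have "c0 + e \<le> z x" using z_far[OF that] by simp
      then have "f (c0 + e) \<le> f (z x)" using f(1) by (simp add: strict_mono_less_eq)
      then have "k \<le> f (z x) - \<rho>" by (simp add: k_def min_def split: if_splits)
      then have "e * k \<le> (z x - c0) * (f (z x) - \<rho>)"
        using \<open>c0 + e \<le> z x\<close> e k by (intro mult_mono) auto
      then show ?thesis by (simp add: algebra_simps)
    qed
    \<comment> \<open>So far back that the growth \<open>2 * e * k\<close> per unit of time exceeds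
      the bound \<open>(2 * K + \<bar>c0\<bar>)^2\<close> which boundedness of y imposes on
      E.\<close>
    define s where "s = - (((2 * K + \<bar>c0\<bar>)\<^sup>2 + 1) / (2 * e * k))"
    have s: "s < 0" using e k by (simp add: s_def add_nonneg_pos)
    have "E 0 + 2 * e * k * 0 \<le> E s + 2 * e * k * s"
    proof (rule DERIV_nonpos_imp_decreasing_open[of s 0 "\<lambda>x. E x + 2 * e * k * x"])
      fix x assume x: "s < x" "x < 0"
      have "((\<lambda>x. E x + 2 * e * k * x) has_real_derivative
          2 * (z x - c0) * (\<rho> - f (z x)) + 2 * e * k) (at x)"
        by (rule derivative_eq_intros dE x refl | simp)+
      then show "\<exists>y. ((\<lambda>x. E x + 2 * e * k * x) has_real_derivative y) (at x) \<and> y \<le> 0"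
        using drift[of x] x by force
    qed (use s contE in \<open>auto intro!: continuous_intros\<close>)
    moreover have "2 * e * k * s = - ((2 * K + \<bar>c0\<bar>)\<^sup>2 + 1)" using e k by (simp add: s_def)
    moreover have "0 \<le> E 0" by (simp add: E_def)
    moreover have "E s \<le> (2 * K + \<bar>c0\<bar>)\<^sup>2"
    proof -
      have "\<bar>z s - c0\<bar> \<le> \<bar>2 * K + \<bar>c0\<bar>\<bar>"
        using bd[of s i0] bd[of 0 i0] s by (auto simp: z_def)
      then show ?thesis unfolding E_def by (simp add: abs_le_square_iff)
    qed
    ultimately show False by simp
  qed
  then show ?thesis using c0 by (simp add: f_def)
qed

section \<open>The optimality equation\<close>

definition absorbing :: "('s \<times> 'a \<Rightarrow> 's \<Rightarrow> real) \<Rightarrow> 's set \<Rightarrow> bool" where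
  "absorbing p D \<longleftrightarrow> (\<forall>s\<in>D. \<forall>a s'. 0 < p (s, a) s' \<longrightarrow> s' \<in> D)"

definition confinable :: "('s \<times> 'a \<Rightarrow> 's \<Rightarrow> real) \<Rightarrow> 's set \<Rightarrow> bool" where
  "confinable p D \<longleftrightarrow> (\<forall>s\<in>D. \<exists>a. \<forall>s'. 0 < p (s, a) s' \<longrightarrow> s' \<in> D)"

text \<open>The only consequence of weak communication that the analysis needs.\<close>

definition meeting :: "('s \<times> 'a \<Rightarrow> 's \<Rightarrow> real) \<Rightarrow> bool" where
  "meeting p \<longleftrightarrow> (\<forall>D D'. D \<noteq> {} \<and> absorbing p D \<and> D' \<noteq> {} \<and> confinable p D' \<longrightarrow> D \<inter> D' \<noteq> {})"

text \<open>Mass on any value below c would pull the average strictly below c.\<close>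

lemma avg_extremal:
  fixes v :: "'s::finite \<Rightarrow> real"
  assumes p: "stoch_kernel p" and le: "\<And>s. v s \<le> c" and eq: "c \<le> (\<Sum>s\<in>UNIV. p i s * v s)"
    and s: "0 < p i s"
  shows "v s = c"
proof (rule ccontr)
  assume "v s \<noteq> c"
  then have "v s < c" using le[of s] by simp
  have "(\<Sum>s\<in>UNIV. p i s * v s) < (\<Sum>s\<in>UNIV. p i s * c)"
  proof (rule sum_strict_mono_ex1)
    show "\<forall>x\<in>UNIV. p i x * v x \<le> p i x * c"
      using p le unfolding stoch_kernel_def by (auto intro: mult_left_mono)
    show "\<exists>a\<in>UNIV. p i a * v a < p i a * c"
      using mult_strict_left_mono[OF \<open>v s < c\<close> s] by blast
  qed simp
  also have "\<dots> = c"
    using stoch_kernel_avg_const[OF p] by simp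
  finally show False using eq by simp
qed

text \<open>At a state with minimal \<open>vmax w\<close> every action has value at most the
  minimum, so all successors are minimal again: the minimisers are absorbing. At a maximal state
  only the maximising action is known to lead to maximal successors: the maximisers are confinable.
  The two sets meet, so minimum and maximum agree.\<close>

lemma harmonic_const:
  fixes w :: "'s::finite \<times> 'a::finite \<Rightarrow> real"
  assumes p: "stoch_kernel p" and m: "meeting p"
    and w: "\<And>i. w i = (\<Sum>s\<in>UNIV. p i s * vmax w s)"
  shows "\<exists>c. w = (\<lambda>_. c)"
proof -
  define lo where "lo = Min (range (vmax w))"
  define hi where "hi = Max (range (vmax w))"
  have lo: "lo \<le> vmax w s" and hi: "vmax w s \<le> hi" for s
    unfolding lo_def hi_def by auto
  define D where "D = {s. vmax w s = lo}"
  define D' where "D' = {s. vmax w s = hi}"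
  have "lo \<in> range (vmax w)" unfolding lo_def by (rule Min_in) auto
  then have D: "D \<noteq> {}" unfolding D_def by auto
  have "hi \<in> range (vmax w)" unfolding hi_def by (rule Max_in) auto
  then have D': "D' \<noteq> {}" unfolding D'_def by auto
  have "absorbing p D"
    unfolding absorbing_def
  proof (intro ballI allI impI)
    fix s a s' assume s: "s \<in> D" and s': "0 < p (s, a) s'"
    have "- vmax w s' = - lo"
    proof (rule avg_extremal[OF p, where i = "(s, a)" and v = "\<lambda>s. - vmax w s"])
      have "w (s, a) \<le> lo" using s vmax_ge[of w s a] by (simp add: D_def)
      then show "- lo \<le> (\<Sum>s'\<in>UNIV. p (s, a) s' * - vmax w s')"
        using w[of "(s, a)"] by (simp add: sum_negf)
    qed (use lo s' in auto)
    then show "s' \<in> D" by (simp add: D_def)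
  qed
  moreover have "confinable p D'"
    unfolding confinable_def
  proof
    fix s assume s: "s \<in> D'"
    obtain a where a: "vmax w s = w (s, a)" using vmax_attained[of w s] by blast
    show "\<exists>a. \<forall>s'. 0 < p (s, a) s' \<longrightarrow> s' \<in> D'"
    proof (intro exI[of _ a] allI impI)
      fix s' assume s': "0 < p (s, a) s'"
      have "vmax w s' = hi"
        by (rule avg_extremal[OF p hi _ s']) (use s a w[of "(s, a)"] in \<open>auto simp: D'_def\<close>)
      then show "s' \<in> D'" by (simp add: D'_def)
    qed
  qed
  ultimately obtain s where "s \<in> D" "s \<in> D'"
    using m D D' unfolding meeting_def by blast
  then have "lo = hi" by (simp add: D_def D'_def)
  then have "vmax w s = lo" for s using lo[of s] hi[of s] by simp
  then have "w i = lo" for i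
    using w[of i] stoch_kernel_avg_const[OF p] by simp
  then show ?thesis by blast
qed

lemma relval_zero_const:
  assumes "stoch_kernel p" "meeting p" "\<And>i. 0 < t i" "\<And>i. relval (\<lambda>_. 0) t p w i = 0"
  shows "\<exists>c. w = (\<lambda>_. c)"
proof (rule harmonic_const[OF assms(1,2)])
  fix i
  show "w i = (\<Sum>s\<in>UNIV. p i s * vmax w s)"
    using assms(3)[of i] assms(4)[of i] by (simp add: relval_def)
qed

section \<open>The discounted equation and the vanishing discount limit\<close>

lemma vmax_lipschitz: "supnorm_lipschitz (\<lambda>u::'s::finite \<times> 'a::finite \<Rightarrow> real. vmax u s) 1"
  unfolding supnorm_lipschitz_def
proof (intro conjI allI)
  fix u w :: "'s \<times> 'a \<Rightarrow> real"
  have "\<bar>u j - w j\<bar> \<le> supnorm (\<lambda>i. u i - w i)" for j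
    using supnorm_ge[of "\<lambda>i. u i - w i" j] .
  then have "u j - w j \<le> supnorm (\<lambda>i. u i - w i)" "w j - u j \<le> supnorm (\<lambda>i. u i - w i)" for j
    by (simp_all add: abs_le_iff)
  then have "vmax u s - vmax w s \<le> supnorm (\<lambda>i. u i - w i)"
    "vmax w s - vmax u s \<le> supnorm (\<lambda>i. u i - w i)"
    by (auto intro!: vmax_diff_le)
  then show "\<bar>vmax u s - vmax w s\<bar> \<le> 1 * supnorm (\<lambda>i. u i - w i)"
    by (simp add: abs_le_iff)
qed simp

text \<open>The equation is the fixed point equation of G, obtained by solving for the term
  \<open>q i\<close>; G maps a box into itself and Brouwer's theorem applies. The bound on
  \<open>l * q i\<close> is free of l and so survives the limit of vanishing discount.\<close>

lemma discounted_solution: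
  fixes r t :: "'s::finite \<times> 'a::finite \<Rightarrow> real"
  assumes p: "stoch_kernel p" and t: "\<And>i. 0 < t i" and l: "0 < l"
  shows "\<exists>q. (\<forall>i. relval r t p q i = l * q i) \<and> (\<forall>i. \<bar>l * q i\<bar> \<le> supnorm r / Min (range t))"
proof -
  define m where "m = Min (range t)"
  have m: "0 < m" "\<And>i. m \<le> t i"
    unfolding m_def using t by auto
  have den: "0 < 1 + l * t i" for i using t[of i] l by (simp add: add_pos_pos)
  have den': "1 + l * t i \<noteq> 0" for i using den[of i] by simp
  \<comment> \<open>Chosen so that \<open>supnorm r = B * (l * m)\<close>, which is the excess that
    the denominator \<open>1 + l * t i\<close> has to absorb.\<close>
  define B where "B = supnorm r / (l * m)"
  have B: "0 \<le> B" using l m(1) by (simp add: B_def supnorm_nonneg)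
  define S :: "(real ^ ('s \<times> 'a)) set" where "S = cbox (\<chi> i. - B) (\<chi> i. B)"
  have S: "v \<in> S \<longleftrightarrow> (\<forall>i. \<bar>v $ i\<bar> \<le> B)" for v
    unfolding S_def mem_box_cart by (auto simp: abs_le_iff) (smt (verit))+
  define G :: "real ^ ('s \<times> 'a) \<Rightarrow> real ^ ('s \<times> 'a)" where
    "G v = (\<chi> i. (r i + (\<Sum>s\<in>UNIV. p i s * vmax (($) v) s)) / (1 + l * t i))" for v
  have "continuous_on S G"
    unfolding continuous_on_def
  proof
    fix v assume "v \<in> S"
    have "((\<lambda>u. vmax (($) u) s) \<longlongrightarrow> vmax (($) v) s) (at v within S)" for s
      by (rule supnorm_lipschitz_tendsto[OF vmax_lipschitz]) (intro tendsto_intros)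
    then show "(G \<longlongrightarrow> G v) (at v within S)"
      unfolding G_def by (intro tendsto_intros den')
  qed
  moreover have "G \<in> S \<rightarrow> S"
  proof
    fix v assume v: "v \<in> S"
    have "\<bar>G v $ i\<bar> \<le> B" for i
    proof -
      have b: "\<bar>vmax (($) v) s\<bar> \<le> B" for s
        using v abs_vmax_le[of "($) v" s] by (meson S supnorm_le_iff order_trans)
      have "\<bar>\<Sum>s\<in>UNIV. p i s * vmax (($) v) s\<bar> \<le> (\<Sum>s\<in>UNIV. p i s * B)"
        using stoch_kernel_nonneg[OF p] b
        by (intro order_trans[OF sum_abs] sum_mono) (simp add: abs_mult mult_left_mono)
      also have "\<dots> = B"
        using stoch_kernel_avg_const[OF p] by simp
      finally have "\<bar>r i + (\<Sum>s\<in>UNIV. p i s * vmax (($) v) s)\<bar> \<le> supnorm r + B"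
        using supnorm_ge[of r i] by linarith
      also have "supnorm r \<le> B * (l * t i)"
      proof -
        have "supnorm r = B * (l * m)" using l m(1) by (simp add: B_def)
        also have "\<dots> \<le> B * (l * t i)" using B l m(2) by (intro mult_left_mono) auto
        finally show ?thesis .
      qed
      finally show ?thesis
        using den[of i] by (simp add: G_def abs_divide pos_divide_le_eq algebra_simps)
    qed
    then show "G v \<in> S" by (simp add: S)
  qed
  moreover have "compact S" "convex S" unfolding S_def by auto
  moreover have "S \<noteq> {}" using S[of 0] B by auto
  ultimately obtain v where v: "v \<in> S" "G v = v"
    using brouwer[of S G] by blast
  show ?thesis
  proof (intro exI[of _ "($) v"] conjI allI)
    fix i
    have "v $ i = (r i + (\<Sum>s\<in>UNIV. p i s * vmax (($) v) s)) / (1 + l * t i)"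
      by (subst v(2)[symmetric]) (simp add: G_def)
    then have "v $ i * (1 + l * t i) = r i + (\<Sum>s\<in>UNIV. p i s * vmax (($) v) s)"
      using den[of i] by (simp add: eq_divide_eq)
    then show "relval r t p (($) v) i = l * v $ i"
      using t[of i] by (simp add: relval_def field_simps)
    have "l * \<bar>v $ i\<bar> \<le> l * B" using v(1) S l by (intro mult_left_mono) auto
    then show "\<bar>l * v $ i\<bar> \<le> supnorm r / Min (range t)"
      using l m(1) by (simp add: B_def m_def abs_mult)
  qed
qed

text \<open>Vanishing discount: the spans of the discounted solutions stay bounded because a rescaled limit
  would be a nonconstant harmonic function.\<close>

lemma optimality_equation_solvable:
  fixes r t :: "'s::finite \<times> 'a::finite \<Rightarrow> real"
  assumes p: "stoch_kernel p" and m: "meeting p" and t: "\<And>i. 0 < t i"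
  shows "\<exists>\<rho> q. \<forall>i. relval r t p q i = \<rho>"
proof -
  define l where "l n = 1 / real (Suc n)" for n
  have l: "0 < l n" for n by (simp add: l_def)
  define R where "R = supnorm r / Min (range t)"
  have "\<exists>q. \<forall>n. (\<forall>i. relval r t p (q n) i = l n * q n i) \<and> (\<forall>i. \<bar>l n * q n i\<bar> \<le> R)"
    unfolding R_def by (rule choice, rule allI, rule discounted_solution[OF p t l])
  then obtain q where q: "\<And>n i. relval r t p (q n) i = l n * q n i" "\<And>n i. \<bar>l n * q n i\<bar> \<le> R"
    by blast
  \<comment> \<open>Normalised to have minimum 0. The operator is invariant under this shift, and
    the level of \<open>q n\<close>, which may diverge as the discount vanishes, is removed.\<close>
  define w where "w n i = q n i + - Min (range (q n))" for n i
  have wz: "\<exists>i. w n i = 0" for n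
  proof -
    have "Min (range (q n)) \<in> range (q n)" by (rule Min_in) auto
    then obtain i where "Min (range (q n)) = q n i" by (elim rangeE)
    then show ?thesis by (intro exI[of _ i]) (simp add: w_def)
  qed
  have wr: "relval r t p (w n) i = l n * q n i" for n i
    unfolding w_def relval_shift[OF p] by (rule q(1))
  have "\<exists>K. \<forall>n. supnorm (w n) \<le> K"
  proof (rule ccontr)
    assume "\<not> ?thesis"
    then have "\<forall>k::nat. \<exists>n. real k + 1 < supnorm (w n)" by (meson not_le)
    then obtain n where n: "\<And>k. real k + 1 < supnorm (w (n k))" by metis
    define c where "c k = supnorm (w (n k))" for k
    have c: "0 < c k" "real k \<le> c k" for k using n[of k] by (auto simp: c_def)
    have c_top: "filterlim c at_top sequentially"
      by (rule filterlim_at_top_mono[OF filterlim_real_sequentially]) (simp add: c)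
    define x where "x k i = w (n k) i / c k" for k i
    have x1: "\<bar>x k i\<bar> \<le> 1" for k i
      using supnorm_ge[of "w (n k)" i] c(1)[of k] by (simp add: x_def c_def)
    obtain s y where s: "strict_mono (s :: nat \<Rightarrow> nat)" "\<And>i. (\<lambda>k. x (s k) i) \<longlonglongrightarrow> y i"
      using pointwise_bounded_subseq[of x, OF x1] by blast
    have cs: "filterlim (\<lambda>k. c (s k)) at_top sequentially"
      by (rule filterlim_compose[OF c_top filterlim_subseq[OF s(1)]])
    have rel: "relval (\<lambda>_. 0) t p (x k) i = (l (n k) * q (n k) i - r i / t i) / c k" for k i
    proof -
      have "w (n k) = (\<lambda>i. c k * x k i)" using c(1)[of k] by (auto simp: x_def)
      then have "relval (\<lambda>i. r i / c k) t p (x k) i = l (n k) * q (n k) i / c k"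
        using relval_scale[OF c(1)[of k], of r t p "x k" i] wr[of "n k" i] by simp
      moreover have "relval (\<lambda>i. r i / c k) t p (x k) i = relval (\<lambda>_. 0) t p (x k) i + r i / t i / c k"
        by (simp add: relval_def add_divide_distrib diff_divide_distrib)
      ultimately show ?thesis by (simp add: diff_divide_distrib)
    qed
    have "relval (\<lambda>_. 0) t p y i = 0" for i
    proof (rule LIMSEQ_unique)
      show "(\<lambda>k. relval (\<lambda>_. 0) t p (x (s k)) i) \<longlonglongrightarrow> relval (\<lambda>_. 0) t p y i"
        by (rule supnorm_lipschitz_tendsto[OF relval_lipschitz[OF p t] s(2)])
      show "(\<lambda>k. relval (\<lambda>_. 0) t p (x (s k)) i) \<longlonglongrightarrow> 0"
      proof (rule Lim_null_comparison)
        show "(\<lambda>k. (R + \<bar>r i / t i\<bar>) / c (s k)) \<longlonglongrightarrow> 0"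
          by (rule tendsto_divide_0[OF tendsto_const filterlim_at_top_imp_at_infinity[OF cs]])
        have "\<bar>l (n k) * q (n k) i - r i / t i\<bar> \<le> R + \<bar>r i / t i\<bar>" for k
          using q(2)[of "n k" i] by linarith
        then show "\<forall>\<^sub>F k in sequentially. norm (relval (\<lambda>_. 0) t p (x (s k)) i) \<le> (R + \<bar>r i / t i\<bar>) / c (s k)"
          unfolding rel using c(1) by (simp add: abs_divide divide_right_mono less_imp_le)
      qed
    qed
    then obtain d where d: "y = (\<lambda>_. d)" using relval_zero_const[OF p m, of t y] t by blast
    \<comment> \<open>A vanishing product says that some coordinate is 0, in a form that passes to
      the limit although the coordinate may change with k.\<close>
    have "(\<lambda>k. \<Prod>i\<in>UNIV. x (s k) i) \<longlonglongrightarrow> (\<Prod>i\<in>UNIV. y i)"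
      by (intro tendsto_prod s(2))
    moreover have "(\<Prod>i\<in>UNIV. x (s k) i) = 0" for k
      using wz[of "n (s k)"] by (auto simp: x_def)
    ultimately have "(\<Prod>i\<in>UNIV. y i) = 0"
      by (simp add: LIMSEQ_const_iff)
    then have d0: "d = 0" by (simp add: d)
    have "(\<lambda>k. supnorm (\<lambda>i. x (s k) i - y i)) \<longlonglongrightarrow> 0"
      by (rule tendsto_supnorm_diff[OF s(2)])
    moreover have "supnorm (\<lambda>i. x (s k) i - y i) = 1" for k
    proof (rule antisym)
      show "supnorm (\<lambda>i. x (s k) i - y i) \<le> 1"
        using x1 by (simp add: d d0 supnorm_le_iff)
      obtain i where i: "supnorm (w (n (s k))) = \<bar>w (n (s k)) i\<bar>" using supnorm_attained by blast
      have "\<bar>x (s k) i - y i\<bar> = 1"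
        using i c(1)[of "s k"] by (simp add: x_def c_def d d0 abs_divide)
      then show "1 \<le> supnorm (\<lambda>i. x (s k) i - y i)"
        using supnorm_ge[of "\<lambda>i. x (s k) i - y i" i] by simp
    qed
    ultimately show False by (simp add: LIMSEQ_const_iff)
  qed
  then obtain K where K: "\<And>n. supnorm (w n) \<le> K" by blast
  then have wK: "\<bar>w n i\<bar> \<le> K" for n i using supnorm_ge[of "w n" i] by (rule order_trans[rotated])
  obtain s1 y where s1: "strict_mono (s1 :: nat \<Rightarrow> nat)" "\<And>i. (\<lambda>k. w (s1 k) i) \<longlonglongrightarrow> y i"
    using pointwise_bounded_subseq[of w, OF wK] by blast
  obtain s2 g where s2: "strict_mono (s2 :: nat \<Rightarrow> nat)"
    "\<And>i. (\<lambda>k. l (s1 (s2 k)) * q (s1 (s2 k)) i) \<longlonglongrightarrow> g i"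
    using pointwise_bounded_subseq[of "\<lambda>k i. l (s1 k) * q (s1 k) i", OF q(2)] by blast
  define s where "s k = s1 (s2 k)" for k
  have s: "strict_mono s" using s1(1) s2(1) by (simp add: s_def strict_mono_def)
  have wy: "(\<lambda>k. w (s k) i) \<longlonglongrightarrow> y i" for i
    using LIMSEQ_subseq_LIMSEQ[OF s1(2) s2(1), of i] by (simp add: s_def o_def)
  have lim: "(\<lambda>k. relval r t p (w (s k)) i) \<longlonglongrightarrow> relval r t p y i" for i
    by (rule supnorm_lipschitz_tendsto[OF relval_lipschitz[OF p t] wy])
  then have rg: "relval r t p y i = g i" for i
    using LIMSEQ_unique s2(2)[of i] unfolding wr s_def by blast
  have l0: "l \<longlonglongrightarrow> 0" unfolding l_def by (rule LIMSEQ_inverse_real_of_nat[unfolded inverse_eq_divide])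
  \<comment> \<open>Differences of \<open>l * q\<close> are l times differences of the bounded
    functions w, hence vanish in the limit.\<close>
  have "g i = g j" for i j
  proof -
    have "(\<lambda>k. l (s k) * q (s k) i - l (s k) * q (s k) j) \<longlonglongrightarrow> g i - g j"
      using s2(2) unfolding s_def by (intro tendsto_diff) auto
    moreover have "l (s k) * q (s k) i - l (s k) * q (s k) j = l (s k) * (w (s k) i - w (s k) j)" for k
      by (simp add: w_def algebra_simps)
    moreover have "(\<lambda>k. l (s k) * (w (s k) i - w (s k) j)) \<longlonglongrightarrow> 0 * (y i - y j)"
      by (intro tendsto_intros wy LIMSEQ_subseq_LIMSEQ[OF l0 s, unfolded o_def])
    ultimately show ?thesis using LIMSEQ_unique by fastforce
  qed
  then show ?thesis using rg by metis
qed

section \<open>Limits of shifted and rescaled iterates\<close>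

text \<open>An Arzela-Ascoli argument for step functions, which are equicontinuous only up to an
  error that dies out along the sequence. A diagonal subsequence converges at all nonpositive
  rational times, and the asymptotic Lipschitz bound carries the Cauchy property to every other
  time.\<close>

lemma asymp_lipschitz_subseq:
  fixes X :: "nat \<Rightarrow> real \<Rightarrow> 'i::finite \<Rightarrow> real"
  assumes bd: "\<And>k s i. s \<le> 0 \<Longrightarrow> \<bar>X k s i\<bar> \<le> K"
    and lip: "\<And>T e. 0 < T \<Longrightarrow> 0 < e \<Longrightarrow> \<exists>N. \<forall>k\<ge>N. \<forall>s t i. - T \<le> s \<longrightarrow> s \<le> t \<longrightarrow> t \<le> 0 \<longrightarrow>
      \<bar>X k t i - X k s i\<bar> \<le> L * (t - s) + e"
  shows "\<exists>r Y. strict_mono (r :: nat \<Rightarrow> nat) \<and> (\<forall>s\<le>0. \<forall>i. (\<lambda>k. X (r k) s i) \<longlonglongrightarrow> Y s i)"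
proof -
  \<comment> \<open>An enumeration, with repetitions, of the nonpositive rationals.\<close>
  define q where "q n = - \<bar>real_of_rat (from_nat n)\<bar>" for n
  have q0: "q n \<le> 0" for n by (simp add: q_def)
  define P where "P n s \<longleftrightarrow> (\<forall>i. convergent (\<lambda>k. X (s k) (q n) i))" for n and s :: "nat \<Rightarrow> nat"
  interpret subseqs P
  proof
    fix n and s :: "nat \<Rightarrow> nat" assume "strict_mono s"
    obtain r y where "strict_mono (r :: nat \<Rightarrow> nat)" "\<And>i. (\<lambda>k. X (s (r k)) (q n) i) \<longlonglongrightarrow> y i"
      by (rule pointwise_bounded_subseq[of "\<lambda>k. X (s k) (q n)" K, OF bd[OF q0]]) (rule that)
    then show "\<exists>r'. strict_mono r' \<and> P n (s \<circ> r')"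
      unfolding P_def convergent_def by (auto simp: o_def)
  qed
  have conv: "convergent (\<lambda>k. X (diagseq k) (q n) i)" for n i
  proof -
    have "P n (diagseq \<circ> ((+) (Suc n)))"
    proof (rule diagseq_holds)
      fix r s :: "nat \<Rightarrow> nat" and n assume "strict_mono r" "P n s"
      then show "P n (s \<circ> r)"
        using convergent_subseq_convergent[of "\<lambda>k. X (s k) (q n) i" r for i]
        by (simp add: P_def o_def)
    qed
    then have "convergent (\<lambda>k. X (diagseq (k + Suc n)) (q n) i)"
      unfolding P_def by (simp add: add.commute)
    then show ?thesis
      by (rule convergent_ignore_initial_segment[of "\<lambda>k. X (diagseq k) (q n) i" "Suc n", THEN iffD1])
  qed
  have "convergent (\<lambda>k. X (diagseq k) s i)" if s: "s \<le> 0" for s i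
  proof (rule Cauchy_convergent, rule CauchyI)
    fix e :: real assume e: "0 < e"
    \<comment> \<open>Five shares of \<open>e / 5\<close>: two for each of the two moves between s
      and the rational time, one for the Cauchy gap at that time.\<close>
    define d where "d = e / (5 * (\<bar>L\<bar> + 1))"
    have d: "0 < d" using e by (simp add: d_def)
    obtain x where x: "s - d < real_of_rat x" "real_of_rat x < s"
      using of_rat_dense[of "s - d" s] d by auto
    obtain n where n: "x = from_nat n" by (metis surj_from_nat surjD)
    have "real_of_rat x < 0" using x(2) s by linarith
    then have "q n = real_of_rat x" using n unfolding q_def by (metis abs_of_neg minus_minus)
    then have qn: "s - d < q n" "q n \<le> s" using x by simp_all
    have "0 < d - s" "0 < e / 5" using s d e by simp_all
    from lip[OF this] obtain N1 where N1: "\<And>k s' t i. k \<ge> N1 \<Longrightarrow> - (d - s) \<le> s' \<Longrightarrow> s' \<le> t \<Longrightarrow> t \<le> 0 \<Longrightarrow>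
        \<bar>X k t i - X k s' i\<bar> \<le> L * (t - s') + e / 5"
      by blast
    have near: "\<bar>X k s i - X k (q n) i\<bar> \<le> 2 * (e / 5)" if "k \<ge> N1" for k
    proof -
      have "\<bar>X k s i - X k (q n) i\<bar> \<le> L * (s - q n) + e / 5"
        using N1[OF that, of "q n" s i] qn s by simp
      also have "L * (s - q n) \<le> (\<bar>L\<bar> + 1) * d"
        using qn by (intro mult_mono) auto
      also have "(\<bar>L\<bar> + 1) * d = e / 5" by (simp add: d_def field_simps)
      finally show ?thesis by simp
    qed
    from conv[of n i] have "Cauchy (\<lambda>k. X (diagseq k) (q n) i)" by (rule convergent_Cauchy)
    then obtain N2 where N2: "\<And>j k. j \<ge> N2 \<Longrightarrow> k \<ge> N2 \<Longrightarrow>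
        \<bar>X (diagseq j) (q n) i - X (diagseq k) (q n) i\<bar> < e / 5"
      using CauchyD[of "\<lambda>k. X (diagseq k) (q n) i" "e / 5"] e by auto
    show "\<exists>M. \<forall>m\<ge>M. \<forall>n\<ge>M. norm (X (diagseq m) s i - X (diagseq n) s i) < e"
    proof (intro exI[of _ "max N1 N2"] allI impI)
      fix j k assume jk: "j \<ge> max N1 N2" "k \<ge> max N1 N2"
      have dj: "diagseq j \<ge> N1" "diagseq k \<ge> N1"
        using jk seq_suble[OF subseq_diagseq] by (meson max.bounded_iff order_trans)+
      show "norm (X (diagseq j) s i - X (diagseq k) s i) < e"
        using near[OF dj(1)] near[OF dj(2)] N2[of j k] jk unfolding real_norm_def by linarith
    qed
  qed
  then have "\<forall>s\<le>0. \<forall>i. (\<lambda>k. X (diagseq k) s i) \<longlonglongrightarrow> lim (\<lambda>k. X (diagseq k) s i)"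
    by (simp add: convergent_LIMSEQ_iff)
  then show ?thesis
    by (intro exI[of _ diagseq] exI[of _ "\<lambda>s i. lim (\<lambda>k. X (diagseq k) s i)"] conjI subseq_diagseq) auto
qed

section \<open>Asynchronous iterations in clock time\<close>

lemma scaled_diff_le:
  fixes l :: real
  assumes "0 < l" "\<bar>a - b\<bar> \<le> L * (l * S)"
  shows "\<bar>a / l - b / l\<bar> \<le> L * S"
proof -
  have "\<bar>a / l - b / l\<bar> = \<bar>a - b\<bar> / l"
    using assms(1) by (simp add: abs_divide flip: diff_divide_distrib)
  also have "\<dots> \<le> L * (l * S) / l" using assms by (intro divide_right_mono) auto
  also have "\<dots> = L * S" using assms(1) by simp
  finally show ?thesis .
qed

text \<open>Errors are measured against the nondecreasing envelope W rather than in absolute terms,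
  so that the assumptions can be checked before boundedness is known. The clock c is such that over
  windows of bounded length each component receives a step mass close to the elapsed time.\<close>

locale async_iteration =
  fixes x :: "nat \<Rightarrow> 'i::finite \<Rightarrow> real" and a err :: "nat \<Rightarrow> 'i \<Rightarrow> real"
    and h :: "('i \<Rightarrow> real) \<Rightarrow> 'i \<Rightarrow> real" and W c :: "nat \<Rightarrow> real" and Lh :: real
  assumes step: "\<And>n i. x (Suc n) i = x n i + a n i * h (x n) i + err n i"
    and a_nonneg: "\<And>n i. 0 \<le> a n i"
    and x_le_W: "\<And>n. 1 + supnorm (x n) \<le> W n" and W_mono: "mono W"
    and h_lip: "\<And>i. supnorm_lipschitz (\<lambda>y. h y i) Lh"
    and err_small: "\<And>T e i. 0 < T \<Longrightarrow> 0 < e \<Longrightarrow> \<exists>N. \<forall>m\<ge>N. \<forall>n\<ge>m. c n - c m \<le> T \<longrightarrow>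
        \<bar>\<Sum>j=m..<n. err j i\<bar> \<le> e * W n"
    and balance: "\<And>T e i. 0 < T \<Longrightarrow> 0 < e \<Longrightarrow> \<exists>N. \<forall>m\<ge>N. \<forall>n\<ge>m. c n - c m \<le> T \<longrightarrow>
        \<bar>(\<Sum>j=m..<n. a j i) - (c n - c m)\<bar> \<le> e"
    and c_less: "\<And>n. c n < c (Suc n)" and c_0: "c 0 = 0"
    and c_top: "filterlim c at_top sequentially"
    and c_gap: "(\<lambda>n. c (Suc n) - c n) \<longlonglongrightarrow> 0"
begin

definition Ch :: real where "Ch = max Lh (supnorm (h (\<lambda>_. 0)))"

lemma Ch_nonneg: "0 \<le> Ch"
  unfolding Ch_def using supnorm_nonneg[of "h (\<lambda>_. 0)"] by linarith

lemma Lh_nonneg: "0 \<le> Lh"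
  using h_lip unfolding supnorm_lipschitz_def by blast

lemma h_bound: "\<bar>h y i\<bar> \<le> Ch * (1 + supnorm y)"
proof -
  have "\<bar>h y i - h (\<lambda>_. 0) i\<bar> \<le> Lh * supnorm y"
    by (rule supnorm_lipschitzD[OF h_lip]) (simp add: supnorm_ge)
  moreover have "\<bar>h (\<lambda>_. 0) i\<bar> \<le> Ch" using supnorm_ge[of "h (\<lambda>_. 0)" i] unfolding Ch_def by linarith
  moreover have "Lh * supnorm y \<le> Ch * supnorm y"
    unfolding Ch_def by (intro mult_right_mono) (auto simp: supnorm_nonneg)
  ultimately show ?thesis by (simp add: distrib_left)
qed

lemma W_ge_1: "1 \<le> W n"
  using x_le_W[of n] supnorm_nonneg[of "x n"] by linarith

lemma W_le: "m \<le> n \<Longrightarrow> W m \<le> W n"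
  using W_mono by (rule monoD)

lemma h_bound_W: "j \<le> n \<Longrightarrow> \<bar>h (x j) i\<bar> \<le> Ch * W n"
  using h_bound[of "x j" i] mult_left_mono[OF order_trans[OF x_le_W W_le] Ch_nonneg, of j n]
  by linarith

lemma x_bound_W: "j \<le> n \<Longrightarrow> \<bar>x j i\<bar> \<le> W n"
  using supnorm_ge[of "x j" i] x_le_W[of j] W_le[of j n] by linarith

lemma c_mono: "m \<le> n \<Longrightarrow> c m \<le> c n"
  by (rule lift_Suc_mono_le[of c]) (rule less_imp_le[OF c_less])

lemma increment:
  "m \<le> n \<Longrightarrow> x n i - x m i = (\<Sum>j=m..<n. a j i * h (x j) i) + (\<Sum>j=m..<n. err j i)"
proof (induction n rule: dec_induct)
  case (step n)
  then show ?case using async_iteration.step[OF async_iteration_axioms, of n i] by simp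
qed simp

text \<open>The bound B on the drift is quantified after N. It is used with B of the order of the
  envelope for the growth estimates, and with an arbitrarily small B once the drift is known to
  vanish.\<close>

lemma window_bound:
  assumes T: "0 < T" and e: "0 < e"
  shows "\<exists>N. \<forall>m\<ge>N. \<forall>n\<ge>m. c n - c m \<le> T \<longrightarrow> (\<forall>B i. 0 \<le> B \<longrightarrow> (\<forall>j\<in>{m..<n}. \<bar>h (x j) i\<bar> \<le> B) \<longrightarrow>
      \<bar>x n i - x m i\<bar> \<le> B * (c n - c m + e) + e * W n)"
proof -
  have "\<forall>i. \<exists>N. \<forall>m\<ge>N. \<forall>n\<ge>m. c n - c m \<le> T \<longrightarrow> \<bar>(\<Sum>j=m..<n. a j i) - (c n - c m)\<bar> \<le> e"
    using balance[OF T e] by blast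
  then obtain N1 where N1: "\<And>i m n. m \<ge> N1 i \<Longrightarrow> n \<ge> m \<Longrightarrow> c n - c m \<le> T \<Longrightarrow>
      \<bar>(\<Sum>j=m..<n. a j i) - (c n - c m)\<bar> \<le> e" by metis
  have "\<forall>i. \<exists>N. \<forall>m\<ge>N. \<forall>n\<ge>m. c n - c m \<le> T \<longrightarrow> \<bar>\<Sum>j=m..<n. err j i\<bar> \<le> e * W n"
    using err_small[OF T e] by blast
  then obtain N2 where N2: "\<And>i m n. m \<ge> N2 i \<Longrightarrow> n \<ge> m \<Longrightarrow> c n - c m \<le> T \<Longrightarrow>
      \<bar>\<Sum>j=m..<n. err j i\<bar> \<le> e * W n" by metis
  define N where "N = Max (range (\<lambda>i. max (N1 i) (N2 i)))"
  have "max (N1 i) (N2 i) \<le> N" for i unfolding N_def by (rule Max_ge) auto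
  then have N: "N1 i \<le> N" "N2 i \<le> N" for i by (simp_all add: max.bounded_iff)
  show ?thesis
  proof (intro exI[of _ N] allI impI)
    fix m n B i assume m: "m \<ge> N" and n: "n \<ge> m" and cT: "c n - c m \<le> T"
      and B0: "0 \<le> B" and B: "\<forall>j\<in>{m..<n}. \<bar>h (x j) i\<bar> \<le> B"
    have "\<bar>\<Sum>j=m..<n. a j i * h (x j) i\<bar> \<le> (\<Sum>j=m..<n. a j i * B)"
      using B a_nonneg by (intro order_trans[OF sum_abs] sum_mono) (simp add: abs_mult mult_left_mono)
    also have "\<dots> = B * (\<Sum>j=m..<n. a j i)" by (simp add: sum_distrib_left mult.commute)
    also have "\<dots> \<le> B * (c n - c m + e)"
      using N1[of i m n] N(1)[of i] m n cT B0 by (intro mult_left_mono) (auto simp: abs_le_iff)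
    finally show "\<bar>x n i - x m i\<bar> \<le> B * (c n - c m + e) + e * W n"
      using N2[of i m n] N(2)[of i] m n cT unfolding increment[OF n] by simp
  qed
qed

text \<open>The discrete source of the second-order estimate: inside a window the drift is replaced
  by its value at the left end, at the cost of Lh times the movement, which is itself of order
  \<open>Ch * W n * (c n - c m)\<close>. Imbalance of the steps and noise go into
  \<open>e * W n\<close>.\<close>

lemma window_quadratic:
  assumes T: "0 < T" and e: "0 < e"
  shows "\<exists>N. \<forall>m\<ge>N. \<forall>n\<ge>m. c n - c m \<le> T \<longrightarrow> (\<forall>i.
      \<bar>x n i - x m i\<bar> \<le> Ch * W n * (c n - c m) + e * W n \<and>
      \<bar>x n i - x m i - (c n - c m) * h (x m) i\<bar> \<le> Lh * Ch * W n * (c n - c m)\<^sup>2 + e * W n)"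
proof -
  \<comment> \<open>The sum of all coefficients of \<open>d * W n\<close> that appear in the final
    estimate, with T bounding the window length and 1 bounding d.\<close>
  define b where "b = Lh * Ch * T + (T + 1) * Lh * (Ch + 1) + Ch + 1"
  have b1: "1 \<le> b" "Ch + 1 \<le> b"
    unfolding b_def using Lh_nonneg Ch_nonneg T by simp_all
  define d where "d = min 1 (e / b)"
  have d: "0 < d" "d \<le> 1" "d * b \<le> e"
    unfolding d_def using e b1 by (auto simp: min_def field_simps)
  obtain N1 where N1: "\<And>m n B i. m \<ge> N1 \<Longrightarrow> n \<ge> m \<Longrightarrow> c n - c m \<le> T \<Longrightarrow> 0 \<le> B \<Longrightarrow>
      (\<forall>j\<in>{m..<n}. \<bar>h (x j) i\<bar> \<le> B) \<Longrightarrow> \<bar>x n i - x m i\<bar> \<le> B * (c n - c m + d) + d * W n"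
    using window_bound[OF T d(1)] by blast
  have "\<forall>i. \<exists>N. \<forall>m\<ge>N. \<forall>n\<ge>m. c n - c m \<le> T \<longrightarrow> \<bar>(\<Sum>j=m..<n. a j i) - (c n - c m)\<bar> \<le> d"
    using balance[OF T d(1)] by blast
  then obtain N2 where N2: "\<And>i m n. m \<ge> N2 i \<Longrightarrow> n \<ge> m \<Longrightarrow> c n - c m \<le> T \<Longrightarrow>
      \<bar>(\<Sum>j=m..<n. a j i) - (c n - c m)\<bar> \<le> d" by metis
  have "\<forall>i. \<exists>N. \<forall>m\<ge>N. \<forall>n\<ge>m. c n - c m \<le> T \<longrightarrow> \<bar>\<Sum>j=m..<n. err j i\<bar> \<le> d * W n"
    using err_small[OF T d(1)] by blast
  then obtain N3 where N3: "\<And>i m n. m \<ge> N3 i \<Longrightarrow> n \<ge> m \<Longrightarrow> c n - c m \<le> T \<Longrightarrow>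
      \<bar>\<Sum>j=m..<n. err j i\<bar> \<le> d * W n" by metis
  define N where "N = max N1 (Max (range (\<lambda>i. max (N2 i) (N3 i))))"
  have "max (N2 i) (N3 i) \<le> Max (range (\<lambda>i. max (N2 i) (N3 i)))" for i by (rule Max_ge) auto
  then have N: "N1 \<le> N" "N2 i \<le> N" "N3 i \<le> N" for i
    unfolding N_def by (auto simp: le_max_iff_disj)
  show ?thesis
  proof (intro exI[of _ N] allI impI)
    fix m n i assume m: "m \<ge> N" and n: "n \<ge> m" and cT: "c n - c m \<le> T"
    have W: "0 \<le> W n" "1 \<le> W n" using W_ge_1[of n] by simp_all
    have CW: "0 \<le> Ch * W n" using Ch_nonneg W by simp
    have D: "0 \<le> c n - c m" using c_mono[OF n] by simp
    have osc: "\<bar>x j k - x m k\<bar> \<le> Ch * W n * (c j - c m) + d * (Ch + 1) * W n"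
      if j: "j \<in> {m..n}" for j k
    proof -
      have "c j - c m \<le> T" using cT c_mono[of j n] j by simp
      then have "\<bar>x j k - x m k\<bar> \<le> Ch * W n * (c j - c m + d) + d * W j"
        using N1[of m j "Ch * W n" k] j N(1) m CW h_bound_W[of _ n k] by simp
      also have "d * W j \<le> d * W n" using W_le[of j n] j d by (intro mult_left_mono) auto
      finally show ?thesis by (simp add: algebra_simps)
    qed
    have sum_a: "\<bar>(\<Sum>j=m..<n. a j i) - (c n - c m)\<bar> \<le> d"
      using N2[of i m n] N(2)[of i] m n cT by simp
    have sum_a0: "0 \<le> (\<Sum>j=m..<n. a j i)" using a_nonneg by (intro sum_nonneg) auto
    define o' where "o' = Lh * (Ch * W n * (c n - c m) + d * (Ch + 1) * W n)"
    have o': "0 \<le> o'" unfolding o'_def using Lh_nonneg Ch_nonneg W D d by simp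
    have hdiff: "\<bar>h (x j) i - h (x m) i\<bar> \<le> o'" if j: "j \<in> {m..<n}" for j
      unfolding o'_def
    proof (rule supnorm_lipschitzD[OF h_lip])
      fix k
      have "Ch * W n * (c j - c m) \<le> Ch * W n * (c n - c m)"
        using c_mono[of j n] j CW by (intro mult_left_mono) auto
      then show "\<bar>x j k - x m k\<bar> \<le> Ch * W n * (c n - c m) + d * (Ch + 1) * W n"
        using osc[of j k] j by simp
    qed
    \<comment> \<open>Three sources of error: variation of the drift, imbalance of the step mass
      against the clock, and noise.\<close>
    have "x n i - x m i - (c n - c m) * h (x m) i
        = (\<Sum>j=m..<n. a j i * (h (x j) i - h (x m) i))
          + ((\<Sum>j=m..<n. a j i) - (c n - c m)) * h (x m) i + (\<Sum>j=m..<n. err j i)"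
      unfolding increment[OF n]
      by (simp add: right_diff_distrib left_diff_distrib sum_subtractf sum_distrib_right)
    moreover have "\<bar>\<Sum>j=m..<n. a j i * (h (x j) i - h (x m) i)\<bar> \<le> (c n - c m + d) * o'"
    proof -
      have "\<bar>\<Sum>j=m..<n. a j i * (h (x j) i - h (x m) i)\<bar> \<le> (\<Sum>j=m..<n. a j i * o')"
        using hdiff a_nonneg
        by (intro order_trans[OF sum_abs] sum_mono) (simp add: abs_mult mult_left_mono)
      also have "\<dots> = (\<Sum>j=m..<n. a j i) * o'" by (simp add: sum_distrib_right)
      also have "\<dots> \<le> (c n - c m + d) * o'"
        using sum_a o' by (intro mult_right_mono) (auto simp: abs_le_iff)
      finally show ?thesis .
    qed
    moreover have "\<bar>((\<Sum>j=m..<n. a j i) - (c n - c m)) * h (x m) i\<bar> \<le> d * (Ch * W n)"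
      unfolding abs_mult using sum_a h_bound_W[OF n] by (intro mult_mono) (use d in auto)
    moreover have "\<bar>\<Sum>j=m..<n. err j i\<bar> \<le> d * W n"
      using N3[of i m n] N(3)[of i] m n cT by simp
    ultimately have "\<bar>x n i - x m i - (c n - c m) * h (x m) i\<bar>
        \<le> (c n - c m + d) * o' + d * (Ch * W n) + d * W n"
      by linarith
    also have "\<dots> \<le> Lh * Ch * W n * (c n - c m)\<^sup>2 + d * b * W n"
    proof -
      have "(c n - c m + d) * o' = Lh * Ch * W n * (c n - c m)\<^sup>2
          + d * W n * (Lh * Ch * (c n - c m) + (c n - c m + d) * Lh * (Ch + 1))"
        unfolding o'_def by (simp add: power2_eq_square algebra_simps)
      moreover have "Lh * Ch * (c n - c m) + (c n - c m + d) * Lh * (Ch + 1)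
          \<le> Lh * Ch * T + (T + 1) * Lh * (Ch + 1)"
        using cT d Lh_nonneg Ch_nonneg T
        by (intro add_mono mult_left_mono mult_right_mono) auto
      then have "d * W n * (Lh * Ch * (c n - c m) + (c n - c m + d) * Lh * (Ch + 1))
          \<le> d * W n * (Lh * Ch * T + (T + 1) * Lh * (Ch + 1))"
        using d W by (intro mult_left_mono) auto
      ultimately show ?thesis unfolding b_def by (simp add: algebra_simps)
    qed
    also have "d * b * W n \<le> e * W n" using d W by (intro mult_right_mono) auto
    finally have quad: "\<bar>x n i - x m i - (c n - c m) * h (x m) i\<bar>
        \<le> Lh * Ch * W n * (c n - c m)\<^sup>2 + e * W n" by simp
    have "d * (Ch + 1) \<le> e" using order_trans[OF mult_left_mono[OF b1(2)] d(3)] d(1) by simp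
    then have "d * (Ch + 1) * W n \<le> e * W n" using W by (intro mult_right_mono) auto
    then have "\<bar>x n i - x m i\<bar> \<le> Ch * W n * (c n - c m) + e * W n"
      using osc[of n i] n by simp
    then show "\<bar>x n i - x m i\<bar> \<le> Ch * W n * (c n - c m) + e * W n \<and>
      \<bar>x n i - x m i - (c n - c m) * h (x m) i\<bar> \<le> Lh * Ch * W n * (c n - c m)\<^sup>2 + e * W n"
      using quad by blast
  qed
qed

text \<open>The inverse of the clock, giving the interval from \<open>c n\<close> to
  \<open>c (Suc n)\<close> that contains u. Its form under LEAST copies the one in
  \<open>xbar\<close>, which later allows the two to be identified.\<close>

definition idx :: "real \<Rightarrow> nat" where "idx u = (LEAST n. u < c (Suc n))"

lemma idx_upper: "u < c (Suc (idx u))"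
proof -
  obtain n where "u < c n"
    using c_top unfolding filterlim_at_top_dense eventually_sequentially by blast
  then have "u < c (Suc n)" using c_less[of n] by simp
  then show ?thesis unfolding idx_def by (rule LeastI)
qed

lemma idx_le: "u < c (Suc n) \<Longrightarrow> idx u \<le> n"
  unfolding idx_def by (rule Least_le)

lemma idx_lower: "0 \<le> u \<Longrightarrow> c (idx u) \<le> u"
proof (cases "idx u")
  case (Suc n)
  then have "\<not> u < c (Suc n)" using idx_le[of u n] by auto
  then show ?thesis using Suc by simp
qed (simp add: c_0)

lemma idx_mono: "u \<le> v \<Longrightarrow> idx u \<le> idx v"
  using idx_upper[of v] by (intro idx_le) simp

lemma idx_c: "idx (c n) = n"
proof (rule antisym)
  show "idx (c n) \<le> n" by (rule idx_le) (rule c_less)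
  show "n \<le> idx (c n)" using idx_upper[of "c n"] c_mono[of "Suc (idx (c n))" n] by force
qed

lemma idx_ge: "c n \<le> u \<Longrightarrow> n \<le> idx u"
  using idx_mono[of "c n" u] idx_c by simp

text \<open>Look back in clock time from the index \<open>n k\<close> and divide by
  \<open>l k\<close>. As W is nondecreasing, the single bound at \<open>n k\<close> controls the
  whole past, and this is why the limit lives on nonpositive times. The scale l is 1 for the plain
  iterates and the envelope for the rescaled ones; h' is the drift that results.\<close>

lemma limit_solution:
  fixes n :: "nat \<Rightarrow> nat" and l :: "nat \<Rightarrow> real"
  assumes n: "filterlim n at_top sequentially" and l: "\<And>k. 0 < l k"
    and K: "\<And>k. W (n k) \<le> K * l k"
    and h': "\<And>y i. (\<lambda>k. h (\<lambda>j. l k * y j) i / l k) \<longlonglongrightarrow> h' y i"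
  shows "\<exists>r Y C L. strict_mono (r :: nat \<Rightarrow> nat) \<and>
    (\<forall>i. (\<lambda>k. x (n (r k)) i / l (r k)) \<longlonglongrightarrow> Y 0 i) \<and>
    (\<forall>s\<le>0. \<forall>i. \<bar>Y s i\<bar> \<le> K) \<and>
    (\<forall>s\<le>0. \<forall>t\<le>0. \<forall>i. \<bar>Y t i - Y s i\<bar> \<le> L * \<bar>t - s\<bar>) \<and>
    (\<forall>s\<le>0. \<forall>t\<le>0. \<forall>i. \<bar>Y t i - Y s i - (t - s) * h' (Y s) i\<bar> \<le> C * (t - s)\<^sup>2)"
proof -
  have K0: "0 \<le> K"
    using K[of 0] W_ge_1[of "n 0"] l[of 0] by (meson less_eq_real_def mult_neg_pos not_less order_trans zero_le_one)
  \<comment> \<open>A step function of s, constant between two ticks of the clock. Where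
    \<open>c (n k) + s\<close> is negative, \<open>idx\<close> gives 0; that happens only outside
    any fixed window once k is large.\<close>
  define X where "X k s i = x (idx (c (n k) + s)) i / l k" for k s i
  have idx_n: "idx (c (n k) + s) \<le> n k" if "s \<le> 0" for k s
    using idx_mono[of "c (n k) + s" "c (n k)"] that idx_c by simp
  have WK: "w / l k \<le> K" if "w \<le> W (n k)" for w k
    using order_trans[OF that K[of k]] l[of k] by (simp add: pos_divide_le_eq)
  have bd: "\<bar>X k s i\<bar> \<le> K" if "s \<le> 0" for k s i
    using WK[OF x_bound_W[OF idx_n[OF that]]] l[of k] by (simp add: X_def abs_divide)
  have main: "\<exists>N. \<forall>k\<ge>N. \<forall>s t i. - T \<le> s \<longrightarrow> s \<le> t \<longrightarrow> t \<le> 0 \<longrightarrow>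
      \<bar>X k t i - X k s i\<bar> \<le> Ch * K * (t - s) + e \<and>
      \<bar>X k t i - X k s i - (t - s) * (h (\<lambda>j. l k * X k s j) i / l k)\<bar> \<le> Lh * Ch * K * (t - s)\<^sup>2 + e"
    if T: "0 < T" and e: "0 < e" for T e
  proof -
    \<comment> \<open>The sum of the coefficients of d in both estimates, from noise, from rounding
      to clock ticks, and from the square of the rounded duration.\<close>
    define b where "b = Lh * Ch * K * (2 * T + 1) + Ch * K + K + 1"
    have LCK: "0 \<le> Lh * Ch * K" "0 \<le> Ch * K" using K0 Ch_nonneg Lh_nonneg by simp_all
    have b: "1 \<le> b" "Ch * K + K \<le> b" unfolding b_def using LCK T K0 by simp_all
    define d where "d = min 1 (e / b)"
    have d: "0 < d" "d \<le> 1" "d * b \<le> e"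
      unfolding d_def using e b by (auto simp: min_def field_simps)
    have T1: "0 < T + 1" using T by simp
    obtain N1 where N1: "\<And>m n i. m \<ge> N1 \<Longrightarrow> n \<ge> m \<Longrightarrow> c n - c m \<le> T + 1 \<Longrightarrow>
      \<bar>x n i - x m i\<bar> \<le> Ch * W n * (c n - c m) + d * W n \<and>
      \<bar>x n i - x m i - (c n - c m) * h (x m) i\<bar> \<le> Lh * Ch * W n * (c n - c m)\<^sup>2 + d * W n"
      using window_quadratic[OF T1 d(1)] by blast
    obtain N2 where N2: "\<And>m. m \<ge> N2 \<Longrightarrow> \<bar>c (Suc m) - c m\<bar> < d"
      using LIMSEQ_D[OF c_gap d(1)] by auto
    have "\<forall>\<^sub>F k in sequentially. c (max N1 N2) + T \<le> c (n k)"
      using filterlim_compose[OF c_top n] unfolding filterlim_at_top by blast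
    then obtain N where N: "\<And>k. k \<ge> N \<Longrightarrow> c (max N1 N2) + T \<le> c (n k)"
      unfolding eventually_sequentially by blast
    show ?thesis
    proof (intro exI[of _ N] allI impI)
      fix k s t i assume k: "k \<ge> N" and s: "- T \<le> s" and st: "s \<le> t" and t: "t \<le> 0"
      define m where "m = idx (c (n k) + s)"
      define p where "p = idx (c (n k) + t)"
      have mp: "m \<le> p" unfolding m_def p_def using st by (intro idx_mono) simp
      have mN: "max N1 N2 \<le> m"
        unfolding m_def using N[OF k] s by (intro idx_ge) simp
      then have mN': "N1 \<le> m" "N2 \<le> m" "N2 \<le> p" using mp by auto
      have nn: "0 \<le> c (n k) + s" "0 \<le> c (n k) + t"
        using N[OF k] s st c_mono[of 0 "max N1 N2"] c_0 by auto
      have cm: "c m \<le> c (n k) + s" "c (n k) + s < c m + d"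
        using idx_lower[OF nn(1)] idx_upper[of "c (n k) + s"] N2[OF mN'(2)] unfolding m_def by auto
      have cp: "c p \<le> c (n k) + t" "c (n k) + t < c p + d"
        using idx_lower[OF nn(2)] idx_upper[of "c (n k) + t"] N2[OF mN'(3)] unfolding p_def by auto
      \<comment> \<open>Rounding to ticks moves each end by less than d, so the rounded duration D
        differs from \<open>t - s\<close> by at most d.\<close>
      define D where "D = c p - c m"
      have D: "0 \<le> D" "D \<le> t - s + d" "t - s - d \<le> D" "D \<le> T + 1"
        unfolding D_def using cm cp c_mono[OF mp] s t d by auto
      have pn: "p \<le> n k" unfolding p_def by (rule idx_n[OF t])
      have Wp: "W p / l k \<le> K" by (rule WK[OF W_le[OF pn]])
      note win = N1[OF mN'(1) mp, folded D_def, OF D(4)]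
      have X1: "X k t i - X k s i = (x p i - x m i) / l k"
        by (simp add: X_def m_def p_def diff_divide_distrib)
      have X2: "(\<lambda>j. l k * X k s j) = x m"
        using l[of k] by (auto simp: X_def m_def)
      have "\<bar>X k t i - X k s i\<bar> = \<bar>x p i - x m i\<bar> / l k"
        unfolding X1 using l[of k] by (simp add: abs_divide)
      also have "\<dots> \<le> (Ch * W p * D + d * W p) / l k"
        using win[of i] l[of k] by (intro divide_right_mono) auto
      also have "\<dots> = (Ch * D + d) * (W p / l k)" by (simp add: field_simps)
      also have "\<dots> \<le> (Ch * D + d) * K"
        using Wp Ch_nonneg D d by (intro mult_left_mono) auto
      also have "\<dots> \<le> (Ch * (t - s + d) + d) * K"
        using D Ch_nonneg K0 by (intro mult_right_mono add_mono mult_left_mono) auto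
      also have "\<dots> = Ch * K * (t - s) + d * (Ch * K + K)" by (simp add: algebra_simps)
      also have "d * (Ch * K + K) \<le> e"
        using order_trans[OF mult_left_mono[OF b(2)] d(3)] d(1) by simp
      finally have lip: "\<bar>X k t i - X k s i\<bar> \<le> Ch * K * (t - s) + e" by simp
      have "X k t i - X k s i - D * (h (x m) i / l k) = (x p i - x m i - D * h (x m) i) / l k"
        unfolding X1 by (simp add: diff_divide_distrib)
      then have "\<bar>X k t i - X k s i - D * (h (x m) i / l k)\<bar> = \<bar>x p i - x m i - D * h (x m) i\<bar> / l k"
        using l[of k] by (simp add: abs_divide)
      also have "\<dots> \<le> (Lh * Ch * W p * D\<^sup>2 + d * W p) / l k"
        using win[of i] l[of k] by (intro divide_right_mono) auto
      also have "\<dots> = (Lh * Ch * D\<^sup>2 + d) * (W p / l k)" by (simp add: field_simps)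
      also have "\<dots> \<le> (Lh * Ch * D\<^sup>2 + d) * K"
        using Wp Ch_nonneg Lh_nonneg D d by (intro mult_left_mono) auto
      also have "\<dots> = Lh * Ch * K * D\<^sup>2 + d * K" by (simp add: algebra_simps)
      also have "Lh * Ch * K * D\<^sup>2 \<le> Lh * Ch * K * ((t - s)\<^sup>2 + d * (2 * T + 1))"
      proof (rule mult_left_mono)
        have "D\<^sup>2 \<le> (t - s + d)\<^sup>2" using D by (intro power_mono) auto
        also have "\<dots> = (t - s)\<^sup>2 + d * (2 * (t - s) + d)" by (simp add: power2_eq_square algebra_simps)
        also have "\<dots> \<le> (t - s)\<^sup>2 + d * (2 * T + 1)"
          using d s t by (intro add_mono mult_left_mono) auto
        finally show "D\<^sup>2 \<le> (t - s)\<^sup>2 + d * (2 * T + 1)" .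
      qed (rule LCK)
      finally have q1: "\<bar>X k t i - X k s i - D * (h (x m) i / l k)\<bar>
          \<le> Lh * Ch * K * ((t - s)\<^sup>2 + d * (2 * T + 1)) + d * K" by simp
      have hm: "\<bar>h (x m) i / l k\<bar> \<le> Ch * K"
      proof -
        have "\<bar>h (x m) i\<bar> / l k \<le> Ch * W p / l k"
          using h_bound_W[OF mp, of i] l[of k] by (intro divide_right_mono) auto
        also have "\<dots> = Ch * (W p / l k)" by simp
        also have "\<dots> \<le> Ch * K" using Wp Ch_nonneg by (rule mult_left_mono)
        finally show ?thesis using l[of k] by (simp add: abs_divide)
      qed
      have "\<bar>(D - (t - s)) * (h (x m) i / l k)\<bar> \<le> d * (Ch * K)"
        unfolding abs_mult using D hm d by (intro mult_mono) auto
      moreover have "\<bar>A - (t - s) * z\<bar> \<le> \<bar>A - D * z\<bar> + \<bar>(D - (t - s)) * z\<bar>" for A z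
      proof -
        have "A - (t - s) * z = (A - D * z) + (D - (t - s)) * z" by (simp add: algebra_simps)
        then show ?thesis by (metis abs_triangle_ineq)
      qed
      ultimately have "\<bar>X k t i - X k s i - (t - s) * (h (x m) i / l k)\<bar>
          \<le> Lh * Ch * K * ((t - s)\<^sup>2 + d * (2 * T + 1)) + d * K + d * (Ch * K)"
        using q1 by (meson add_mono order_trans)
      also have "\<dots> \<le> Lh * Ch * K * (t - s)\<^sup>2 + d * b"
        using d(1) unfolding b_def by (simp add: algebra_simps)
      also have "d * b \<le> e" by (rule d(3))
      finally have quad: "\<bar>X k t i - X k s i - (t - s) * (h (x m) i / l k)\<bar> \<le> Lh * Ch * K * (t - s)\<^sup>2 + e"
        by simp
      show "\<bar>X k t i - X k s i\<bar> \<le> Ch * K * (t - s) + e \<and>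
        \<bar>X k t i - X k s i - (t - s) * (h (\<lambda>j. l k * X k s j) i / l k)\<bar> \<le> Lh * Ch * K * (t - s)\<^sup>2 + e"
        unfolding X2 using lip quad by blast
    qed
  qed
  have lip0: "\<exists>N. \<forall>k\<ge>N. \<forall>s t i. - T \<le> s \<longrightarrow> s \<le> t \<longrightarrow> t \<le> 0 \<longrightarrow>
      \<bar>X k t i - X k s i\<bar> \<le> Ch * K * (t - s) + e" if "0 < T" "0 < e" for T e
    using main[OF that] by meson
  have "\<exists>r Y. strict_mono (r :: nat \<Rightarrow> nat) \<and> (\<forall>s\<le>0. \<forall>i. (\<lambda>k. X (r k) s i) \<longlonglongrightarrow> Y s i)"
    by (rule asymp_lipschitz_subseq[where K = K and X = X and L = "Ch * K"]) (fact bd lip0)+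
  then obtain r Y where r: "strict_mono (r :: nat \<Rightarrow> nat)"
    and Y: "\<And>s i. s \<le> 0 \<Longrightarrow> (\<lambda>k. X (r k) s i) \<longlonglongrightarrow> Y s i" by blast
  have r_ge: "k \<le> r k" for k by (rule seq_suble[OF r])
  have lip: "\<bar>Y t i - Y s i\<bar> \<le> Ch * K * (t - s)" if st: "s \<le> t" "t \<le> 0" for s t i
  proof (rule field_le_epsilon)
    fix e :: real assume e: "0 < e"
    obtain N where N: "\<And>k. k \<ge> N \<Longrightarrow> \<bar>X k t i - X k s i\<bar> \<le> Ch * K * (t - s) + e"
      using main[of "\<bar>s\<bar> + 1" e] e st by fastforce
    have "(\<lambda>k. \<bar>X (r k) t i - X (r k) s i\<bar>) \<longlonglongrightarrow> \<bar>Y t i - Y s i\<bar>"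
      using st by (intro tendsto_intros Y) auto
    then show "\<bar>Y t i - Y s i\<bar> \<le> Ch * K * (t - s) + e"
      by (rule LIMSEQ_le_const2) (use N r_ge order_trans in blast)
  qed
  \<comment> \<open>The limit drift is given at fixed arguments. The Lipschitz constant of h is
    unaffected by the scaling, which lets the argument move with k.\<close>
  have hY: "(\<lambda>k. h (\<lambda>j. l (r k) * X (r k) s j) i / l (r k)) \<longlonglongrightarrow> h' (Y s) i" if s: "s \<le> 0" for s i
  proof -
    have "(\<lambda>k. h (\<lambda>j. l (r k) * Y s j) i / l (r k)) \<longlonglongrightarrow> h' (Y s) i"
      using LIMSEQ_subseq_LIMSEQ[OF h' r, of "Y s" i] by (simp add: o_def)
    moreover have "(\<lambda>k. h (\<lambda>j. l (r k) * X (r k) s j) i / l (r k) - h (\<lambda>j. l (r k) * Y s j) i / l (r k)) \<longlonglongrightarrow> 0"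
    proof (rule Lim_null_comparison)
      show "(\<lambda>k. Lh * supnorm (\<lambda>i. X (r k) s i - Y s i)) \<longlonglongrightarrow> 0"
        using tendsto_mult_left[OF tendsto_supnorm_diff[OF Y[OF s]], of Lh] by simp
      have "\<bar>h (\<lambda>j. l (r k) * X (r k) s j) i - h (\<lambda>j. l (r k) * Y s j) i\<bar>
          \<le> Lh * (l (r k) * supnorm (\<lambda>i. X (r k) s i - Y s i))" for k
      proof (rule supnorm_lipschitzD[OF h_lip])
        fix j show "\<bar>l (r k) * X (r k) s j - l (r k) * Y s j\<bar> \<le> l (r k) * supnorm (\<lambda>i. X (r k) s i - Y s i)"
          using supnorm_ge[of "\<lambda>i. X (r k) s i - Y s i" j] l[of "r k"]
          by (simp add: abs_mult flip: right_diff_distrib)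
      qed
      then show "\<forall>\<^sub>F k in sequentially. norm (h (\<lambda>j. l (r k) * X (r k) s j) i / l (r k) - h (\<lambda>j. l (r k) * Y s j) i / l (r k))
          \<le> Lh * supnorm (\<lambda>i. X (r k) s i - Y s i)"
        using scaled_diff_le[OF l] by simp
    qed
    ultimately show ?thesis using tendsto_add by fastforce
  qed
  have quad: "\<bar>Y t i - Y s i - (t - s) * h' (Y s) i\<bar> \<le> Lh * Ch * K * (t - s)\<^sup>2"
    if st: "s \<le> t" "t \<le> 0" for s t i
  proof (rule field_le_epsilon)
    fix e :: real assume e: "0 < e"
    obtain N where N: "\<And>k. k \<ge> N \<Longrightarrow>
        \<bar>X k t i - X k s i - (t - s) * (h (\<lambda>j. l k * X k s j) i / l k)\<bar> \<le> Lh * Ch * K * (t - s)\<^sup>2 + e"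
      using main[of "\<bar>s\<bar> + 1" e] e st by fastforce
    have "(\<lambda>k. \<bar>X (r k) t i - X (r k) s i - (t - s) * (h (\<lambda>j. l (r k) * X (r k) s j) i / l (r k))\<bar>)
        \<longlonglongrightarrow> \<bar>Y t i - Y s i - (t - s) * h' (Y s) i\<bar>"
      using st by (intro tendsto_intros Y hY) auto
    then show "\<bar>Y t i - Y s i - (t - s) * h' (Y s) i\<bar> \<le> Lh * Ch * K * (t - s)\<^sup>2 + e"
      by (rule LIMSEQ_le_const2) (use N r_ge order_trans in blast)
  qed
  have h'_diff: "\<bar>h' y i - h' z i\<bar> \<le> Lh * B" if "\<And>j. \<bar>y j - z j\<bar> \<le> B" for y z i B
  proof (rule LIMSEQ_le_const2)
    show "(\<lambda>k. \<bar>h (\<lambda>j. l k * y j) i / l k - h (\<lambda>j. l k * z j) i / l k\<bar>) \<longlonglongrightarrow> \<bar>h' y i - h' z i\<bar>"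
      by (intro tendsto_intros h')
    have "\<bar>h (\<lambda>j. l k * y j) i - h (\<lambda>j. l k * z j) i\<bar> \<le> Lh * (l k * B)" for k
      by (rule supnorm_lipschitzD[OF h_lip])
        (use that l[of k] in \<open>simp add: abs_mult flip: right_diff_distrib\<close>)
    then show "\<exists>N. \<forall>k\<ge>N. \<bar>h (\<lambda>j. l k * y j) i / l k - h (\<lambda>j. l k * z j) i / l k\<bar> \<le> Lh * B"
      using scaled_diff_le[OF l] by simp
  qed
  \<comment> \<open>For \<open>t < s\<close> the estimate available is based at t while the one
    wanted is based at s; exchanging the drifts costs the second summand.\<close>
  define C where "C = Lh * Ch * K + Lh * (Ch * K)"
  have C: "Lh * Ch * K \<le> C" unfolding C_def using Lh_nonneg Ch_nonneg K0 by simp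
  have quad': "\<bar>Y t i - Y s i - (t - s) * h' (Y s) i\<bar> \<le> C * (t - s)\<^sup>2"
    if st: "s \<le> 0" "t \<le> 0" for s t i
  proof (cases "s \<le> t")
    case True
    then show ?thesis
      using quad[OF True st(2), of i] mult_right_mono[OF C, of "(t - s)\<^sup>2"] by simp
  next
    case False
    then have ts: "t \<le> s" by simp
    have "\<bar>h' (Y s) i - h' (Y t) i\<bar> \<le> Lh * (Ch * K * (s - t))"
      by (rule h'_diff) (rule lip[OF ts st(1)])
    then have "\<bar>(s - t) * (h' (Y s) i - h' (Y t) i)\<bar> \<le> (s - t) * (Lh * (Ch * K * (s - t)))"
      unfolding abs_mult using ts by (intro mult_mono) auto
    moreover have "\<bar>Y s i - Y t i - (s - t) * h' (Y t) i\<bar> \<le> Lh * Ch * K * (s - t)\<^sup>2"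
      by (rule quad[OF ts st(1)])
    ultimately show ?thesis
      unfolding C_def by (simp add: power2_eq_square algebra_simps abs_le_iff)
  qed
  have lip': "\<bar>Y t i - Y s i\<bar> \<le> Ch * K * \<bar>t - s\<bar>" if st: "s \<le> 0" "t \<le> 0" for s t i
    using lip[of s t i] lip[of t s i] st by (cases "s \<le> t") (auto simp: abs_minus_commute)
  have bdY: "\<bar>Y s i\<bar> \<le> K" if "s \<le> 0" for s i
    by (rule LIMSEQ_le_const2[OF tendsto_rabs[OF Y[OF that]]]) (use bd that in blast)
  have "(\<lambda>k. x (n (r k)) i / l (r k)) \<longlonglongrightarrow> Y 0 i" for i
    using Y[of 0 i] by (simp add: X_def idx_c)
  then show ?thesis using r bdY lip' quad' by blast
qed

end

section \<open>Almost sure convergence of the noise\<close>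

locale filtered_prob_space = prob_space M for M :: "'w measure" +
  fixes F :: "nat \<Rightarrow> 'w measure"
  assumes filt_sets: "\<And>n. sets (F n) \<subseteq> sets M" and filt_space: "\<And>n. space (F n) = space M"
    and filt_Suc: "\<And>n. sets (F n) \<subseteq> sets (F (Suc n))"
begin

lemma filt_mono: "m \<le> n \<Longrightarrow> sets (F m) \<subseteq> sets (F n)"
  using filt_Suc by (rule lift_Suc_mono_le)

lemma measurable_F: "X \<in> measurable (F n) N \<Longrightarrow> X \<in> measurable M N"
  using filt_sets[of n] filt_space[of n] unfolding measurable_def by auto

lemma measurable_F_mono: "m \<le> n \<Longrightarrow> X \<in> measurable (F m) N \<Longrightarrow> X \<in> measurable (F n) N"
  using filt_mono[of m n] filt_space unfolding measurable_def by auto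

end

section \<open>Sums of orthogonal square-integrable increments\<close>

lemma integrable_mult_of_squares:
  fixes f g :: "'w \<Rightarrow> real"
  assumes [measurable]: "f \<in> borel_measurable M" "g \<in> borel_measurable M"
    and "integrable M (\<lambda>x. (f x)\<^sup>2)" "integrable M (\<lambda>x. (g x)\<^sup>2)"
  shows "integrable M (\<lambda>x. f x * g x)"
proof (rule Bochner_Integration.integrable_bound)
  show "integrable M (\<lambda>x. (f x)\<^sup>2 + (g x)\<^sup>2)" using assms by simp
  show "AE x in M. norm (f x * g x) \<le> norm ((f x)\<^sup>2 + (g x)\<^sup>2)"
  proof (rule AE_I2)
    fix x
    have "2 * \<bar>f x\<bar> * \<bar>g x\<bar> \<le> (f x)\<^sup>2 + (g x)\<^sup>2"
      using sum_squares_bound[of "\<bar>f x\<bar>" "\<bar>g x\<bar>"] by simp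
    moreover have "0 \<le> \<bar>f x\<bar> * \<bar>g x\<bar>" by simp
    ultimately have "\<bar>f x\<bar> * \<bar>g x\<bar> \<le> (f x)\<^sup>2 + (g x)\<^sup>2" by linarith
    then show "norm (f x * g x) \<le> norm ((f x)\<^sup>2 + (g x)\<^sup>2)"
      by (simp add: abs_mult)
  qed
qed measurable

context filtered_prob_space
begin

text \<open>The martingale difference property is phrased as orthogonality to every
  square-integrable variable of the past, in place of a conditional expectation.\<close>

context
  fixes D :: "nat \<Rightarrow> 'w \<Rightarrow> real"
  assumes D_meas: "\<And>n. D n \<in> borel_measurable (F (Suc n))"
    and D_sq: "\<And>n. integrable M (\<lambda>\<omega>. (D n \<omega>)\<^sup>2)"
    and orth: "\<And>n Z. Z \<in> borel_measurable (F n) \<Longrightarrow> integrable M (\<lambda>\<omega>. (Z \<omega>)\<^sup>2) \<Longrightarrow>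
      (\<integral>\<omega>. Z \<omega> * D n \<omega> \<partial>M) = 0"
begin

text \<open>Kolmogorov's inequality, by stopping the partial sums once they have moved by \<open>e\<close>.\<close>

lemma maximal_inequality:
  assumes e: "0 < e" and mn: "m \<le> n"
  shows "measure M {\<omega> \<in> space M. \<exists>j\<in>{m..n}. e \<le> \<bar>\<Sum>k=m..<j. D k \<omega>\<bar>}
    \<le> (\<Sum>k=m..<n. \<integral>\<omega>. (D k \<omega>)\<^sup>2 \<partial>M) / e\<^sup>2"
proof -
  define S where "S j \<omega> = (\<Sum>k=m..<j. D k \<omega>)" for j \<omega>
  define B where "B j = {\<omega> \<in> space M. \<forall>i\<in>{m..j}. \<bar>S i \<omega>\<bar> < e}" for j
  have S_meas: "S j \<in> borel_measurable (F j)" for j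
    unfolding S_def
  proof (rule borel_measurable_sum)
    fix k assume "k \<in> {m..<j}"
    then show "D k \<in> borel_measurable (F j)"
      using measurable_F_mono[OF _ D_meas, of k j] by simp
  qed
  have B_meas: "B j \<in> sets (F j)" for j
  proof -
    have "B j = {\<omega> \<in> space (F j). \<forall>i\<in>{m..j}. \<bar>S i \<omega>\<bar> < e}"
      by (simp add: B_def filt_space)
    also have "\<dots> \<in> sets (F j)"
    proof (rule sets.sets_Collect_finite_All)
      fix i assume "i \<in> {m..j}"
      then have [measurable]: "S i \<in> borel_measurable (F j)"
        using measurable_F_mono[OF _ S_meas, of i j] by simp
      show "{\<omega> \<in> space (F j). \<bar>S i \<omega>\<bar> < e} \<in> sets (F j)" by measurable
    qed simp
    finally show ?thesis .
  qed
  \<comment> \<open>The stopped sum: a term enters only while no partial sum has reached e.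
    Membership in \<open>B k\<close> is decided at time k, so the cross terms vanish by
    orthogonality and the second moments add up.\<close>
  define Z where "Z j \<omega> = (\<Sum>k=m..<j. indicator (B k) \<omega> * D k \<omega>)" for j \<omega>
  have ZM: "Z j \<in> borel_measurable (F j)" for j
    unfolding Z_def
  proof (rule borel_measurable_sum)
    fix k assume "k \<in> {m..<j}"
    then have [measurable]: "D k \<in> borel_measurable (F j)" "B k \<in> sets (F j)"
      using measurable_F_mono[OF _ D_meas, of k j] filt_mono[of k j] B_meas[of k] by auto
    show "(\<lambda>\<omega>. indicator (B k) \<omega> * D k \<omega>) \<in> borel_measurable (F j)" by measurable
  qed
  note [measurable] = measurable_F[OF ZM] measurable_F[OF D_meas] subsetD[OF filt_sets B_meas]
  have Z2: "integrable M (\<lambda>\<omega>. (Z j \<omega>)\<^sup>2) \<and> (\<integral>\<omega>. (Z j \<omega>)\<^sup>2 \<partial>M) \<le> (\<Sum>k=m..<j. \<integral>\<omega>. (D k \<omega>)\<^sup>2 \<partial>M)"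
    if "m \<le> j" for j
    using that
  proof (induction j rule: dec_induct)
    case base
    show ?case by (simp add: Z_def)
  next
    case (step j)
    have ZS: "(Z (Suc j) \<omega>)\<^sup>2 = (Z j \<omega>)\<^sup>2 + 2 * (Z j \<omega> * indicator (B j) \<omega> * D j \<omega>) + indicator (B j) \<omega> * (D j \<omega>)\<^sup>2"
      for \<omega>
      using step(1) by (simp add: Z_def power2_eq_square algebra_simps indicator_def)
    have ZB2: "integrable M (\<lambda>\<omega>. (Z j \<omega> * indicator (B j) \<omega>)\<^sup>2)"
      by (rule Bochner_Integration.integrable_bound[OF conjunct1[OF step(3)]])
         (auto simp: indicator_def)
    have i1: "integrable M (\<lambda>\<omega>. Z j \<omega> * indicator (B j) \<omega> * D j \<omega>)"
      by (rule integrable_mult_of_squares[OF _ _ ZB2 D_sq]) measurable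
    have i2: "integrable M (\<lambda>\<omega>. indicator (B j) \<omega> * (D j \<omega>)\<^sup>2)"
      by (rule Bochner_Integration.integrable_bound[OF D_sq[of j]]) (auto simp: indicator_def)
    have o: "(\<integral>\<omega>. Z j \<omega> * indicator (B j) \<omega> * D j \<omega> \<partial>M) = 0"
    proof (rule orth[OF _ ZB2])
      have "B j \<in> sets (F j)" by (rule B_meas)
      with ZM[of j] show "(\<lambda>\<omega>. Z j \<omega> * indicator (B j) \<omega>) \<in> borel_measurable (F j)"
        by measurable
    qed
    have i3: "(\<integral>\<omega>. indicator (B j) \<omega> * (D j \<omega>)\<^sup>2 \<partial>M) \<le> (\<integral>\<omega>. (D j \<omega>)\<^sup>2 \<partial>M)"
      by (rule integral_mono[OF i2 D_sq]) (auto simp: indicator_def)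
    have "(\<integral>\<omega>. (Z (Suc j) \<omega>)\<^sup>2 \<partial>M) = (\<integral>\<omega>. (Z j \<omega>)\<^sup>2 \<partial>M) + (\<integral>\<omega>. indicator (B j) \<omega> * (D j \<omega>)\<^sup>2 \<partial>M)"
      unfolding ZS using step(3) i1 i2 o by simp
    moreover have "integrable M (\<lambda>\<omega>. (Z (Suc j) \<omega>)\<^sup>2)"
      unfolding ZS using step(3) i1 i2 by simp
    ultimately show ?case using step i3 by simp
  qed
  \<comment> \<open>At the first exit Z still agrees with S and has modulus at least e; afterwards
    it is frozen.\<close>
  have stop: "(\<omega> \<in> B j \<longrightarrow> Z (Suc j) \<omega> = S (Suc j) \<omega>) \<and> (\<omega> \<notin> B j \<longrightarrow> e \<le> \<bar>Z j \<omega>\<bar>)"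
    if "m \<le> j" "\<omega> \<in> space M" for j \<omega>
    using that(1)
  proof (induction j rule: dec_induct)
    case base
    have "\<omega> \<in> B m" using that(2) e by (simp add: B_def S_def)
    then show ?case by (simp add: Z_def S_def)
  next
    case (step j)
    have B_Suc: "\<omega> \<in> B (Suc j) \<longleftrightarrow> \<omega> \<in> B j \<and> \<bar>S (Suc j) \<omega>\<bar> < e"
      using step(1) by (auto simp: B_def le_Suc_eq)
    show ?case
    proof (cases "\<omega> \<in> B j")
      case True
      then have "Z (Suc j) \<omega> = S (Suc j) \<omega>" using step by simp
      moreover have "Z (Suc (Suc j)) \<omega> = Z (Suc j) \<omega> + indicator (B (Suc j)) \<omega> * D (Suc j) \<omega>"
        "S (Suc (Suc j)) \<omega> = S (Suc j) \<omega> + D (Suc j) \<omega>"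
        using step(1) by (auto simp: Z_def S_def)
      ultimately show ?thesis using B_Suc True by auto
    next
      case False
      moreover have "Z (Suc j) \<omega> = Z j \<omega> + indicator (B j) \<omega> * D j \<omega>"
        using step(1) by (auto simp: Z_def)
      ultimately show ?thesis using B_Suc step by auto
    qed
  qed
  have "{\<omega> \<in> space M. \<exists>j\<in>{m..n}. e \<le> \<bar>\<Sum>k=m..<j. D k \<omega>\<bar>} \<subseteq> {\<omega> \<in> space M. e\<^sup>2 \<le> (Z n \<omega>)\<^sup>2}"
  proof safe
    fix \<omega> j assume w: "\<omega> \<in> space M" "j \<in> {m..n}" "e \<le> \<bar>\<Sum>k=m..<j. D k \<omega>\<bar>"
    then have "\<omega> \<notin> B n" by (auto simp: B_def S_def not_less)
    then have "e \<le> \<bar>Z n \<omega>\<bar>" using stop[OF mn w(1)] by simp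
    then show "e\<^sup>2 \<le> (Z n \<omega>)\<^sup>2" using e by (metis abs_le_square_iff abs_of_pos)
  qed
  then have "measure M {\<omega> \<in> space M. \<exists>j\<in>{m..n}. e \<le> \<bar>\<Sum>k=m..<j. D k \<omega>\<bar>}
      \<le> measure M {\<omega> \<in> space M. e\<^sup>2 \<le> (Z n \<omega>)\<^sup>2}"
    by (rule finite_measure_mono) measurable
  also have "\<dots> \<le> (\<integral>\<omega>. (Z n \<omega>)\<^sup>2 \<partial>M) / e\<^sup>2"
    by (rule integral_Markov_inequality_measure[where A = "space M"]) (use Z2[OF mn] e in auto)
  also have "\<dots> \<le> (\<Sum>k=m..<n. \<integral>\<omega>. (D k \<omega>)\<^sup>2 \<partial>M) / e\<^sup>2"
    using Z2[OF mn] by (intro divide_right_mono) auto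
  finally show ?thesis .
qed

text \<open>The tail of the variance series from m on bounds the probability that the partial sums
  started at m ever reach e. This tends to 0 with m, so almost every path is Cauchy.\<close>

lemma orthogonal_increments_summable:
  assumes sm: "summable (\<lambda>n. \<integral>\<omega>. (D n \<omega>)\<^sup>2 \<partial>M)"
  shows "AE \<omega> in M. summable (\<lambda>n. D n \<omega>)"
proof -
  note [measurable] = measurable_F[OF D_meas]
  define v where "v n = (\<integral>\<omega>. (D n \<omega>)\<^sup>2 \<partial>M)" for n
  have v0: "0 \<le> v n" for n by (simp add: v_def)
  have ae: "AE \<omega> in M. \<exists>m. \<forall>j\<ge>m. \<bar>\<Sum>k=m..<j. D k \<omega>\<bar> < e" if e: "0 < e" for e
  proof -
    define G where "G m = {\<omega> \<in> space M. \<exists>j\<ge>m. e \<le> \<bar>\<Sum>k=m..<j. D k \<omega>\<bar>}" for m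
    have G_meas: "G m \<in> sets M" for m unfolding G_def by measurable
    have G_le: "measure M (G m) \<le> (\<Sum>k. v (k + m)) / e\<^sup>2" for m
    proof -
      \<comment> \<open>Finite horizons, to which the maximal inequality applies; they increase to
        \<open>G m\<close>.\<close>
      define H where "H n = {\<omega> \<in> space M. \<exists>j\<in>{m..m + n}. e \<le> \<bar>\<Sum>k=m..<j. D k \<omega>\<bar>}" for n
      have "H n \<in> sets M" for n unfolding H_def by measurable
      moreover have "incseq H"
        unfolding H_def by (rule incseq_SucI) force
      ultimately have "(\<lambda>n. measure M (H n)) \<longlonglongrightarrow> measure M (\<Union>n. H n)"
        by (intro finite_Lim_measure_incseq) auto
      moreover have "(\<Union>n. H n) = G m"
      proof safe
        fix \<omega> assume "\<omega> \<in> G m"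
        then obtain j where "\<omega> \<in> space M" "j \<ge> m" "e \<le> \<bar>\<Sum>k=m..<j. D k \<omega>\<bar>" by (auto simp: G_def)
        then have "\<omega> \<in> H (j - m)" by (auto simp: H_def)
        then show "\<omega> \<in> (\<Union>n. H n)" by blast
      qed (auto simp: G_def H_def)
      ultimately have lim: "(\<lambda>n. measure M (H n)) \<longlonglongrightarrow> measure M (G m)" by simp
      have "measure M (H n) \<le> (\<Sum>k. v (k + m)) / e\<^sup>2" for n
      proof -
        have "measure M (H n) \<le> (\<Sum>k=m..<m+n. v k) / e\<^sup>2"
          unfolding H_def v_def by (rule maximal_inequality[OF e]) simp
        also have "(\<Sum>k=m..<m+n. v k) = (\<Sum>k<n. v (k + m))"
          by (rule sum.reindex_bij_witness[of _ "\<lambda>k. k + m" "\<lambda>k. k - m"]) auto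
        also have "\<dots> \<le> (\<Sum>k. v (k + m))"
          using sm v0 unfolding v_def[symmetric] by (intro sum_le_suminf) auto
        finally show ?thesis by (simp add: divide_right_mono)
      qed
      then show ?thesis using LIMSEQ_le_const2[OF lim] by blast
    qed
    have "(\<Inter>m. G m) \<in> null_sets M"
    proof (rule null_setsI)
      show "(\<Inter>m. G m) \<in> sets M" using G_meas by auto
      have "measure M (\<Inter>m. G m) \<le> (\<Sum>k. v (k + m)) / e\<^sup>2" for m
        by (rule order_trans[OF finite_measure_mono G_le]) (use G_meas in auto)
      moreover have "(\<lambda>m. (\<Sum>k. v (k + m)) / e\<^sup>2) \<longlonglongrightarrow> 0 / e\<^sup>2"
        using sm unfolding v_def[symmetric] by (intro tendsto_intros suminf_exist_split2) (use e in auto)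
      ultimately have "measure M (\<Inter>m. G m) \<le> 0"
        using LIMSEQ_le_const[of "\<lambda>m. (\<Sum>k. v (k + m)) / e\<^sup>2" 0] by simp
      then show "emeasure M (\<Inter>m. G m) = 0"
        by (simp add: emeasure_eq_measure measure_le_0_iff)
    qed
    then have "AE \<omega> in M. \<omega> \<notin> (\<Inter>m. G m)" by (rule AE_not_in)
    then show ?thesis
    proof (rule AE_mp, intro AE_I2 impI)
      fix \<omega> assume "\<omega> \<in> space M" "\<omega> \<notin> (\<Inter>m. G m)"
      then obtain m where m: "\<omega> \<notin> G m" by blast
      show "\<exists>m. \<forall>j\<ge>m. \<bar>\<Sum>k=m..<j. D k \<omega>\<bar> < e"
      proof (intro exI[of _ m] allI impI, rule ccontr)
        fix j assume "m \<le> j" "\<not> \<bar>\<Sum>k=m..<j. D k \<omega>\<bar> < e"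
        then have "\<omega> \<in> G m" using \<open>\<omega> \<in> space M\<close> unfolding G_def by force
        with m show False by contradiction
      qed
    qed
  qed
  have "AE \<omega> in M. \<forall>i::nat. \<exists>m. \<forall>j\<ge>m. \<bar>\<Sum>k=m..<j. D k \<omega>\<bar> < 1 / real (Suc i)"
    unfolding AE_all_countable using ae by simp
  then show ?thesis
  proof (rule AE_mp, intro AE_I2 impI)
    fix \<omega> assume H: "\<forall>i::nat. \<exists>m. \<forall>j\<ge>m. \<bar>\<Sum>k=m..<j. D k \<omega>\<bar> < 1 / real (Suc i)"
    show "summable (\<lambda>n. D n \<omega>)"
      unfolding summable_Cauchy
    proof (intro allI impI)
      fix e :: real assume "0 < e"
      then obtain i :: nat where i: "1 / real (Suc i) < e / 2"
        using nat_approx_posE[of "e / 2"] by (metis half_gt_zero)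
      obtain m where m: "\<And>j. j \<ge> m \<Longrightarrow> \<bar>\<Sum>k=m..<j. D k \<omega>\<bar> < 1 / real (Suc i)" using H by blast
      show "\<exists>N. \<forall>m\<ge>N. \<forall>n. norm (\<Sum>k=m..<n. D k \<omega>) < e"
      proof (intro exI[of _ m] allI impI)
        fix p n assume p: "p \<ge> m"
        show "norm (\<Sum>k=p..<n. D k \<omega>) < e"
        proof (cases "p \<le> n")
          case True
          have "(\<Sum>k=p..<n. D k \<omega>) = (\<Sum>k=m..<n. D k \<omega>) - (\<Sum>k=m..<p. D k \<omega>)"
            using sum.atLeastLessThan_concat[OF p True, of "\<lambda>k. D k \<omega>"] by simp
          then show ?thesis using m[of n] m[OF p] i p True unfolding real_norm_def by linarith
        qed (use \<open>0 < e\<close> in auto)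
      qed
    qed
  qed
qed

end

text \<open>One component of the asynchronous sampling scheme: \<open>E n\<close> is the event that the component
  is updated at step \<open>n\<close>, and \<open>V n\<close> the sample then drawn.\<close>

lemma sampled_noise_summable:
  fixes V :: "nat \<Rightarrow> 'w \<Rightarrow> 'b" and g :: "'b \<Rightarrow> real" and w :: "nat \<Rightarrow> 'w \<Rightarrow> real"
  assumes N: "prob_space N"
    and V[measurable]: "\<And>n. V n \<in> measurable (F (Suc n)) N"
    and E: "\<And>n. E n \<in> sets (F n)"
    and law: "\<And>n A B. A \<in> sets (F n) \<Longrightarrow> B \<in> sets N \<Longrightarrow>
      measure M {\<omega> \<in> A. \<omega> \<in> E n \<and> V n \<omega> \<in> B} = measure M {\<omega> \<in> A. \<omega> \<in> E n} * measure N B"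
    and g[measurable]: "g \<in> borel_measurable N" and g0: "(\<integral>x. g x \<partial>N) = 0"
    and g2: "integrable N (\<lambda>x. (g x)\<^sup>2)"
    and w: "\<And>n. w n \<in> borel_measurable (F n)"
    and w0: "\<And>n \<omega>. \<omega> \<in> space M \<Longrightarrow> \<omega> \<notin> E n \<Longrightarrow> w n \<omega> = 0"
    and wB: "\<And>n \<omega>. \<omega> \<in> space M \<Longrightarrow> (\<Sum>k<n. (w k \<omega>)\<^sup>2) \<le> B"
  shows "AE \<omega> in M. summable (\<lambda>n. w n \<omega> * g (V n \<omega>))"
proof -
  interpret N: prob_space N by fact
  have E_M[measurable]: "E n \<in> sets M" for n using E filt_sets by blast
  note V_M[measurable] = measurable_F[OF V]
  note w_M[measurable] = measurable_F[OF w]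
  \<comment> \<open>The restriction of M to the event of selection, seen on the past only. The
    hypothesis on the law then says that past and sample together have the product measure of
    \<open>R n\<close> and N, so that Fubini replaces conditioning.\<close>
  define R where "R n = distr (density M (indicator (E n))) (F n) (\<lambda>\<omega>. \<omega>)" for n
  have id_meas[measurable]: "(\<lambda>\<omega>. \<omega>) \<in> measurable M (F n)" for n
    using filt_sets[of n] filt_space[of n] by (auto simp: measurable_def)
  have sets_R[measurable_cong]: "sets (R n) = sets (F n)" for n by (simp add: R_def)
  have space_R: "space (R n) = space M" for n by (simp add: R_def filt_space)
  have R_em: "emeasure (R n) A = emeasure M {\<omega> \<in> A. \<omega> \<in> E n}" if A: "A \<in> sets (F n)" for n A
  proof -
    have AM: "A \<in> sets M" using A filt_sets by blast
    have "emeasure (R n) A = emeasure (density M (indicator (E n))) (A \<inter> space M)"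
      unfolding R_def using A by (subst emeasure_distr) auto
    also have "A \<inter> space M = A" using AM sets.sets_into_space by blast
    also have "emeasure (density M (indicator (E n))) A = emeasure M (E n \<inter> A)"
      using AM by (simp add: emeasure_density flip: indicator_inter_arith)
    also have "E n \<inter> A = {\<omega> \<in> A. \<omega> \<in> E n}" by auto
    finally show ?thesis .
  qed
  have R_fin: "finite_measure (R n)" for n
  proof
    have "space (R n) \<in> sets (F n)" unfolding space_R filt_space[of n, symmetric] by simp
    from R_em[OF this] show "emeasure (R n) (space (R n)) \<noteq> \<infinity>"
      by (simp add: emeasure_eq_measure)
  qed
  have pair_meas[measurable]: "(\<lambda>\<omega>. (\<omega>, V n \<omega>)) \<in> measurable M (F n \<Otimes>\<^sub>M N)" for n by measurable
  have joint: "R n \<Otimes>\<^sub>M N = distr (density M (indicator (E n))) (F n \<Otimes>\<^sub>M N) (\<lambda>\<omega>. (\<omega>, V n \<omega>))" for n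
  proof (rule pair_measure_eqI)
    show "sigma_finite_measure (R n)"
      using R_fin[of n] by (rule finite_measure.sigma_finite_measure)
    show "sigma_finite_measure N" by (rule N.sigma_finite_measure_axioms)
    show "sets (R n \<Otimes>\<^sub>M N) = sets (distr (density M (indicator (E n))) (F n \<Otimes>\<^sub>M N) (\<lambda>\<omega>. (\<omega>, V n \<omega>)))"
      by (simp add: sets_R cong: sets_pair_measure_cong)
    fix A B' assume "A \<in> sets (R n)" and B': "B' \<in> sets N"
    then have A: "A \<in> sets (F n)" by (simp add: sets_R)
    have AM: "A \<in> sets M" using A filt_sets by blast
    have "emeasure (distr (density M (indicator (E n))) (F n \<Otimes>\<^sub>M N) (\<lambda>\<omega>. (\<omega>, V n \<omega>))) (A \<times> B')
        = emeasure (density M (indicator (E n))) ((\<lambda>\<omega>. (\<omega>, V n \<omega>)) -` (A \<times> B') \<inter> space M)"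
      using A B' by (subst emeasure_distr) auto
    also have "(\<lambda>\<omega>. (\<omega>, V n \<omega>)) -` (A \<times> B') \<inter> space M = {\<omega> \<in> space M. \<omega> \<in> A \<and> V n \<omega> \<in> B'}"
      by auto
    also have "emeasure (density M (indicator (E n))) \<dots> = emeasure M (E n \<inter> \<dots>)"
      using AM B' by (subst emeasure_density) (auto simp flip: indicator_inter_arith)
    also have "E n \<inter> {\<omega> \<in> space M. \<omega> \<in> A \<and> V n \<omega> \<in> B'} = {\<omega> \<in> A. \<omega> \<in> E n \<and> V n \<omega> \<in> B'}"
      using sets.sets_into_space[OF AM] by auto
    finally show "emeasure (R n) A * emeasure N B'
        = emeasure (distr (density M (indicator (E n))) (F n \<Otimes>\<^sub>M N) (\<lambda>\<omega>. (\<omega>, V n \<omega>))) (A \<times> B')"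
      unfolding R_em[OF A] emeasure_eq_measure N.emeasure_eq_measure law[OF A B']
      by (simp add: ennreal_mult)
  qed
  define D where "D n \<omega> = w n \<omega> * g (V n \<omega>)" for n \<omega>
  have D_M[measurable]: "D n \<in> borel_measurable M" for n unfolding D_def by measurable
  define v where "v = (\<integral>x. (g x)\<^sup>2 \<partial>N)"
  have w_le: "(w n \<omega>)\<^sup>2 \<le> B" if "\<omega> \<in> space M" for n \<omega>
  proof -
    have "(w n \<omega>)\<^sup>2 \<le> (\<Sum>k<Suc n. (w k \<omega>)\<^sup>2)" by (simp add: sum_nonneg)
    then show ?thesis using wB[OF that, of "Suc n"] by linarith
  qed
  have w2: "integrable M (\<lambda>\<omega>. (w n \<omega>)\<^sup>2)" for n
    by (rule integrable_const_bound[where B = B]) (use w_le in auto)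
  have D2: "(\<integral>\<^sup>+\<omega>. ennreal ((D n \<omega>)\<^sup>2) \<partial>M) = ennreal ((\<integral>\<omega>. (w n \<omega>)\<^sup>2 \<partial>M) * v)" for n
  proof -
    have wR[measurable]: "w n \<in> borel_measurable (R n)"
      using w[of n] by (subst measurable_cong_sets[OF sets_R refl])
    have "(\<integral>\<^sup>+\<omega>. ennreal ((D n \<omega>)\<^sup>2) \<partial>M)
        = (\<integral>\<^sup>+\<omega>. indicator (E n) \<omega> * ennreal ((w n \<omega>)\<^sup>2 * (g (V n \<omega>))\<^sup>2) \<partial>M)"
      by (rule nn_integral_cong) (use w0 in \<open>auto simp: D_def indicator_def power_mult_distrib\<close>)
    also have "\<dots> = (\<integral>\<^sup>+\<omega>. ennreal ((w n \<omega>)\<^sup>2 * (g (V n \<omega>))\<^sup>2) \<partial>density M (indicator (E n)))"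
      by (subst nn_integral_density) auto
    also have "\<dots> = (\<integral>\<^sup>+z. ennreal ((w n (fst z))\<^sup>2 * (g (snd z))\<^sup>2) \<partial>(R n \<Otimes>\<^sub>M N))"
      unfolding joint using w[of n] by (subst nn_integral_distr) auto
    also have "\<dots> = (\<integral>\<^sup>+\<omega>. \<integral>\<^sup>+x. ennreal ((w n \<omega>)\<^sup>2 * (g x)\<^sup>2) \<partial>N \<partial>R n)"
      by (subst N.nn_integral_fst[symmetric]) auto
    also have "\<dots> = (\<integral>\<^sup>+\<omega>. ennreal ((w n \<omega>)\<^sup>2) * ennreal v \<partial>R n)"
    proof (rule nn_integral_cong)
      fix \<omega>
      have "(\<integral>\<^sup>+x. ennreal ((w n \<omega>)\<^sup>2 * (g x)\<^sup>2) \<partial>N) = ennreal ((w n \<omega>)\<^sup>2) * (\<integral>\<^sup>+x. ennreal ((g x)\<^sup>2) \<partial>N)"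
        by (simp add: ennreal_mult nn_integral_cmult)
      also have "(\<integral>\<^sup>+x. ennreal ((g x)\<^sup>2) \<partial>N) = ennreal v"
        unfolding v_def by (rule nn_integral_eq_integral[OF g2]) simp
      finally show "(\<integral>\<^sup>+x. ennreal ((w n \<omega>)\<^sup>2 * (g x)\<^sup>2) \<partial>N) = ennreal ((w n \<omega>)\<^sup>2) * ennreal v" .
    qed
    also have "\<dots> = (\<integral>\<^sup>+\<omega>. ennreal ((w n \<omega>)\<^sup>2) \<partial>R n) * ennreal v"
      by (rule nn_integral_multc) measurable
    also have "(\<integral>\<^sup>+\<omega>. ennreal ((w n \<omega>)\<^sup>2) \<partial>R n) = (\<integral>\<^sup>+\<omega>. ennreal ((w n \<omega>)\<^sup>2) \<partial>density M (indicator (E n)))"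
      unfolding R_def using w[of n] by (subst nn_integral_distr) auto
    also have "\<dots> = (\<integral>\<^sup>+\<omega>. ennreal ((w n \<omega>)\<^sup>2) \<partial>M)"
      by (subst nn_integral_density) (auto intro!: nn_integral_cong simp: w0 indicator_def)
    also have "\<dots> = ennreal (\<integral>\<omega>. (w n \<omega>)\<^sup>2 \<partial>M)"
      by (rule nn_integral_eq_integral[OF w2]) simp
    finally show ?thesis by (simp add: ennreal_mult v_def)
  qed
  have D_sq: "integrable M (\<lambda>\<omega>. (D n \<omega>)\<^sup>2)" for n
    by (rule integrableI_bounded) (use D2[of n] in auto)
  have D_int: "(\<integral>\<omega>. (D n \<omega>)\<^sup>2 \<partial>M) = (\<integral>\<omega>. (w n \<omega>)\<^sup>2 \<partial>M) * v" for n
    using D2[of n] nn_integral_eq_integral[OF D_sq[of n]]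
    by (simp add: v_def)
  have "AE \<omega> in M. summable (\<lambda>n. D n \<omega>)"
  proof (rule orthogonal_increments_summable[OF _ D_sq])
    show "D n \<in> borel_measurable (F (Suc n))" for n
    proof -
      have [measurable]: "w n \<in> borel_measurable (F (Suc n))"
        by (rule measurable_F_mono[OF _ w]) simp
      show ?thesis unfolding D_def by measurable
    qed
  next
    fix n and Z :: "'w \<Rightarrow> real" assume Z[measurable]: "Z \<in> borel_measurable (F n)" and Z2: "integrable M (\<lambda>\<omega>. (Z \<omega>)\<^sup>2)"
    note [measurable] = measurable_F[OF Z]
    have int: "integrable M (\<lambda>\<omega>. Z \<omega> * D n \<omega>)"
      by (rule integrable_mult_of_squares[OF _ _ Z2 D_sq]) measurable
    have eq: "Z \<omega> * D n \<omega> = indicator (E n) \<omega> * (Z \<omega> * w n \<omega> * g (V n \<omega>))" if "\<omega> \<in> space M" for \<omega>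
      using w0[OF that, of n] by (auto simp: D_def indicator_def)
    define f where "f z = Z (fst z) * w n (fst z) * g (snd z)" for z
    have f_meas[measurable]: "f \<in> borel_measurable (F n \<Otimes>\<^sub>M N)"
      unfolding f_def using w[of n] by measurable
    have "integrable M (\<lambda>\<omega>. indicator (E n) \<omega> * (Z \<omega> * w n \<omega> * g (V n \<omega>)))"
      using int by (rule Bochner_Integration.integrable_cong[THEN iffD1, rotated 2]) (auto simp: eq)
    then have "integrable (density M (indicator (E n))) (\<lambda>\<omega>. f (\<omega>, V n \<omega>))"
      unfolding f_def
      by (subst integrable_density[where g = "indicator (E n)", unfolded ennreal_indicator]) auto
    then have f_int: "integrable (R n \<Otimes>\<^sub>M N) f"
      unfolding joint by (subst integrable_distr_eq) auto
    interpret P: pair_sigma_finite "R n" N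
      using R_fin[of n] N.sigma_finite_measure_axioms
      by (simp add: pair_sigma_finite_def finite_measure.sigma_finite_measure)
    have "(\<integral>\<omega>. Z \<omega> * D n \<omega> \<partial>M) = (\<integral>\<omega>. indicator (E n) \<omega> * (Z \<omega> * w n \<omega> * g (V n \<omega>)) \<partial>M)"
      by (rule Bochner_Integration.integral_cong) (auto simp: eq)
    also have "\<dots> = (\<integral>\<omega>. f (\<omega>, V n \<omega>) \<partial>density M (indicator (E n)))"
      unfolding f_def
      by (subst integral_density[where g = "indicator (E n)", unfolded ennreal_indicator]) auto
    also have "\<dots> = (\<integral>z. f z \<partial>(R n \<Otimes>\<^sub>M N))"
      unfolding joint by (subst integral_distr) auto
    also have "\<dots> = (\<integral>\<omega>. \<integral>x. f (\<omega>, x) \<partial>N \<partial>R n)"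
      by (rule P.integral_fst'[symmetric]) (rule f_int)
    also have "\<dots> = 0" by (simp add: f_def g0)
    finally show "(\<integral>\<omega>. Z \<omega> * D n \<omega> \<partial>M) = 0" .
  next
    have v0: "0 \<le> v" by (simp add: v_def)
    show "summable (\<lambda>n. \<integral>\<omega>. (D n \<omega>)\<^sup>2 \<partial>M)"
      unfolding D_int
    proof (rule summableI_nonneg_bounded[where x = "B * v"])
      fix n
      have "(\<Sum>i<n. \<integral>\<omega>. (w i \<omega>)\<^sup>2 \<partial>M) = (\<integral>\<omega>. (\<Sum>i<n. (w i \<omega>)\<^sup>2) \<partial>M)"
        using w2 by simp
      also have "\<dots> \<le> (\<integral>\<omega>. B \<partial>M)"
        by (rule integral_mono) (use w2 wB in auto)
      also have "\<dots> = B" by (simp add: prob_space)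
      finally show "(\<Sum>i<n. (\<integral>\<omega>. (w i \<omega>)\<^sup>2 \<partial>M) * v) \<le> B * v"
        using v0 by (simp add: mult_right_mono flip: sum_distrib_right)
    qed (simp add: v0)
  qed
  then show ?thesis by (simp add: D_def)
qed

end

text \<open>Summation by parts. A nondecreasing weight has total variation at most
  \<open>W n\<close> over a window ending at n, so the tail bound on the sums of z is multiplied by
  \<open>W n\<close> only. It puts back the envelope by which the noise has been divided.\<close>

lemma abel_weighted_sum_small:
  fixes W z :: "nat \<Rightarrow> real"
  assumes W: "mono W" "\<And>n. 0 \<le> W n" and z: "summable z" and e: "0 < e"
  shows "\<exists>N. \<forall>m\<ge>N. \<forall>n\<ge>m. \<bar>\<Sum>j=m..<n. W j * z j\<bar> \<le> e * W n"
proof -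
  obtain N where N: "\<And>m n. m \<ge> N \<Longrightarrow> \<bar>\<Sum>j=m..<n. z j\<bar> < e / 2"
    using z e unfolding summable_Cauchy real_norm_def by (metis half_gt_zero)
  show ?thesis
  proof (intro exI[of _ N] allI impI)
    fix m n assume m: "m \<ge> N" and n: "n \<ge> m"
    define S where "S k = (\<Sum>j=m..<k. z j)" for k
    have S: "\<bar>S k\<bar> \<le> e / 2" for k using N[OF m, of k] by (simp add: S_def less_imp_le)
    have "(\<Sum>j=m..<n. W j * z j) = W n * S n - (\<Sum>j=m..<n. (W (Suc j) - W j) * S (Suc j))"
      using n by (induction n rule: dec_induct) (simp_all add: S_def algebra_simps)
    moreover have "\<bar>W n * S n\<bar> \<le> W n * (e / 2)"
      using mult_left_mono[OF S W(2), of n n] W(2)[of n] by (simp add: abs_mult)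
    moreover have "\<bar>\<Sum>j=m..<n. (W (Suc j) - W j) * S (Suc j)\<bar> \<le> (\<Sum>j=m..<n. (W (Suc j) - W j) * (e / 2))"
    proof (intro order_trans[OF sum_abs] sum_mono)
      fix j
      have "0 \<le> W (Suc j) - W j" using monoD[OF W(1), of j "Suc j"] by simp
      then show "\<bar>(W (Suc j) - W j) * S (Suc j)\<bar> \<le> (W (Suc j) - W j) * (e / 2)"
        using mult_left_mono[OF S] by (simp add: abs_mult)
    qed
    moreover have "(\<Sum>j=m..<n. (W (Suc j) - W j) * (e / 2)) = (W n - W m) * (e / 2)"
      using sum_Suc_diff'[OF n, of W] by (simp flip: sum_distrib_right sum_divide_distrib)
    moreover have "(W n - W m) * (e / 2) \<le> W n * (e / 2)"
      using W(2)[of m] e by (intro mult_right_mono) auto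
    ultimately show "\<bar>\<Sum>j=m..<n. W j * z j\<bar> \<le> e * W n" by (simp add: mult.commute)
  qed
qed

lemma convex_shift: "(1 - b) * x + b * y = (1 - b) * (x - y) + (y :: real)"
  by (simp add: algebra_simps)

text \<open>Subtracting the tail correction d of the convergent noise series turns the recursion
  into one in which u contracts by \<open>1 - b n\<close> and is perturbed by
  \<open>b n * d n\<close> with d tending to 0. Since the rates b have a divergent sum, the product
  of the contraction factors tends to 0.\<close>

lemma averaging_tendsto_zero:
  fixes y b z :: "nat \<Rightarrow> real"
  assumes y: "\<And>n. y (Suc n) = y n + b n * (z n - y n)"
    and b: "\<And>n. 0 \<le> b n" "\<And>n. b n \<le> 1" "filterlim (\<lambda>n. \<Sum>k<n. b k) at_top sequentially"
    and z: "summable (\<lambda>n. b n * z n)"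
  shows "y \<longlonglongrightarrow> 0"
proof -
  define d where "d n = (\<Sum>k<n. b k * z k) - (\<Sum>k. b k * z k)" for n
  have d: "d \<longlonglongrightarrow> 0"
    unfolding d_def using summable_LIMSEQ[OF z] by (simp add: LIM_zero)
  define u where "u n = y n - d n" for n
  have u_Suc: "u (Suc n) = (1 - b n) * u n - b n * d n" for n
    unfolding u_def y by (simp add: d_def algebra_simps)
  have "u \<longlonglongrightarrow> 0"
  proof (rule LIMSEQ_I)
    fix r :: real assume r: "0 < r"
    obtain N where N: "\<And>n. n \<ge> N \<Longrightarrow> \<bar>d n\<bar> < r / 2"
      using LIMSEQ_D[OF d, of "r / 2"] r by auto
    have bound: "\<bar>u n\<bar> - r / 2 \<le> exp (- (\<Sum>k=N..<n. b k)) * \<bar>u N\<bar>" if "n \<ge> N" for n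
      using that
    proof (induction n rule: dec_induct)
      case base then show ?case using r by simp
    next
      case (step n)
      have "\<bar>u (Suc n)\<bar> \<le> (1 - b n) * \<bar>u n\<bar> + b n * \<bar>d n\<bar>"
        unfolding u_Suc using b(1,2)[of n] abs_triangle_ineq4[of "(1 - b n) * u n" "b n * d n"]
        by (simp add: abs_mult)
      also have "b n * \<bar>d n\<bar> \<le> b n * (r / 2)"
        using N[of n] step(1) b(1)[of n] by (intro mult_left_mono) auto
      also have "(1 - b n) * \<bar>u n\<bar> + b n * (r / 2) = (1 - b n) * (\<bar>u n\<bar> - r / 2) + r / 2"
        using convex_shift[of "b n" "\<bar>u n\<bar>" "r / 2"] .
      finally have "\<bar>u (Suc n)\<bar> - r / 2 \<le> (1 - b n) * (\<bar>u n\<bar> - r / 2)" by simp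
      also have "\<dots> \<le> (1 - b n) * (exp (- (\<Sum>k=N..<n. b k)) * \<bar>u N\<bar>)"
        using step b(2)[of n] by (intro mult_left_mono) auto
      also have "\<dots> \<le> exp (- b n) * (exp (- (\<Sum>k=N..<n. b k)) * \<bar>u N\<bar>)"
        using exp_ge_add_one_self[of "- b n"] by (intro mult_right_mono) auto
      also have "\<dots> = exp (- (\<Sum>k=N..<Suc n. b k)) * \<bar>u N\<bar>"
        using step(1) by (simp add: exp_add[symmetric] flip: mult.assoc)
      finally show ?case .
    qed
    have "filterlim (\<lambda>n. \<Sum>k=N..<n. b k) at_top sequentially"
    proof -
      have "filterlim (\<lambda>n. - (\<Sum>k<N. b k) + (\<Sum>k<n. b k)) at_top sequentially"
        by (rule filterlim_tendsto_add_at_top[OF tendsto_const b(3)])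
      moreover have "\<forall>\<^sub>F n in sequentially. - (\<Sum>k<N. b k) + (\<Sum>k<n. b k) = (\<Sum>k=N..<n. b k)"
        using eventually_ge_at_top[of N]
      proof (rule eventually_mono)
        fix n assume "N \<le> n"
        then show "- (\<Sum>k<N. b k) + (\<Sum>k<n. b k) = (\<Sum>k=N..<n. b k)"
          using sum.atLeastLessThan_concat[of 0 N n b] by (simp add: lessThan_atLeast0)
      qed
      ultimately show ?thesis by (rule filterlim_cong[OF refl refl, THEN iffD1, rotated])
    qed
    then have "((\<lambda>n. exp (- (\<Sum>k=N..<n. b k)) * \<bar>u N\<bar>) \<longlongrightarrow> 0 * \<bar>u N\<bar>) sequentially"
      by (intro tendsto_intros filterlim_compose[OF exp_at_bot] filterlim_compose[OF filterlim_uminus_at_bot_at_top])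
    then have "\<forall>\<^sub>F n in sequentially. exp (- (\<Sum>k=N..<n. b k)) * \<bar>u N\<bar> < r / 2"
      using r by (intro order_tendstoD(2)) auto
    then have "\<forall>\<^sub>F n in sequentially. \<bar>u n\<bar> < r"
      using eventually_ge_at_top[of N]
    proof eventually_elim
      case (elim n)
      then show ?case using bound[of n] by simp
    qed
    then show "\<exists>no. \<forall>n\<ge>no. norm (u n - 0) < r"
      unfolding eventually_sequentially by simp
  qed
  then have "(\<lambda>n. u n + d n) \<longlonglongrightarrow> 0 + 0" using d by (rule tendsto_add)
  then show ?thesis by (simp add: u_def)
qed

section \<open>Asynchronous step sizes are asymptotically balanced\<close>

lemma nu_0 [simp]: "nu Y 0 i = 0"
  by (simp add: nu_def)

lemma nu_Suc: "nu Y (Suc n) i = nu Y n i + (if i \<in> Y n then 1 else 0)"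
proof -
  have "{k. k < Suc n \<and> i \<in> Y k} = {k. k < n \<and> i \<in> Y k} \<union> (if i \<in> Y n then {n} else {})"
    by (auto simp: less_Suc_eq)
  then show ?thesis by (simp add: nu_def)
qed

lemma nu_mono: "m \<le> n \<Longrightarrow> nu Y m i \<le> nu Y n i"
  by (rule lift_Suc_mono_le[of "\<lambda>n. nu Y n i"]) (simp add: nu_Suc)

lemma nu_le: "nu Y n i \<le> n"
  by (induction n) (auto simp: nu_Suc)

definition step_size :: "(nat \<Rightarrow> real) \<Rightarrow> (nat \<Rightarrow> 'i set) \<Rightarrow> nat \<Rightarrow> 'i \<Rightarrow> real" where
  "step_size \<alpha> Y n i = (if i \<in> Y n then \<alpha> (nu Y n i) else 0)"

text \<open>At its successive updates the counter of a component runs through 0, 1, 2 and so on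
  without gaps, which converts sums over time into sums over the counter.\<close>

lemma sum_over_updates:
  "(\<Sum>k<n. if i \<in> Y k then g (nu Y k i) else 0) = (\<Sum>j<nu Y n i. g j :: real)"
  by (induction n) (auto simp: nu_Suc)

lemma sum_step_size: "(\<Sum>k<n. step_size \<alpha> Y k i) = (\<Sum>j<nu Y n i. \<alpha> j)"
  unfolding step_size_def by (rule sum_over_updates)

lemma sum_step_size_sq: "(\<Sum>k<n. (step_size \<alpha> Y k i)\<^sup>2) = (\<Sum>j<nu Y n i. (\<alpha> j)\<^sup>2)"
proof -
  have "(step_size \<alpha> Y k i)\<^sup>2 = (if i \<in> Y k then (\<alpha> (nu Y k i))\<^sup>2 else 0)" for k
    by (simp add: step_size_def)
  then show ?thesis using sum_over_updates[of i Y "\<lambda>j. (\<alpha> j)\<^sup>2" n] by simp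
qed

lemma alpha_tilde_eq: "alpha_tilde \<alpha> Y n = (\<Sum>i\<in>UNIV. step_size \<alpha> Y n i)"
  unfolding alpha_tilde_def step_size_def by (simp add: sum.If_cases)

text \<open>Ratios are taken to converge for the window lengths \<open>1 / real (Suc k)\<close>:
  countably many almost sure statements hold simultaneously, and longer windows are assembled from
  short blocks. The bound \<open>\<Delta> < 1\<close> lets \<Delta> serve as the parameter x of
  \<open>req_alpha_det\<close>.\<close>

locale async_clock =
  fixes \<alpha> :: "nat \<Rightarrow> real" and Y :: "nat \<Rightarrow> 'i::finite set" and \<Delta> :: real
  assumes alpha: "req_alpha_det \<alpha>" and Y_ne: "\<And>n. Y n \<noteq> {}"
    and Delta: "0 < \<Delta>" "\<Delta> < 1"
    and nu_ge: "\<And>i. \<forall>\<^sub>F n in sequentially. \<Delta> * real n \<le> real (nu Y n i)"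
    and ratio: "\<And>k i j. convergent (\<lambda>n.
        (\<Sum>l = nu Y n i..nu Y (Nx \<alpha> n (1 / real (Suc k))) i. \<alpha> l) /
        (\<Sum>l = nu Y n j..nu Y (Nx \<alpha> n (1 / real (Suc k))) j. \<alpha> l))"
begin

definition tau :: "nat \<Rightarrow> real" where "tau n = (\<Sum>k<n. \<alpha> k)"
definition A :: "'i \<Rightarrow> nat \<Rightarrow> real" where "A i n = tau (nu Y n i)"
text \<open>The mean of the step masses \<open>A i n\<close> over the components. Dividing the ODE
  time by their number makes the clock run at the speed of a single component.\<close>

definition clock :: "nat \<Rightarrow> real" where "clock n = t_tilde \<alpha> Y n / real CARD('i)"

section \<open>Elementary properties of the clocks\<close>

lemma alpha_pos: "0 < \<alpha> n"
  using alpha unfolding req_alpha_det_def by blast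

lemma tau_Suc: "tau (Suc n) = tau n + \<alpha> n"
  by (simp add: tau_def)

lemma tau_less: "m < n \<Longrightarrow> tau m < tau n"
  by (rule lift_Suc_mono_less[of tau]) (simp_all add: tau_Suc alpha_pos)

lemma tau_le: "m \<le> n \<Longrightarrow> tau m \<le> tau n"
  using tau_less[of m n] by (cases "m = n") auto

lemma tau_nonneg: "0 \<le> tau n"
  using tau_le[of 0 n] by (simp add: tau_def)

lemma tau_top: "filterlim tau at_top sequentially"
  using alpha unfolding req_alpha_det_def tau_def by blast

lemma tau_diff: "m \<le> n \<Longrightarrow> (\<Sum>k=m..n. \<alpha> k) = tau (Suc n) - tau m"
  by (induction n rule: dec_induct) (simp_all add: tau_Suc)

lemma alpha_null: "\<alpha> \<longlonglongrightarrow> 0"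
proof -
  have "(\<lambda>n. (\<alpha> n)\<^sup>2) \<longlonglongrightarrow> 0"
    using alpha unfolding req_alpha_det_def by (blast intro: summable_LIMSEQ_zero)
  then have "(\<lambda>n. sqrt ((\<alpha> n)\<^sup>2)) \<longlonglongrightarrow> sqrt 0" by (rule tendsto_real_sqrt)
  then show ?thesis using alpha_pos by (simp add: less_imp_le)
qed

lemma nu_top: "filterlim (\<lambda>n. nu Y n i) at_top sequentially"
proof -
  have "filterlim (\<lambda>n. \<Delta> * real n) at_top sequentially"
    using Delta filterlim_real_sequentially by (intro filterlim_tendsto_pos_mult_at_top[OF tendsto_const]) auto
  then have "filterlim (\<lambda>n. real (nu Y n i)) at_top sequentially"
    by (rule filterlim_at_top_mono[OF _ nu_ge])
  then show ?thesis by (simp add: filterlim_sequentially_iff_filterlim_real)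
qed

lemma alpha_nu_null: "(\<lambda>n. \<alpha> (nu Y n i)) \<longlonglongrightarrow> 0"
  by (rule filterlim_compose[OF alpha_null nu_top])

lemma step_size_nonneg: "0 \<le> step_size \<alpha> Y n i"
  by (simp add: step_size_def alpha_pos less_imp_le)

lemma step_size_le: "step_size \<alpha> Y n i \<le> \<alpha> (nu Y n i)"
  by (simp add: step_size_def alpha_pos less_imp_le)

lemma sum_step_size_eq: "m \<le> n \<Longrightarrow> (\<Sum>k=m..<n. step_size \<alpha> Y k i) = A i n - A i m"
proof -
  assume "m \<le> n"
  then have "(\<Sum>k<n. step_size \<alpha> Y k i) = (\<Sum>k<m. step_size \<alpha> Y k i) + (\<Sum>k=m..<n. step_size \<alpha> Y k i)"
    using sum.atLeastLessThan_concat[of 0 m n "\<lambda>k. step_size \<alpha> Y k i"] by (simp add: lessThan_atLeast0)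
  then show ?thesis by (simp add: sum_step_size A_def tau_def)
qed

lemma A_mono: "m \<le> n \<Longrightarrow> A i m \<le> A i n"
  unfolding A_def by (intro tau_le nu_mono)

lemma clock_eq: "clock n = (\<Sum>i\<in>UNIV. A i n) / real CARD('i)"
  unfolding clock_def t_tilde_def alpha_tilde_eq
  by (subst sum.swap) (simp add: sum_step_size A_def tau_def)

lemma clock_Suc: "clock (Suc n) - clock n = alpha_tilde \<alpha> Y n / real CARD('i)"
  by (simp add: clock_def t_tilde_def add_divide_distrib)

lemma alpha_tilde_pos: "0 < alpha_tilde \<alpha> Y n"
  unfolding alpha_tilde_def using Y_ne[of n] alpha_pos by (intro sum_pos) auto

lemma clock_less: "clock n < clock (Suc n)"
proof -
  have "0 < alpha_tilde \<alpha> Y n / real CARD('i)" using alpha_tilde_pos[of n] by simp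
  then show ?thesis unfolding clock_Suc[symmetric] by simp
qed

lemma clock_0: "clock 0 = 0"
  by (simp add: clock_def t_tilde_def)

lemma A_top: "filterlim (A i) at_top sequentially"
  unfolding A_def by (rule filterlim_compose[OF tau_top nu_top])

lemma clock_top: "filterlim clock at_top sequentially"
proof (rule filterlim_at_top_mono)
  show "filterlim (\<lambda>n. inverse (real CARD('i)) * A undefined n) at_top sequentially"
    by (intro filterlim_tendsto_pos_mult_at_top[OF tendsto_const _ A_top]) simp
  have "A undefined n \<le> (\<Sum>i\<in>UNIV. A i n)" for n
    by (rule member_le_sum) (auto simp: A_def tau_nonneg)
  then show "\<forall>\<^sub>F n in sequentially. inverse (real CARD('i)) * A undefined n \<le> clock n"
    unfolding clock_eq by (simp add: divide_inverse mult.commute)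
qed

lemma step_size_null: "(\<lambda>n. step_size \<alpha> Y n i) \<longlonglongrightarrow> 0"
  by (rule tendsto_sandwich[OF _ _ tendsto_const alpha_nu_null[of i]])
    (auto simp: step_size_nonneg step_size_le)

lemma clock_gap: "(\<lambda>n. clock (Suc n) - clock n) \<longlonglongrightarrow> 0"
  unfolding clock_Suc alpha_tilde_eq
  by (intro tendsto_divide_zero tendsto_null_sum step_size_null)

text \<open>The counter lies between \<open>\<Delta> * k\<close> and k, and \<alpha> is eventually
  nonincreasing. The lower bound on the counter together with the bounded ratio of
  \<open>req_alpha_det\<close> gives the upper estimate; the upper bound on the counter, at some
  selected component, gives the lower one.\<close>

lemma rates:
  "\<exists>N B. 0 < B \<and> (\<forall>k\<ge>N. \<forall>i. step_size \<alpha> Y k i \<le> B * \<alpha> k) \<and>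
    (\<forall>k\<ge>N. \<alpha> k \<le> alpha_tilde \<alpha> Y k)"
proof -
  obtain n1 where n1: "\<And>n. n \<ge> n1 \<Longrightarrow> \<alpha> (Suc n) \<le> \<alpha> n"
    using alpha unfolding req_alpha_det_def eventually_sequentially by blast
  have dec: "\<alpha> n \<le> \<alpha> m" if "n1 \<le> m" "m \<le> n" for m n
    using that(2)
  proof (induction n rule: dec_induct)
    case (step n)
    then show ?case using n1[of n] that(1) by simp
  qed simp
  have "\<exists>B. \<forall>n. \<alpha> (nat \<lfloor>\<Delta> * real n\<rfloor>) / \<alpha> n \<le> B"
    using alpha Delta unfolding req_alpha_det_def by auto
  then obtain B where B: "\<And>n. \<alpha> (nat \<lfloor>\<Delta> * real n\<rfloor>) / \<alpha> n \<le> B" by blast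
  have B0: "0 < B" using B[of 0] alpha_pos[of 0] by simp
  have "\<forall>\<^sub>F n in sequentially. \<forall>i. \<Delta> * real n \<le> real (nu Y n i)"
    by (rule eventually_all_finite[OF nu_ge])
  then obtain n2 where n2: "\<And>n i. n \<ge> n2 \<Longrightarrow> \<Delta> * real n \<le> real (nu Y n i)"
    unfolding eventually_sequentially by blast
  obtain n3 :: nat where n3: "real n1 + 1 < n3 * \<Delta>"
    using reals_Archimedean3[OF Delta(1)] by blast
  define N where "N = max n2 n3"
  have nu: "n1 \<le> nat \<lfloor>\<Delta> * real k\<rfloor>" "nat \<lfloor>\<Delta> * real k\<rfloor> \<le> nu Y k i" if "k \<ge> N" for k i
  proof -
    have "n3 * \<Delta> \<le> \<Delta> * real k" using that Delta by (simp add: N_def mult.commute mult_left_mono)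
    then have "real n1 \<le> \<Delta> * real k" using n3 by simp
    then show "n1 \<le> nat \<lfloor>\<Delta> * real k\<rfloor>" by (simp add: le_nat_iff le_floor_iff)
    have "\<Delta> * real k \<le> real (nu Y k i)" using n2 that by (simp add: N_def)
    then show "nat \<lfloor>\<Delta> * real k\<rfloor> \<le> nu Y k i" by linarith
  qed
  show ?thesis
  proof (intro exI[of _ N] exI[of _ B] conjI allI impI B0)
    fix k i assume k: "k \<ge> N"
    have "step_size \<alpha> Y k i \<le> \<alpha> (nu Y k i)" by (rule step_size_le)
    also have "\<dots> \<le> \<alpha> (nat \<lfloor>\<Delta> * real k\<rfloor>)" by (rule dec[OF nu[OF k]])
    also have "\<dots> \<le> B * \<alpha> k" using B[of k] alpha_pos[of k] by (simp add: pos_divide_le_eq)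
    finally show "step_size \<alpha> Y k i \<le> B * \<alpha> k" .
  next
    fix k assume k: "k \<ge> N"
    obtain i where i: "i \<in> Y k" using Y_ne by blast
    have "\<alpha> k \<le> \<alpha> (nu Y k i)"
      by (rule dec) (use nu(1)[OF k] nu(2)[OF k, of i] nu_le[of Y k i] in auto)
    also have "\<dots> \<le> alpha_tilde \<alpha> Y k"
      unfolding alpha_tilde_def by (rule member_le_sum[OF i]) (auto simp: alpha_pos less_imp_le)
    finally show "\<alpha> k \<le> alpha_tilde \<alpha> Y k" .
  qed
qed

lemma window_rates:
  obtains N B where "0 < B"
    "\<And>m n i. N \<le> m \<Longrightarrow> m \<le> n \<Longrightarrow> A i n - A i m \<le> B * (tau n - tau m)"
    "\<And>m n. N \<le> m \<Longrightarrow> m \<le> n \<Longrightarrow> tau n - tau m \<le> real CARD('i) * (clock n - clock m)"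
proof -
  obtain B N where B: "0 < B" "\<And>k i. k \<ge> N \<Longrightarrow> step_size \<alpha> Y k i \<le> B * \<alpha> k"
    and lo: "\<And>k. k \<ge> N \<Longrightarrow> \<alpha> k \<le> alpha_tilde \<alpha> Y k"
    using rates by blast
  have 1: "A i n - A i m \<le> B * (tau n - tau m)" if "N \<le> m" "m \<le> n" for m n i
    using that(2)
  proof (induction n rule: dec_induct)
    case (step n)
    have "A i (Suc n) - A i n = step_size \<alpha> Y n i"
      using sum_step_size_eq[of n "Suc n" i] by simp
    then show ?case using step B(2)[of n i] that(1) by (simp add: tau_Suc algebra_simps)
  qed simp
  have 2: "tau n - tau m \<le> real CARD('i) * (clock n - clock m)" if "N \<le> m" "m \<le> n" for m n
    using that(2)
  proof (induction n rule: dec_induct)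
    case (step n)
    have "real CARD('i) * (clock (Suc n) - clock n) = alpha_tilde \<alpha> Y n"
      unfolding clock_Suc by simp
    then show ?case using step lo[of n] that(1) by (simp add: tau_Suc algebra_simps)
  qed simp
  show thesis by (rule that[OF B(1) 1 2])
qed

text \<open>The fraction y of updates received by a component moves with n and is only known to stay
  in the interval from \<Delta> to 1, so the uniformity in y of the step size condition is what
  applies.\<close>

lemma A_over_sum: "(\<lambda>n. A i n / tau (Suc n)) \<longlonglongrightarrow> 1"
proof -
  have "(\<lambda>n. tau (Suc (nu Y n i)) / tau (Suc n)) \<longlonglongrightarrow> 1"
  proof (rule LIMSEQ_I)
    fix e :: real assume e: "0 < e"
    have "\<exists>N. \<forall>n\<ge>N. \<forall>y\<in>{\<Delta>..1}. \<bar>(\<Sum>k\<le>nat \<lfloor>y * real n\<rfloor>. \<alpha> k) / (\<Sum>k\<le>n. \<alpha> k) - 1\<bar> < e"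
      using alpha Delta e unfolding req_alpha_det_def by auto
    then obtain N where N: "\<And>n y. n \<ge> N \<Longrightarrow> y \<in> {\<Delta>..1} \<Longrightarrow>
        \<bar>(\<Sum>k\<le>nat \<lfloor>y * real n\<rfloor>. \<alpha> k) / (\<Sum>k\<le>n. \<alpha> k) - 1\<bar> < e" by blast
    obtain N2 where N2: "\<And>n. n \<ge> N2 \<Longrightarrow> \<Delta> * real n \<le> real (nu Y n i)"
      using nu_ge[of i] unfolding eventually_sequentially by blast
    show "\<exists>no. \<forall>n\<ge>no. norm (tau (Suc (nu Y n i)) / tau (Suc n) - 1) < e"
    proof (intro exI[of _ "max 1 (max N N2)"] allI impI)
      fix n assume n: "max 1 (max N N2) \<le> n"
      define y where "y = real (nu Y n i) / real n"
      have y: "y * real n = real (nu Y n i)" using n by (simp add: y_def)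
      have "y \<in> {\<Delta>..1}"
        using N2[of n] n nu_le[of Y n i] by (simp add: y_def pos_le_divide_eq)
      from N[OF _ this, of n] n show "norm (tau (Suc (nu Y n i)) / tau (Suc n) - 1) < e"
        unfolding y by (simp add: tau_def lessThan_Suc_atMost)
    qed
  qed
  \<comment> \<open>\<open>A i n\<close> stops one term before the sum up to the counter; that last
    term is negligible against the divergent total.\<close>
  moreover have "(\<lambda>n. \<alpha> (nu Y n i) / tau (Suc n)) \<longlonglongrightarrow> 0"
    by (rule tendsto_divide_0[OF alpha_nu_null filterlim_at_top_imp_at_infinity])
       (rule filterlim_compose[OF tau_top filterlim_Suc])
  ultimately have "(\<lambda>n. tau (Suc (nu Y n i)) / tau (Suc n) - \<alpha> (nu Y n i) / tau (Suc n)) \<longlonglongrightarrow> 1 - 0"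
    by (rule tendsto_diff)
  then show ?thesis by (simp add: A_def tau_Suc diff_divide_distrib[symmetric])
qed

section \<open>Blocks of prescribed step mass\<close>

context
  fixes x :: real
  assumes x: "0 < x"
begin

lemma Nx_props: "n < Nx \<alpha> n x" "x \<le> tau (Suc (Nx \<alpha> n x)) - tau n"
  "tau (Nx \<alpha> n x) - tau n \<le> x + \<alpha> n"
proof -
  define P where "P m \<longleftrightarrow> n < m \<and> x \<le> (\<Sum>k=n..m. \<alpha> k)" for m
  have Nx: "Nx \<alpha> n x = (LEAST m. P m)" by (simp add: Nx_def P_def)
  obtain m where m: "\<And>k. k \<ge> m \<Longrightarrow> x + tau n \<le> tau k"
    using tau_top unfolding filterlim_at_top eventually_sequentially by blast
  have "P (max m (Suc n))"
    using m[of "Suc (max m (Suc n))"] tau_diff[of n "max m (Suc n)"]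
    unfolding P_def by (auto simp: max_def)
  then have P: "P (Nx \<alpha> n x)" unfolding Nx by (rule LeastI)
  then show 1: "n < Nx \<alpha> n x" "x \<le> tau (Suc (Nx \<alpha> n x)) - tau n"
    using tau_diff[of n "Nx \<alpha> n x"] by (auto simp: P_def)
  show "tau (Nx \<alpha> n x) - tau n \<le> x + \<alpha> n"
  \<comment> \<open>Because \<open>Nx\<close> must exceed n strictly, it can be \<open>Suc n\<close>
    even if the first term alone is larger than x. Hence the slack
    \<open>\<alpha> n\<close>.\<close>
  proof (cases "Nx \<alpha> n x = Suc n")
    case True then show ?thesis using x by (simp add: tau_Suc)
  next
    case False
    define m where "m = Nx \<alpha> n x - 1"
    have m: "n < m" "Nx \<alpha> n x = Suc m" using 1(1) False by (auto simp: m_def)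
    have "\<not> P m" using not_less_Least[of m P] m(2) unfolding Nx[symmetric] by simp
    then have "tau (Suc m) - tau n < x" using m(1) tau_diff[of n m] by (simp add: P_def)
    then show ?thesis using m(2) alpha_pos[of n] by simp
  qed
qed

definition blk :: "'i \<Rightarrow> nat \<Rightarrow> real" where
  "blk i n = (\<Sum>l = nu Y n i..nu Y (Nx \<alpha> n x) i. \<alpha> l)"

text \<open>The sums of the ratio condition are closed at both ends, so consecutive blocks share one
  term. It is split off here because it tends to 0.\<close>

lemma blk_eq: "blk i n = A i (Nx \<alpha> n x) - A i n + \<alpha> (nu Y (Nx \<alpha> n x) i)"
  unfolding blk_def A_def
  by (subst tau_diff) (use nu_mono[of n "Nx \<alpha> n x" Y i] Nx_props(1)[of n] in \<open>auto simp: tau_Suc\<close>)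

lemma blk_pos: "0 < blk i n"
  using A_mono[of n "Nx \<alpha> n x" i] Nx_props(1)[of n] alpha_pos[of "nu Y (Nx \<alpha> n x) i"]
  unfolding blk_eq by simp

lemma Nx_top: "filterlim (\<lambda>n. Nx \<alpha> n x) at_top sequentially"
  by (rule filterlim_at_top_mono[OF filterlim_ident]) (use Nx_props(1) in \<open>auto simp: less_imp_le\<close>)

lemma overlap_null: "(\<lambda>n. \<alpha> (nu Y (Nx \<alpha> n x) i)) \<longlonglongrightarrow> 0"
  by (rule filterlim_compose[OF alpha_nu_null Nx_top])

text \<open>A block ratio limit above 1 would persist in the totals, whose ratio tends to 1.\<close>

lemma ratio_limit_le_1:
  assumes l: "(\<lambda>n. blk i n / blk j n) \<longlonglongrightarrow> l"
  shows "l \<le> 1"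
proof (rule ccontr)
  assume "\<not> l \<le> 1"
  then have l1: "1 < l" by simp
  define h where "h = (l - 1) / 2"
  have h: "0 < h" "1 + h < l" using l1 by (auto simp: h_def field_simps)
  \<comment> \<open>A block advances \<open>tau\<close> by at least \<open>x / 2\<close>, so the
    fraction \<open>h / 4\<close> of the advance pays for an overlap of
    \<open>h * x / 8\<close>.\<close>
  define e where "e = h * x / 8"
  have e: "0 < e" using h x by (simp add: e_def)
  have "\<forall>\<^sub>F n in sequentially. 1 + h < blk i n / blk j n"
    by (rule order_tendstoD(1)[OF l h(2)])
  moreover have "\<forall>\<^sub>F n in sequentially. \<alpha> (nu Y (Nx \<alpha> n x) i) < e"
    by (rule order_tendstoD(2)[OF overlap_null e])
  moreover have "\<forall>\<^sub>F n in sequentially. \<alpha> n < x / 2"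
    by (rule order_tendstoD(2)[OF alpha_null]) (use x in simp)
  ultimately have "\<forall>\<^sub>F n in sequentially. 1 + h < blk i n / blk j n \<and>
      \<alpha> (nu Y (Nx \<alpha> n x) i) < e \<and> \<alpha> n < x / 2"
    by eventually_elim simp
  then obtain n0 where n0: "\<And>n. n \<ge> n0 \<Longrightarrow> 1 + h < blk i n / blk j n"
    "\<And>n. n \<ge> n0 \<Longrightarrow> \<alpha> (nu Y (Nx \<alpha> n x) i) < e" "\<And>n. n \<ge> n0 \<Longrightarrow> \<alpha> n < x / 2"
    unfolding eventually_sequentially by blast
  define n where "n M = ((\<lambda>n. Nx \<alpha> n x) ^^ M) n0" for M
  have n_Suc: "n (Suc M) = Nx \<alpha> (n M) x" for M by (simp add: n_def)
  have n_ge: "n0 + M \<le> n M" for M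
  proof (induction M)
    case (Suc M)
    then show ?case using Nx_props(1)[of "n M"] by (simp add: n_Suc)
  qed (simp add: n_def)
  then have n_ge0: "n0 \<le> n M" for M using le_trans[OF le_add1] by blast
  have n_top: "filterlim n at_top sequentially"
    by (rule filterlim_at_top_mono[OF filterlim_ident]) (use le_trans[OF le_add2 n_ge] in \<open>auto intro: always_eventually\<close>)
  \<comment> \<open>A potential that does not decrease along the blocks, although divided by
    \<open>tau\<close> it tends to \<open>1 - (1 + h) + h / 4\<close>, which is negative.\<close>
  define f where "f M = A i (n M) - (1 + h) * A j (n M) + h / 4 * tau (Suc (n M))" for M
  have mono: "f M \<le> f (Suc M)" for M
  proof -
    let ?m = "n M"
    have "(1 + h) * blk j ?m < blk i ?m"
      using n0(1)[OF n_ge0[of M]] blk_pos[of j ?m] by (simp add: pos_less_divide_eq)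
    moreover have "(1 + h) * (A j (n (Suc M)) - A j ?m) \<le> (1 + h) * blk j ?m"
      unfolding blk_eq n_Suc using alpha_pos h by (intro mult_left_mono) (auto simp: less_imp_le)
    moreover have "blk i ?m \<le> A i (n (Suc M)) - A i ?m + e"
      unfolding blk_eq n_Suc using n0(2)[OF n_ge0[of M]] by simp
    moreover have "e \<le> h / 4 * (tau (Suc (n (Suc M))) - tau (Suc ?m))"
    proof -
      have "x / 2 \<le> tau (Suc (n (Suc M))) - tau (Suc ?m)"
        using Nx_props(2)[of ?m] n0(3)[OF n_ge0[of M]] by (simp add: n_Suc tau_Suc)
      then have "h / 4 * (x / 2) \<le> h / 4 * (tau (Suc (n (Suc M))) - tau (Suc ?m))"
        using h by (intro mult_left_mono) auto
      then show ?thesis by (simp add: e_def)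
    qed
    ultimately show ?thesis by (simp add: f_def algebra_simps)
  qed
  have f_ge: "f 0 \<le> f M" for M
    using lift_Suc_mono_le[of f 0 M] mono by simp
  have tn: "filterlim (\<lambda>M. tau (Suc (n M))) at_top sequentially"
    by (rule filterlim_compose[OF tau_top filterlim_compose[OF filterlim_Suc n_top]])
  have tpos: "0 < tau (Suc m)" for m
    using tau_less[of 0 "Suc m"] by (simp add: tau_def)
  have "(\<lambda>M. A i (n M) / tau (Suc (n M)) - (1 + h) * (A j (n M) / tau (Suc (n M))) + h / 4)
      \<longlonglongrightarrow> 1 - (1 + h) * 1 + h / 4"
    by (intro tendsto_intros filterlim_compose[OF A_over_sum n_top])
  moreover have "A i (n M) / tau (Suc (n M)) - (1 + h) * (A j (n M) / tau (Suc (n M))) + h / 4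
      = f M / tau (Suc (n M))" for M
    using tpos[of "n M"] by (simp add: f_def field_simps)
  ultimately have fl: "(\<lambda>M. f M / tau (Suc (n M))) \<longlonglongrightarrow> - (3 / 4 * h)" by simp
  have f0: "(\<lambda>M. f 0 / tau (Suc (n M))) \<longlonglongrightarrow> 0"
    by (rule tendsto_divide_0[OF tendsto_const filterlim_at_top_imp_at_infinity[OF tn]])
  have "0 \<le> - (3 / 4 * h)"
  proof (rule LIMSEQ_le[OF f0 fl])
    show "\<exists>N. \<forall>M\<ge>N. f 0 / tau (Suc (n M)) \<le> f M / tau (Suc (n M))"
      by (intro exI[of _ 0] allI impI divide_right_mono f_ge less_imp_le[OF tpos])
  qed
  then show False using h by simp
qed

end

text \<open>A ratio and its reciprocal both have limits at most 1, and these multiply to 1, so both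
  are 1. Blocks are bounded, hence also the difference of two blocks tends to 0.\<close>

lemma block_balanced:
  fixes k :: nat
  defines "x \<equiv> 1 / real (Suc k)"
  shows "(\<lambda>n. (A i (Nx \<alpha> n x) - A i n) - (A j (Nx \<alpha> n x) - A j n)) \<longlonglongrightarrow> 0"
proof -
  have x: "0 < x" by (simp add: x_def)
  have conv: "convergent (\<lambda>n. blk x i n / blk x j n)" for i j
    using ratio[where k = k and i = i and j = j] unfolding blk_def[OF x] unfolding x_def .
  obtain l l' where l: "(\<lambda>n. blk x i n / blk x j n) \<longlonglongrightarrow> l" "(\<lambda>n. blk x j n / blk x i n) \<longlonglongrightarrow> l'"
    using conv unfolding convergent_def by blast
  have "(\<lambda>n. (blk x i n / blk x j n) * (blk x j n / blk x i n)) \<longlonglongrightarrow> l * l'"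
    by (rule tendsto_mult[OF l])
  moreover have "(blk x i n / blk x j n) * (blk x j n / blk x i n) = 1" for n
    using blk_pos[OF x, of i n] blk_pos[OF x, of j n] by simp
  ultimately have ll: "l * l' = 1" by (simp add: LIMSEQ_const_iff)
  have "0 \<le> l" "0 \<le> l'"
    using blk_pos[OF x] by (auto intro!: LIMSEQ_le_const[OF l(1)] LIMSEQ_le_const[OF l(2)] simp: less_imp_le)
  moreover have "l \<le> 1" "l' \<le> 1" by (rule ratio_limit_le_1[OF x l(1)], rule ratio_limit_le_1[OF x l(2)])
  ultimately have l1: "l = 1"
    using ll mult_left_mono[of l' 1 l] by simp
  obtain N B where B: "0 < B" "\<And>m n i. N \<le> m \<Longrightarrow> m \<le> n \<Longrightarrow> A i n - A i m \<le> B * (tau n - tau m)"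
    using window_rates by metis
  have "\<forall>\<^sub>F n in sequentially. \<alpha> n < 1" "\<forall>\<^sub>F n in sequentially. \<alpha> (nu Y (Nx \<alpha> n x) j) < 1"
    using order_tendstoD(2)[OF alpha_null, of 1] order_tendstoD(2)[OF overlap_null[OF x], of 1] by auto
  then have bd: "\<forall>\<^sub>F n in sequentially. norm (blk x j n) \<le> B * (x + 1) + 1"
    using eventually_ge_at_top[of N]
  proof eventually_elim
    case (elim n)
    have "A j (Nx \<alpha> n x) - A j n \<le> B * (tau (Nx \<alpha> n x) - tau n)"
      using B(2)[of n "Nx \<alpha> n x" j] Nx_props(1)[OF x, of n] elim by simp
    also have "\<dots> \<le> B * (x + 1)"
      using Nx_props(3)[OF x, of n] elim B(1) by (intro mult_left_mono) auto
    finally have "blk x j n \<le> B * (x + 1) + 1" unfolding blk_eq[OF x] using elim by simp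
    then show ?case using blk_pos[OF x, of j n] by simp
  qed
  have "(\<lambda>n. blk x i n / blk x j n - 1) \<longlonglongrightarrow> 0"
    using l(1) unfolding l1 by (simp add: LIM_zero)
  then have "(\<lambda>n. (blk x i n / blk x j n - 1) * blk x j n) \<longlonglongrightarrow> 0"
    by (rule lim_null_mult_right_bounded[OF _ bd])
  moreover have "(blk x i n / blk x j n - 1) * blk x j n = blk x i n - blk x j n" for n
    using blk_pos[OF x, of j n] by (simp add: field_simps)
  ultimately have "(\<lambda>n. blk x i n - blk x j n) \<longlonglongrightarrow> 0" by simp
  then have "(\<lambda>n. (blk x i n - blk x j n) - \<alpha> (nu Y (Nx \<alpha> n x) i) + \<alpha> (nu Y (Nx \<alpha> n x) j)) \<longlonglongrightarrow> 0 - 0 + 0"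
    by (intro tendsto_intros overlap_null[OF x])
  then show ?thesis unfolding blk_eq[OF x] by (simp add: algebra_simps)
qed

text \<open>A window is cut into a bounded number of blocks, each contributing an imbalance below d,
  and a remainder shorter than one block, in which each component receives at most
  \<open>e / 2\<close>.\<close>

lemma window_balanced:
  assumes T: "0 < T" and e: "0 < e"
  shows "\<exists>N. \<forall>m\<ge>N. \<forall>n\<ge>m. tau n - tau m \<le> T \<longrightarrow> \<bar>(A i n - A i m) - (A j n - A j m)\<bar> \<le> e"
proof -
  obtain N1 B where B: "0 < B" "\<And>m n i. N1 \<le> m \<Longrightarrow> m \<le> n \<Longrightarrow> A i n - A i m \<le> B * (tau n - tau m)"
    using window_rates by metis
  obtain k :: nat where k: "1 / real (Suc k) < e / (4 * B)"
    using nat_approx_posE[of "e / (4 * B)"] e B(1) by (metis divide_pos_pos mult_pos_pos zero_less_numeral)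
  define x where "x = 1 / real (Suc k)"
  have x: "0 < x" "2 * B * x \<le> e / 2"
    using k B(1) unfolding x_def[symmetric] by (auto simp: x_def pos_less_divide_eq mult_ac)
  \<comment> \<open>Each block advances \<open>tau\<close> by at least \<open>x / 2\<close>, so K
    blocks exhaust a window of length T.\<close>
  obtain K :: nat where K: "T < K * (x / 2)"
    using reals_Archimedean3[of "x / 2"] x(1) by auto
  define d where "d = e / (2 * (real K + 1))"
  have d: "0 < d" "K * d \<le> e / 2" unfolding d_def using e by (auto simp: field_simps)
  have "\<forall>\<^sub>F n in sequentially. \<bar>(A i (Nx \<alpha> n x) - A i n) - (A j (Nx \<alpha> n x) - A j n)\<bar> < d"
    using block_balanced[of i k j] d(1) unfolding x_def[symmetric] tendsto_iff dist_real_def by simp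
  moreover have "\<forall>\<^sub>F n in sequentially. \<alpha> n < x / 2"
    by (rule order_tendstoD(2)[OF alpha_null]) (use x in simp)
  ultimately have "\<forall>\<^sub>F n in sequentially. N1 \<le> n \<and> \<alpha> n < x / 2 \<and>
      \<bar>(A i (Nx \<alpha> n x) - A i n) - (A j (Nx \<alpha> n x) - A j n)\<bar> < d"
    using eventually_ge_at_top[of N1] by eventually_elim simp
  then obtain N where N: "\<And>n. n \<ge> N \<Longrightarrow> N1 \<le> n" "\<And>n. n \<ge> N \<Longrightarrow> \<alpha> n < x / 2"
    "\<And>n. n \<ge> N \<Longrightarrow> \<bar>(A i (Nx \<alpha> n x) - A i n) - (A j (Nx \<alpha> n x) - A j n)\<bar> < d"
    unfolding eventually_sequentially by blast
  have main: "\<bar>(A i n - A i m) - (A j n - A j m)\<bar> \<le> r * d + e / 2"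
    if "N \<le> m" "m \<le> n" "tau n - tau m \<le> real r * (x / 2)" for m n r
    using that
  proof (induction r arbitrary: m)
    case 0
    then have "n = m" using tau_less[of m n] by (cases "m = n") auto
    then show ?case using e by simp
  next
    case (Suc r)
    define p where "p = Nx \<alpha> m x"
    note p = Nx_props[OF x(1), of m, folded p_def]
    show ?case
    proof (cases "n < p")
      case True
      have le: "A k n - A k m \<le> e / 2" "0 \<le> A k n - A k m" for k
      proof -
        have "A k n - A k m \<le> B * (tau n - tau m)"
          by (rule B(2)) (use N(1) Suc.prems in auto)
        also have "\<dots> \<le> B * (2 * x)"
          using tau_le[of n p] True p(3) N(2)[OF Suc.prems(1)] B(1) x(1)
          by (intro mult_left_mono) auto
        finally show "A k n - A k m \<le> e / 2" using x(2) by simp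
        show "0 \<le> A k n - A k m" using A_mono[OF Suc.prems(2)] by simp
      qed
      have "0 \<le> real (Suc r) * d" using d(1) by simp
      then show ?thesis using le[of i] le[of j] by linarith
    next
      case False
      have "tau n - tau p \<le> real r * (x / 2)"
      proof -
        have "x / 2 \<le> tau p - tau m"
          using p(1,2) N(2)[of p] Suc.prems(1) by (simp add: tau_Suc)
        then show ?thesis using Suc.prems(3) by (simp add: algebra_simps add_divide_distrib)
      qed
      then have "\<bar>(A i n - A i p) - (A j n - A j p)\<bar> \<le> r * d + e / 2"
        using Suc.IH[of p] Suc.prems p(1) False by simp
      moreover have "\<bar>(A i p - A i m) - (A j p - A j m)\<bar> < d"
        using N(3)[OF Suc.prems(1)] by (simp add: p_def)
      moreover have "real (Suc r) * d = real r * d + d" by (simp add: algebra_simps)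
      ultimately show ?thesis by linarith
    qed
  qed
  show ?thesis
  proof (intro exI[of _ N] allI impI)
    fix m n assume "N \<le> m" "m \<le> n" "tau n - tau m \<le> T"
    then show "\<bar>(A i n - A i m) - (A j n - A j m)\<bar> \<le> e"
      using main[of m n K] K d(2) by simp
  qed
qed

text \<open>The clock is the average of the \<open>A j\<close>, so its deviation from
  \<open>A i\<close> is the average of the pairwise imbalances.\<close>

lemma clock_balanced:
  assumes T: "0 < T" and e: "0 < e"
  shows "\<exists>N. \<forall>m\<ge>N. \<forall>n\<ge>m. clock n - clock m \<le> T \<longrightarrow>
    \<bar>(\<Sum>k=m..<n. step_size \<alpha> Y k i) - (clock n - clock m)\<bar> \<le> e"
proof -
  obtain N1 where N1: "\<And>m n. N1 \<le> m \<Longrightarrow> m \<le> n \<Longrightarrow> tau n - tau m \<le> real CARD('i) * (clock n - clock m)"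
    using window_rates by metis
  have dT: "0 < real CARD('i) * T" using T by simp
  have "\<forall>j. \<exists>N. \<forall>m\<ge>N. \<forall>n\<ge>m. tau n - tau m \<le> real CARD('i) * T \<longrightarrow>
      \<bar>(A i n - A i m) - (A j n - A j m)\<bar> \<le> e"
    using window_balanced[OF dT e] by blast
  then obtain N2 where N2: "\<And>j m n. m \<ge> N2 j \<Longrightarrow> n \<ge> m \<Longrightarrow> tau n - tau m \<le> real CARD('i) * T \<Longrightarrow>
      \<bar>(A i n - A i m) - (A j n - A j m)\<bar> \<le> e" by metis
  define N where "N = max N1 (Max (range N2))"
  have "N2 j \<le> Max (range N2)" for j by (rule Max_ge) auto
  then have N: "N1 \<le> N" "N2 j \<le> N" for j unfolding N_def by (auto simp: le_max_iff_disj)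
  show ?thesis
  proof (intro exI[of _ N] allI impI)
    fix m n assume mn: "N \<le> m" "m \<le> n" "clock n - clock m \<le> T"
    have "real CARD('i) * (clock n - clock m) \<le> real CARD('i) * T"
      using mn(3) by (intro mult_left_mono) auto
    moreover have "tau n - tau m \<le> real CARD('i) * (clock n - clock m)"
      by (rule N1) (use N(1) mn in auto)
    ultimately have "tau n - tau m \<le> real CARD('i) * T" by linarith
    then have diff: "\<bar>(A i n - A i m) - (A j n - A j m)\<bar> \<le> e" for j
      using N2[of j m n] N(2)[of j] mn by simp
    have "(\<Sum>j\<in>UNIV. (A i n - A i m) - (A j n - A j m))
        = real CARD('i) * (A i n - A i m) - ((\<Sum>j\<in>UNIV. A j n) - (\<Sum>j\<in>UNIV. A j m))"
      by (simp only: sum_subtractf sum_constant right_diff_distrib)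
    moreover have "real CARD('i) * (clock n - clock m) = (\<Sum>j\<in>UNIV. A j n) - (\<Sum>j\<in>UNIV. A j m)"
      by (simp add: clock_eq flip: diff_divide_distrib)
    ultimately have "real CARD('i) * ((A i n - A i m) - (clock n - clock m))
        = (\<Sum>j\<in>UNIV. (A i n - A i m) - (A j n - A j m))"
      by (simp only: right_diff_distrib)
    then have "real CARD('i) * \<bar>(A i n - A i m) - (clock n - clock m)\<bar>
        = \<bar>\<Sum>j\<in>UNIV. (A i n - A i m) - (A j n - A j m)\<bar>"
      by (metis abs_mult abs_of_nat)
    also have "\<dots> \<le> (\<Sum>j\<in>(UNIV::'i set). e)"
      by (intro order_trans[OF sum_abs] sum_mono diff)
    finally have "\<bar>(A i n - A i m) - (clock n - clock m)\<bar> \<le> e" by simp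
    then show "\<bar>(\<Sum>k=m..<n. step_size \<alpha> Y k i) - (clock n - clock m)\<bar> \<le> e"
      by (simp add: sum_step_size_eq[OF mn(2)])
  qed
qed

end

section \<open>Trajectory measures of policies\<close>

lemma sets_sample_M_step [measurable]:
  "Pair a \<in> measurable sample_M (step_M :: ('a \<times> 's \<times> real \<times> real) measure)"
  unfolding step_M_def by measurable

lemma fst_step_M [measurable]: "fst \<in> measurable step_M (count_space UNIV)"
  unfolding step_M_def by measurable

lemma snd_step_M [measurable]: "snd \<in> measurable step_M sample_M"
  unfolding step_M_def by measurable

lemma fst_sample_M [measurable]: "fst \<in> measurable sample_M (count_space UNIV)"
  unfolding sample_M_def by measurable

lemma snd_sample_M [measurable]: "snd \<in> measurable sample_M (borel \<Otimes>\<^sub>M borel)"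
  unfolding sample_M_def by measurable

lemma space_sample_M [simp]: "space sample_M = UNIV"
  unfolding sample_M_def by (simp add: space_pair_measure)

lemma space_step_M [simp]: "space step_M = UNIV"
  unfolding step_M_def by (simp add: space_pair_measure)

lemma state_at_measurable [measurable]:
  "state_at s0 n \<in> measurable (hist_M n) (count_space UNIV)"
proof (cases n)
  case (Suc m)
  have [measurable]: "(\<lambda>h. h m) \<in> measurable (hist_M n) step_M"
    unfolding hist_M_def Suc by (rule measurable_component_singleton) simp
  have "(\<lambda>h. fst (snd (h m))) \<in> measurable (hist_M n) (count_space UNIV)" by measurable
  then show ?thesis by (simp add: state_at_def[abs_def] Suc)
qed (simp add: state_at_def[abs_def])

lemma state_at_restrict: "m \<le> n \<Longrightarrow> state_at s0 m (restrict \<omega> {..<n}) = state_at s0 m \<omega>"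
  by (auto simp: state_at_def)

text \<open>Cylinders over finitely many coordinates determine a measure on trajectories, and each
  of them is already visible in some \<open>hist_M n\<close>.\<close>

lemma policy_measure_unique:
  assumes 1: "policy_measure P \<pi> s0 \<mu>" and 2: "policy_measure P \<pi> s0 \<mu>'"
  shows "\<mu> = \<mu>'"
proof (rule measure_eqI_PiM_infinite)
  interpret prob_space \<mu> using 1 by (simp add: policy_measure_def)
  show "finite_measure \<mu>" by (rule finite_measure_axioms)
  show "sets \<mu> = sets (PiM UNIV (\<lambda>_. step_M))" "sets \<mu>' = sets (PiM UNIV (\<lambda>_. step_M))"
    using 1 2 by (simp_all add: policy_measure_def traj_M_def)
  fix A :: "nat \<Rightarrow> ('b \<times> 'a \<times> real \<times> real) set" and J :: "nat set"
  assume J: "finite J" and A: "\<And>i. i \<in> J \<Longrightarrow> A i \<in> sets step_M"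
  obtain n where n: "J \<subseteq> {..<n}" using J finite_nat_bounded by blast
  define X where "X = prod_emb {..<n} (\<lambda>_. step_M) J (Pi\<^sub>E J A)"
  have X: "X \<in> sets (PiM {..<n} (\<lambda>_. step_M))"
    unfolding X_def using n J A by (intro measurable_prod_emb sets_PiM_I_finite) auto
  have "emeasure m (prod_emb UNIV (\<lambda>_. step_M) J (Pi\<^sub>E J A)) = emeasure (hist_law P \<pi> s0 n) X"
    if m: "policy_measure P \<pi> s0 m" for m
  proof -
    have "emeasure m (prod_emb UNIV (\<lambda>_. step_M) J (Pi\<^sub>E J A)) = emeasure m (prod_emb UNIV (\<lambda>_. step_M) {..<n} X)"
      unfolding X_def using n by (subst prod_emb_trans) auto
    also have "\<dots> = emeasure (distr m (PiM {..<n} (\<lambda>_. step_M)) (\<lambda>\<omega>. restrict \<omega> {..<n})) X"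
      by (rule emeasure_distr_restrict[symmetric])
         (use m X in \<open>auto simp: policy_measure_def traj_M_def\<close>)
    also have "distr m (PiM {..<n} (\<lambda>_. step_M)) (\<lambda>\<omega>. restrict \<omega> {..<n}) = hist_law P \<pi> s0 n"
      using m unfolding policy_measure_def hist_M_def by blast
    finally show ?thesis .
  qed
  from this[OF 1] this[OF 2]
  show "emeasure \<mu> (prod_emb UNIV (\<lambda>_. step_M) J (Pi\<^sub>E J A)) = emeasure \<mu>' (prod_emb UNIV (\<lambda>_. step_M) J (Pi\<^sub>E J A))"
    by simp
qed

section \<open>Transition laws and the Ionescu-Tulcea construction\<close>

locale smdp =
  fixes P :: "'s::finite \<times> 'a::finite \<Rightarrow> ('s \<times> real \<times> real) measure"
  assumes model: "smdp_model P"
begin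

lemma prob_P: "prob_space (P i)" and sets_P [measurable_cong]: "sets (P i) = sets sample_M"
  and tau_nonneg_P: "AE x in P i. 0 \<le> fst (snd x)"
  using model unfolding smdp_model_def by blast+

lemma space_P [simp]: "space (P i) = UNIV"
  using sets_eq_imp_space_eq[OF sets_P] by simp

lemma Pair_measurable_P [measurable]: "Pair a \<in> measurable (P i) step_M"
  unfolding measurable_cong_sets[OF sets_P refl] by (rule sets_sample_M_step)

lemma ptrans_emeasure: "emeasure (P i) {x. fst x = s} = ennreal (ptrans P i s)"
proof -
  interpret prob_space "P i" by (rule prob_P)
  show ?thesis unfolding ptrans_def by (simp add: emeasure_eq_measure)
qed

lemma nn_integral_P_fst:
  fixes g :: "'s \<Rightarrow> ennreal"
  shows "(\<integral>\<^sup>+x. g (fst x) \<partial>P i) = (\<Sum>s\<in>UNIV. ennreal (ptrans P i s) * g s)"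
proof -
  have m[measurable]: "{x. fst x = s} \<in> sets sample_M" for s :: 's
  proof -
    have "{x \<in> space sample_M. fst x = s} \<in> sets sample_M" by measurable
    then show ?thesis by simp
  qed
  have "(\<integral>\<^sup>+x. g (fst x) \<partial>P i) = (\<integral>\<^sup>+x. (\<Sum>s\<in>UNIV. g s * indicator {x. fst x = s} x) \<partial>P i)"
    by (rule nn_integral_cong) (simp add: indicator_def)
  also have "\<dots> = (\<Sum>s\<in>UNIV. \<integral>\<^sup>+x. g s * indicator {x. fst x = s} x \<partial>P i)"
    by (rule nn_integral_sum) measurable
  also have "\<dots> = (\<Sum>s\<in>UNIV. g s * emeasure (P i) {x. fst x = s})"
    by (intro sum.cong refl nn_integral_cmult_indicator) (simp add: sets_P)
  finally show ?thesis by (simp add: ptrans_emeasure mult.commute)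
qed

lemma ptrans_nonneg: "0 \<le> ptrans P i s"
  by (simp add: ptrans_def)

lemma stoch_kernel_ptrans: "stoch_kernel (ptrans P)"
  unfolding stoch_kernel_def
proof (intro conjI allI)
  fix i
  interpret prob_space "P i" by (rule prob_P)
  have "ennreal (\<Sum>s\<in>UNIV. ptrans P i s) = (\<Sum>s\<in>UNIV. ennreal (ptrans P i s) * 1)"
    by (simp add: sum_ennreal ptrans_nonneg)
  also have "\<dots> = (\<integral>\<^sup>+x. 1 \<partial>P i)" by (rule nn_integral_P_fst[symmetric])
  also have "\<dots> = ennreal 1" using emeasure_space_1 by simp
  finally show "(\<Sum>s\<in>UNIV. ptrans P i s) = 1"
    by (subst (asm) ennreal_inj) (auto simp: sum_nonneg ptrans_nonneg)
qed (rule ptrans_nonneg)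

context
  fixes \<pi> :: "nat \<Rightarrow> 's \<Rightarrow> (nat \<Rightarrow> 'a \<times> 's \<times> real \<times> real) \<Rightarrow> 'a pmf" and s0 :: 's
  assumes pol: "is_policy \<pi>"
begin

lemma pol_meas [measurable]: "(\<lambda>h. pmf (\<pi> n s0 h) a) \<in> borel_measurable (hist_M n)"
  using pol unfolding is_policy_def by blast

text \<open>The law of the next pair of action and sample given the history. It joins the two nested
  binds of \<open>hist_law\<close> into the single kernel per step which the Ionescu-Tulcea theorem
  takes.\<close>

definition step_kernel :: "nat \<Rightarrow> (nat \<Rightarrow> 'a \<times> 's \<times> real \<times> real) \<Rightarrow> ('a \<times> 's \<times> real \<times> real) measure" where
  "step_kernel n h = bind (measure_pmf (\<pi> n s0 h)) (\<lambda>a. distr (P (state_at s0 n h, a)) step_M (Pair a))"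

lemma step_distr_in: "distr (P i) step_M (Pair a) \<in> space (subprob_algebra step_M)"
  using prob_space.prob_space_distr[OF prob_P Pair_measurable_P, of i a]
  by (auto simp: space_subprob_algebra intro: prob_space_imp_subprob_space)

lemma nn_integral_step_kernel:
  assumes f[measurable]: "f \<in> borel_measurable step_M"
  shows "(\<integral>\<^sup>+z. f z \<partial>step_kernel n h)
    = (\<Sum>a\<in>UNIV. ennreal (pmf (\<pi> n s0 h) a) * (\<integral>\<^sup>+x. f (a, x) \<partial>P (state_at s0 n h, a)))"
proof -
  have "(\<integral>\<^sup>+z. f z \<partial>step_kernel n h)
      = (\<integral>\<^sup>+a. \<integral>\<^sup>+z. f z \<partial>distr (P (state_at s0 n h, a)) step_M (Pair a) \<partial>measure_pmf (\<pi> n s0 h))"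
    unfolding step_kernel_def
    by (rule nn_integral_bind[OF f]) (simp add: step_distr_in)
  also have "\<dots> = (\<integral>\<^sup>+a. \<integral>\<^sup>+x. f (a, x) \<partial>P (state_at s0 n h, a) \<partial>measure_pmf (\<pi> n s0 h))"
    by (intro nn_integral_cong nn_integral_distr) measurable
  also have "\<dots> = (\<Sum>a\<in>UNIV. ennreal (pmf (\<pi> n s0 h) a) * (\<integral>\<^sup>+x. f (a, x) \<partial>P (state_at s0 n h, a)))"
    by (simp add: nn_integral_measure_pmf nn_integral_count_space_finite)
  finally show ?thesis .
qed

lemma prob_space_step_kernel: "prob_space (step_kernel n h)"
  unfolding step_kernel_def
proof (rule prob_space.prob_space_bind[of _ _ step_M])
  show "prob_space (measure_pmf (\<pi> n s0 h))" by (rule measure_pmf.prob_space_axioms)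
  show "AE x in measure_pmf (\<pi> n s0 h). prob_space (distr (P (state_at s0 n h, x)) step_M (Pair x))"
    by (intro AE_I2 prob_space.prob_space_distr prob_P) measurable
qed (simp add: step_distr_in)

lemma sets_step_kernel [measurable_cong]: "sets (step_kernel n h) = sets step_M"
  unfolding step_kernel_def by (rule sets_bind) auto

lemma step_kernel_measurable: "step_kernel n \<in> measurable (hist_M n) (subprob_algebra step_M)"
proof (rule measurable_subprob_algebra)
  fix A :: "('a \<times> 's \<times> real \<times> real) set" assume A[measurable]: "A \<in> sets step_M"
  have "emeasure (step_kernel n h) A
      = (\<Sum>a\<in>UNIV. ennreal (pmf (\<pi> n s0 h) a) * (\<integral>\<^sup>+x. indicator A (a, x) \<partial>P (state_at s0 n h, a)))" for h
    using nn_integral_step_kernel[of "indicator A" n h] A by (simp add: sets_step_kernel)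
  moreover have "(\<lambda>h. \<Sum>a\<in>UNIV. ennreal (pmf (\<pi> n s0 h) a) * (\<integral>\<^sup>+x. indicator A (a, x) \<partial>P (state_at s0 n h, a)))
      \<in> borel_measurable (hist_M n)"
  proof (intro borel_measurable_sum borel_measurable_times_ennreal)
    fix a
    show "(\<lambda>h. ennreal (pmf (\<pi> n s0 h) a)) \<in> borel_measurable (hist_M n)" by measurable
    show "(\<lambda>h. \<integral>\<^sup>+x. indicator A (a, x) \<partial>P (state_at s0 n h, a)) \<in> borel_measurable (hist_M n)"
      by (rule measurable_compose[OF state_at_measurable]) simp
  qed
  ultimately show "(\<lambda>h. emeasure (step_kernel n h) A) \<in> borel_measurable (hist_M n)" by simp
qed (simp_all add: sets_step_kernel prob_space_imp_subprob_space prob_space_step_kernel)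

interpretation IT: Ionescu_Tulcea step_kernel "\<lambda>_. step_M"
proof (rule Ionescu_Tulcea.intro)
  show "step_kernel i \<in> measurable (PiM {0..<i} (\<lambda>_. step_M)) (subprob_algebra step_M)" for i
    using step_kernel_measurable[of i] by (simp add: hist_M_def lessThan_atLeast0)
qed (rule prob_space_step_kernel)

text \<open>Identifies the recursively defined laws with the finite-horizon measures of the
  construction; pushing the update of the history through the bind over actions makes the two
  recursions equal.\<close>

lemma hist_law_eq: "hist_law P \<pi> s0 n = IT.C 0 n (\<lambda>_. undefined)"
proof (induction n)
  case 0
  show ?case by (simp add: hist_M_def lessThan_atLeast0)
next
  case (Suc n)
  have "bind (measure_pmf (\<pi> n s0 h)) (\<lambda>a. distr (P (state_at s0 n h, a)) (hist_M (Suc n)) (\<lambda>x. h(n := (a, x))))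
      = IT.eP n h" if h: "h \<in> space (hist_M n)" for h
  proof -
    have up: "fun_upd h n \<in> measurable step_M (hist_M (Suc n))"
      unfolding hist_M_def
      by (rule measurable_fun_upd[where J = "{..<n}"])
         (use h in \<open>auto simp: hist_M_def lessThan_Suc\<close>)
    have "IT.eP n h = distr (step_kernel n h) (hist_M (Suc n)) (fun_upd h n)"
      by (simp add: IT.eP_def hist_M_def lessThan_atLeast0)
    also have "\<dots> = bind (measure_pmf (\<pi> n s0 h))
        (\<lambda>a. distr (distr (P (state_at s0 n h, a)) step_M (Pair a)) (hist_M (Suc n)) (fun_upd h n))"
      unfolding step_kernel_def by (rule distr_bind[OF _ _ up]) (auto simp: step_distr_in)
    also have "\<dots> = bind (measure_pmf (\<pi> n s0 h))
        (\<lambda>a. distr (P (state_at s0 n h, a)) (hist_M (Suc n)) (\<lambda>x. h(n := (a, x))))"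
      by (intro bind_cong refl) (subst distr_distr[OF up], auto simp: comp_def)
    finally show ?thesis by simp
  qed
  moreover have "space (IT.C 0 n (\<lambda>_. undefined)) = space (hist_M n)"
    using IT.space_C[of "\<lambda>_. undefined" 0 n] by (simp add: hist_M_def lessThan_atLeast0)
  ultimately show ?case
    by (simp add: Suc) (intro bind_cong refl, simp)
qed

text \<open>Existence comes from the projective limit. Uniqueness gives meaning to the definite
  description in \<open>avg_rate\<close>.\<close>

lemma ex1_policy_measure: "\<exists>!\<mu>. policy_measure P \<pi> s0 \<mu>"
proof (rule ex1I)
  show lim: "policy_measure P \<pi> s0 IT.PF.lim"
    unfolding policy_measure_def
  proof (intro conjI allI)
    show "prob_space IT.PF.lim"
    proof
      \<comment> \<open>The whole space is the cylinder over the empty index set, whose mass is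
        computed from the empty marginal.\<close>
      have "prod_emb UNIV (\<lambda>_. step_M) {} (space (PiM {} (\<lambda>_. step_M))) = space IT.PF.lim"
        by (auto simp: prod_emb_def space_PiM)
      moreover have "emeasure IT.PF.lim (prod_emb UNIV (\<lambda>_. step_M) {} (space (PiM {} (\<lambda>_. step_M))))
          = emeasure (IT.CI {}) (space (PiM {} (\<lambda>_. step_M)))"
        by (rule IT.lim) auto
      moreover have "emeasure (IT.CI {}) (space (PiM {} (\<lambda>_. step_M))) = 1"
      proof -
        have "space (IT.CI {}) = space (PiM {} (\<lambda>_. step_M))" by (simp add: IT.CI_def)
        then show ?thesis using prob_space.emeasure_space_1[OF IT.PF.prob_space_P[of "{}"]] by simp
      qed
      ultimately show "emeasure IT.PF.lim (space IT.PF.lim) = 1" by simp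
    qed
    show sets: "sets IT.PF.lim = sets traj_M" by (simp add: traj_M_def)
    fix n
    show "distr IT.PF.lim (hist_M n) (\<lambda>\<omega>. restrict \<omega> {..<n}) = hist_law P \<pi> s0 n"
    proof (rule measure_eqI)
      show "sets (distr IT.PF.lim (hist_M n) (\<lambda>\<omega>. restrict \<omega> {..<n})) = sets (hist_law P \<pi> s0 n)"
        unfolding hist_law_eq using IT.sets_C[of "\<lambda>_. undefined" 0 n] by (simp add: hist_M_def lessThan_atLeast0)
      fix X assume "X \<in> sets (distr IT.PF.lim (hist_M n) (\<lambda>\<omega>. restrict \<omega> {..<n}))"
      then have X: "X \<in> sets (PiM {0..<n} (\<lambda>_. step_M))" by (simp add: hist_M_def lessThan_atLeast0)
      have "emeasure (distr IT.PF.lim (hist_M n) (\<lambda>\<omega>. restrict \<omega> {..<n})) X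
          = emeasure IT.PF.lim (prod_emb UNIV (\<lambda>_. step_M) {0..<n} X)"
        unfolding hist_M_def lessThan_atLeast0
        by (rule emeasure_distr_restrict) (use X in auto)
      also have "\<dots> = emeasure (IT.CI {0..<n}) X" by (rule IT.lim[OF _ X]) simp
      also have "\<dots> = emeasure (IT.C 0 n (\<lambda>_. undefined)) (prod_emb {0..<n} (\<lambda>_. step_M) {0..<n} X)"
        by (rule IT.emeasure_CI[OF order_refl X])
      also have "prod_emb {0..<n} (\<lambda>_. step_M) {0..<n} X = X"
        using sets.sets_into_space[OF X] by (intro prod_emb_id) (simp add: space_PiM)
      finally show "emeasure (distr IT.PF.lim (hist_M n) (\<lambda>\<omega>. restrict \<omega> {..<n})) X = emeasure (hist_law P \<pi> s0 n) X"
        unfolding hist_law_eq .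
    qed
  qed
  fix \<mu> assume mu: "policy_measure P \<pi> s0 \<mu>"
  then show "\<mu> = IT.PF.lim"
    using lim by (rule policy_measure_unique)
qed

text \<open>Disintegration of the last transition, stated for nonnegative integrands so that
  integrability is no concern.\<close>

lemma nn_integral_hist_Suc:
  assumes mu: "policy_measure P \<pi> s0 \<mu>" and G[measurable]: "G \<in> borel_measurable (hist_M (Suc n))"
  shows "(\<integral>\<^sup>+\<omega>. G (restrict \<omega> {..<Suc n}) \<partial>\<mu>)
    = (\<integral>\<^sup>+\<omega>. (\<Sum>a\<in>UNIV. ennreal (pmf (\<pi> n s0 (restrict \<omega> {..<n})) a) *
        (\<integral>\<^sup>+x. G ((restrict \<omega> {..<n})(n := (a, x))) \<partial>P (state_at s0 n \<omega>, a))) \<partial>\<mu>)"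
proof -
  have sets_mu: "sets \<mu> = sets traj_M" using mu by (simp add: policy_measure_def)
  have res: "(\<lambda>\<omega>. restrict \<omega> {..<m}) \<in> measurable \<mu> (hist_M m)" for m
    unfolding measurable_cong_sets[OF sets_mu refl] traj_M_def hist_M_def
    by (rule measurable_restrict_subset) simp
  have law: "distr \<mu> (hist_M m) (\<lambda>\<omega>. restrict \<omega> {..<m}) = IT.C 0 m (\<lambda>_. undefined)" for m
    using mu unfolding policy_measure_def hist_law_eq[symmetric] by blast
  have hM: "hist_M m = PiM {0..<m} (\<lambda>_. step_M)" for m by (simp add: hist_M_def lessThan_atLeast0)
  have eP: "IT.eP n \<in> measurable (hist_M n) (subprob_algebra (hist_M (Suc n)))"
    unfolding hM by (rule IT.measurable_eP)
  have eP': "IT.eP n \<in> measurable (IT.C 0 n (\<lambda>_. undefined)) (subprob_algebra (hist_M (Suc n)))"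
  proof -
    have "sets (IT.C 0 n (\<lambda>_. undefined)) = sets (hist_M n)"
      using IT.sets_C[of "\<lambda>_. undefined" 0 n] by (simp add: hM)
    show ?thesis unfolding measurable_cong_sets[OF \<open>sets (IT.C 0 n (\<lambda>_. undefined)) = sets (hist_M n)\<close> refl]
      by (rule eP)
  qed
  have eP_G: "(\<lambda>h. integral\<^sup>N (IT.eP n h) G) \<in> borel_measurable (hist_M n)"
    by (rule measurable_compose[OF eP nn_integral_measurable_subprob_algebra[OF G]])
  have "(\<integral>\<^sup>+\<omega>. G (restrict \<omega> {..<Suc n}) \<partial>\<mu>) = (\<integral>\<^sup>+h. G h \<partial>IT.C 0 (Suc n) (\<lambda>_. undefined))"
    unfolding law[symmetric] by (rule nn_integral_distr[OF res, symmetric]) (simp add: G)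
  also have "\<dots> = (\<integral>\<^sup>+h. \<integral>\<^sup>+y. G y \<partial>IT.eP n h \<partial>IT.C 0 n (\<lambda>_. undefined))"
    unfolding IT.C.simps add_0 by (rule nn_integral_bind[OF G eP'])
  also have "\<dots> = (\<integral>\<^sup>+\<omega>. \<integral>\<^sup>+y. G y \<partial>IT.eP n (restrict \<omega> {..<n}) \<partial>\<mu>)"
    unfolding law[symmetric]
    by (rule nn_integral_distr[OF res]) (use eP_G in simp)
  also have "\<dots> = (\<integral>\<^sup>+\<omega>. (\<Sum>a\<in>UNIV. ennreal (pmf (\<pi> n s0 (restrict \<omega> {..<n})) a) *
        (\<integral>\<^sup>+x. G ((restrict \<omega> {..<n})(n := (a, x))) \<partial>P (state_at s0 n \<omega>, a))) \<partial>\<mu>)"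
  proof (rule nn_integral_cong)
    fix \<omega> assume "\<omega> \<in> space \<mu>"
    then have h: "restrict \<omega> {..<n} \<in> space (hist_M n)" by (rule measurable_space[OF res])
    have up: "fun_upd (restrict \<omega> {..<n}) n \<in> measurable step_M (hist_M (Suc n))"
      unfolding hist_M_def
      by (rule measurable_fun_upd[where J = "{..<n}"])
         (use h in \<open>auto simp: hist_M_def lessThan_Suc\<close>)
    have "(\<integral>\<^sup>+y. G y \<partial>IT.eP n (restrict \<omega> {..<n}))
        = (\<integral>\<^sup>+y. G ((restrict \<omega> {..<n})(n := y)) \<partial>step_kernel n (restrict \<omega> {..<n}))"
      by (rule IT.nn_integral_eP) (use h G in \<open>simp_all add: hM\<close>)
    also have "\<dots> = (\<Sum>a\<in>UNIV. ennreal (pmf (\<pi> n s0 (restrict \<omega> {..<n})) a) *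
        (\<integral>\<^sup>+x. G ((restrict \<omega> {..<n})(n := (a, x))) \<partial>P (state_at s0 n (restrict \<omega> {..<n}), a)))"
      by (rule nn_integral_step_kernel) (rule measurable_compose[OF up G])
    finally show "(\<integral>\<^sup>+y. G y \<partial>IT.eP n (restrict \<omega> {..<n})) = (\<Sum>a\<in>UNIV. ennreal (pmf (\<pi> n s0 (restrict \<omega> {..<n})) a) *
        (\<integral>\<^sup>+x. G ((restrict \<omega> {..<n})(n := (a, x))) \<partial>P (state_at s0 n \<omega>, a)))"
      by (simp add: state_at_restrict)
  qed
  finally show ?thesis .
qed

end

end

section \<open>Expectations along a run of a policy\<close>

locale policy_run = smdp P for P :: "'s::finite \<times> 'a::finite \<Rightarrow> ('s \<times> real \<times> real) measure" +
  fixes \<pi> :: "nat \<Rightarrow> 's \<Rightarrow> (nat \<Rightarrow> 'a \<times> 's \<times> real \<times> real) \<Rightarrow> 'a pmf" and s0 :: 's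
    and \<mu> :: "(nat \<Rightarrow> 'a \<times> 's \<times> real \<times> real) measure"
  assumes pol: "is_policy \<pi>" and mu: "policy_measure P \<pi> s0 \<mu>"
begin

sublocale mu: prob_space \<mu>
  using mu by (simp add: policy_measure_def)

lemma sets_mu [measurable_cong]: "sets \<mu> = sets traj_M"
  using mu by (simp add: policy_measure_def)

lemma restrict_measurable [measurable]: "(\<lambda>\<omega>. restrict \<omega> {..<n}) \<in> measurable \<mu> (hist_M n)"
  unfolding measurable_cong_sets[OF sets_mu refl] traj_M_def hist_M_def
  by (rule measurable_restrict_subset) simp

lemma component_measurable [measurable]: "(\<lambda>\<omega>. \<omega> n) \<in> measurable \<mu> step_M"
  unfolding measurable_cong_sets[OF sets_mu refl] traj_M_def
  by (rule measurable_component_singleton) simp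

lemma state_measurable [measurable]: "(\<lambda>\<omega>. state_at s0 n \<omega>) \<in> measurable \<mu> (count_space UNIV)"
  using measurable_compose[OF restrict_measurable[of n] state_at_measurable[of s0 n]]
  by (simp add: state_at_restrict)

lemma nn_integral_step:
  assumes phi[measurable]: "\<phi> \<in> borel_measurable (hist_M n)"
    and psi: "\<And>s. \<psi> s \<in> borel_measurable step_M"
  shows "(\<integral>\<^sup>+\<omega>. \<phi> (restrict \<omega> {..<n}) * \<psi> (state_at s0 n \<omega>) (\<omega> n) \<partial>\<mu>)
    = (\<integral>\<^sup>+\<omega>. \<phi> (restrict \<omega> {..<n}) * (\<Sum>a\<in>UNIV. ennreal (pmf (\<pi> n s0 (restrict \<omega> {..<n})) a) *
        (\<integral>\<^sup>+x. \<psi> (state_at s0 n \<omega>) (a, x) \<partial>P (state_at s0 n \<omega>, a))) \<partial>\<mu>)"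
proof -
  define G where "G h = \<phi> (restrict h {..<n}) * \<psi> (state_at s0 n h) (h n)" for h
  have res: "(\<lambda>h. restrict h {..<n}) \<in> measurable (hist_M (Suc n)) (hist_M n)"
    unfolding hist_M_def by (rule measurable_restrict_subset) auto
  have st: "state_at s0 n \<in> measurable (hist_M (Suc n)) (count_space UNIV)"
    using measurable_compose[OF res state_at_measurable[of s0 n]] by (simp add: state_at_restrict)
  have cn: "(\<lambda>h. h n) \<in> measurable (hist_M (Suc n)) step_M"
    unfolding hist_M_def by (rule measurable_component_singleton) simp
  have "(\<lambda>h. \<psi> (state_at s0 n h) (h n)) \<in> borel_measurable (hist_M (Suc n))"
    by (rule measurable_compose_countable[OF measurable_compose[OF cn psi] st])
  then have G: "G \<in> borel_measurable (hist_M (Suc n))"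
    unfolding G_def using measurable_compose[OF res phi] by measurable
  have "(\<integral>\<^sup>+\<omega>. \<phi> (restrict \<omega> {..<n}) * \<psi> (state_at s0 n \<omega>) (\<omega> n) \<partial>\<mu>)
      = (\<integral>\<^sup>+\<omega>. G (restrict \<omega> {..<Suc n}) \<partial>\<mu>)"
    by (simp add: G_def state_at_restrict Int_absorb1 lessThan_Suc_atMost[symmetric] restrict_restrict)
  also have "\<dots> = (\<integral>\<^sup>+\<omega>. (\<Sum>a\<in>UNIV. ennreal (pmf (\<pi> n s0 (restrict \<omega> {..<n})) a) *
        (\<integral>\<^sup>+x. G ((restrict \<omega> {..<n})(n := (a, x))) \<partial>P (state_at s0 n \<omega>, a))) \<partial>\<mu>)"
    by (rule nn_integral_hist_Suc[OF pol mu G])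
  also have "\<dots> = (\<integral>\<^sup>+\<omega>. \<phi> (restrict \<omega> {..<n}) * (\<Sum>a\<in>UNIV. ennreal (pmf (\<pi> n s0 (restrict \<omega> {..<n})) a) *
        (\<integral>\<^sup>+x. \<psi> (state_at s0 n \<omega>) (a, x) \<partial>P (state_at s0 n \<omega>, a))) \<partial>\<mu>)"
  proof (rule nn_integral_cong)
    fix \<omega>
    have "G ((restrict \<omega> {..<n})(n := z)) = \<phi> (restrict \<omega> {..<n}) * \<psi> (state_at s0 n \<omega>) z" for z
    proof -
      have "restrict ((restrict \<omega> {..<n})(n := z)) {..<n} = restrict \<omega> {..<n}" by (auto simp: restrict_def)
      moreover have "state_at s0 n ((restrict \<omega> {..<n})(n := z)) = state_at s0 n \<omega>"
        by (auto simp: state_at_def)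
      ultimately show ?thesis by (simp add: G_def)
    qed
    moreover have "(\<integral>\<^sup>+x. c * \<psi> s (a, x) \<partial>P (s, a)) = c * (\<integral>\<^sup>+x. \<psi> s (a, x) \<partial>P (s, a))" for c s a
      by (rule nn_integral_cmult) (rule measurable_compose[OF Pair_measurable_P psi])
    ultimately show "(\<Sum>a\<in>UNIV. ennreal (pmf (\<pi> n s0 (restrict \<omega> {..<n})) a) *
        (\<integral>\<^sup>+x. G ((restrict \<omega> {..<n})(n := (a, x))) \<partial>P (state_at s0 n \<omega>, a)))
      = \<phi> (restrict \<omega> {..<n}) * (\<Sum>a\<in>UNIV. ennreal (pmf (\<pi> n s0 (restrict \<omega> {..<n})) a) *
        (\<integral>\<^sup>+x. \<psi> (state_at s0 n \<omega>) (a, x) \<partial>P (state_at s0 n \<omega>, a)))"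
      by (simp add: sum_distrib_left mult.left_commute)
  qed
  finally show ?thesis .
qed

text \<open>The one-step formula gives both sides the same value: on the right the integrand is
  already averaged over the sample, and averaging again changes nothing because \<open>P\<close> has
  mass 1.\<close>

lemma nn_integral_step_avg:
  assumes phi: "\<phi> \<in> borel_measurable (hist_M n)" and psi: "\<And>s. \<psi> s \<in> borel_measurable step_M"
  shows "(\<integral>\<^sup>+\<omega>. \<phi> (restrict \<omega> {..<n}) * \<psi> (state_at s0 n \<omega>) (\<omega> n) \<partial>\<mu>)
    = (\<integral>\<^sup>+\<omega>. \<phi> (restrict \<omega> {..<n}) *
        (\<integral>\<^sup>+x. \<psi> (state_at s0 n \<omega>) (fst (\<omega> n), x) \<partial>P (state_at s0 n \<omega>, fst (\<omega> n))) \<partial>\<mu>)"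
proof -
  define \<psi>' where "\<psi>' s z = (\<integral>\<^sup>+x. \<psi> s (fst z, x) \<partial>P (s, fst z))" for s :: 's and z :: "'a \<times> 's \<times> real \<times> real"
  have psi': "\<psi>' s \<in> borel_measurable step_M" for s
    unfolding \<psi>'_def by (rule measurable_compose[OF fst_step_M]) simp
  show ?thesis
    using nn_integral_step[of \<phi> n \<psi>', OF phi psi'] nn_integral_step[of \<phi> n \<psi>, OF phi psi]
    by (simp add: \<psi>'_def prob_space.emeasure_space_1[OF prob_P, simplified])
qed

lemma AE_step:
  assumes m: "\<And>s. Measurable.pred step_M (Q s)" and Q: "\<And>s a. AE x in P (s, a). Q s (a, x)"
  shows "AE \<omega> in \<mu>. \<forall>n. Q (state_at s0 n \<omega>) (\<omega> n)"
  unfolding AE_all_countable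
proof
  fix n
  define \<psi> where "\<psi> s z = (if Q s z then 0 else 1 :: ennreal)" for s z
  have psi: "\<psi> s \<in> borel_measurable step_M" for s
    unfolding \<psi>_def using m[of s] by measurable
  have z: "(\<integral>\<^sup>+x. \<psi> s (a, x) \<partial>P (s, a)) = 0" for s a
  proof -
    have "(\<integral>\<^sup>+x. \<psi> s (a, x) \<partial>P (s, a)) = (\<integral>\<^sup>+x. 0 \<partial>P (s, a))"
      by (rule nn_integral_cong_AE) (use Q[of s a] in \<open>auto simp: \<psi>_def\<close>)
    then show ?thesis by simp
  qed
  have "(\<integral>\<^sup>+\<omega>. 1 * \<psi> (state_at s0 n \<omega>) (\<omega> n) \<partial>\<mu>) = 0"
    using nn_integral_step[of "\<lambda>_. 1" n \<psi>, OF _ psi] by (simp add: z)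
  then have "AE \<omega> in \<mu>. \<psi> (state_at s0 n \<omega>) (\<omega> n) = 0"
    using measurable_compose_countable[OF measurable_compose[OF component_measurable psi] state_measurable]
    by (subst (asm) nn_integral_0_iff_AE) simp_all
  then show "AE \<omega> in \<mu>. Q (state_at s0 n \<omega>) (\<omega> n)"
    by (rule AE_mp) (auto simp: \<psi>_def)
qed

text \<open>Reduces questions about reachability to the finite graph of positive transition
  probabilities.\<close>

lemma AE_edges: "AE \<omega> in \<mu>. \<forall>n. 0 < ptrans P (state_at s0 n \<omega>, fst (\<omega> n)) (state_at s0 (Suc n) \<omega>)"
proof -
  have "AE \<omega> in \<mu>. \<forall>n. 0 < ptrans P (state_at s0 n \<omega>, fst (\<omega> n)) (fst (snd (\<omega> n)))"
  proof (rule AE_step)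
    fix s show "Measurable.pred step_M (\<lambda>z. 0 < ptrans P (s, fst z) (fst (snd z)))"
      by measurable
  next
    fix s a
    have "(\<integral>\<^sup>+x. (if 0 < ptrans P (s, a) (fst x) then 0 else 1 :: ennreal) \<partial>P (s, a)) = 0"
      unfolding nn_integral_P_fst[where g = "\<lambda>s'. if 0 < ptrans P (s, a) s' then 0 else 1"]
      by (auto intro!: sum.neutral simp: not_less ennreal_neg)
    then have "AE x in P (s, a). (if 0 < ptrans P (s, a) (fst x) then 0 else 1 :: ennreal) = 0"
      by (subst (asm) nn_integral_0_iff_AE) simp_all
    then show "AE x in P (s, a). 0 < ptrans P (s, fst (a, x)) (fst (snd (a, x)))"
      by (rule AE_mp) auto
  qed
  then show ?thesis by (simp add: state_at_def)
qed

lemma AE_deterministic_action: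
  assumes g: "\<And>n h. \<pi> n s0 h = return_pmf (g (state_at s0 n h))"
  shows "AE \<omega> in \<mu>. \<forall>n. fst (\<omega> n) = g (state_at s0 n \<omega>)"
  unfolding AE_all_countable
proof
  fix n
  define \<psi> where "\<psi> s z = (if fst z = g s then 0 else 1 :: ennreal)" for s and z :: "'a \<times> 's \<times> real \<times> real"
  have psi: "\<psi> s \<in> borel_measurable step_M" for s unfolding \<psi>_def by measurable
  have z: "(\<Sum>a\<in>UNIV. ennreal (pmf (return_pmf (g s)) a) * (\<integral>\<^sup>+x. \<psi> s (a, x) \<partial>P (s, a))) = 0" for s
    by (rule sum.neutral) (auto simp: \<psi>_def indicator_def)
  have "(\<integral>\<^sup>+\<omega>. 1 * \<psi> (state_at s0 n \<omega>) (\<omega> n) \<partial>\<mu>) = 0"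
    using nn_integral_step[of "\<lambda>_. 1" n \<psi>, OF _ psi] by (simp only: g state_at_restrict[OF order_refl] z) simp
  then have "AE \<omega> in \<mu>. \<psi> (state_at s0 n \<omega>) (\<omega> n) = 0"
    using measurable_compose_countable[OF measurable_compose[OF component_measurable psi] state_measurable]
    by (subst (asm) nn_integral_0_iff_AE) simp_all
  then show "AE \<omega> in \<mu>. fst (\<omega> n) = g (state_at s0 n \<omega>)"
    by (rule AE_mp) (auto simp: \<psi>_def split: if_splits)
qed

end

lemma is_policy_stationary:
  "is_policy (\<lambda>n s0 h. return_pmf (g (state_at s0 n h)))"
proof -
  have "(\<lambda>h. pmf (return_pmf (g (state_at s0 n h))) a) \<in> borel_measurable (hist_M n)" for n s0 a
    by (rule measurable_compose[OF state_at_measurable]) simp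
  then show ?thesis unfolding is_policy_def by blast
qed

section \<open>Verification of the optimality equation\<close>

context policy_run
begin

section \<open>Transitions started before a time horizon\<close>

definition hold :: "nat \<Rightarrow> (nat \<Rightarrow> 'a \<times> 's \<times> real \<times> real) \<Rightarrow> real" where
  "hold k \<omega> = fst (snd (snd (\<omega> k)))"

definition jump :: "nat \<Rightarrow> (nat \<Rightarrow> 'a \<times> 's \<times> real \<times> real) \<Rightarrow> real" where
  "jump n \<omega> = (\<Sum>k<n. hold k \<omega>)"

text \<open>Whether transition n has started by time t is decided by the first n transitions, so
  that transition may be averaged given this event. Randomly stopped sums become series with this
  factor.\<close>

definition alive :: "real \<Rightarrow> nat \<Rightarrow> (nat \<Rightarrow> 'a \<times> 's \<times> real \<times> real) \<Rightarrow> real" where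
  "alive t n \<omega> = (if jump n \<omega> \<le> t then 1 else 0)"

lemma epochs_eq: "epochs t \<omega> = Max {n. jump n \<omega> \<le> t}"
  by (simp add: epochs_def jump_def hold_def)

lemma hold_measurable [measurable]: "hold k \<in> borel_measurable \<mu>"
  unfolding hold_def[abs_def]
  by (intro measurable_compose[OF component_measurable]) (simp add: step_M_def sample_M_def)

lemma jump_measurable [measurable]: "jump n \<in> borel_measurable \<mu>"
  unfolding jump_def[abs_def] by measurable

lemma alive_measurable [measurable]: "alive t n \<in> borel_measurable \<mu>"
  unfolding alive_def[abs_def] by measurable

lemma epochs_measurable [measurable]: "epochs t \<in> measurable \<mu> (count_space UNIV)"
  unfolding epochs_eq[abs_def] by measurable

lemma alive_bounds: "0 \<le> alive t n \<omega>" "alive t n \<omega> \<le> 1"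
  by (simp_all add: alive_def)

lemma step_fun_measurable:
  assumes "\<And>s. g s \<in> borel_measurable step_M"
  shows "(\<lambda>\<omega>. g (state_at s0 n \<omega>) (\<omega> n)) \<in> borel_measurable \<mu>"
  by (rule measurable_compose_countable[OF measurable_compose[OF component_measurable assms] state_measurable])

lemma nn_integral_alive:
  assumes "\<And>s. \<psi> s \<in> borel_measurable step_M"
  shows "(\<integral>\<^sup>+\<omega>. ennreal (alive t n \<omega>) * \<psi> (state_at s0 n \<omega>) (\<omega> n) \<partial>\<mu>)
    = (\<integral>\<^sup>+\<omega>. ennreal (alive t n \<omega>) *
        (\<integral>\<^sup>+x. \<psi> (state_at s0 n \<omega>) (fst (\<omega> n), x) \<partial>P (state_at s0 n \<omega>, fst (\<omega> n))) \<partial>\<mu>)"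
proof -
  define \<phi> where "\<phi> h = ennreal (if (\<Sum>k<n. fst (snd (snd (h k)))) \<le> t then 1 else 0)"
    for h :: "nat \<Rightarrow> 'a \<times> 's \<times> real \<times> real"
  have "(\<lambda>h. \<Sum>k<n. fst (snd (snd (h k)))) \<in> borel_measurable (hist_M n)"
  proof (rule borel_measurable_sum)
    fix k assume "k \<in> {..<n}"
    then have c: "(\<lambda>h. h k) \<in> measurable (hist_M n) step_M"
      unfolding hist_M_def by (intro measurable_component_singleton) simp
    show "(\<lambda>h. fst (snd (snd (h k)))) \<in> borel_measurable (hist_M n)"
      by (rule measurable_compose[OF c]) (simp add: step_M_def sample_M_def)
  qed
  then have phi: "\<phi> \<in> borel_measurable (hist_M n)" unfolding \<phi>_def by measurable
  have "\<phi> (restrict \<omega> {..<n}) = ennreal (alive t n \<omega>)" for \<omega>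
    by (simp add: \<phi>_def alive_def jump_def hold_def)
  with nn_integral_step_avg[of \<phi> n \<psi>, OF phi assms] show ?thesis by simp
qed

text \<open>The sum includes the transition in progress at time t, one more than the reward sum of
  \<open>avg_rate\<close>. With it the number of terms is a stopping time, as Wald's identity
  requires.\<close>

definition stopped :: "real \<Rightarrow> ('s \<Rightarrow> 'a \<times> 's \<times> real \<times> real \<Rightarrow> real) \<Rightarrow> (nat \<Rightarrow> 'a \<times> 's \<times> real \<times> real) \<Rightarrow> real" where
  "stopped t g \<omega> = (\<Sum>n\<le>epochs t \<omega>. g (state_at s0 n \<omega>) (\<omega> n))"

definition avg :: "('s \<Rightarrow> 'a \<times> 's \<times> real \<times> real \<Rightarrow> real) \<Rightarrow> 's \<Rightarrow> 'a \<times> 's \<times> real \<times> real \<Rightarrow> real" where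
  "avg g s z = (\<integral>x. g s (fst z, x) \<partial>P (s, fst z))"

definition mean_abs :: "('s \<Rightarrow> 'a \<times> 's \<times> real \<times> real \<Rightarrow> real) \<Rightarrow> real" where
  "mean_abs g = supnorm (\<lambda>i. \<integral>x. \<bar>g (fst i) (snd i, x)\<bar> \<partial>P i)"

definition step_integrable :: "('s \<Rightarrow> 'a \<times> 's \<times> real \<times> real \<Rightarrow> real) \<Rightarrow> bool" where
  "step_integrable g \<longleftrightarrow> (\<forall>s. g s \<in> borel_measurable step_M) \<and>
    (\<forall>s a. integrable (P (s, a)) (\<lambda>x. g s (a, x)))"

lemma mean_abs_ge: "(\<integral>x. \<bar>g s (a, x)\<bar> \<partial>P (s, a)) \<le> mean_abs g"
  using supnorm_ge[of "\<lambda>i. \<integral>x. \<bar>g (fst i) (snd i, x)\<bar> \<partial>P i" "(s, a)"]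
  unfolding mean_abs_def by simp

lemma avg_measurable: "avg g s \<in> borel_measurable step_M"
  unfolding avg_def[abs_def] by (rule measurable_compose[OF fst_step_M]) simp

lemma avg_integrable: "step_integrable (avg g)"
  unfolding step_integrable_def
proof (intro conjI allI avg_measurable)
  fix s a
  interpret prob_space "P (s, a)" by (rule prob_P)
  show "integrable (P (s, a)) (\<lambda>x. avg g s (a, x))" by (simp add: avg_def)
qed

lemma alive_integral_nonneg:
  assumes g: "step_integrable g" and nn: "\<And>s z. 0 \<le> g s z"
  shows "integrable \<mu> (\<lambda>\<omega>. alive t n \<omega> * g (state_at s0 n \<omega>) (\<omega> n))"
    "(\<integral>\<omega>. alive t n \<omega> * g (state_at s0 n \<omega>) (\<omega> n) \<partial>\<mu>)
      = (\<integral>\<omega>. alive t n \<omega> * avg g (state_at s0 n \<omega>) (\<omega> n) \<partial>\<mu>)"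
    "(\<integral>\<omega>. alive t n \<omega> * g (state_at s0 n \<omega>) (\<omega> n) \<partial>\<mu>) \<le> mean_abs g * (\<integral>\<omega>. alive t n \<omega> \<partial>\<mu>)"
proof -
  have gm: "g s \<in> borel_measurable step_M" and gi: "integrable (P (s, a)) (\<lambda>x. g s (a, x))" for s a
    using g unfolding step_integrable_def by auto
  note [measurable] = step_fun_measurable[OF gm] step_fun_measurable[OF avg_measurable]
  have avg0: "0 \<le> avg g s z" for s z unfolding avg_def using nn by simp
  have avg_le: "avg g s z \<le> mean_abs g" for s z
    using mean_abs_ge[where g = g and s = s and a = "fst z"] nn by (simp add: avg_def)
  have "(\<integral>\<^sup>+\<omega>. ennreal (alive t n \<omega> * g (state_at s0 n \<omega>) (\<omega> n)) \<partial>\<mu>)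
      = (\<integral>\<^sup>+\<omega>. ennreal (alive t n \<omega>) * ennreal (g (state_at s0 n \<omega>) (\<omega> n)) \<partial>\<mu>)"
    using alive_bounds nn by (simp add: ennreal_mult)
  also have "\<dots> = (\<integral>\<^sup>+\<omega>. ennreal (alive t n \<omega>) *
        (\<integral>\<^sup>+x. ennreal (g (state_at s0 n \<omega>) (fst (\<omega> n), x)) \<partial>P (state_at s0 n \<omega>, fst (\<omega> n))) \<partial>\<mu>)"
    by (rule nn_integral_alive[where \<psi> = "\<lambda>s z. ennreal (g s z)"]) (use gm in measurable)
  also have "\<dots> = (\<integral>\<^sup>+\<omega>. ennreal (alive t n \<omega> * avg g (state_at s0 n \<omega>) (\<omega> n)) \<partial>\<mu>)"
  proof (rule nn_integral_cong)
    fix \<omega>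
    have "(\<integral>\<^sup>+x. ennreal (g s (a, x)) \<partial>P (s, a)) = ennreal (\<integral>x. g s (a, x) \<partial>P (s, a))" for s a
      by (rule nn_integral_eq_integral[OF gi]) (simp add: nn)
    then show "ennreal (alive t n \<omega>) * (\<integral>\<^sup>+x. ennreal (g (state_at s0 n \<omega>) (fst (\<omega> n), x)) \<partial>P (state_at s0 n \<omega>, fst (\<omega> n)))
        = ennreal (alive t n \<omega> * avg g (state_at s0 n \<omega>) (\<omega> n))"
      using alive_bounds avg0 by (simp add: ennreal_mult avg_def)
  qed
  finally have eq: "(\<integral>\<^sup>+\<omega>. ennreal (alive t n \<omega> * g (state_at s0 n \<omega>) (\<omega> n)) \<partial>\<mu>)
      = (\<integral>\<^sup>+\<omega>. ennreal (alive t n \<omega> * avg g (state_at s0 n \<omega>) (\<omega> n)) \<partial>\<mu>)" .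
  have iavg: "integrable \<mu> (\<lambda>\<omega>. alive t n \<omega> * avg g (state_at s0 n \<omega>) (\<omega> n))"
  proof (rule mu.integrable_const_bound[where B = "mean_abs g"])
    show "AE \<omega> in \<mu>. norm (alive t n \<omega> * avg g (state_at s0 n \<omega>) (\<omega> n)) \<le> mean_abs g"
      using avg0 avg_le by (intro AE_I2) (simp add: alive_def order_trans[OF avg0 avg_le])
  qed measurable
  have ialive: "integrable \<mu> (alive t n)"
    by (rule mu.integrable_const_bound[where B = 1]) (auto simp: alive_def)
  show 1: "integrable \<mu> (\<lambda>\<omega>. alive t n \<omega> * g (state_at s0 n \<omega>) (\<omega> n))"
  proof (rule integrableI_nonneg)
    have "(\<integral>\<^sup>+\<omega>. ennreal (alive t n \<omega> * avg g (state_at s0 n \<omega>) (\<omega> n)) \<partial>\<mu>) < \<infinity>"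
      using iavg avg0 alive_bounds by (subst nn_integral_eq_integral[OF iavg]) auto
    then show "(\<integral>\<^sup>+\<omega>. ennreal (alive t n \<omega> * g (state_at s0 n \<omega>) (\<omega> n)) \<partial>\<mu>) < \<infinity>" by (simp add: eq)
  qed (use nn alive_bounds in auto)
  show 2: "(\<integral>\<omega>. alive t n \<omega> * g (state_at s0 n \<omega>) (\<omega> n) \<partial>\<mu>)
      = (\<integral>\<omega>. alive t n \<omega> * avg g (state_at s0 n \<omega>) (\<omega> n) \<partial>\<mu>)"
    using eq nn avg0 alive_bounds
    by (subst (1 2) integral_eq_nn_integral) auto
  have "(\<integral>\<omega>. alive t n \<omega> * avg g (state_at s0 n \<omega>) (\<omega> n) \<partial>\<mu>) \<le> (\<integral>\<omega>. mean_abs g * alive t n \<omega> \<partial>\<mu>)"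
    by (rule integral_mono[OF iavg integrable_mult_right[OF ialive]]) (simp add: alive_def avg_le)
  then show "(\<integral>\<omega>. alive t n \<omega> * g (state_at s0 n \<omega>) (\<omega> n) \<partial>\<mu>) \<le> mean_abs g * (\<integral>\<omega>. alive t n \<omega> \<partial>\<mu>)"
    unfolding 2 by simp
qed

lemma alive_integrable: "integrable \<mu> (alive t n)"
  by (rule mu.integrable_const_bound[where B = 1]) (auto simp: alive_def)

text \<open>Reduction to positive and negative parts, each of which has a finite mean under every
  pair.\<close>

lemma alive_integral:
  assumes g: "step_integrable g"
  shows "integrable \<mu> (\<lambda>\<omega>. alive t n \<omega> * g (state_at s0 n \<omega>) (\<omega> n))"
    "(\<integral>\<omega>. alive t n \<omega> * g (state_at s0 n \<omega>) (\<omega> n) \<partial>\<mu>)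
      = (\<integral>\<omega>. alive t n \<omega> * avg g (state_at s0 n \<omega>) (\<omega> n) \<partial>\<mu>)"
    "(\<integral>\<omega>. \<bar>alive t n \<omega> * g (state_at s0 n \<omega>) (\<omega> n)\<bar> \<partial>\<mu>) \<le> mean_abs g * (\<integral>\<omega>. alive t n \<omega> \<partial>\<mu>)"
proof -
  have gm[measurable]: "g s \<in> borel_measurable step_M" and gi: "integrable (P (s, a)) (\<lambda>x. g s (a, x))" for s a
    using g unfolding step_integrable_def by auto
  define u where "u s z = max 0 (g s z)" for s z
  define l where "l s z = max 0 (- g s z)" for s z
  have ul: "g s z = u s z - l s z" for s z by (simp add: u_def l_def max_def)
  have su: "step_integrable u" and sl: "step_integrable l"
    unfolding step_integrable_def u_def l_def using gi by auto
  have nn: "0 \<le> u s z" "0 \<le> l s z" for s z by (simp_all add: u_def l_def)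
  note U = alive_integral_nonneg[OF su nn(1), of t n] and L = alive_integral_nonneg[OF sl nn(2), of t n]
  have split: "alive t n \<omega> * g s z = alive t n \<omega> * u s z - alive t n \<omega> * l s z" for \<omega> s z
    by (simp add: ul right_diff_distrib)
  show "integrable \<mu> (\<lambda>\<omega>. alive t n \<omega> * g (state_at s0 n \<omega>) (\<omega> n))"
    unfolding split using U(1) L(1) by simp
  have avg_ul: "avg g s z = avg u s z - avg l s z" for s z
    using su sl unfolding avg_def ul step_integrable_def by (intro Bochner_Integration.integral_diff) auto
  have Ia: "integrable \<mu> (\<lambda>\<omega>. alive t n \<omega> * avg u (state_at s0 n \<omega>) (\<omega> n))"
    "integrable \<mu> (\<lambda>\<omega>. alive t n \<omega> * avg l (state_at s0 n \<omega>) (\<omega> n))"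
    by (rule alive_integral_nonneg(1)[OF avg_integrable], simp add: avg_def nn)+
  show "(\<integral>\<omega>. alive t n \<omega> * g (state_at s0 n \<omega>) (\<omega> n) \<partial>\<mu>)
      = (\<integral>\<omega>. alive t n \<omega> * avg g (state_at s0 n \<omega>) (\<omega> n) \<partial>\<mu>)"
    unfolding split avg_ul right_diff_distrib using U L Ia by simp
  have "step_integrable (\<lambda>s z. \<bar>g s z\<bar>)"
    using g unfolding step_integrable_def by auto
  from alive_integral_nonneg(3)[OF this, of t n]
  show "(\<integral>\<omega>. \<bar>alive t n \<omega> * g (state_at s0 n \<omega>) (\<omega> n)\<bar> \<partial>\<mu>) \<le> mean_abs g * (\<integral>\<omega>. alive t n \<omega> \<partial>\<mu>)"
    using alive_bounds by (simp add: abs_mult mean_abs_def)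
qed

lemma AE_hold_nonneg: "AE \<omega> in \<mu>. \<forall>n. 0 \<le> hold n \<omega>"
  unfolding hold_def
proof (rule AE_step[of "\<lambda>s z. 0 \<le> fst (snd (snd z))"])
  show "Measurable.pred step_M (\<lambda>z. 0 \<le> fst (snd (snd z)))"
    unfolding step_M_def sample_M_def by measurable
  show "AE x in P (s, a). 0 \<le> fst (snd (snd (a, x)))" for s a
    using tau_nonneg_P[of "(s, a)"] by simp
qed

end

text \<open>Holding times are truncated at e so that the one crossing the horizon overshoots by at
  most e; c is a lower bound of the truncated means, uniform over all pairs.\<close>

definition (in smdp) hold_bound :: "real \<Rightarrow> real \<Rightarrow> bool" where
  "hold_bound e c \<longleftrightarrow> 0 < e \<and> 0 < c \<and> (\<forall>i. c \<le> (\<integral>x. min e (max 0 (fst (snd x))) \<partial>P i))"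

text \<open>The truncated mean is at least e times the probability of exceeding e, which assumption
  (M) makes positive, and there are finitely many pairs.\<close>

lemma (in smdp) hold_bound_exists:
  assumes "assumption_M P"
  shows "\<exists>e c. hold_bound e c"
proof -
  obtain e where e: "0 < e" "\<And>i. measure (P i) {x \<in> space (P i). fst (snd x) \<le> e} < 1"
    using assms unfolding assumption_M_def by blast
  define m where "m i = (\<integral>x. min e (max 0 (fst (snd x))) \<partial>P i)" for i
  have "0 < m i" for i
  proof -
    interpret prob_space "P i" by (rule prob_P)
    have [measurable]: "(\<lambda>x. fst (snd x)) \<in> borel_measurable (P i)"
      unfolding measurable_cong_sets[OF sets_P refl] sample_M_def by measurable
    have "e * measure (P i) {x \<in> space (P i). e < fst (snd x)}
        = (\<integral>x. e * indicator {x \<in> space (P i). e < fst (snd x)} x \<partial>P i)" by simp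
    also have "\<dots> \<le> m i"
      unfolding m_def
    proof (rule integral_mono)
      show "integrable (P i) (\<lambda>x. min e (max 0 (fst (snd x))))"
        by (rule integrable_const_bound[where B = e]) (use e in auto)
      show "e * indicator {x \<in> space (P i). e < fst (snd x)} x \<le> min e (max 0 (fst (snd x)))" for x
        using e by (auto simp: indicator_def)
      show "integrable (P i) (\<lambda>x. e * indicator {x \<in> space (P i). e < fst (snd x)} x)"
        by (rule integrable_const_bound[where B = e]) (use e in \<open>auto simp: indicator_def\<close>)
    qed
    finally have *: "e * measure (P i) {x \<in> space (P i). e < fst (snd x)} \<le> m i" .
    have "measure (P i) {x \<in> space (P i). e < fst (snd x)} = 1 - measure (P i) {x \<in> space (P i). fst (snd x) \<le> e}"
    proof -
      have "{x \<in> space (P i). fst (snd x) \<le> e} \<in> sets (P i)" by measurable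
      from prob_compl[OF this]
      have "measure (P i) (space (P i) - {x \<in> space (P i). fst (snd x) \<le> e}) = 1 - measure (P i) {x \<in> space (P i). fst (snd x) \<le> e}" .
      moreover have "space (P i) - {x \<in> space (P i). fst (snd x) \<le> e} = {x \<in> space (P i). e < fst (snd x)}"
        by auto
      ultimately show ?thesis by simp
    qed
    then have "0 < measure (P i) {x \<in> space (P i). e < fst (snd x)}" using e(2)[of i] by simp
    with * show ?thesis using e(1) by (meson less_le_trans mult_pos_pos)
  qed
  then have "hold_bound e (Min (range m))"
    using e(1) unfolding hold_bound_def by (auto simp: m_def)
  then show ?thesis by blast
qed

context policy_run
begin

context
  fixes e c t :: real
  assumes hb: "hold_bound e c" and t: "0 \<le> t"
begin

lemma ec: "0 < e" "0 < c"
  using hb unfolding hold_bound_def by auto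

text \<open>Truncated holding times add up to at most the elapsed time as long as it does not pass
  t, and the one that passes t adds at most e. Later terms carry the factor 0.\<close>

lemma sum_alive_hold_le:
  assumes "\<And>n. 0 \<le> hold n \<omega>"
  shows "(\<Sum>n<m. alive t n \<omega> * min e (max 0 (hold n \<omega>))) \<le> (if jump m \<omega> \<le> t then jump m \<omega> else t + e)"
proof (induction m)
  case (Suc m)
  have "jump (Suc m) \<omega> = jump m \<omega> + hold m \<omega>" by (simp add: jump_def)
  then show ?case
    using Suc assms[of m] ec t by (auto simp: alive_def min_def max_def split: if_splits)
qed (simp add: jump_def t)

text \<open>Each transition that starts by t contributes at least c to the expectation of a sum that
  never exceeds \<open>t + e\<close>.\<close>

lemma sum_alive_le: "(\<Sum>n<m. \<integral>\<omega>. alive t n \<omega> \<partial>\<mu>) \<le> (t + e) / c"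
proof -
  define g where "g s z = min e (max 0 (fst (snd (snd z))))" for s :: 's and z :: "'a \<times> 's \<times> real \<times> real"
  have g: "step_integrable g"
    unfolding step_integrable_def
  proof (intro conjI allI)
    show gm: "g s \<in> borel_measurable step_M" for s
      unfolding g_def step_M_def sample_M_def by measurable
    fix s a
    interpret prob_space "P (s, a)" by (rule prob_P)
    show "integrable (P (s, a)) (\<lambda>x. g s (a, x))"
    proof (rule integrable_const_bound[where B = e])
      show "AE x in P (s, a). norm (g s (a, x)) \<le> e" using ec by (auto simp: g_def)
      show "(\<lambda>x. g s (a, x)) \<in> borel_measurable (P (s, a))"
        by (rule measurable_compose[OF Pair_measurable_P gm])
    qed
  qed
  have "c * (\<integral>\<omega>. alive t n \<omega> \<partial>\<mu>) \<le> (\<integral>\<omega>. alive t n \<omega> * g (state_at s0 n \<omega>) (\<omega> n) \<partial>\<mu>)" for n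
  proof -
    have "(\<integral>\<omega>. c * alive t n \<omega> \<partial>\<mu>) \<le> (\<integral>\<omega>. alive t n \<omega> * avg g (state_at s0 n \<omega>) (\<omega> n) \<partial>\<mu>)"
    proof (rule integral_mono)
      show "integrable \<mu> (\<lambda>\<omega>. alive t n \<omega> * avg g (state_at s0 n \<omega>) (\<omega> n))"
        by (rule alive_integral(1)[OF avg_integrable])
      fix \<omega>
      have "c \<le> avg g (state_at s0 n \<omega>) (\<omega> n)"
        using hb unfolding hold_bound_def avg_def g_def by simp
      then show "c * alive t n \<omega> \<le> alive t n \<omega> * avg g (state_at s0 n \<omega>) (\<omega> n)"
        by (simp add: alive_def)
    qed (use alive_integrable in simp)
    then show ?thesis using alive_integral(2)[OF g, of t n] by simp
  qed
  then have "c * (\<Sum>n<m. \<integral>\<omega>. alive t n \<omega> \<partial>\<mu>) \<le> (\<Sum>n<m. \<integral>\<omega>. alive t n \<omega> * g (state_at s0 n \<omega>) (\<omega> n) \<partial>\<mu>)"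
    unfolding sum_distrib_left by (intro sum_mono)
  also have "\<dots> = (\<integral>\<omega>. (\<Sum>n<m. alive t n \<omega> * g (state_at s0 n \<omega>) (\<omega> n)) \<partial>\<mu>)"
    by (rule Bochner_Integration.integral_sum[symmetric]) (rule alive_integral(1)[OF g])
  also have "\<dots> \<le> (\<integral>\<omega>. t + e \<partial>\<mu>)"
  proof (rule integral_mono_AE)
    show "AE \<omega> in \<mu>. (\<Sum>n<m. alive t n \<omega> * g (state_at s0 n \<omega>) (\<omega> n)) \<le> t + e"
      using AE_hold_nonneg
    proof (rule AE_mp, intro AE_I2 impI)
      fix \<omega> assume "\<forall>n. 0 \<le> hold n \<omega>"
      then have "(\<Sum>n<m. alive t n \<omega> * min e (max 0 (hold n \<omega>))) \<le> t + e"
        using sum_alive_hold_le[of \<omega> m] ec by (simp split: if_splits)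
      then show "(\<Sum>n<m. alive t n \<omega> * g (state_at s0 n \<omega>) (\<omega> n)) \<le> t + e"
        by (simp add: g_def hold_def)
    qed
  qed (use alive_integral(1)[OF g] in auto)
  also have "\<dots> = t + e" by (simp add: mu.prob_space)
  finally show ?thesis using ec by (simp add: pos_le_divide_eq mult.commute)
qed

lemma summable_alive: "summable (\<lambda>n. \<integral>\<omega>. alive t n \<omega> \<partial>\<mu>)"
  by (rule summableI_nonneg_bounded[OF _ sum_alive_le]) (simp add: alive_bounds)

text \<open>No explosion: on the exceptional event every \<open>alive t n\<close> equals 1, while
  their expectations are summable and so tend to 0.\<close>

lemma AE_jump_unbounded: "AE \<omega> in \<mu>. \<exists>n. t < jump n \<omega>"
proof -
  define A where "A = {\<omega> \<in> space \<mu>. \<forall>n. jump n \<omega> \<le> t}"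
  have A[measurable]: "A \<in> sets \<mu>" unfolding A_def by measurable
  have "measure \<mu> A \<le> (\<integral>\<omega>. alive t n \<omega> \<partial>\<mu>)" for n
  proof -
    have "measure \<mu> A = (\<integral>\<omega>. indicator A \<omega> \<partial>\<mu>)" by simp
    also have "\<dots> \<le> (\<integral>\<omega>. alive t n \<omega> \<partial>\<mu>)"
    proof (rule integral_mono[OF _ alive_integrable])
      show "integrable \<mu> (indicat_real A)"
        by (rule mu.integrable_const_bound[where B = 1]) auto
    qed (auto simp: A_def alive_def indicator_def)
    finally show ?thesis .
  qed
  then have "measure \<mu> A \<le> 0"
    using LIMSEQ_le_const[OF summable_LIMSEQ_zero[OF summable_alive]] by blast
  then have "A \<in> null_sets \<mu>"
    using A by (intro null_setsI) (simp_all add: mu.emeasure_eq_measure measure_le_0_iff)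
  then show ?thesis
    by (rule AE_mp[OF AE_not_in]) (auto simp: A_def not_le)
qed

text \<open>Without explosion the set under Max in \<open>epochs\<close> is a finite initial segment
  containing 0, so Max returns its true last element.\<close>

lemma AE_epochs: "AE \<omega> in \<mu>. (\<forall>n. 0 \<le> hold n \<omega>) \<and> (\<forall>n. jump n \<omega> \<le> t \<longleftrightarrow> n \<le> epochs t \<omega>)"
  using AE_hold_nonneg AE_jump_unbounded
proof eventually_elim
  fix \<omega> assume h: "\<forall>n. 0 \<le> hold n \<omega>" and "\<exists>n. t < jump n \<omega>"
  then obtain m where m: "t < jump m \<omega>" by blast
  have mono: "jump i \<omega> \<le> jump j \<omega>" if "i \<le> j" for i j
    by (rule lift_Suc_mono_le[of "\<lambda>n. jump n \<omega>", OF _ that]) (simp add: jump_def h)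
  have fin: "finite {n. jump n \<omega> \<le> t}"
  proof (rule finite_subset)
    show "{n. jump n \<omega> \<le> t} \<subseteq> {..<m}"
    proof
      fix n assume "n \<in> {n. jump n \<omega> \<le> t}"
      then show "n \<in> {..<m}" using m mono[of m n] by (cases "m \<le> n") auto
    qed
  qed simp
  have ne: "{n. jump n \<omega> \<le> t} \<noteq> {}" using t by (auto simp: jump_def intro!: exI[of _ 0])
  have "jump n \<omega> \<le> t \<longleftrightarrow> n \<le> epochs t \<omega>" for n
  proof
    assume "jump n \<omega> \<le> t"
    then show "n \<le> epochs t \<omega>" unfolding epochs_eq using fin by (intro Max_ge) auto
  next
    assume n: "n \<le> epochs t \<omega>"
    have "epochs t \<omega> \<in> {n. jump n \<omega> \<le> t}" unfolding epochs_eq by (rule Max_in[OF fin ne])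
    then show "jump n \<omega> \<le> t" using mono[OF n] by simp
  qed
  then show "(\<forall>n. 0 \<le> hold n \<omega>) \<and> (\<forall>n. jump n \<omega> \<le> t \<longleftrightarrow> n \<le> epochs t \<omega>)" using h by blast
qed

lemma stopped_measurable:
  assumes "step_integrable g"
  shows "stopped t g \<in> borel_measurable \<mu>"
proof -
  have gm: "g s \<in> borel_measurable step_M" for s using assms unfolding step_integrable_def by blast
  show ?thesis
    unfolding stopped_def[abs_def]
    by (rule measurable_compose_countable[OF borel_measurable_sum[OF step_fun_measurable[OF gm]] epochs_measurable])
qed

text \<open>Wald's argument: the stopped sum is a series whose terms vanish from some index on, and
  the expected absolute terms are dominated by \<open>mean_abs g\<close> times the summable
  expectations of \<open>alive\<close>.\<close>

lemma stopped_integral_sums: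
  assumes g: "step_integrable g"
  shows "integrable \<mu> (stopped t g)"
    "(\<integral>\<omega>. stopped t g \<omega> \<partial>\<mu>) = (\<Sum>n. \<integral>\<omega>. alive t n \<omega> * g (state_at s0 n \<omega>) (\<omega> n) \<partial>\<mu>)"
    "(\<integral>\<omega>. stopped t g \<omega> \<partial>\<mu>) \<le> mean_abs g * ((t + e) / c)"
proof -
  define f where "f n \<omega> = alive t n \<omega> * g (state_at s0 n \<omega>) (\<omega> n)" for n \<omega>
  have fi: "integrable \<mu> (f n)" for n unfolding f_def[abs_def] by (rule alive_integral(1)[OF g])
  have fle: "(\<integral>\<omega>. norm (f n \<omega>) \<partial>\<mu>) \<le> mean_abs g * (\<integral>\<omega>. alive t n \<omega> \<partial>\<mu>)" for n
    using alive_integral(3)[OF g, of t n] by (simp add: f_def)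
  have sn: "summable (\<lambda>n. \<integral>\<omega>. norm (f n \<omega>) \<partial>\<mu>)"
    by (rule summable_comparison_test'[OF summable_mult[OF summable_alive, of "mean_abs g"], of 0])
       (use fle in simp)
  have sums: "AE \<omega> in \<mu>. finite {n. f n \<omega> \<noteq> 0} \<and> (\<lambda>n. f n \<omega>) sums stopped t g \<omega>"
    using AE_epochs
  proof eventually_elim
    fix \<omega> assume "(\<forall>n. 0 \<le> hold n \<omega>) \<and> (\<forall>n. jump n \<omega> \<le> t \<longleftrightarrow> n \<le> epochs t \<omega>)"
    then have f: "f n \<omega> = (if n \<le> epochs t \<omega> then g (state_at s0 n \<omega>) (\<omega> n) else 0)" for n
      by (simp add: f_def alive_def)
    have "(\<lambda>n. f n \<omega>) sums (\<Sum>n\<in>{..epochs t \<omega>}. f n \<omega>)"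
      by (rule sums_finite) (auto simp: f)
    moreover have "(\<Sum>n\<in>{..epochs t \<omega>}. f n \<omega>) = stopped t g \<omega>"
      unfolding stopped_def by (intro sum.cong) (auto simp: f)
    moreover have "finite {n. f n \<omega> \<noteq> 0}"
      by (rule finite_subset[of _ "{..epochs t \<omega>}"]) (auto simp: f)
    ultimately show "finite {n. f n \<omega> \<noteq> 0} \<and> (\<lambda>n. f n \<omega>) sums stopped t g \<omega>" by simp
  qed
  have sa: "AE \<omega> in \<mu>. summable (\<lambda>n. norm (f n \<omega>))"
    using sums by eventually_elim (auto intro!: summable_finite[of "{n. f n _ \<noteq> 0}"])
  have eq: "AE \<omega> in \<mu>. (\<Sum>n. f n \<omega>) = stopped t g \<omega>"
    using sums by eventually_elim (auto dest: sums_unique)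
  note I = integrable_suminf[OF fi sa sn] integral_suminf[OF fi sa sn]
  have m: "stopped t g \<in> borel_measurable \<mu>" by (rule stopped_measurable[OF g])
  show i: "integrable \<mu> (stopped t g)"
    by (rule integrable_cong_AE_imp[OF I(1) m]) (use eq in \<open>auto elim: eventually_mono\<close>)
  have "(\<integral>\<omega>. stopped t g \<omega> \<partial>\<mu>) = (\<integral>\<omega>. (\<Sum>n. f n \<omega>) \<partial>\<mu>)"
    by (rule integral_cong_AE[OF m borel_measurable_integrable[OF I(1)]]) (use eq in \<open>auto elim: eventually_mono\<close>)
  then show s: "(\<integral>\<omega>. stopped t g \<omega> \<partial>\<mu>) = (\<Sum>n. \<integral>\<omega>. alive t n \<omega> * g (state_at s0 n \<omega>) (\<omega> n) \<partial>\<mu>)"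
    using I(2) by (simp add: f_def)
  have "(\<Sum>n. \<integral>\<omega>. f n \<omega> \<partial>\<mu>) \<le> (\<Sum>n. mean_abs g * (\<integral>\<omega>. alive t n \<omega> \<partial>\<mu>))"
  proof (rule suminf_le)
    show "(\<integral>\<omega>. f n \<omega> \<partial>\<mu>) \<le> mean_abs g * (\<integral>\<omega>. alive t n \<omega> \<partial>\<mu>)" for n
    proof -
      have "(\<integral>\<omega>. f n \<omega> \<partial>\<mu>) \<le> (\<integral>\<omega>. norm (f n \<omega>) \<partial>\<mu>)"
        by (rule integral_mono[OF fi integrable_norm[OF fi]]) simp
      then show ?thesis using fle[of n] by linarith
    qed
    show "summable (\<lambda>n. \<integral>\<omega>. f n \<omega> \<partial>\<mu>)"
      by (rule summable_comparison_test'[OF sn, of 0]) (rule integral_norm_bound)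
    show "summable (\<lambda>n. mean_abs g * (\<integral>\<omega>. alive t n \<omega> \<partial>\<mu>))"
      by (rule summable_mult[OF summable_alive])
  qed
  also have "\<dots> = mean_abs g * (\<Sum>n. \<integral>\<omega>. alive t n \<omega> \<partial>\<mu>)" by (rule suminf_mult[OF summable_alive])
  also have "\<dots> \<le> mean_abs g * ((t + e) / c)"
    using suminf_le_const[OF summable_alive sum_alive_le]
    by (intro mult_left_mono) (auto simp: mean_abs_def supnorm_nonneg)
  finally show "(\<integral>\<omega>. stopped t g \<omega> \<partial>\<mu>) \<le> mean_abs g * ((t + e) / c)"
    using s by (simp add: f_def)
qed

lemma stopped_integral_avg:
  assumes g: "step_integrable g"
  shows "(\<integral>\<omega>. stopped t g \<omega> \<partial>\<mu>) = (\<integral>\<omega>. stopped t (avg g) \<omega> \<partial>\<mu>)"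
  unfolding stopped_integral_sums(2)[OF g] stopped_integral_sums(2)[OF avg_integrable]
  using alive_integral(2)[OF g] by simp

end

end

section \<open>Moments of a single transition\<close>

context smdp
begin

lemma integral_P_fst:
  fixes v :: "'s \<Rightarrow> real"
  shows "integrable (P i) (\<lambda>x. v (fst x))" "(\<integral>x. v (fst x) \<partial>P i) = (\<Sum>s\<in>UNIV. ptrans P i s * v s)"
proof -
  interpret prob_space "P i" by (rule prob_P)
  have [measurable]: "fst \<in> measurable (P i) (count_space UNIV)"
    unfolding measurable_cong_sets[OF sets_P refl] by measurable
  have m[measurable]: "{x \<in> space (P i). fst x = s} \<in> sets (P i)" for s by measurable
  have ind: "integrable (P i) (\<lambda>x. v s * indicator {x \<in> space (P i). fst x = s} x)" for s
    by (rule integrable_const_bound[where B = "\<bar>v s\<bar>"]) (auto simp: indicator_def)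
  have eq: "v (fst x) = (\<Sum>s\<in>UNIV. v s * indicator {x \<in> space (P i). fst x = s} x)" for x
    by (simp add: indicator_def)
  show "integrable (P i) (\<lambda>x. v (fst x))"
    unfolding eq using ind by (rule Bochner_Integration.integrable_sum)
  show "(\<integral>x. v (fst x) \<partial>P i) = (\<Sum>s\<in>UNIV. ptrans P i s * v s)"
    unfolding eq using ind
    by (subst Bochner_Integration.integral_sum) (simp_all add: ptrans_def mult.commute)
qed

lemma second_moments_integrable:
  assumes "assumption_M P"
  shows "integrable (P i) (\<lambda>x. fst (snd x))" "integrable (P i) (\<lambda>x. snd (snd x))"
    "integrable (P i) (\<lambda>x. (fst (snd x))\<^sup>2)" "integrable (P i) (\<lambda>x. (snd (snd x))\<^sup>2)"
proof -
  interpret prob_space "P i" by (rule prob_P)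
  have m: "(\<lambda>x. fst (snd x)) \<in> borel_measurable (P i)" "(\<lambda>x. snd (snd x)) \<in> borel_measurable (P i)"
    unfolding measurable_cong_sets[OF sets_P refl] sample_M_def by measurable
  show i: "integrable (P i) (\<lambda>x. (fst (snd x))\<^sup>2)" "integrable (P i) (\<lambda>x. (snd (snd x))\<^sup>2)"
    using assms unfolding assumption_M_def by blast+
  show "integrable (P i) (\<lambda>x. fst (snd x))" "integrable (P i) (\<lambda>x. snd (snd x))"
    by (rule square_integrable_imp_integrable[OF m(1) i(1)], rule square_integrable_imp_integrable[OF m(2) i(2)])
qed

lemma tbar_pos:
  assumes "assumption_M P"
  shows "0 < tbar P i"
proof -
  obtain e c where hb: "hold_bound e c" using hold_bound_exists[OF assms] by blast
  interpret prob_space "P i" by (rule prob_P)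
  have [measurable]: "(\<lambda>x. fst (snd x)) \<in> borel_measurable (P i)"
    unfolding measurable_cong_sets[OF sets_P refl] sample_M_def by measurable
  have "c \<le> (\<integral>x. min e (max 0 (fst (snd x))) \<partial>P i)" using hb by (simp add: hold_bound_def)
  also have "\<dots> \<le> tbar P i"
    unfolding tbar_def
  proof (rule integral_mono_AE)
    show "integrable (P i) (\<lambda>x. min e (max 0 (fst (snd x))))"
      by (rule integrable_const_bound[where B = "\<bar>e\<bar>"]) auto
    show "AE x in P i. min e (max 0 (fst (snd x))) \<le> fst (snd x)"
      using tau_nonneg_P[of i] by eventually_elim auto
  qed (rule second_moments_integrable[OF assms])
  finally show ?thesis using hb by (simp add: hold_bound_def)
qed

end

text \<open>The reward and holding time of the transition straddling the horizon are size-biased, so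
  their means are not controlled by the means of \<open>P\<close>. Their squares are terms of a
  stopped sum of squares, and this inequality trades the modulus for a small multiple of the
  square.\<close>

lemma abs_le_square_split:
  assumes "0 < (d::real)"
  shows "\<bar>x\<bar> \<le> 1 / d + d * x\<^sup>2"
proof (cases "\<bar>x\<bar> \<le> 1 / d")
  case False
  then have "1 \<le> d * \<bar>x\<bar>" using assms by (simp add: not_le pos_divide_less_eq mult.commute)
  then have "1 * \<bar>x\<bar> \<le> d * \<bar>x\<bar> * \<bar>x\<bar>" by (intro mult_right_mono) auto
  then have "\<bar>x\<bar> \<le> d * x\<^sup>2" by (simp add: power2_eq_square mult.assoc flip: abs_mult)
  then show ?thesis using assms by (simp add: add_increasing)
qed (use assms in \<open>simp add: add_increasing2\<close>)

section \<open>Advantages, rewards and the optimal rate\<close>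

context policy_run
begin

context
  fixes q :: "'s \<times> 'a \<Rightarrow> real" and \<rho> e c :: real
  assumes M: "assumption_M P" and hb: "hold_bound e c"
    and q: "\<And>i. q i = rbar P i - tbar P i * \<rho> + (\<Sum>s\<in>UNIV. ptrans P i s * vmax q s)"
begin

text \<open>A sample of the advantage: its mean given state and action is
  \<open>q (s, a) - vmax q s\<close>, which is never positive and vanishes for a maximising
  action.\<close>

definition adv :: "'s \<Rightarrow> 'a \<times> 's \<times> real \<times> real \<Rightarrow> real" where
  "adv s z = snd (snd (snd z)) - \<rho> * fst (snd (snd z)) + vmax q (fst (snd z)) - vmax q s"

definition sqr :: "'s \<Rightarrow> 'a \<times> 's \<times> real \<times> real \<Rightarrow> real" where
  "sqr s z = (snd (snd (snd z)))\<^sup>2 + \<bar>\<rho>\<bar> * (fst (snd (snd z)))\<^sup>2"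

lemma adv_integrable: "step_integrable adv"
  unfolding step_integrable_def
proof (intro conjI allI)
  have [measurable]: "vmax q \<in> borel_measurable (count_space UNIV)" by simp
  show "adv s \<in> borel_measurable step_M" for s
    unfolding adv_def[abs_def] step_M_def sample_M_def by measurable
  fix s a
  interpret prob_space "P (s, a)" by (rule prob_P)
  show "integrable (P (s, a)) (\<lambda>x. adv s (a, x))"
    unfolding adv_def using second_moments_integrable[OF M, of "(s, a)"] integral_P_fst(1)[of "(s, a)" "vmax q"]
    by simp
qed

lemma sqr_integrable: "step_integrable sqr"
  unfolding step_integrable_def
proof (intro conjI allI)
  show "sqr s \<in> borel_measurable step_M" for s
    unfolding sqr_def[abs_def] step_M_def sample_M_def by measurable
  show "integrable (P (s, a)) (\<lambda>x. sqr s (a, x))" for s a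
    unfolding sqr_def using second_moments_integrable[OF M, of "(s, a)"] by simp
qed

lemma avg_adv: "avg adv s z = q (s, fst z) - vmax q s"
proof -
  interpret prob_space "P (s, fst z)" by (rule prob_P)
  have "avg adv s z = rbar P (s, fst z) - \<rho> * tbar P (s, fst z)
      + (\<Sum>s'\<in>UNIV. ptrans P (s, fst z) s' * vmax q s') - vmax q s"
    unfolding avg_def adv_def rbar_def tbar_def
    using second_moments_integrable[OF M, of "(s, fst z)"] integral_P_fst[of "(s, fst z)" "vmax q"]
    by (simp add: prob_space[simplified])
  then show ?thesis using q[of "(s, fst z)"] by (simp add: mult.commute)
qed

definition total :: "real \<Rightarrow> (nat \<Rightarrow> 'a \<times> 's \<times> real \<times> real) \<Rightarrow> real" where
  "total t \<omega> = (\<Sum>k<epochs t \<omega>. snd (snd (snd (\<omega> k))))"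

text \<open>Summed over the started transitions, \<open>adv\<close> telescopes in
  \<open>vmax q\<close> and leaves rewards minus \<rho> times elapsed time. The boundary terms are
  the reward of the last transition, its overshoot beyond t, and the two end values of
  \<open>vmax q\<close>; in mean they are of order \<open>sqrt t\<close>.\<close>

lemma total_estimate:
  assumes t: "1 \<le> t"
  shows "\<bar>(\<integral>\<omega>. total t \<omega> \<partial>\<mu>) - (\<integral>\<omega>. stopped t (avg adv) \<omega> \<partial>\<mu>) - \<rho> * t\<bar>
    \<le> (2 * supnorm q + 1 + \<bar>\<rho>\<bar> + mean_abs sqr * ((1 + e) / c)) * sqrt t"
proof -
  have t0: "0 \<le> t" using t by simp
  note ec = ec[OF hb t0]
  \<comment> \<open>Balances \<open>1 / d\<close> against d times the expected sum of squares, which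
    grows linearly in t.\<close>
  define d where "d = 1 / sqrt t"
  have d: "0 < d" using t by (simp add: d_def)
  define K where "K = 2 * supnorm q + (1 + \<bar>\<rho>\<bar>) / d"
  have pt: "AE \<omega> in \<mu>. \<bar>total t \<omega> - stopped t adv \<omega> - \<rho> * t\<bar> \<le> K + d * stopped t sqr \<omega>"
    using AE_epochs[OF hb t0]
  proof eventually_elim
    fix \<omega> assume H: "(\<forall>n. 0 \<le> hold n \<omega>) \<and> (\<forall>n. jump n \<omega> \<le> t \<longleftrightarrow> n \<le> epochs t \<omega>)"
    define N where "N = epochs t \<omega>"
    define R where "R k = snd (snd (snd (\<omega> k)))" for k
    define v where "v k = vmax q (state_at s0 k \<omega>)" for k
    have "stopped t adv \<omega> = (\<Sum>n<Suc N. R n - \<rho> * hold n \<omega> + (v (Suc n) - v n))"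
      unfolding stopped_def lessThan_Suc_atMost N_def
      by (rule sum.cong) (simp_all add: adv_def R_def hold_def v_def state_at_def)
    also have "\<dots> = (\<Sum>n<Suc N. R n) - (\<Sum>n<Suc N. \<rho> * hold n \<omega>) + (\<Sum>n<Suc N. v (Suc n) - v n)"
      by (simp only: sum.distrib sum_subtractf)
    also have "\<dots> = (\<Sum>n<Suc N. R n) - \<rho> * jump (Suc N) \<omega> + (v (Suc N) - v 0)"
      unfolding sum_lessThan_telescope jump_def sum_distrib_left ..
    finally have st: "stopped t adv \<omega> = (\<Sum>n<Suc N. R n) - \<rho> * jump (Suc N) \<omega> + (v (Suc N) - v 0)" .
    have tot: "total t \<omega> = (\<Sum>n<N. R n)" by (simp add: total_def N_def R_def)
    have jN: "jump N \<omega> \<le> t" "\<not> jump (Suc N) \<omega> \<le> t" "jump (Suc N) \<omega> = jump N \<omega> + hold N \<omega>"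
      using H by (simp_all add: N_def) (simp add: jump_def)
    have "\<bar>\<rho> * (jump (Suc N) \<omega> - t)\<bar> \<le> \<bar>\<rho>\<bar> * hold N \<omega>"
      unfolding abs_mult using jN by (intro mult_left_mono) auto
    moreover have "total t \<omega> - stopped t adv \<omega> - \<rho> * t = - R N + \<rho> * (jump (Suc N) \<omega> - t) - (v (Suc N) - v 0)"
      unfolding st tot by (simp add: algebra_simps)
    moreover have "\<bar>v (Suc N) - v 0\<bar> \<le> 2 * supnorm q"
      using abs_vmax_le[of q "state_at s0 (Suc N) \<omega>"] abs_vmax_le[of q "state_at s0 0 \<omega>"]
      unfolding v_def by linarith
    ultimately have 1: "\<bar>total t \<omega> - stopped t adv \<omega> - \<rho> * t\<bar> \<le> \<bar>R N\<bar> + \<bar>\<rho>\<bar> * hold N \<omega> + 2 * supnorm q"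
      by linarith
    have "\<bar>R N\<bar> \<le> 1 / d + d * (R N)\<^sup>2" by (rule abs_le_square_split[OF d])
    moreover have "\<bar>\<rho>\<bar> * hold N \<omega> \<le> \<bar>\<rho>\<bar> * (1 / d + d * (hold N \<omega>)\<^sup>2)"
      using abs_le_square_split[OF d, of "hold N \<omega>"] by (intro mult_left_mono) auto
    moreover have "d * ((R N)\<^sup>2 + \<bar>\<rho>\<bar> * (hold N \<omega>)\<^sup>2) \<le> d * stopped t sqr \<omega>"
    proof (rule mult_left_mono)
      have "sqr (state_at s0 N \<omega>) (\<omega> N) \<le> stopped t sqr \<omega>"
        unfolding stopped_def N_def by (rule member_le_sum) (auto simp: sqr_def)
      then show "(R N)\<^sup>2 + \<bar>\<rho>\<bar> * (hold N \<omega>)\<^sup>2 \<le> stopped t sqr \<omega>"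
        by (simp add: sqr_def R_def hold_def)
    qed (use d in simp)
    ultimately show "\<bar>total t \<omega> - stopped t adv \<omega> - \<rho> * t\<bar> \<le> K + d * stopped t sqr \<omega>"
      using 1 unfolding K_def by (simp add: algebra_simps add_divide_distrib)
  qed
  note Ia = stopped_integral_sums[OF hb t0 adv_integrable]
  note Is = stopped_integral_sums[OF hb t0 sqr_integrable]
  have Rm: "(\<lambda>\<omega>. snd (snd (snd (\<omega> k)))) \<in> borel_measurable \<mu>" for k
    by (intro measurable_compose[OF component_measurable]) (simp add: step_M_def sample_M_def)
  have tm: "total t \<in> borel_measurable \<mu>"
    unfolding total_def[abs_def]
    by (rule measurable_compose_countable[OF borel_measurable_sum[OF Rm] epochs_measurable])
  define f where "f \<omega> = total t \<omega> - stopped t adv \<omega> - \<rho> * t" for \<omega>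
  have fm: "f \<in> borel_measurable \<mu>"
    unfolding f_def using tm borel_measurable_integrable[OF Ia(1)] by measurable
  have bi: "integrable \<mu> (\<lambda>\<omega>. K + d * stopped t sqr \<omega>)" using Is(1) by simp
  have fi: "integrable \<mu> f"
    by (rule Bochner_Integration.integrable_bound[OF bi fm])
       (use pt in \<open>eventually_elim, auto simp: f_def\<close>)
  have ti: "integrable \<mu> (total t)"
  proof -
    have "integrable \<mu> (\<lambda>\<omega>. f \<omega> + stopped t adv \<omega> + \<rho> * t)" using fi Ia(1) by simp
    then show ?thesis by (simp add: f_def)
  qed
  have "(\<integral>\<omega>. f \<omega> \<partial>\<mu>) = (\<integral>\<omega>. total t \<omega> \<partial>\<mu>) - (\<integral>\<omega>. stopped t adv \<omega> \<partial>\<mu>) - \<rho> * t"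
    unfolding f_def using ti Ia(1) by (simp add: mu.prob_space)
  moreover have "\<bar>\<integral>\<omega>. f \<omega> \<partial>\<mu>\<bar> \<le> (\<integral>\<omega>. K + d * stopped t sqr \<omega> \<partial>\<mu>)"
  proof -
    have "\<bar>\<integral>\<omega>. f \<omega> \<partial>\<mu>\<bar> \<le> (\<integral>\<omega>. norm (f \<omega>) \<partial>\<mu>)" using integral_norm_bound[of \<mu> f] by simp
    also have "\<dots> \<le> (\<integral>\<omega>. K + d * stopped t sqr \<omega> \<partial>\<mu>)"
      by (rule integral_mono_AE[OF integrable_norm[OF fi] bi]) (use pt in \<open>simp add: f_def\<close>)
    finally show ?thesis .
  qed
  moreover have "(\<integral>\<omega>. K + d * stopped t sqr \<omega> \<partial>\<mu>) \<le> K + d * (mean_abs sqr * ((t + e) / c))"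
    using Is(1) mult_left_mono[OF Is(3), of d] d by (simp add: mu.prob_space)
  moreover have "K + d * (mean_abs sqr * ((t + e) / c))
      \<le> (2 * supnorm q + 1 + \<bar>\<rho>\<bar> + mean_abs sqr * ((1 + e) / c)) * sqrt t"
  proof -
    have sq: "1 \<le> sqrt t" using t by simp
    have "2 * supnorm q \<le> 2 * supnorm q * sqrt t"
      using mult_left_mono[OF sq, of "2 * supnorm q"] supnorm_nonneg[of q] by simp
    moreover have "(1 + \<bar>\<rho>\<bar>) / d = (1 + \<bar>\<rho>\<bar>) * sqrt t" by (simp add: d_def)
    moreover have "d * (mean_abs sqr * ((t + e) / c)) \<le> mean_abs sqr * ((1 + e) / c) * sqrt t"
    proof -
      have "d * (t + e) \<le> (1 + e) * sqrt t"
      proof -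
        have "t + e \<le> (1 + e) * t" using t ec by (simp add: algebra_simps)
        then have "d * (t + e) \<le> d * ((1 + e) * t)" using d by (intro mult_left_mono) auto
        also have "\<dots> = (1 + e) * (t / sqrt t)" by (simp add: d_def)
        also have "t / sqrt t = sqrt t" using t by (simp add: real_div_sqrt)
        finally show ?thesis .
      qed
      then have "mean_abs sqr / c * (d * (t + e)) \<le> mean_abs sqr / c * ((1 + e) * sqrt t)"
        using ec by (intro mult_left_mono) (auto simp: mean_abs_def supnorm_nonneg)
      then show ?thesis by (simp add: mult_ac)
    qed
    ultimately show ?thesis unfolding K_def by (simp add: distrib_right)
  qed
  ultimately show ?thesis
    using stopped_integral_avg[OF hb t0 adv_integrable] by linarith
qed

lemma avg_rate_eq: "avg_rate P \<pi> s0 = Liminf at_top (\<lambda>t. ereal ((\<integral>\<omega>. total t \<omega> \<partial>\<mu>) / t))"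
proof -
  have "(THE \<mu>. policy_measure P \<pi> s0 \<mu>) = \<mu>"
    by (rule the1_equality[OF ex1_policy_measure[OF pol] mu])
  then show ?thesis by (simp add: avg_rate_def total_def)
qed

lemma rate_error_tendsto: "((\<lambda>t. ereal (\<rho> + C / sqrt t)) \<longlongrightarrow> ereal \<rho>) at_top"
proof -
  have "((\<lambda>t. \<rho> + C / sqrt t) \<longlongrightarrow> \<rho> + 0) at_top"
    by (intro tendsto_intros tendsto_divide_0[OF tendsto_const] filterlim_at_top_imp_at_infinity sqrt_at_top)
  then show ?thesis by simp
qed

lemma divide_sqrt_bound:
  assumes "1 \<le> (t::real)" "\<bar>x - \<rho> * t\<bar> \<le> C * sqrt t"
  shows "\<bar>x / t - \<rho>\<bar> \<le> C / sqrt t"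
proof -
  have "x / t - \<rho> = (x - \<rho> * t) / t" using assms(1) by (simp add: field_simps)
  then have "\<bar>x / t - \<rho>\<bar> = \<bar>x - \<rho> * t\<bar> / t" using assms(1) by (simp add: abs_divide)
  also have "\<dots> \<le> C * sqrt t / t" using assms by (intro divide_right_mono) auto
  also have "\<dots> = C * (sqrt t / t)" by simp
  also have "sqrt t / t = 1 / sqrt t"
    using assms(1) by (simp add: field_simps)
  finally show ?thesis by simp
qed

text \<open>Mean advantages are nonpositive whatever the policy does, so only the boundary terms of
  order \<open>sqrt t\<close> can push the total reward above \<open>\<rho> * t\<close>.\<close>

lemma avg_rate_le: "avg_rate P \<pi> s0 \<le> ereal \<rho>"
proof -
  define C where "C = 2 * supnorm q + 1 + \<bar>\<rho>\<bar> + mean_abs sqr * ((1 + e) / c)"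
  have le: "(\<integral>\<omega>. total t \<omega> \<partial>\<mu>) / t \<le> \<rho> + C / sqrt t" if t: "1 \<le> t" for t
  proof -
    have "stopped t (avg adv) \<omega> \<le> 0" for \<omega>
      unfolding stopped_def by (rule sum_nonpos) (simp add: avg_adv vmax_ge)
    then have "(\<integral>\<omega>. stopped t (avg adv) \<omega> \<partial>\<mu>) \<le> 0"
      using Bochner_Integration.integral_nonneg[of \<mu> "\<lambda>\<omega>. - stopped t (avg adv) \<omega>"] by simp
    then have "(\<integral>\<omega>. total t \<omega> \<partial>\<mu>) \<le> \<rho> * t + C * sqrt t"
      using total_estimate[OF t] unfolding C_def by (simp add: abs_le_iff)
    then have "(\<integral>\<omega>. total t \<omega> \<partial>\<mu>) / t \<le> (\<rho> * t + C * sqrt t) / t"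
      using t by (intro divide_right_mono) auto
    also have "\<dots> \<le> \<rho> + C / sqrt t"
      using divide_sqrt_bound[OF t, of "\<rho> * t + C * sqrt t" C] total_estimate[OF t] t
      unfolding C_def[symmetric] by (simp add: abs_le_iff)
    finally show ?thesis .
  qed
  have "Liminf at_top (\<lambda>t. ereal ((\<integral>\<omega>. total t \<omega> \<partial>\<mu>) / t)) \<le> Liminf at_top (\<lambda>t. ereal (\<rho> + C / sqrt t))"
    by (rule Liminf_mono, rule eventually_mono[OF eventually_ge_at_top[of 1]]) (use le in simp)
  also have "\<dots> = ereal \<rho>"
    by (rule lim_imp_Liminf[OF _ rate_error_tendsto]) simp
  finally show ?thesis unfolding avg_rate_eq .
qed

lemma avg_rate_greedy:
  assumes g: "\<And>n h. \<pi> n s0 h = return_pmf (g (state_at s0 n h))"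
    and greedy: "\<And>s. q (s, g s) = vmax q s"
  shows "avg_rate P \<pi> s0 = ereal \<rho>"
proof -
  define C where "C = 2 * supnorm q + 1 + \<bar>\<rho>\<bar> + mean_abs sqr * ((1 + e) / c)"
  have le: "\<bar>(\<integral>\<omega>. total t \<omega> \<partial>\<mu>) / t - \<rho>\<bar> \<le> C / sqrt t" if t: "1 \<le> t" for t
  proof -
    have "AE \<omega> in \<mu>. stopped t (avg adv) \<omega> = 0"
      using AE_deterministic_action[OF g]
      by eventually_elim (simp add: stopped_def avg_adv greedy)
    then have "(\<integral>\<omega>. stopped t (avg adv) \<omega> \<partial>\<mu>) = 0"
      by (rule integral_eq_zero_AE)
    then show ?thesis
      using total_estimate[OF t] divide_sqrt_bound[OF t, of "\<integral>\<omega>. total t \<omega> \<partial>\<mu>" C] unfolding C_def by simp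
  qed
  have "((\<lambda>t. (\<integral>\<omega>. total t \<omega> \<partial>\<mu>) / t - \<rho>) \<longlongrightarrow> 0) at_top"
  proof (rule Lim_null_comparison)
    show "\<forall>\<^sub>F t in at_top. norm ((\<integral>\<omega>. total t \<omega> \<partial>\<mu>) / t - \<rho>) \<le> C / sqrt t"
      using eventually_ge_at_top[of 1] by (rule eventually_mono) (use le in simp)
    show "((\<lambda>t. C / sqrt t) \<longlongrightarrow> 0) at_top"
      by (intro tendsto_divide_0[OF tendsto_const] filterlim_at_top_imp_at_infinity sqrt_at_top)
  qed
  then have "((\<lambda>t. ereal ((\<integral>\<omega>. total t \<omega> \<partial>\<mu>) / t)) \<longlongrightarrow> ereal \<rho>) at_top"
    by (simp add: LIM_zero_iff)
  then show ?thesis unfolding avg_rate_eq by (intro lim_imp_Liminf) simp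
qed

end

end

text \<open>The upper bound holds for every policy and a greedy stationary one attains it. The
  argument is the same at each state, so the arbitrary state in the definition of
  \<open>rstar\<close> is harmless.\<close>

lemma (in smdp) rstar_eq:
  assumes M: "assumption_M P"
    and q: "\<And>i. q i = rbar P i - tbar P i * \<rho> + (\<Sum>s\<in>UNIV. ptrans P i s * vmax q s)"
  shows "rstar P = \<rho>"
proof -
  obtain e c where hb: "hold_bound e c" using hold_bound_exists[OF M] by blast
  have run: "policy_run P \<pi> s \<mu>" if "is_policy \<pi>" "policy_measure P \<pi> s \<mu>" for \<pi> s \<mu>
    by (intro policy_run.intro policy_run_axioms.intro smdp_axioms that)
  have "\<forall>s. \<exists>a. q (s, a) = vmax q s" using vmax_attained[of q] by metis
  then obtain g where g: "\<And>s. q (s, g s) = vmax q s" by metis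
  have "opt_rate P s = ereal \<rho>" for s
    unfolding opt_rate_def
  proof (rule antisym)
    show "(SUP \<pi>\<in>{\<pi>. is_policy \<pi>}. avg_rate P \<pi> s) \<le> ereal \<rho>"
    proof (rule SUP_least)
      fix \<pi> :: "nat \<Rightarrow> 's \<Rightarrow> (nat \<Rightarrow> 'a \<times> 's \<times> real \<times> real) \<Rightarrow> 'a pmf" assume "\<pi> \<in> {\<pi>. is_policy \<pi>}"
      then have pol: "is_policy \<pi>" by simp
      obtain \<mu> where mu: "policy_measure P \<pi> s \<mu>" using ex1_policy_measure[OF pol] by blast
      show "avg_rate P \<pi> s \<le> ereal \<rho>"
        by (rule policy_run.avg_rate_le[OF run[OF pol mu] M hb q])
    qed
    define \<pi> :: "nat \<Rightarrow> 's \<Rightarrow> (nat \<Rightarrow> 'a \<times> 's \<times> real \<times> real) \<Rightarrow> 'a pmf"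
      where "\<pi> = (\<lambda>n s0 h. return_pmf (g (state_at s0 n h)))"
    have pol: "is_policy \<pi>" unfolding \<pi>_def by (rule is_policy_stationary)
    obtain \<mu> where mu: "policy_measure P \<pi> s \<mu>" using ex1_policy_measure[OF pol] by blast
    have "avg_rate P \<pi> s = ereal \<rho>"
      by (rule policy_run.avg_rate_greedy[OF run[OF pol mu] M hb q _ g]) (simp add: \<pi>_def)
    then show "ereal \<rho> \<le> (SUP \<pi>\<in>{\<pi>. is_policy \<pi>}. avg_rate P \<pi> s)"
      using pol by (intro SUP_upper2[of \<pi>]) auto
  qed
  then show ?thesis by (simp add: rstar_def)
qed

text \<open>A confinable set disjoint from C would let a stationary rule stay forever among finitely
  many transient states; hence each of the two sets contains a state of C. From the one in the
  absorbing set some policy reaches the other with positive probability, but no policy leaves the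
  absorbing set, so the other state lies in it as well.\<close>

lemma (in smdp) weakly_communicating_meeting:
  assumes wc: "weakly_communicating P"
  shows "meeting (ptrans P)"
proof -
  have run: "policy_run P \<pi> s \<mu>" if "is_policy \<pi>" "policy_measure P \<pi> s \<mu>" for \<pi> s \<mu>
    by (intro policy_run.intro policy_run_axioms.intro smdp_axioms that)
  obtain C where C: "closed_comm_class P C"
    using ex1_implies_ex[OF conjunct1[OF wc[unfolded weakly_communicating_def]]] by (elim exE)
  have trans: "AE \<omega> in \<mu>. finite {n. state_at s0 n \<omega> = s}"
    if "s \<notin> C" "is_policy \<pi>" "policy_measure P \<pi> s0 \<mu>" for s s0 \<pi> \<mu>
    by (rule conjunct2[OF wc[unfolded weakly_communicating_def], rule_format, OF C that(1) conjI[OF that(2,3)]])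
  have hit: "D \<inter> C \<noteq> {}" if ne: "D \<noteq> {}" and conf: "confinable (ptrans P) D" for D
  proof
    assume empty: "D \<inter> C = {}"
    have "\<forall>s. \<exists>a. s \<in> D \<longrightarrow> (\<forall>s'. 0 < ptrans P (s, a) s' \<longrightarrow> s' \<in> D)"
      using conf unfolding confinable_def by blast
    then obtain g where g: "\<And>s s'. s \<in> D \<Longrightarrow> 0 < ptrans P (s, g s) s' \<Longrightarrow> s' \<in> D" by metis
    define \<pi> :: "nat \<Rightarrow> 's \<Rightarrow> (nat \<Rightarrow> 'a \<times> 's \<times> real \<times> real) \<Rightarrow> 'a pmf"
      where "\<pi> = (\<lambda>n s0 h. return_pmf (g (state_at s0 n h)))"
    have pol: "is_policy \<pi>" unfolding \<pi>_def by (rule is_policy_stationary)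
    obtain s0 where s0: "s0 \<in> D" using ne by blast
    obtain \<mu> where mu: "policy_measure P \<pi> s0 \<mu>" using ex1_policy_measure[OF pol] by blast
    interpret R: policy_run P \<pi> s0 \<mu> by (rule run[OF pol mu])
    have "AE \<omega> in \<mu>. \<forall>s\<in>D. finite {n. state_at s0 n \<omega> = s}"
      by (rule AE_finite_allI) (use trans[OF _ pol mu] empty in auto)
    moreover have "AE \<omega> in \<mu>. \<forall>n. fst (\<omega> n) = g (state_at s0 n \<omega>)"
      by (rule R.AE_deterministic_action) (simp add: \<pi>_def)
    ultimately have "AE \<omega> in \<mu>. False"
      using R.AE_edges
    proof eventually_elim
      fix \<omega> assume fin: "\<forall>s\<in>D. finite {n. state_at s0 n \<omega> = s}"
        and act: "\<forall>n. fst (\<omega> n) = g (state_at s0 n \<omega>)"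
        and edge: "\<forall>n. 0 < ptrans P (state_at s0 n \<omega>, fst (\<omega> n)) (state_at s0 (Suc n) \<omega>)"
      have in_D: "state_at s0 n \<omega> \<in> D" for n
      proof (induction n)
        case 0 then show ?case using s0 by (simp add: state_at_def)
      next
        case (Suc n)
        then show ?case using g[of "state_at s0 n \<omega>"] edge act by metis
      qed
      have "finite (\<Union>s\<in>D. {n. state_at s0 n \<omega> = s})" using fin by (intro finite_UN_I) auto
      moreover have "(\<Union>s\<in>D. {n. state_at s0 n \<omega> = s}) = UNIV" using in_D by auto
      ultimately show False by simp
    qed
    then show False by (simp add: R.mu.AE_const)
  qed
  show ?thesis
    unfolding meeting_def
  proof (intro allI impI)
    fix D D' assume A: "D \<noteq> {} \<and> absorbing (ptrans P) D \<and> D' \<noteq> {} \<and> confinable (ptrans P) D'"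
    then have "confinable (ptrans P) D" unfolding absorbing_def confinable_def by blast
    then obtain s where s: "s \<in> D" "s \<in> C" using hit A by blast
    obtain s' where s': "s' \<in> D'" "s' \<in> C" using hit A by blast
    obtain \<pi> \<mu> where pm: "is_policy \<pi>" "policy_measure P \<pi> s \<mu>"
      and pos: "measure \<mu> {\<omega> \<in> space \<mu>. \<exists>n. state_at s n \<omega> = s'} > 0"
      using C s(2) s'(2) unfolding closed_comm_class_def by blast
    interpret R: policy_run P \<pi> s \<mu> by (rule run[OF pm])
    have "s' \<in> D"
    proof (rule ccontr)
      assume s'D: "s' \<notin> D"
      have "AE \<omega> in \<mu>. \<not> (\<exists>n. state_at s n \<omega> = s')"
        using R.AE_edges
      proof eventually_elim
        fix \<omega> assume edge: "\<forall>n. 0 < ptrans P (state_at s n \<omega>, fst (\<omega> n)) (state_at s (Suc n) \<omega>)"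
        have "state_at s n \<omega> \<in> D" for n
        proof (induction n)
          case 0 then show ?case using s(1) by (simp add: state_at_def)
        next
          case (Suc n)
          then show ?case using A edge unfolding absorbing_def by blast
        qed
        then show "\<not> (\<exists>n. state_at s n \<omega> = s')" using s'D by auto
      qed
      then have "measure \<mu> {\<omega> \<in> space \<mu>. \<exists>n. state_at s n \<omega> = s'} = 0"
        by (intro R.mu.prob_eq_0_AE)
      with pos show False by simp
    qed
    then show "D \<inter> D' \<noteq> {}" using s'(1) by blast
  qed
qed

section \<open>Boundedness and limit points of the iterates\<close>

lemma nonexp_field_relval:
  "stoch_kernel p \<Longrightarrow> (\<And>i. 0 < t i) \<Longrightarrow> nonexp_field (relval r t p) t"
  by unfold_locales (auto intro: relval_nonexp)

text \<open>A shift only reparametrises the line of constants. It moves the condition on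
  \<open>finf\<close> from the origin to any constant function.\<close>

lemma sistr_at_shift:
  assumes "sistr_at g x"
  shows "sistr_at g (\<lambda>i. x i + k)"
proof -
  define f where "f c = g (\<lambda>i. x i + c)" for c
  have f: "strict_mono f" "surj f" using assms by (simp_all add: sistr_at_def f_def[abs_def])
  have eq: "(\<lambda>c. g (\<lambda>i. x i + k + c)) = (\<lambda>c. f (k + c))" by (simp add: f_def add.assoc)
  have "strict_mono (\<lambda>c. f (k + c))" using f(1) by (simp add: strict_mono_def)
  moreover have "surj (\<lambda>c. f (k + c))"
  proof (rule surjI)
    fix y
    show "f (k + (inv f y - k)) = y" using f(2) by (simp add: surj_f_inv_f)
  qed
  ultimately show ?thesis unfolding sistr_at_def eq by blast
qed

text \<open>The solution q of the optimality equation is the stationary function against which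
  backward solutions are compared. \<open>W_rec\<close> says that the envelope is attained, which
  provides the record times.\<close>

locale rvi_iteration = async_iteration x a err h W c Lh
  for x :: "nat \<Rightarrow> 's::finite \<times> 'a::finite \<Rightarrow> real" and a err h W c Lh +
  fixes r t :: "'s \<times> 'a \<Rightarrow> real" and p :: "'s \<times> 'a \<Rightarrow> 's \<Rightarrow> real"
    and f finf :: "('s \<times> 'a \<Rightarrow> real) \<Rightarrow> real" and Lf \<rho> :: real and q :: "'s \<times> 'a \<Rightarrow> real"
  assumes h_def: "\<And>y i. h y i = relval r t p y i - f y"
    and p: "stoch_kernel p" and meet: "meeting p" and t: "\<And>i. 0 < t i"
    and f_lip: "supnorm_lipschitz f Lf" and f_sistr: "\<And>y. sistr_at f y"
    and finf: "\<And>y. ((\<lambda>c. f (\<lambda>i. c * y i) / c) \<longlongrightarrow> finf y) at_top"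
    and finf_sistr: "sistr_at finf (\<lambda>_. 0)"
    and q: "\<And>i. relval r t p q i = \<rho>"
    and W_rec: "\<And>n. \<exists>k\<le>n. W n = 1 + supnorm (x k)"
begin

lemma finf_lip: "supnorm_lipschitz finf Lf"
proof -
  have "\<bar>finf y - finf z\<bar> \<le> Lf * supnorm (\<lambda>i. y i - z i)" for y z
  proof (rule tendsto_upperbound)
    show "((\<lambda>c. \<bar>f (\<lambda>i. c * y i) / c - f (\<lambda>i. c * z i) / c\<bar>) \<longlongrightarrow> \<bar>finf y - finf z\<bar>) at_top"
      by (intro tendsto_intros finf)
    show "\<forall>\<^sub>F c in at_top. \<bar>f (\<lambda>i. c * y i) / c - f (\<lambda>i. c * z i) / c\<bar> \<le> Lf * supnorm (\<lambda>i. y i - z i)"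
      using eventually_gt_at_top[of 0]
    proof (rule eventually_mono)
      fix c :: real assume c: "0 < c"
      have "\<bar>f (\<lambda>i. c * y i) - f (\<lambda>i. c * z i)\<bar> \<le> Lf * (c * supnorm (\<lambda>i. y i - z i))"
      proof (rule supnorm_lipschitzD[OF f_lip])
        fix i show "\<bar>c * y i - c * z i\<bar> \<le> c * supnorm (\<lambda>i. y i - z i)"
          using supnorm_ge[of "\<lambda>i. y i - z i" i] c by (simp add: abs_mult flip: right_diff_distrib)
      qed
      then show "\<bar>f (\<lambda>i. c * y i) / c - f (\<lambda>i. c * z i) / c\<bar> \<le> Lf * supnorm (\<lambda>i. y i - z i)"
        by (rule scaled_diff_le[OF c])
    qed
  qed simp
  moreover have "0 \<le> Lf" using f_lip by (simp add: supnorm_lipschitz_def)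
  ultimately show ?thesis by (simp add: supnorm_lipschitz_def)
qed

lemma finf_0: "finf (\<lambda>_. 0) = 0"
proof -
  have a: "((\<lambda>c. f (\<lambda>i. 0) / c) \<longlongrightarrow> 0) at_top"
    by (rule tendsto_divide_0[OF tendsto_const]) (rule filterlim_at_top_imp_at_infinity[OF filterlim_ident])
  have b: "((\<lambda>c. f (\<lambda>i. 0) / c) \<longlongrightarrow> finf (\<lambda>_. 0)) at_top" using finf[of "\<lambda>_. 0"] by simp
  show ?thesis by (rule tendsto_unique[OF trivial_limit_at_top_linorder b a])
qed

text \<open>The scaled limit is stationary for the reward-free operator, hence harmonic, hence
  constant because sets meet; its level is fixed by \<open>finf\<close>, which is strictly
  increasing along constants and 0 at the origin. At record times the scaled norm is
  \<open>1 - 1 / W\<close>, so the limit cannot be 0.\<close>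

lemma iterates_bounded: "\<exists>K. \<forall>n. supnorm (x n) \<le> K"
proof (rule ccontr)
  assume "\<not> ?thesis"
  then have unb: "\<exists>n. K < supnorm (x n)" for K by (meson not_le)
  have "\<exists>n. W n = 1 + supnorm (x n) \<and> real k < W n" for k :: nat
  proof -
    obtain m where m: "real k < supnorm (x m)" using unb by blast
    obtain j where j: "j \<le> m" "W m = 1 + supnorm (x j)" using W_rec by blast
    \<comment> \<open>Moving from m back to the index j where the envelope is attained produces a
      record time with the same envelope.\<close>
    have "W j = W m" using W_le[OF j(1)] x_le_W[of j] j(2) by linarith
    then show ?thesis using j m x_le_W[of m] by (intro exI[of _ j]) simp
  qed
  then obtain n where n: "\<And>k. W (n k) = 1 + supnorm (x (n k))" "\<And>k. real k < W (n k)" by metis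
  have l: "0 < W (n k)" for k using W_ge_1[of "n k"] by simp
  have l_top: "filterlim (\<lambda>k. W (n k)) at_top sequentially"
    by (rule filterlim_at_top_mono[OF filterlim_real_sequentially]) (use n(2) in \<open>simp add: less_imp_le\<close>)
  have n_top: "filterlim n at_top sequentially"
    unfolding filterlim_at_top
  proof
    fix N
    have "\<forall>\<^sub>F k in sequentially. W N < W (n k)"
      using l_top unfolding filterlim_at_top_dense by blast
    then show "\<forall>\<^sub>F k in sequentially. N \<le> n k"
      by (rule eventually_mono) (use W_le[of _ N] in \<open>meson not_le nat_le_linear\<close>)
  qed
  define h' where "h' y i = relval (\<lambda>_. 0) t p y i - finf y" for y i
  have h': "(\<lambda>k. h (\<lambda>j. W (n k) * y j) i / W (n k)) \<longlonglongrightarrow> h' y i" for y i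
  proof -
    have "(\<lambda>k. f (\<lambda>j. W (n k) * y j) / W (n k)) \<longlonglongrightarrow> finf y"
      by (rule filterlim_compose[OF finf l_top])
    moreover have "(\<lambda>k. relval (\<lambda>_. 0) t p y i + r i / t i / W (n k)) \<longlonglongrightarrow> relval (\<lambda>_. 0) t p y i + 0"
      by (intro tendsto_intros tendsto_divide_0[OF tendsto_const] filterlim_at_top_imp_at_infinity l_top)
    moreover have "relval r t p (\<lambda>j. W (n k) * y j) i / W (n k) = relval (\<lambda>_. 0) t p y i + r i / t i / W (n k)" for k
      unfolding relval_scale[OF l] by (simp add: relval_def add_divide_distrib diff_divide_distrib)
    ultimately have "(\<lambda>k. relval r t p (\<lambda>j. W (n k) * y j) i / W (n k) - f (\<lambda>j. W (n k) * y j) / W (n k))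
        \<longlonglongrightarrow> relval (\<lambda>_. 0) t p y i + 0 - finf y"
      by (simp add: tendsto_diff)
    then show ?thesis by (simp add: h_def h'_def diff_divide_distrib)
  qed
  have K1: "W (n k) \<le> 1 * W (n k)" for k by simp
  obtain s Y C L where s: "strict_mono (s :: nat \<Rightarrow> nat)"
    and Y0: "\<forall>i. (\<lambda>k. x (n (s k)) i / W (n (s k))) \<longlonglongrightarrow> Y 0 i"
    and bd: "\<forall>u\<le>0. \<forall>i. \<bar>Y u i\<bar> \<le> 1"
    and lip: "\<forall>u\<le>0. \<forall>v\<le>0. \<forall>i. \<bar>Y v i - Y u i\<bar> \<le> L * \<bar>v - u\<bar>"
    and quad: "\<forall>u\<le>0. \<forall>v\<le>0. \<forall>i. \<bar>Y v i - Y u i - (v - u) * h' (Y u) i\<bar> \<le> C * (v - u)\<^sup>2"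
    using limit_solution[of n "\<lambda>k. W (n k)" 1 h', OF n_top l K1 h']
    by (elim exE conjE) (rule that)
  note Y0 = Y0[rule_format] and bd = bd[rule_format] and lip = lip[rule_format] and quad = quad[rule_format]
  interpret N0: nonexp_field "relval (\<lambda>_. 0) t p" t by (rule nonexp_field_relval[OF p t])
  have rz: "relval (\<lambda>_. 0) t p (\<lambda>_. 0) i = 0" for i by (simp add: relval_def)
  have st1: "relval (\<lambda>_. 0) t p (Y u) i = 0" if "u \<le> 0" for u i
    by (rule N0.backward_solution_stationary(1)[OF quad[unfolded h'_def] lip bd relval_shift[OF p] finf_lip rz that])
  have st2: "Y u i - Y u j = Y 0 i - Y 0 j" if "u \<le> 0" for u i j
    by (rule N0.backward_solution_stationary(2)[OF quad[unfolded h'_def] lip bd relval_shift[OF p] finf_lip rz that])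
  have "\<exists>k. Y 0 = (\<lambda>_. k)"
    by (rule relval_zero_const[where t = t, OF p meet t st1]) simp
  then obtain k where k: "Y 0 = (\<lambda>_. k)" by blast
  have "finf (Y 0) = 0"
  proof (rule backward_solution_level[of Y 0 finf C L 1])
    show "\<bar>Y v i - Y u i - (v - u) * (0 - finf (Y u))\<bar> \<le> C * (v - u)\<^sup>2" if "u \<le> 0" "v \<le> 0" for u v i
      using quad[OF that, of i] st1[OF that(1), of i] by (simp add: h'_def)
    show "sistr_at finf (Y 0)" using sistr_at_shift[OF finf_sistr, of k] by (simp add: k)
  qed (fact lip bd st2)+
  then have "k = 0"
    using finf_sistr finf_0 strict_mono_eq[of "\<lambda>c. finf (\<lambda>_. c)" k 0] unfolding k sistr_at_def by simp
  then have "(\<lambda>k. supnorm (\<lambda>i. x (n (s k)) i / W (n (s k)) - 0)) \<longlonglongrightarrow> 0"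
    using Y0 unfolding k by (intro tendsto_supnorm_diff) simp
  moreover have "supnorm (\<lambda>i. x m i / W m - 0) = supnorm (x m) / W m" for m
  proof (rule antisym)
    have W: "0 < W m" using W_ge_1[of m] by simp
    show "supnorm (\<lambda>i. x m i / W m - 0) \<le> supnorm (x m) / W m"
      using W supnorm_ge[of "x m"] by (simp add: supnorm_le_iff abs_divide divide_right_mono)
    obtain i where "supnorm (x m) = \<bar>x m i\<bar>" using supnorm_attained by blast
    then show "supnorm (x m) / W m \<le> supnorm (\<lambda>i. x m i / W m - 0)"
      using supnorm_ge[of "\<lambda>i. x m i / W m - 0" i] W by (simp add: abs_divide)
  qed
  ultimately have lim0: "(\<lambda>k. supnorm (x (n (s k))) / W (n (s k))) \<longlonglongrightarrow> 0" by simp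
  have "(\<lambda>k. 1 - 1 / W (n (s k))) \<longlonglongrightarrow> 1 - 0"
    by (intro tendsto_intros tendsto_divide_0[OF tendsto_const] filterlim_at_top_imp_at_infinity
        filterlim_compose[OF l_top filterlim_subseq[OF s]])
  moreover have "1 - 1 / W (n j) = supnorm (x (n j)) / W (n j)" for j
    using n(1)[of j] l[of j] by (simp add: field_simps)
  ultimately have "(\<lambda>k. supnorm (x (n (s k))) / W (n (s k))) \<longlonglongrightarrow> 1" by simp
  with lim0 show False using LIMSEQ_unique by fastforce
qed

text \<open>With scale 1 the bound on the iterates controls the whole past, so each limit point is
  the end of a bounded backward solution of the unscaled equation.\<close>

lemma limit_point_solution:
  assumes n: "filterlim n at_top sequentially" and y: "\<And>i. (\<lambda>k. x (n k) i) \<longlonglongrightarrow> y i"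
  shows "relval r t p y i = \<rho>" "f y = \<rho>"
proof -
  obtain K where K: "\<And>n. supnorm (x n) \<le> K" using iterates_bounded by blast
  have WK: "W m \<le> (1 + K) * 1" for m
  proof -
    obtain j where "W m = 1 + supnorm (x j)" using W_rec by blast
    then show ?thesis using K[of j] by simp
  qed
  have h1: "(\<lambda>k. h (\<lambda>j. 1 * y j) i / 1) \<longlonglongrightarrow> h y i" for y i by simp
  have l1: "0 < (1 :: real)" by simp
  obtain s Y C L where s: "strict_mono (s :: nat \<Rightarrow> nat)"
    and Y0: "\<forall>i. (\<lambda>k. x (n (s k)) i / 1) \<longlonglongrightarrow> Y 0 i"
    and bd: "\<forall>u\<le>0. \<forall>i. \<bar>Y u i\<bar> \<le> 1 + K"
    and lip: "\<forall>u\<le>0. \<forall>v\<le>0. \<forall>i. \<bar>Y v i - Y u i\<bar> \<le> L * \<bar>v - u\<bar>"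
    and quad: "\<forall>u\<le>0. \<forall>v\<le>0. \<forall>i. \<bar>Y v i - Y u i - (v - u) * h (Y u) i\<bar> \<le> C * (v - u)\<^sup>2"
    using limit_solution[of n "\<lambda>_. 1" "1 + K" h, OF n l1 WK h1]
    by (elim exE conjE) (rule that)
  note Y0 = Y0[rule_format] and bd = bd[rule_format] and lip = lip[rule_format] and quad = quad[rule_format]
  have Yy: "Y 0 = y"
  proof
    fix i
    have "(\<lambda>k. x (n (s k)) i) \<longlonglongrightarrow> y i"
      using LIMSEQ_subseq_LIMSEQ[OF y s, of i] by (simp add: o_def)
    then show "Y 0 i = y i" using LIMSEQ_unique Y0[of i] by fastforce
  qed
  interpret N0: nonexp_field "relval r t p" t by (rule nonexp_field_relval[OF p t])
  have st1: "relval r t p (Y u) i = \<rho>" if "u \<le> 0" for u i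
    by (rule N0.backward_solution_stationary(1)[OF quad[unfolded h_def] lip bd relval_shift[OF p] f_lip q that])
  have st2: "Y u i - Y u j = Y 0 i - Y 0 j" if "u \<le> 0" for u i j
    by (rule N0.backward_solution_stationary(2)[OF quad[unfolded h_def] lip bd relval_shift[OF p] f_lip q that])
  show "relval r t p y i = \<rho>" using st1[of 0] by (simp add: Yy)
  have "f (Y 0) = \<rho>"
  proof (rule backward_solution_level[of Y \<rho> f C L "1 + K"])
    show "\<bar>Y v i - Y u i - (v - u) * (\<rho> - f (Y u))\<bar> \<le> C * (v - u)\<^sup>2" if "u \<le> 0" "v \<le> 0" for u v i
      using quad[OF that, of i] st1[OF that(1), of i] by (simp add: h_def)
  qed (fact lip bd st2 f_sistr)+
  then show "f y = \<rho>" by (simp add: Yy)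
qed

text \<open>In a bounded sequence, a functional that stays away from b along a subsequence would do
  so at a limit point. It serves for f and for the drift.\<close>

lemma tendsto_of_limit_points:
  assumes phi: "supnorm_lipschitz \<phi> L"
    and lp: "\<And>y. (\<And>i. relval r t p y i = \<rho>) \<Longrightarrow> f y = \<rho> \<Longrightarrow> \<phi> y = b"
  shows "(\<lambda>n. \<phi> (x n)) \<longlonglongrightarrow> b"
proof (rule LIMSEQ_I, rule ccontr)
  fix e :: real assume e: "0 < e" and ne: "\<not> (\<exists>no. \<forall>n\<ge>no. norm (\<phi> (x n) - b) < e)"
  have "\<not> (\<forall>\<^sub>F n in sequentially. norm (\<phi> (x n) - b) < e)"
    using ne unfolding eventually_sequentially .
  then obtain n where n: "strict_mono (n :: nat \<Rightarrow> nat)" "\<And>k. \<not> norm (\<phi> (x (n k)) - b) < e"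
    using not_eventually_sequentiallyD by blast
  obtain K where K: "\<And>n. supnorm (x n) \<le> K" using iterates_bounded by blast
  have "\<bar>x (n k) i\<bar> \<le> K" for k i using supnorm_ge[of "x (n k)" i] K[of "n k"] by linarith
  then obtain s y
    where s: "strict_mono (s :: nat \<Rightarrow> nat)" "\<And>i. (\<lambda>k. x (n (s k)) i) \<longlonglongrightarrow> y i"
    using pointwise_bounded_subseq[of "\<lambda>k. x (n k)" K] by blast
  have top: "filterlim (\<lambda>k. n (s k)) at_top sequentially"
    by (rule filterlim_compose[OF filterlim_subseq[OF n(1)] filterlim_subseq[OF s(1)]])
  have "\<phi> y = b"
    using limit_point_solution[of "\<lambda>k. n (s k)" y, OF top s(2)] lp by blast
  moreover have "(\<lambda>k. \<phi> (x (n (s k)))) \<longlonglongrightarrow> \<phi> y"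
    by (rule supnorm_lipschitz_tendsto[OF phi s(2)])
  ultimately obtain N where "norm (\<phi> (x (n (s N))) - b) < e"
    using LIMSEQ_D[OF _ e, of "\<lambda>k. \<phi> (x (n (s k)))" b] by auto
  with n(2) show False by blast
qed

lemma f_tendsto: "(\<lambda>n. f (x n)) \<longlonglongrightarrow> \<rho>"
  by (rule tendsto_of_limit_points[OF f_lip]) simp

lemma h_tendsto: "(\<lambda>n. h (x n) i) \<longlonglongrightarrow> 0"
  by (rule tendsto_of_limit_points[OF h_lip]) (simp add: h_def)

text \<open>The drift vanishes along the iterates, so they move arbitrarily slowly.\<close>

lemma window_oscillation:
  assumes T: "0 < T" and e: "0 < e"
  shows "\<exists>N. \<forall>m\<ge>N. \<forall>n\<ge>m. c n - c m \<le> T \<longrightarrow> (\<forall>i. \<bar>x n i - x m i\<bar> \<le> e)"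
proof -
  obtain K where K: "\<And>n. supnorm (x n) \<le> K" using iterates_bounded by blast
  have WK: "W m \<le> 1 + K" for m
  proof -
    obtain j where "W m = 1 + supnorm (x j)" using W_rec by blast
    then show ?thesis using K[of j] by simp
  qed
  have K1: "0 < 1 + K" using WK[of 0] W_ge_1[of 0] by simp
  define d where "d = min 1 (e / (2 * (1 + K)))"
  have d: "0 < d" "d \<le> 1" unfolding d_def using e K1 by auto
  have "d * (1 + K) \<le> e / (2 * (1 + K)) * (1 + K)"
    using K1 by (intro mult_right_mono) (auto simp: d_def)
  also have "\<dots> = e / 2" using K1 by (simp add: field_simps)
  finally have d2: "d * (1 + K) \<le> e / 2" .
  define B where "B = e / (2 * (T + 1))"
  have B: "0 < B" "B * (T + 1) = e / 2" unfolding B_def using e T by (auto simp: field_simps)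
  obtain N1 where N1: "\<And>m n B i. m \<ge> N1 \<Longrightarrow> n \<ge> m \<Longrightarrow> c n - c m \<le> T \<Longrightarrow> 0 \<le> B \<Longrightarrow>
      (\<forall>j\<in>{m..<n}. \<bar>h (x j) i\<bar> \<le> B) \<Longrightarrow> \<bar>x n i - x m i\<bar> \<le> B * (c n - c m + d) + d * W n"
    using window_bound[OF T d(1)] by blast
  have "\<forall>\<^sub>F n in sequentially. \<forall>i. \<bar>h (x n) i\<bar> < B"
  proof (rule eventually_all_finite)
    fix i show "\<forall>\<^sub>F n in sequentially. \<bar>h (x n) i\<bar> < B"
      using h_tendsto[of i] B(1) unfolding tendsto_iff dist_real_def by simp
  qed
  then obtain N2 where N2: "\<And>n i. n \<ge> N2 \<Longrightarrow> \<bar>h (x n) i\<bar> < B"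
    unfolding eventually_sequentially by blast
  show ?thesis
  proof (intro exI[of _ "max N1 N2"] allI impI)
    fix m n i assume m: "max N1 N2 \<le> m" and n: "m \<le> n" and cT: "c n - c m \<le> T"
    have "\<bar>x n i - x m i\<bar> \<le> B * (c n - c m + d) + d * W n"
      by (rule N1) (use m n cT B N2 in \<open>auto simp: less_imp_le\<close>)
    also have "\<dots> \<le> B * (T + 1) + d * (1 + K)"
      using cT d B WK[of n] by (intro add_mono mult_left_mono) auto
    also have "\<dots> \<le> e" using B d2 by simp
    finally show "\<bar>x n i - x m i\<bar> \<le> e" .
  qed
qed

lemma increments_tendsto: "(\<lambda>n. x (Suc n) i - x n i) \<longlonglongrightarrow> 0"
proof (rule LIMSEQ_I)
  fix e :: real assume e: "0 < e"
  have e2: "0 < e / 2" using e by simp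
  obtain N1 where N1: "\<And>m n i. m \<ge> N1 \<Longrightarrow> n \<ge> m \<Longrightarrow> c n - c m \<le> 1 \<Longrightarrow> \<bar>x n i - x m i\<bar> \<le> e / 2"
    using window_oscillation[OF zero_less_one e2] by blast
  obtain N2 where N2: "\<And>n. n \<ge> N2 \<Longrightarrow> \<bar>c (Suc n) - c n\<bar> < 1"
    using LIMSEQ_D[OF c_gap zero_less_one] by auto
  show "\<exists>no. \<forall>n\<ge>no. norm (x (Suc n) i - x n i - 0) < e"
  proof (intro exI[of _ "max N1 N2"] allI impI)
    fix n assume n: "max N1 N2 \<le> n"
    have "\<bar>x (Suc n) i - x n i\<bar> \<le> e / 2"
      by (rule N1) (use n N2[of n] in auto)
    then show "norm (x (Suc n) i - x n i - 0) < e" using e by simp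
  qed
qed

end

section \<open>Limit sets of slowly moving bounded sequences\<close>

text \<open>Two separated pieces of the limit set lie at a distance d, while the sequence stays
  within \<open>d / 3\<close> of the limit set and moves by less than \<open>d / 3\<close> per step.
  It can therefore never cross from one piece to the other, though it must visit both infinitely
  often.\<close>

lemma limit_set_compact_connected:
  fixes x :: "nat \<Rightarrow> 'i::finite \<Rightarrow> real"
  assumes bd: "\<And>n i. \<bar>x n i\<bar> \<le> K" and inc: "\<And>i. (\<lambda>n. x (Suc n) i - x n i) \<longlonglongrightarrow> 0"
    and lp: "\<And>n y. filterlim n at_top sequentially \<Longrightarrow> (\<And>i. (\<lambda>k. x (n k) i) \<longlonglongrightarrow> y i) \<Longrightarrow> y \<in> Z"
  shows "\<exists>A. compact A \<and> connected A \<and> A \<subseteq> Z \<and> (\<lambda>n. INF q\<in>A. supnorm (\<lambda>i. x n i - q i)) \<longlonglongrightarrow> 0"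
proof -
  define X where "X n = (\<chi> i. x n i)" for n
  have Xi: "X n $ i = x n i" for n i by (simp add: X_def)
  have "norm (X n) \<le> real CARD('i) * K" for n
  proof -
    have "norm (X n) \<le> (\<Sum>i\<in>UNIV. \<bar>X n $ i\<bar>)" by (rule norm_le_l1_cart)
    also have "\<dots> \<le> (\<Sum>i\<in>(UNIV::'i set). K)"
      by (intro sum_mono) (simp add: X_def bd)
    finally show ?thesis by simp
  qed
  then have X_bdd: "bounded (range X)" by (auto intro: boundedI)
  define L where "L = (\<Inter>N. closure (X ` {N..}))"
  have L_compact: "compact L"
  proof -
    have "L \<subseteq> closure (range X)" unfolding L_def by (rule INF_lower2[of 0]) auto
    then have "bounded L" using bounded_closure[OF X_bdd] bounded_subset by blast
    moreover have "closed L" unfolding L_def by auto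
    ultimately show ?thesis by (simp add: compact_eq_bounded_closed)
  qed
  have L_I: "l \<in> L" if n: "filterlim n at_top sequentially" and l: "(\<lambda>k. X (n k)) \<longlonglongrightarrow> l" for n l
    unfolding L_def
  proof
    fix N
    have "\<forall>\<^sub>F k in sequentially. N \<le> n k" using n unfolding filterlim_at_top by blast
    then have "\<forall>\<^sub>F k in sequentially. X (n k) \<in> closure (X ` {N..})"
      by (rule eventually_mono) (auto intro: closure_subset[THEN subsetD])
    then show "l \<in> closure (X ` {N..})"
      using Lim_in_closed_set[OF closed_closure _ sequentially_bot l] by blast
  qed
  have near: "\<forall>\<^sub>F n in sequentially. \<exists>l\<in>L. dist (X n) l < e" if e: "0 < e" for e
  proof (rule ccontr)
    assume "\<not> ?thesis"
    then obtain n where n: "strict_mono (n :: nat \<Rightarrow> nat)" "\<And>k. \<not> (\<exists>l\<in>L. dist (X (n k)) l < e)"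
      using not_eventually_sequentiallyD by blast
    have "bounded (range (\<lambda>k. X (n k)))" by (rule bounded_subset[OF X_bdd]) auto
    then obtain l s where s: "strict_mono (s :: nat \<Rightarrow> nat)" "((\<lambda>k. X (n k)) \<circ> s) \<longlonglongrightarrow> l"
      using bounded_imp_convergent_subsequence by blast
    have "l \<in> L"
      by (rule L_I[of "\<lambda>k. n (s k)"])
         (use s(2) filterlim_compose[OF filterlim_subseq[OF n(1)] filterlim_subseq[OF s(1)]] in \<open>auto simp: o_def\<close>)
    moreover obtain k where "dist (X (n (s k))) l < e"
      using metric_LIMSEQ_D[OF s(2) e] by auto
    ultimately show False using n(2) by blast
  qed
  have L_lp: "(\<lambda>i. l $ i) \<in> Z" if l: "l \<in> L" for l
  proof -
    have "\<exists>n\<ge>k. dist (X n) l < 1 / real (Suc k)" for k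
    proof -
      have "l \<in> closure (X ` {k..})" using l unfolding L_def by blast
      then have "\<exists>z\<in>X ` {k..}. dist z l < 1 / real (Suc k)"
        unfolding closure_approachable by (elim allE impE) auto
      then show ?thesis by blast
    qed
    then obtain n where n: "\<And>k. k \<le> n k" "\<And>k. dist (X (n k)) l < 1 / real (Suc k)" by metis
    have "(\<lambda>k. dist (X (n k)) l) \<longlonglongrightarrow> 0"
      by (rule tendsto_sandwich[OF _ _ tendsto_const LIMSEQ_inverse_real_of_nat[unfolded inverse_eq_divide]])
         (use n(2) in \<open>auto simp: less_imp_le\<close>)
    then have "(\<lambda>k. X (n k)) \<longlonglongrightarrow> l" by (rule tendsto_dist_iff[THEN iffD2])
    then have "(\<lambda>k. x (n k) i) \<longlonglongrightarrow> l $ i" for i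
      using tendsto_vec_nth[of "\<lambda>k. X (n k)" l sequentially i] by (simp add: Xi)
    moreover have "filterlim n at_top sequentially"
      by (rule filterlim_at_top_mono[OF filterlim_ident]) (use n(1) in auto)
    ultimately show ?thesis by (intro lp) auto
  qed
  have L_ne: "L \<noteq> {}" using near[of 1] eventually_happens'[OF sequentially_bot] by force
  have X_inc: "(\<lambda>n. dist (X (Suc n)) (X n)) \<longlonglongrightarrow> 0"
  proof (rule tendsto_sandwich[of "\<lambda>_. 0"])
    show "(\<lambda>n. \<Sum>i\<in>UNIV. \<bar>x (Suc n) i - x n i\<bar>) \<longlonglongrightarrow> 0"
      by (intro tendsto_null_sum tendsto_rabs_zero inc)
    have "dist (X (Suc n)) (X n) \<le> (\<Sum>i\<in>UNIV. \<bar>x (Suc n) i - x n i\<bar>)" for n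
      using norm_le_l1_cart[of "X (Suc n) - X n"] by (simp add: dist_norm Xi)
    then show "\<forall>\<^sub>F n in sequentially. dist (X (Suc n)) (X n) \<le> (\<Sum>i\<in>UNIV. \<bar>x (Suc n) i - x n i\<bar>)" by simp
  qed auto
  have "connected L"
    unfolding connected_closed
  proof
    assume "\<exists>A B. closed A \<and> closed B \<and> L \<subseteq> A \<union> B \<and> A \<inter> B \<inter> L = {} \<and> A \<inter> L \<noteq> {} \<and> B \<inter> L \<noteq> {}"
    then obtain A B where AB: "closed A" "closed B" "L \<subseteq> A \<union> B" "A \<inter> B \<inter> L = {}" "A \<inter> L \<noteq> {}" "B \<inter> L \<noteq> {}"
      by blast
    have cA: "compact (A \<inter> L)" and cB: "closed (B \<inter> L)"
      using AB L_compact compact_imp_closed[OF L_compact] by (auto simp: closed_Int_compact)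
    have "(A \<inter> L) \<inter> (B \<inter> L) = {}" using AB(4) by blast
    then obtain d where d: "0 < d" "\<And>u v. u \<in> A \<inter> L \<Longrightarrow> v \<in> B \<inter> L \<Longrightarrow> d \<le> dist u v"
      using separate_compact_closed[OF cA cB] by blast
    have d3: "0 < d / 3" using d by simp
    have "\<forall>\<^sub>F n in sequentially. dist (X (Suc n)) (X n) < d / 3"
      by (rule order_tendstoD(2)[OF X_inc d3])
    then have "\<forall>\<^sub>F n in sequentially. (\<exists>l\<in>L. dist (X n) l < d / 3) \<and> dist (X (Suc n)) (X n) < d / 3"
      by (rule eventually_conj[OF near[OF d3]])
    then obtain N where N: "\<And>n. n \<ge> N \<Longrightarrow> \<exists>l\<in>L. dist (X n) l < d / 3" "\<And>n. n \<ge> N \<Longrightarrow> dist (X (Suc n)) (X n) < d / 3"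
      unfolding eventually_sequentially by blast
    obtain u v where uv: "u \<in> A \<inter> L" "v \<in> B \<inter> L" using AB by blast
    have visit: "\<exists>n\<ge>m. dist (X n) w < d / 3" if "w \<in> L" for w m
    proof -
      have "w \<in> closure (X ` {m..})" using that unfolding L_def by blast
      then show ?thesis using d3 unfolding closure_approachable by fastforce
    qed
    obtain n0 where n0: "n0 \<ge> N" "dist (X n0) u < d / 3" using visit[of u N] uv by blast
    \<comment> \<open>Crossing would need three distances below \<open>d / 3\<close> to bridge the
      gap d.\<close>
    have stay: "\<exists>l\<in>A \<inter> L. dist (X n) l < d / 3" if "n \<ge> n0" for n
      using that
    proof (induction n rule: dec_induct)
      case base then show ?case using n0 uv by blast
    next
      case (step n)
      obtain l where l: "l \<in> A \<inter> L" "dist (X n) l < d / 3" using step by blast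
      obtain l' where l': "l' \<in> L" "dist (X (Suc n)) l' < d / 3" using N(1)[of "Suc n"] step(1) n0 by auto
      have "l' \<in> A"
      proof (rule ccontr)
        assume "l' \<notin> A"
        then have "l' \<in> B \<inter> L" using AB(3) l' by blast
        then have "d \<le> dist l l'" by (rule d(2)[OF l(1)])
        also have "\<dots> \<le> dist (X n) l + dist (X (Suc n)) (X n) + dist (X (Suc n)) l'"
          using dist_triangle[of l l' "X n"] dist_triangle[of "X n" l' "X (Suc n)"]
          by (simp add: dist_commute)
        also have "\<dots> < d" using l(2) l'(2) N(2)[of n] step(1) n0(1) by simp
        finally show False by simp
      qed
      then show ?case using l' by blast
    qed
    obtain n where n: "n \<ge> n0" "dist (X n) v < d / 3" using visit[of v n0] uv by blast
    obtain l where l: "l \<in> A \<inter> L" "dist (X n) l < d / 3" using stay[OF n(1)] by blast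
    have "d \<le> dist l v" by (rule d(2)[OF l(1) uv(2)])
    also have "\<dots> \<le> dist (X n) l + dist (X n) v" using dist_triangle[of l v "X n"] by (simp add: dist_commute)
    finally show False using l(2) n(2) d(1) by simp
  qed
  \<comment> \<open>Back from Euclidean vectors to functions; evaluation of coordinates is
    continuous and carries compactness and connectedness along.\<close>
  define A where "A = (\<lambda>l i. l $ i) ` L"
  have cont: "continuous_on L (\<lambda>l i. l $ i)"
    by (intro continuous_on_coordinatewise_then_product continuous_intros)
  have "(\<lambda>n. INF q\<in>A. supnorm (\<lambda>i. x n i - q i)) \<longlonglongrightarrow> 0"
  proof (rule LIMSEQ_I)
    fix e :: real assume "0 < e"
    from near[OF this] obtain N where N: "\<And>n. n \<ge> N \<Longrightarrow> \<exists>l\<in>L. dist (X n) l < e"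
      unfolding eventually_sequentially by blast
    show "\<exists>no. \<forall>n\<ge>no. norm ((INF q\<in>A. supnorm (\<lambda>i. x n i - q i)) - 0) < e"
    proof (intro exI[of _ N] allI impI)
      fix n assume "N \<le> n"
      then obtain l where l: "l \<in> L" "dist (X n) l < e" using N by blast
      have bb: "bdd_below ((\<lambda>q. supnorm (\<lambda>i. x n i - q i)) ` A)"
        by (rule bdd_belowI2[of _ 0]) (rule supnorm_nonneg)
      have "(INF q\<in>A. supnorm (\<lambda>i. x n i - q i)) \<le> supnorm (\<lambda>i. x n i - l $ i)"
        by (rule cINF_lower[OF bb, of "\<lambda>i. l $ i"]) (use l in \<open>simp add: A_def\<close>)
      also have "\<dots> \<le> dist (X n) l"
        unfolding supnorm_le_iff dist_norm
        using component_le_norm_cart[of "X n - l"] by (simp add: Xi)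
      finally have "(INF q\<in>A. supnorm (\<lambda>i. x n i - q i)) < e" using l(2) by simp
      moreover have "0 \<le> (INF q\<in>A. supnorm (\<lambda>i. x n i - q i))"
        by (rule cINF_greatest) (use L_ne in \<open>auto simp: A_def supnorm_nonneg\<close>)
      ultimately show "norm ((INF q\<in>A. supnorm (\<lambda>i. x n i - q i)) - 0) < e" by simp
    qed
  qed
  moreover have "compact A" unfolding A_def by (rule compact_continuous_image[OF cont L_compact])
  moreover have "connected A" unfolding A_def by (rule connected_continuous_image[OF cont \<open>connected L\<close>])
  moreover have "A \<subseteq> Z" using L_lp by (auto simp: A_def)
  ultimately show ?thesis by blast
qed

section \<open>A sample path of the algorithm\<close>

text \<open>The running maximum of the norms. The summand 1 keeps it away from 0, so that it may
  divide.\<close>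

definition envelope :: "(nat \<Rightarrow> 'i::finite \<Rightarrow> real) \<Rightarrow> nat \<Rightarrow> real" where
  "envelope x n = Max ((\<lambda>k. 1 + supnorm (x k)) ` {..n})"

lemma envelope_ge: "k \<le> n \<Longrightarrow> 1 + supnorm (x k) \<le> envelope x n"
  unfolding envelope_def by (rule Max_ge) auto

lemma envelope_attained: "\<exists>k\<le>n. envelope x n = 1 + supnorm (x k)"
proof -
  have "envelope x n \<in> (\<lambda>k. 1 + supnorm (x k)) ` {..n}"
    unfolding envelope_def by (rule Max_in) auto
  then show ?thesis by auto
qed

lemma envelope_mono: "mono (envelope x)"
  unfolding envelope_def by (intro monoI Max_mono) auto

lemma envelope_ge_1: "1 \<le> envelope x n"
  using envelope_ge[of n n x] supnorm_nonneg[of "x n"] by linarith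

lemma supnorm_lipschitz_diff:
  assumes "supnorm_lipschitz f L" "supnorm_lipschitz g K"
  shows "supnorm_lipschitz (\<lambda>x. f x - g x) (L + K)"
proof -
  have "\<bar>(f x - g x) - (f y - g y)\<bar> \<le> (L + K) * supnorm (\<lambda>i. x i - y i)" for x y
  proof -
    have "\<bar>f x - f y\<bar> \<le> L * supnorm (\<lambda>i. x i - y i)" "\<bar>g x - g y\<bar> \<le> K * supnorm (\<lambda>i. x i - y i)"
      using assms unfolding supnorm_lipschitz_def by blast+
    then show ?thesis by (simp add: distrib_right)
  qed
  then show ?thesis using assms unfolding supnorm_lipschitz_def by simp
qed

lemma supnorm_lipschitz_weaken:
  assumes "supnorm_lipschitz f L" "L \<le> K"
  shows "supnorm_lipschitz f K"
proof -
  have "\<bar>f x - f y\<bar> \<le> K * supnorm (\<lambda>i. x i - y i)" for x y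
    using assms mult_right_mono[OF assms(2) supnorm_nonneg[of "\<lambda>i. x i - y i"]]
    unfolding supnorm_lipschitz_def by (meson order_trans)
  then show ?thesis using assms unfolding supnorm_lipschitz_def by simp
qed

text \<open>The reciprocal of the estimated holding time is capped at \<open>2 / t i\<close>, and
  the noise is divided by the envelope; both give the weights constant bounds before anything is
  known about convergence. The noise of the next state is split into one indicator per state s, so
  that the weight \<open>vmax (x n) s\<close> is known before the sample is drawn.\<close>

locale rvi_path = async_clock \<alpha> Y \<Delta>
  for \<alpha> :: "nat \<Rightarrow> real" and Y :: "nat \<Rightarrow> ('s::finite \<times> 'a::finite) set" and \<Delta> :: real +
  fixes r t :: "'s \<times> 'a \<Rightarrow> real" and p :: "'s \<times> 'a \<Rightarrow> 's \<Rightarrow> real"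
    and f finf :: "('s \<times> 'a \<Rightarrow> real) \<Rightarrow> real" and Lf \<rho> :: real and q :: "'s \<times> 'a \<Rightarrow> real"
    and x \<theta> :: "nat \<Rightarrow> 's \<times> 'a \<Rightarrow> real" and S :: "nat \<Rightarrow> 's \<times> 'a \<Rightarrow> 's" and R :: "nat \<Rightarrow> 's \<times> 'a \<Rightarrow> real"
  assumes p: "stoch_kernel p" and meet: "meeting p" and t: "\<And>i. 0 < t i"
    and f_lip: "supnorm_lipschitz f Lf" and f_sistr: "\<And>y. sistr_at f y"
    and finf: "\<And>y. ((\<lambda>c. f (\<lambda>i. c * y i) / c) \<longlongrightarrow> finf y) at_top"
    and finf_sistr: "sistr_at finf (\<lambda>_. 0)"
    and q: "\<And>i. relval r t p q i = \<rho>"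
    and x_step: "\<And>n i. x (Suc n) i = x n i + step_size \<alpha> Y n i *
        ((R n i + vmax (x n) (S n i) - x n i) / \<theta> n i - f (x n))"
    and theta_pos: "\<And>n i. 0 < \<theta> n i" and theta_lim: "\<And>i. (\<lambda>n. \<theta> n i) \<longlonglongrightarrow> t i"
    and sum_R: "\<And>i. summable (\<lambda>n. step_size \<alpha> Y n i * min (1 / \<theta> n i) (2 / t i) / envelope x n *
        (R n i - r i))"
    and sum_S: "\<And>i s. summable (\<lambda>n. step_size \<alpha> Y n i * min (1 / \<theta> n i) (2 / t i) *
        vmax (x n) s / envelope x n * ((if S n i = s then 1 else 0) - p i s))"
begin

definition err :: "nat \<Rightarrow> 's \<times> 'a \<Rightarrow> real" where
  "err n i = step_size \<alpha> Y n i * ((R n i + vmax (x n) (S n i) - x n i) / \<theta> n i - relval r t p (x n) i)"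

definition noise :: "nat \<Rightarrow> 's \<times> 'a \<Rightarrow> real" where
  "noise n i = step_size \<alpha> Y n i * min (1 / \<theta> n i) (2 / t i) / envelope x n * (R n i - r i) +
    (\<Sum>s\<in>UNIV. step_size \<alpha> Y n i * min (1 / \<theta> n i) (2 / t i) *
        vmax (x n) s / envelope x n * ((if S n i = s then 1 else 0) - p i s))"

lemma noise_eq: "envelope x n * noise n i = step_size \<alpha> Y n i * min (1 / \<theta> n i) (2 / t i) *
    (R n i - r i + vmax (x n) (S n i) - (\<Sum>s\<in>UNIV. p i s * vmax (x n) s))"
proof -
  define k where "k = step_size \<alpha> Y n i * min (1 / \<theta> n i) (2 / t i)"
  have W: "envelope x n \<noteq> 0" using envelope_ge_1[of x n] by simp
  have "(\<Sum>s\<in>UNIV. vmax (x n) s * ((if S n i = s then 1 else 0) - p i s))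
      = vmax (x n) (S n i) - (\<Sum>s\<in>UNIV. p i s * vmax (x n) s)"
    by (simp add: right_diff_distrib sum_subtractf mult.commute if_distrib[of "\<lambda>u. _ * u"] cong: if_cong)
  moreover have "noise n i = k / envelope x n * (R n i - r i) +
      k / envelope x n * (\<Sum>s\<in>UNIV. vmax (x n) s * ((if S n i = s then 1 else 0) - p i s))"
    unfolding noise_def k_def[symmetric] by (simp add: sum_distrib_left mult.assoc)
  ultimately have "noise n i = k / envelope x n *
      (R n i - r i + vmax (x n) (S n i) - (\<Sum>s\<in>UNIV. p i s * vmax (x n) s))"
    by (simp only: add_diff_eq[symmetric] distrib_left add.assoc)
  then show ?thesis using W by (simp add: k_def)
qed

lemma noise_summable: "summable (\<lambda>n. noise n i)"
  unfolding noise_def by (intro summable_add summable_sum sum_R sum_S)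

text \<open>As soon as \<open>\<theta> n i\<close> exceeds \<open>t i / 2\<close> the cap is
  inactive. Apart from noise there remains the bias of dividing by \<open>\<theta> n i\<close> in
  place of \<open>t i\<close>.\<close>

lemma err_eventually: "\<forall>\<^sub>F n in sequentially. err n i = envelope x n * noise n i +
    step_size \<alpha> Y n i * (relval r t p (x n) i * (t i / \<theta> n i - 1))"
proof -
  have "\<forall>\<^sub>F n in sequentially. t i / 2 < \<theta> n i"
    by (rule order_tendstoD(1)[OF theta_lim]) (use t[of i] in simp)
  then show ?thesis
  proof (rule eventually_mono)
    fix n assume th: "t i / 2 < \<theta> n i"
    have "min (1 / \<theta> n i) (2 / t i) = 1 / \<theta> n i"
      using th t[of i] theta_pos[of n i] by (simp add: field_simps)
    moreover have "r i + (\<Sum>s\<in>UNIV. p i s * vmax (x n) s) - x n i = t i * relval r t p (x n) i"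
      using t[of i] by (simp add: relval_def)
    then have "(R n i + vmax (x n) (S n i) - x n i) =
        (R n i - r i + vmax (x n) (S n i) - (\<Sum>s\<in>UNIV. p i s * vmax (x n) s)) + t i * relval r t p (x n) i"
      by simp
    then have "(R n i + vmax (x n) (S n i) - x n i) / \<theta> n i =
        1 / \<theta> n i * (R n i - r i + vmax (x n) (S n i) - (\<Sum>s\<in>UNIV. p i s * vmax (x n) s)) +
        relval r t p (x n) i * (t i / \<theta> n i)"
      by (simp only: add_divide_distrib) simp
    ultimately show "err n i = envelope x n * noise n i +
        step_size \<alpha> Y n i * (relval r t p (x n) i * (t i / \<theta> n i - 1))"
      unfolding err_def noise_eq by (simp only: distrib_left right_diff_distrib mult.assoc mult_1_right add_diff_eq)
  qed
qed

lemma relval_le_envelope: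
  "\<bar>relval r t p (x n) i\<bar> \<le> (\<bar>r i\<bar> / t i + 2 / t i) * envelope x n"
proof -
  have "\<bar>r i\<bar> / t i \<le> \<bar>r i\<bar> / t i * envelope x n"
    using mult_left_mono[of 1 "envelope x n" "\<bar>r i\<bar> / t i"] t[of i] envelope_ge_1[of x n] by simp
  moreover have "2 / t i * supnorm (x n) \<le> 2 / t i * envelope x n"
    using t[of i] envelope_ge[of n n x] by (intro mult_left_mono) auto
  ultimately show ?thesis
    using relval_bound[where x = "x n" and i = i and r = r and t = t, OF p t] by (simp add: distrib_right)
qed

text \<open>Summation by parts restores the envelope in the noise. The bias is at most a vanishing
  factor times the envelope times the step mass of the window, which balance bounds by
  \<open>T + 1\<close>.\<close>

lemma err_small:
  assumes T: "0 < T" and e: "0 < e"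
  shows "\<exists>N. \<forall>m\<ge>N. \<forall>n\<ge>m. clock n - clock m \<le> T \<longrightarrow> \<bar>\<Sum>j=m..<n. err j i\<bar> \<le> e * envelope x n"
proof -
  define C where "C = \<bar>r i\<bar> / t i + 2 / t i"
  have C: "0 < C" using t[of i] by (simp add: C_def add_nonneg_pos)
  define d where "d = e / (2 * C * (T + 1))"
  have d: "0 < d" using e C T by (simp add: d_def)
  have dC: "C * d * (T + 1) = e / 2" using C T unfolding d_def by (simp add: divide_simps)
  have "(\<lambda>n. t i / \<theta> n i - 1) \<longlonglongrightarrow> t i / t i - 1"
    using t[of i] by (intro tendsto_intros theta_lim) simp
  then have "(\<lambda>n. t i / \<theta> n i - 1) \<longlonglongrightarrow> 0" using t[of i] by simp
  then have "\<forall>\<^sub>F n in sequentially. \<bar>t i / \<theta> n i - 1\<bar> < d"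
    using d unfolding tendsto_iff dist_real_def by simp
  with err_eventually[of i] obtain N1 where N1: "\<And>n. n \<ge> N1 \<Longrightarrow> err n i = envelope x n * noise n i +
      step_size \<alpha> Y n i * (relval r t p (x n) i * (t i / \<theta> n i - 1))" "\<And>n. n \<ge> N1 \<Longrightarrow> \<bar>t i / \<theta> n i - 1\<bar> < d"
    unfolding eventually_sequentially by (metis max.bounded_iff)
  have e2: "0 < e / 2" using e by simp
  have W0: "0 \<le> envelope x n" for n using envelope_ge_1[of x n] by simp
  obtain N2 where N2: "\<And>m n. m \<ge> N2 \<Longrightarrow> n \<ge> m \<Longrightarrow> \<bar>\<Sum>j=m..<n. envelope x j * noise j i\<bar> \<le> e / 2 * envelope x n"
    using abel_weighted_sum_small[OF envelope_mono W0 noise_summable e2] by blast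
  obtain N3 where N3: "\<And>m n. m \<ge> N3 \<Longrightarrow> n \<ge> m \<Longrightarrow> clock n - clock m \<le> T \<Longrightarrow>
      \<bar>(\<Sum>k=m..<n. step_size \<alpha> Y k i) - (clock n - clock m)\<bar> \<le> 1"
    using clock_balanced[OF T zero_less_one] by blast
  show ?thesis
  proof (intro exI[of _ "max N1 (max N2 N3)"] allI impI)
    fix m n assume m: "max N1 (max N2 N3) \<le> m" and n: "m \<le> n" and cT: "clock n - clock m \<le> T"
    have "\<bar>\<Sum>j=m..<n. step_size \<alpha> Y j i * (relval r t p (x j) i * (t i / \<theta> j i - 1))\<bar>
        \<le> (\<Sum>j=m..<n. step_size \<alpha> Y j i * (C * envelope x n * d))"
    proof (rule order_trans[OF sum_abs], rule sum_mono)
      fix j assume j: "j \<in> {m..<n}"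
      have "\<bar>relval r t p (x j) i\<bar> \<le> C * envelope x j"
        unfolding C_def by (rule relval_le_envelope)
      also have "\<dots> \<le> C * envelope x n"
        using j C monoD[OF envelope_mono, of j n x] by (intro mult_left_mono) auto
      finally have "\<bar>relval r t p (x j) i\<bar> * \<bar>t i / \<theta> j i - 1\<bar> \<le> C * envelope x n * d"
        using N1(2)[of j] j m C W0[of n] by (intro mult_mono) auto
      then show "\<bar>step_size \<alpha> Y j i * (relval r t p (x j) i * (t i / \<theta> j i - 1))\<bar>
          \<le> step_size \<alpha> Y j i * (C * envelope x n * d)"
        unfolding abs_mult using step_size_nonneg[of j i] by (simp add: mult_left_mono)
    qed
    also have "\<dots> = (\<Sum>j=m..<n. step_size \<alpha> Y j i) * (C * envelope x n * d)"
      by (simp add: sum_distrib_right)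
    also have "\<dots> \<le> (T + 1) * (C * envelope x n * d)"
      using N3[of m n] m n cT C d W0[of n] by (intro mult_right_mono) auto
    also have "\<dots> = C * d * (T + 1) * envelope x n" by (simp add: mult_ac)
    also have "\<dots> = e / 2 * envelope x n" unfolding dC ..
    finally have drift: "\<bar>\<Sum>j=m..<n. step_size \<alpha> Y j i * (relval r t p (x j) i * (t i / \<theta> j i - 1))\<bar>
        \<le> e / 2 * envelope x n" .
    have "(\<Sum>j=m..<n. err j i) = (\<Sum>j=m..<n. envelope x j * noise j i) +
        (\<Sum>j=m..<n. step_size \<alpha> Y j i * (relval r t p (x j) i * (t i / \<theta> j i - 1)))"
      unfolding sum.distrib[symmetric] using m by (intro sum.cong) (auto simp: N1(1))
    then show "\<bar>\<Sum>j=m..<n. err j i\<bar> \<le> e * envelope x n"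
      using drift N2[of m n] m n by simp
  qed
qed

sublocale rvi_iteration x "step_size \<alpha> Y" err "\<lambda>y i. relval r t p y i - f y" "envelope x" clock
  "(\<Sum>i\<in>UNIV. 2 / t i) + Lf" r t p f finf Lf \<rho> q
proof
  fix n i
  show "x (Suc n) i = x n i + step_size \<alpha> Y n i * (relval r t p (x n) i - f (x n)) + err n i"
    unfolding err_def x_step by (simp add: algebra_simps)
  have "2 / t i \<le> (\<Sum>i\<in>UNIV. 2 / t i)"
    using t by (intro member_le_sum) (auto simp: less_imp_le)
  then show "supnorm_lipschitz (\<lambda>y. relval r t p y i - f y) ((\<Sum>i\<in>UNIV. 2 / t i) + Lf)"
    by (intro supnorm_lipschitz_diff supnorm_lipschitz_weaken[OF relval_lipschitz[OF p t]] f_lip)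
qed (fact step_size_nonneg envelope_mono err_small clock_balanced clock_less clock_0 clock_top clock_gap
    p meet t f_lip f_sistr finf finf_sistr q envelope_attained | rule envelope_ge order_refl refl)+

lemma t_tilde_eq: "t_tilde \<alpha> Y n = real CARD('s \<times> 'a) * clock n"
  unfolding clock_def by simp

text \<open>A point of the interpolation lies between two consecutive iterates whose clock times are
  within \<open>B + 1\<close> of that of m, on either side. Both are close to \<open>x m\<close> by
  \<open>window_oscillation\<close>, applied from the earlier index to the later one.\<close>

lemma slow_motion:
  assumes B: "0 < B" and e: "0 < e"
  shows "\<exists>N. \<forall>m\<ge>N. \<forall>s. \<bar>s\<bar> \<le> B \<longrightarrow> (\<forall>i. \<bar>xbar \<alpha> Y x (t_tilde \<alpha> Y m + s) i - x m i\<bar> \<le> e)"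
proof -
  define D where "D = real CARD('s \<times> 'a)"
  have D: "1 \<le> D" unfolding D_def by (simp add: Suc_le_eq del: card_prod)
  have B1: "0 < B + 1" using B by simp
  obtain N1 where N1: "\<And>m n i. m \<ge> N1 \<Longrightarrow> n \<ge> m \<Longrightarrow> clock n - clock m \<le> B + 1 \<Longrightarrow> \<bar>x n i - x m i\<bar> \<le> e"
    using window_oscillation[OF B1 e] by blast
  obtain N2 where N2: "\<And>n. n \<ge> N2 \<Longrightarrow> clock (Suc n) - clock n < 1"
    using order_tendstoD(2)[OF clock_gap zero_less_one] unfolding eventually_sequentially by blast
  define N where "N = max N1 N2"
  \<comment> \<open>Times before that of m are included, so m must be late enough for the window
    reaching B back to stay beyond N.\<close>
  obtain N3 where N3: "\<And>m. m \<ge> N3 \<Longrightarrow> clock N + B \<le> clock m"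
    using clock_top unfolding filterlim_at_top eventually_sequentially by blast
  show ?thesis
  proof (intro exI[of _ "max N N3"] allI impI)
    fix m s i assume m: "max N N3 \<le> m" and s: "\<bar>s\<bar> \<le> B"
    \<comment> \<open>ODE time is D times the clock, so a displacement s is \<open>s / D\<close> on
      the clock.\<close>
    define u where "u = clock m + s / D"
    have sD: "\<bar>s / D\<bar> \<le> B"
    proof -
      have "\<bar>s\<bar> \<le> B * D" using mult_mono[of "\<bar>s\<bar>" B 1 D] s D by simp
      then show ?thesis using D by (simp add: abs_divide pos_divide_le_eq)
    qed
    define n where "n = idx u"
    have uN: "clock N \<le> u" unfolding u_def using N3[of m] m sD by linarith
    then have Nn: "N \<le> n" unfolding n_def by (rule idx_ge)
    have u0: "0 \<le> u" using uN c_mono[of 0 N] clock_0 by simp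
    have n: "clock n \<le> u" "u < clock (Suc n)" unfolding n_def by (rule idx_lower[OF u0] idx_upper)+
    have gap: "clock (Suc n) - clock n < 1" using N2[of n] Nn by (simp add: N_def)
    have lt: "t_tilde \<alpha> Y m + s < t_tilde \<alpha> Y k \<longleftrightarrow> u < clock k" for k
      unfolding t_tilde_eq D_def[symmetric] u_def using D by (simp add: field_simps)
    have near: "\<bar>x k i - x m i\<bar> \<le> e" if k: "k = n \<or> k = Suc n" for k
    proof (cases "m \<le> k")
      case True
      have "clock k \<le> u + 1" using k n gap by auto
      then have "clock k - clock m \<le> B + 1" using abs_le_D1[OF sD] by (simp add: u_def)
      then show ?thesis using N1[of m k i] True m by (simp add: N_def)
    next
      case False
      have "u - 1 \<le> clock k" using k n gap by auto
      then have "clock m - clock k \<le> B + 1" using abs_le_D2[OF sD] by (simp add: u_def)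
      then have "\<bar>x m i - x k i\<bar> \<le> e" using N1[of k m i] False k Nn by (auto simp: N_def)
      then show ?thesis by (simp add: abs_minus_commute)
    qed
    define l where "l = (t_tilde \<alpha> Y m + s - t_tilde \<alpha> Y n) / alpha_tilde \<alpha> Y n"
    have least: "(LEAST n. t_tilde \<alpha> Y m + s < t_tilde \<alpha> Y (Suc n)) = n"
      unfolding lt n_def idx_def ..
    have "\<not> t_tilde \<alpha> Y m + s < 0"
      using u0 D unfolding t_tilde_eq D_def[symmetric] u_def by (simp add: field_simps)
    then have xb: "xbar \<alpha> Y x (t_tilde \<alpha> Y m + s) i = x n i + l * (x (Suc n) i - x n i)"
      unfolding xbar_def least l_def by (simp add: Let_def)
    have "t_tilde \<alpha> Y (Suc n) = t_tilde \<alpha> Y n + alpha_tilde \<alpha> Y n" by (simp add: t_tilde_def)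
    then have l: "0 \<le> l" "l \<le> 1"
      using lt[of n] lt[of "Suc n"] n alpha_tilde_pos[of n] unfolding l_def by simp_all
    have "xbar \<alpha> Y x (t_tilde \<alpha> Y m + s) i - x m i = (1 - l) * (x n i - x m i) + l * (x (Suc n) i - x m i)"
      unfolding xb by (simp add: algebra_simps)
    also have "\<bar>\<dots>\<bar> \<le> (1 - l) * e + l * e"
      using near[of n] near[of "Suc n"] l
      by (intro order_trans[OF abs_triangle_ineq] add_mono) (auto simp: abs_mult intro: mult_left_mono)
    finally show "\<bar>xbar \<alpha> Y x (t_tilde \<alpha> Y m + s) i - x m i\<bar> \<le> e" by (simp add: algebra_simps)
  qed
qed

text \<open>Half of \<delta> is spent on the distance of the base iterate from the limit, half on
  the motion during the window. The infimum is taken in the extended reals, so a trajectory that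
  never leaves the ball has exit time infinity.\<close>

lemma exit_time_tendsto:
  assumes d: "0 < \<delta>" and nk: "strict_mono nk" and y: "\<And>i. (\<lambda>k. x (nk k) i) \<longlonglongrightarrow> y i"
  shows "(\<lambda>k. Inf {ereal \<bar>s\<bar> | s. supnorm (\<lambda>i. xbar \<alpha> Y x (t_tilde \<alpha> Y (nk k) + s) i - y i) > \<delta>}) \<longlonglongrightarrow> \<infinity>"
  unfolding tendsto_PInfty
proof
  fix T :: real
  define B where "B = \<bar>T\<bar> + 1"
  have B: "0 < B" by (simp add: B_def)
  have d2: "0 < \<delta> / 2" using d by simp
  obtain N where N: "\<And>m s i. m \<ge> N \<Longrightarrow> \<bar>s\<bar> \<le> B \<Longrightarrow> \<bar>xbar \<alpha> Y x (t_tilde \<alpha> Y m + s) i - x m i\<bar> \<le> \<delta> / 2"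
    using slow_motion[OF B d2] by blast
  have "\<forall>\<^sub>F k in sequentially. supnorm (\<lambda>i. x (nk k) i - y i) < \<delta> / 2"
    by (rule order_tendstoD(2)[OF tendsto_supnorm_diff d2]) (rule y)
  moreover have "\<forall>\<^sub>F k in sequentially. N \<le> nk k"
    using filterlim_subseq[OF nk] unfolding filterlim_at_top by blast
  ultimately show "\<forall>\<^sub>F k in sequentially. ereal T <
      Inf {ereal \<bar>s\<bar> | s. supnorm (\<lambda>i. xbar \<alpha> Y x (t_tilde \<alpha> Y (nk k) + s) i - y i) > \<delta>}"
  proof eventually_elim
    fix k assume k: "supnorm (\<lambda>i. x (nk k) i - y i) < \<delta> / 2" "N \<le> nk k"
    have "ereal B \<le> Inf {ereal \<bar>s\<bar> | s. supnorm (\<lambda>i. xbar \<alpha> Y x (t_tilde \<alpha> Y (nk k) + s) i - y i) > \<delta>}"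
    proof (rule Inf_greatest)
      fix z assume "z \<in> {ereal \<bar>s\<bar> | s. supnorm (\<lambda>i. xbar \<alpha> Y x (t_tilde \<alpha> Y (nk k) + s) i - y i) > \<delta>}"
      then obtain s where z: "z = ereal \<bar>s\<bar>"
        and s: "\<delta> < supnorm (\<lambda>i. xbar \<alpha> Y x (t_tilde \<alpha> Y (nk k) + s) i - y i)" by blast
      have "\<not> \<bar>s\<bar> \<le> B"
      proof
        assume sB: "\<bar>s\<bar> \<le> B"
        have "supnorm (\<lambda>i. xbar \<alpha> Y x (t_tilde \<alpha> Y (nk k) + s) i - y i) \<le> \<delta>"
          unfolding supnorm_le_iff
        proof
          fix i
          show "\<bar>xbar \<alpha> Y x (t_tilde \<alpha> Y (nk k) + s) i - y i\<bar> \<le> \<delta>"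
            using N[OF k(2) sB, of i] k(1) supnorm_ge[of "\<lambda>i. x (nk k) i - y i" i] by linarith
        qed
        with s show False by simp
      qed
      then show "ereal B \<le> z" by (simp add: z)
    qed
    moreover have "ereal T < ereal B" by (simp add: B_def)
    ultimately show "ereal T < Inf {ereal \<bar>s\<bar> | s. supnorm (\<lambda>i. xbar \<alpha> Y x (t_tilde \<alpha> Y (nk k) + s) i - y i) > \<delta>}"
      by (rule less_le_trans[rotated])
  qed
qed

lemma limit_set:
  "\<exists>K. compact K \<and> connected K \<and> K \<subseteq> {y. (\<forall>i. relval r t p y i = \<rho>) \<and> f y = \<rho>} \<and>
    (\<lambda>n. INF y\<in>K. supnorm (\<lambda>i. x n i - y i)) \<longlonglongrightarrow> 0"
proof -
  obtain B where B: "\<And>n. supnorm (x n) \<le> B" using iterates_bounded by blast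
  have bd: "\<bar>x n i\<bar> \<le> B" for n i using supnorm_ge[of "x n" i] B[of n] by linarith
  show ?thesis
    by (rule limit_set_compact_connected[OF bd increments_tendsto])
       (blast intro: limit_point_solution)
qed

end

section \<open>Almost sure behaviour of the algorithm\<close>

lemma isCont_coordinate: "isCont (\<lambda>x :: 'i::finite \<Rightarrow> real. x i) y"
  by (rule continuous_on_eq_continuous_at[OF open_UNIV, THEN iffD1, rule_format,
        OF continuous_on_product_coordinates]) simp

lemma supnorm_lipschitz_measurable:
  fixes g :: "('i::finite \<Rightarrow> real) \<Rightarrow> real"
  assumes "supnorm_lipschitz g L"
  shows "g \<in> borel_measurable borel"
proof (rule borel_measurable_continuous_onI)
  have "continuous (at y) g" for y
    unfolding isCont_def
  proof (rule supnorm_lipschitz_tendsto[OF assms])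
    fix i
    show "((\<lambda>x. x i) \<longlongrightarrow> y i) (at y)" by (rule isCont_coordinate[unfolded isCont_def])
  qed
  then show "continuous_on UNIV g" by (simp add: continuous_at_imp_continuous_on)
qed

lemma supnorm_lipschitz_vmax: "supnorm_lipschitz (\<lambda>q :: 's::finite \<times> 'a::finite \<Rightarrow> real. vmax q s) 1"
proof -
  have *: "vmax q s - vmax q' s \<le> supnorm (\<lambda>i. q i - q' i)" for q q' :: "'s \<times> 'a \<Rightarrow> real"
    by (rule vmax_diff_le) (use supnorm_ge[of "\<lambda>i. q i - q' i"] abs_le_D1 in blast)
  have "\<bar>vmax q s - vmax q' s\<bar> \<le> supnorm (\<lambda>i. q i - q' i)" for q q' :: "'s \<times> 'a \<Rightarrow> real"
    using *[of q q'] *[of q' q] by (simp add: supnorm_def abs_minus_commute abs_le_iff)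
  then show ?thesis unfolding supnorm_lipschitz_def by simp
qed

lemma supnorm_lipschitz_supnorm: "supnorm_lipschitz (supnorm :: ('i::finite \<Rightarrow> real) \<Rightarrow> real) 1"
proof -
  have *: "supnorm x - supnorm y \<le> supnorm (\<lambda>i. x i - y i)" for x y :: "'i \<Rightarrow> real"
  proof -
    have "\<bar>x i\<bar> \<le> supnorm (\<lambda>i. x i - y i) + supnorm y" for i
      using supnorm_ge[of "\<lambda>i. x i - y i" i] supnorm_ge[of y i] by linarith
    then have "supnorm x \<le> supnorm (\<lambda>i. x i - y i) + supnorm y" by (simp add: supnorm_le_iff)
    then show ?thesis by simp
  qed
  have "\<bar>supnorm x - supnorm y\<bar> \<le> supnorm (\<lambda>i. x i - y i)" for x y :: "'i \<Rightarrow> real"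
    using *[of x y] *[of y x] by (simp add: supnorm_def abs_minus_commute abs_le_iff)
  then show ?thesis unfolding supnorm_lipschitz_def by simp
qed

locale rvi_process = smdp P + filtered_prob_space M F
  for P :: "'s::finite \<times> 'a::finite \<Rightarrow> ('s \<times> real \<times> real) measure"
    and M :: "'w measure" and F :: "nat \<Rightarrow> 'w measure" +
  fixes f :: "('s \<times> 'a \<Rightarrow> real) \<Rightarrow> real"
    and Y :: "nat \<Rightarrow> 'w \<Rightarrow> ('s \<times> 'a) set"
    and X :: "nat \<Rightarrow> 's \<times> 'a \<Rightarrow> 'w \<Rightarrow> 's \<times> real \<times> real"
    and \<alpha> \<beta> \<eta> :: "nat \<Rightarrow> real"
    and Q0 T0 :: "'s \<times> 'a \<Rightarrow> real"
    and Lf :: real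
  assumes M_asm: "assumption_M P"
    and f_lip: "supnorm_lipschitz f Lf"
    and Y_meas: "\<And>n. Y n \<in> measurable (F n) (count_space UNIV)"
    and X_meas: "\<And>n i. X n i \<in> measurable (F (Suc n)) sample_M"
    and X_law: "\<And>n i A B. A \<in> sets (F n) \<Longrightarrow> B \<in> sets sample_M \<Longrightarrow>
        measure M {\<omega> \<in> A. i \<in> Y n \<omega> \<and> X n i \<omega> \<in> B} =
        measure M {\<omega> \<in> A. i \<in> Y n \<omega>} * measure (P i) B"
    and alpha_sq: "summable (\<lambda>n. (\<alpha> n)\<^sup>2)" and alpha_pos: "\<And>n. 0 < \<alpha> n"
    and beta: "req_beta \<beta>"
    and eta: "req_eta \<eta>"
begin

definition Q :: "nat \<Rightarrow> 'w \<Rightarrow> 's \<times> 'a \<Rightarrow> real" where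
  "Q n \<omega> = fst (rvi f \<alpha> \<beta> \<eta> Q0 T0 (\<lambda>k. Y k \<omega>) (\<lambda>k i. X k i \<omega>) n)"

definition T :: "nat \<Rightarrow> 'w \<Rightarrow> 's \<times> 'a \<Rightarrow> real" where
  "T n \<omega> = snd (rvi f \<alpha> \<beta> \<eta> Q0 T0 (\<lambda>k. Y k \<omega>) (\<lambda>k i. X k i \<omega>) n)"

definition \<theta> :: "nat \<Rightarrow> 'w \<Rightarrow> 's \<times> 'a \<Rightarrow> real" where
  "\<theta> n \<omega> i = max (T n \<omega> i) (\<eta> n)"

lemma Q_0: "Q 0 \<omega> = Q0" and T_0: "T 0 \<omega> = T0"
  by (simp_all add: Q_def T_def)

lemma Q_Suc: "Q (Suc n) \<omega> i = Q n \<omega> i + step_size \<alpha> (\<lambda>k. Y k \<omega>) n i *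
    ((snd (snd (X n i \<omega>)) + vmax (Q n \<omega>) (fst (X n i \<omega>)) - Q n \<omega> i) / \<theta> n \<omega> i - f (Q n \<omega>))"
  unfolding Q_def T_def \<theta>_def step_size_def vmax_def by (simp add: Let_def)

lemma T_Suc: "T (Suc n) \<omega> i = T n \<omega> i + step_size \<beta> (\<lambda>k. Y k \<omega>) n i * (fst (snd (X n i \<omega>)) - T n \<omega> i)"
  unfolding T_def step_size_def by (simp add: Let_def)

lemma eta_pos: "0 < \<eta> n"
  using eta unfolding req_eta_def by blast

lemma theta_pos: "0 < \<theta> n \<omega> i"
  using eta_pos[of n] unfolding \<theta>_def by simp

section \<open>Adaptedness of the iterates\<close>

lemma selected_sets: "{\<omega> \<in> space M. i \<in> Y n \<omega>} \<in> sets (F n)"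
proof -
  have "Y n -` {A. i \<in> A} \<inter> space (F n) \<in> sets (F n)"
    by (rule measurable_sets[OF Y_meas]) simp
  moreover have "Y n -` {A. i \<in> A} \<inter> space (F n) = {\<omega> \<in> space M. i \<in> Y n \<omega>}"
    using filt_space by auto
  ultimately show ?thesis by simp
qed

lemma selected_pred [measurable]: "Measurable.pred (F n) (\<lambda>\<omega>. i \<in> Y n \<omega>)"
  unfolding pred_def filt_space by (rule selected_sets)

lemma nu_measurable [measurable]:
  "(\<lambda>\<omega>. nu (\<lambda>k. Y k \<omega>) n i) \<in> measurable (F n) (count_space UNIV)"
proof (induction n)
  case (Suc n)
  have a: "(\<lambda>\<omega>. nu (\<lambda>k. Y k \<omega>) n i) \<in> measurable (F (Suc n)) (count_space UNIV)"
    by (rule measurable_F_mono[OF _ Suc]) simp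
  have b: "Measurable.pred (F (Suc n)) (\<lambda>\<omega>. i \<in> Y n \<omega>)"
    by (rule measurable_F_mono[OF _ selected_pred]) simp
  show ?case unfolding nu_Suc using a b by measurable
qed simp

lemma step_size_measurable [measurable]:
  "(\<lambda>\<omega>. step_size \<gamma> (\<lambda>k. Y k \<omega>) n i) \<in> borel_measurable (F n)"
  unfolding step_size_def by measurable

lemma X_fst [measurable]: "(\<lambda>\<omega>. fst (X n i \<omega>)) \<in> measurable (F (Suc n)) (count_space UNIV)"
  and X_tau [measurable]: "(\<lambda>\<omega>. fst (snd (X n i \<omega>))) \<in> borel_measurable (F (Suc n))"
  and X_rew [measurable]: "(\<lambda>\<omega>. snd (snd (X n i \<omega>))) \<in> borel_measurable (F (Suc n))"
  using X_meas[of n i] unfolding sample_M_def by measurable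

lemma vector_measurable:
  assumes "\<And>i. (\<lambda>\<omega>. Z \<omega> i) \<in> borel_measurable N" "supnorm_lipschitz g L"
  shows "(\<lambda>\<omega>. g (Z \<omega>)) \<in> borel_measurable N"
  by (rule measurable_compose[OF measurable_coordinatewise_then_product supnorm_lipschitz_measurable])
     (use assms in auto)

lemma T_measurable [measurable]: "(\<lambda>\<omega>. T n \<omega> i) \<in> borel_measurable (F n)"
proof (induction n)
  case (Suc n)
  have n: "n \<le> Suc n" by simp
  note [measurable] = measurable_F_mono[OF n Suc] measurable_F_mono[OF n step_size_measurable]
  show ?case unfolding T_Suc by measurable
qed (simp add: T_0)

lemma theta_measurable [measurable]: "(\<lambda>\<omega>. \<theta> n \<omega> i) \<in> borel_measurable (F n)"
  unfolding \<theta>_def by measurable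

lemma Q_measurable [measurable]: "(\<lambda>\<omega>. Q n \<omega> i) \<in> borel_measurable (F n)"
proof (induction n arbitrary: i)
  case (Suc n)
  have n: "n \<le> Suc n" by simp
  have Q[measurable]: "(\<lambda>\<omega>. Q n \<omega> i) \<in> borel_measurable (F (Suc n))" for i
    by (rule measurable_F_mono[OF n Suc])
  have [measurable]: "(\<lambda>\<omega>. f (Q n \<omega>)) \<in> borel_measurable (F (Suc n))"
    by (rule vector_measurable[OF Q f_lip])
  have [measurable]: "(\<lambda>\<omega>. vmax (Q n \<omega>) (fst (X n i \<omega>))) \<in> borel_measurable (F (Suc n))"
    by (rule measurable_compose_countable[OF _ X_fst])
       (rule vector_measurable[OF Q supnorm_lipschitz_vmax])
  note [measurable] = measurable_F_mono[OF n step_size_measurable] measurable_F_mono[OF n theta_measurable]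
  show ?case unfolding Q_Suc by measurable
qed (simp add: Q_0)

lemma vmax_Q_measurable [measurable]: "(\<lambda>\<omega>. vmax (Q n \<omega>) s) \<in> borel_measurable (F n)"
  by (rule vector_measurable[OF Q_measurable supnorm_lipschitz_vmax])

lemma envelope_measurable [measurable]: "(\<lambda>\<omega>. envelope (\<lambda>k. Q k \<omega>) n) \<in> borel_measurable (F n)"
proof -
  have [measurable]: "(\<lambda>\<omega>. supnorm (Q k \<omega>)) \<in> borel_measurable (F n)" if "k \<le> n" for k
    by (rule measurable_F_mono[OF that vector_measurable[OF Q_measurable supnorm_lipschitz_supnorm]])
  have "(\<lambda>\<omega>. Max ((\<lambda>k. 1 + supnorm (Q k \<omega>)) ` {..n})) \<in> borel_measurable (F n)"
    by (rule borel_measurable_Max) auto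
  then show ?thesis unfolding envelope_def .
qed

section \<open>Almost sure summability of the noise series\<close>

lemma step_size_sq_bounded:
  assumes "summable (\<lambda>n. (\<gamma> n)\<^sup>2)" "\<And>n. \<bar>w n\<bar> \<le> C * step_size \<gamma> (\<lambda>k. Y k \<omega>) n i"
  shows "(\<Sum>k<n. (w k)\<^sup>2) \<le> C\<^sup>2 * (\<Sum>j. (\<gamma> j)\<^sup>2)"
proof -
  have "(\<Sum>k<n. (w k)\<^sup>2) \<le> (\<Sum>k<n. C\<^sup>2 * (step_size \<gamma> (\<lambda>k. Y k \<omega>) k i)\<^sup>2)"
  proof (rule sum_mono)
    fix k
    have "(w k)\<^sup>2 = \<bar>w k\<bar>\<^sup>2" by simp
    also have "\<dots> \<le> (C * step_size \<gamma> (\<lambda>k. Y k \<omega>) k i)\<^sup>2"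
      by (rule power_mono[OF assms(2)]) simp
    finally show "(w k)\<^sup>2 \<le> C\<^sup>2 * (step_size \<gamma> (\<lambda>k. Y k \<omega>) k i)\<^sup>2" by (simp add: power_mult_distrib)
  qed
  \<comment> \<open>Each counter value is used once, so the bound by the full series holds on every
    path, whatever components are selected.\<close>
  also have "\<dots> = C\<^sup>2 * (\<Sum>j<nu (\<lambda>k. Y k \<omega>) n i. (\<gamma> j)\<^sup>2)"
    by (simp add: sum_step_size_sq flip: sum_distrib_left)
  also have "\<dots> \<le> C\<^sup>2 * (\<Sum>j. (\<gamma> j)\<^sup>2)"
    by (intro mult_left_mono sum_le_suminf[OF assms(1)]) auto
  finally show ?thesis .
qed

text \<open>Common form of the holding time, reward and state noise: a weight known before sampling,
  dominated by the step size, times a centred square-integrable function of the sample.\<close>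

lemma centred_samples_summable:
  assumes g: "g \<in> borel_measurable (P i)" "(\<integral>x. g x \<partial>P i) = 0" "integrable (P i) (\<lambda>x. (g x)\<^sup>2)"
    and w: "\<And>n. w n \<in> borel_measurable (F n)"
    and sq: "summable (\<lambda>n. (\<gamma> n)\<^sup>2)"
    and wC: "\<And>n \<omega>. \<bar>w n \<omega>\<bar> \<le> C * step_size \<gamma> (\<lambda>k. Y k \<omega>) n i"
  shows "AE \<omega> in M. summable (\<lambda>n. w n \<omega> * g (X n i \<omega>))"
proof (rule sampled_noise_summable[OF prob_P _ _ _ g w])
  fix n
  show "X n i \<in> measurable (F (Suc n)) (P i)"
    using X_meas unfolding measurable_cong_sets[OF refl sets_P] .
  show "{\<omega> \<in> space M. i \<in> Y n \<omega>} \<in> sets (F n)" by (rule selected_sets)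
  fix A B assume A: "A \<in> sets (F n)" and B: "B \<in> sets (P i)"
  have "A \<subseteq> space M" using sets.sets_into_space[OF A] by (simp add: filt_space)
  then have "{\<omega> \<in> A. \<omega> \<in> {\<omega> \<in> space M. i \<in> Y n \<omega>} \<and> X n i \<omega> \<in> B} = {\<omega> \<in> A. i \<in> Y n \<omega> \<and> X n i \<omega> \<in> B}"
    "{\<omega> \<in> A. \<omega> \<in> {\<omega> \<in> space M. i \<in> Y n \<omega>}} = {\<omega> \<in> A. i \<in> Y n \<omega>}" by auto
  then show "measure M {\<omega> \<in> A. \<omega> \<in> {\<omega> \<in> space M. i \<in> Y n \<omega>} \<and> X n i \<omega> \<in> B} =
      measure M {\<omega> \<in> A. \<omega> \<in> {\<omega> \<in> space M. i \<in> Y n \<omega>}} * measure (P i) B"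
    using X_law[OF A, of B i] B by (simp add: sets_P)
next
  fix n \<omega> assume "\<omega> \<in> space M" "\<omega> \<notin> {\<omega> \<in> space M. i \<in> Y n \<omega>}"
  then show "w n \<omega> = 0" using wC[of n \<omega>] by (simp add: step_size_def)
next
  fix n \<omega>
  show "(\<Sum>k<n. (w k \<omega>)\<^sup>2) \<le> C\<^sup>2 * (\<Sum>j. (\<gamma> j)\<^sup>2)"
    by (rule step_size_sq_bounded[OF sq wC])
qed

lemma centred_sq_integrable:
  fixes g :: "'s \<times> real \<times> real \<Rightarrow> real"
  assumes "integrable (P i) g" "integrable (P i) (\<lambda>x. (g x)\<^sup>2)"
  shows "integrable (P i) (\<lambda>x. (g x - c)\<^sup>2)" "(\<integral>x. g x - (\<integral>x. g x \<partial>P i) \<partial>P i) = 0"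
proof -
  interpret P: prob_space "P i" by (rule prob_P)
  show "integrable (P i) (\<lambda>x. (g x - c)\<^sup>2)"
    unfolding power2_diff using assms by (intro Bochner_Integration.integrable_add Bochner_Integration.integrable_diff) (auto simp: mult.assoc)
  show "(\<integral>x. g x - (\<integral>x. g x \<partial>P i) \<partial>P i) = 0"
    using assms(1) P.prob_space by simp
qed

lemma holding_noise_summable:
  "AE \<omega> in M. summable (\<lambda>n. step_size \<beta> (\<lambda>k. Y k \<omega>) n i * (fst (snd (X n i \<omega>)) - tbar P i))"
proof -
  have i: "integrable (P i) (\<lambda>x. fst (snd x))" "integrable (P i) (\<lambda>x. (fst (snd x))\<^sup>2)"
    by (rule second_moments_integrable[OF M_asm])+
  have b: "summable (\<lambda>n. (\<beta> n)\<^sup>2)" "\<And>n. 0 \<le> \<beta> n" using beta unfolding req_beta_def by blast+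
  show ?thesis
  proof (rule centred_samples_summable[where C = 1 and g = "\<lambda>x. fst (snd x) - tbar P i" and \<gamma> = \<beta>])
    show "(\<lambda>x. fst (snd x) - tbar P i) \<in> borel_measurable (P i)"
      using borel_measurable_integrable[OF i(1)] by simp
    show "(\<integral>x. fst (snd x) - tbar P i \<partial>P i) = 0"
      using centred_sq_integrable(2)[OF i] unfolding tbar_def .
    show "integrable (P i) (\<lambda>x. (fst (snd x) - tbar P i)\<^sup>2)" by (rule centred_sq_integrable[OF i])
  qed (use b in \<open>auto simp: step_size_def\<close>)
qed

definition weight :: "nat \<Rightarrow> 'w \<Rightarrow> 's \<times> 'a \<Rightarrow> real" where
  "weight n \<omega> i = step_size \<alpha> (\<lambda>k. Y k \<omega>) n i * min (1 / \<theta> n \<omega> i) (2 / tbar P i)"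

lemma weight_measurable [measurable]: "(\<lambda>\<omega>. weight n \<omega> i) \<in> borel_measurable (F n)"
  unfolding weight_def by measurable

lemma weight_bounds: "0 \<le> weight n \<omega> i" "weight n \<omega> i \<le> 2 / tbar P i * step_size \<alpha> (\<lambda>k. Y k \<omega>) n i"
proof -
  have s: "0 \<le> step_size \<alpha> (\<lambda>k. Y k \<omega>) n i" using alpha_pos by (simp add: step_size_def less_imp_le)
  show "0 \<le> weight n \<omega> i"
    unfolding weight_def using s theta_pos[of n \<omega> i] tbar_pos[OF M_asm, of i] by simp
  show "weight n \<omega> i \<le> 2 / tbar P i * step_size \<alpha> (\<lambda>k. Y k \<omega>) n i"
    unfolding weight_def mult.commute[of "2 / tbar P i"] using s by (intro mult_left_mono) auto
qed

lemma scaled_weight_bound: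
  assumes "\<bar>v\<bar> \<le> envelope (\<lambda>k. Q k \<omega>) n"
  shows "\<bar>weight n \<omega> i * v / envelope (\<lambda>k. Q k \<omega>) n\<bar> \<le> 2 / tbar P i * step_size \<alpha> (\<lambda>k. Y k \<omega>) n i"
proof -
  have W: "1 \<le> envelope (\<lambda>k. Q k \<omega>) n" by (rule envelope_ge_1)
  have "\<bar>weight n \<omega> i * v / envelope (\<lambda>k. Q k \<omega>) n\<bar> = weight n \<omega> i * (\<bar>v\<bar> / envelope (\<lambda>k. Q k \<omega>) n)"
    using W weight_bounds(1)[of n \<omega> i] by (simp add: abs_mult)
  also have "\<dots> \<le> weight n \<omega> i * 1"
    using W assms weight_bounds(1)[of n \<omega> i] by (intro mult_left_mono) auto
  finally show ?thesis using weight_bounds(2)[of n \<omega> i] by simp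
qed

lemma reward_noise_summable:
  "AE \<omega> in M. summable (\<lambda>n. weight n \<omega> i / envelope (\<lambda>k. Q k \<omega>) n * (snd (snd (X n i \<omega>)) - rbar P i))"
proof -
  have i: "integrable (P i) (\<lambda>x. snd (snd x))" "integrable (P i) (\<lambda>x. (snd (snd x))\<^sup>2)"
    by (rule second_moments_integrable[OF M_asm])+
  show ?thesis
  proof (rule centred_samples_summable[where C = "2 / tbar P i" and g = "\<lambda>x. snd (snd x) - rbar P i" and \<gamma> = \<alpha>])
    show "(\<lambda>x. snd (snd x) - rbar P i) \<in> borel_measurable (P i)"
      using borel_measurable_integrable[OF i(1)] by simp
    show "(\<integral>x. snd (snd x) - rbar P i \<partial>P i) = 0"
      using centred_sq_integrable(2)[OF i] unfolding rbar_def .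
    show "integrable (P i) (\<lambda>x. (snd (snd x) - rbar P i)\<^sup>2)" by (rule centred_sq_integrable[OF i])
    show "\<bar>weight n \<omega> i / envelope (\<lambda>k. Q k \<omega>) n\<bar> \<le> 2 / tbar P i * step_size \<alpha> (\<lambda>k. Y k \<omega>) n i" for n \<omega>
      using scaled_weight_bound[of 1 \<omega> n i] envelope_ge_1[of "\<lambda>k. Q k \<omega>" n] by simp
  qed (auto intro: alpha_sq)
qed

lemma state_noise_summable:
  "AE \<omega> in M. summable (\<lambda>n. weight n \<omega> i * vmax (Q n \<omega>) s / envelope (\<lambda>k. Q k \<omega>) n *
      ((if fst (X n i \<omega>) = s then 1 else 0) - ptrans P i s))"
proof -
  have ind: "integrable (P i) (\<lambda>x. if fst x = s then 1 else 0 :: real)"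
    "(\<integral>x. (if fst x = s then 1 else 0) \<partial>P i) = ptrans P i s"
    using integral_P_fst[of i "\<lambda>s'. if s' = s then 1 else 0"]
    by (simp_all add: if_distrib[of "(*) _"] cong: if_cong)
  have sq: "integrable (P i) (\<lambda>x. (if fst x = s then 1 else 0 :: real)\<^sup>2)"
    using ind(1) by (simp add: if_distrib[of "\<lambda>u. u\<^sup>2"] cong: if_cong)
  show ?thesis
  proof (rule centred_samples_summable[where C = "2 / tbar P i" and \<gamma> = \<alpha> and
        g = "\<lambda>x. (if fst x = s then 1 else 0) - ptrans P i s"])
    show "(\<lambda>x. (if fst x = s then 1 else 0) - ptrans P i s) \<in> borel_measurable (P i)"
      using borel_measurable_integrable[OF ind(1)] by simp
    show "(\<integral>x. (if fst x = s then 1 else 0) - ptrans P i s \<partial>P i) = 0"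
      using centred_sq_integrable(2)[OF ind(1) sq] unfolding ind(2) .
    show "integrable (P i) (\<lambda>x. ((if fst x = s then 1 else 0) - ptrans P i s)\<^sup>2)"
      by (rule centred_sq_integrable[OF ind(1) sq])
    show "\<bar>weight n \<omega> i * vmax (Q n \<omega>) s / envelope (\<lambda>k. Q k \<omega>) n\<bar>
        \<le> 2 / tbar P i * step_size \<alpha> (\<lambda>k. Y k \<omega>) n i" for n \<omega>
      by (rule scaled_weight_bound)
         (use abs_vmax_le[of "Q n \<omega>" s] envelope_ge[of n n "\<lambda>k. Q k \<omega>"] in simp)
  qed (auto intro: alpha_sq)
qed

text \<open>Between updates the step size is 0, so the asynchronous averaging is an ordinary one
  whose rates still have a divergent sum. The floor \<open>\<eta> n\<close> disappears in the limit
  because the mean holding time is positive.\<close>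

lemma theta_tendsto:
  assumes "summable (\<lambda>n. step_size \<beta> (\<lambda>k. Y k \<omega>) n i * (fst (snd (X n i \<omega>)) - tbar P i))"
    and top: "filterlim (\<lambda>n. nu (\<lambda>k. Y k \<omega>) n i) at_top sequentially"
  shows "(\<lambda>n. \<theta> n \<omega> i) \<longlonglongrightarrow> tbar P i"
proof -
  have b: "\<And>n. 0 \<le> \<beta> n \<and> \<beta> n \<le> 1" "filterlim (\<lambda>n. \<Sum>k<n. \<beta> k) at_top sequentially"
    using beta unfolding req_beta_def by blast+
  have "(\<lambda>n. T n \<omega> i - tbar P i) \<longlonglongrightarrow> 0"
  proof (rule averaging_tendsto_zero[OF _ _ _ _ assms(1)])
    show "T (Suc n) \<omega> i - tbar P i = T n \<omega> i - tbar P i + step_size \<beta> (\<lambda>k. Y k \<omega>) n i *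
        (fst (snd (X n i \<omega>)) - tbar P i - (T n \<omega> i - tbar P i))" for n
      unfolding T_Suc by (simp add: algebra_simps)
    show "filterlim (\<lambda>n. \<Sum>k<n. step_size \<beta> (\<lambda>k. Y k \<omega>) k i) at_top sequentially"
      unfolding sum_step_size by (rule filterlim_compose[OF b(2) top])
  qed (use b in \<open>auto simp: step_size_def\<close>)
  then have "(\<lambda>n. T n \<omega> i) \<longlonglongrightarrow> tbar P i" by (simp add: LIM_zero_iff)
  moreover have "\<eta> \<longlonglongrightarrow> 0" using eta unfolding req_eta_def by blast
  ultimately have "(\<lambda>n. \<theta> n \<omega> i) \<longlonglongrightarrow> max (tbar P i) 0"
    unfolding \<theta>_def by (rule tendsto_max)
  then show ?thesis using tbar_pos[OF M_asm, of i] by simp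
qed

end

section \<open>Assembly along almost every path\<close>

lemma Liminf_ratio_ge:
  fixes v :: "nat \<Rightarrow> nat"
  assumes "ereal \<Delta> \<le> Liminf sequentially (\<lambda>n. ereal (real (v n) / real n))" "D < \<Delta>"
  shows "\<forall>\<^sub>F n in sequentially. D * real n \<le> real (v n)"
proof -
  have "ereal D < Liminf sequentially (\<lambda>n. ereal (real (v n) / real n))"
    using assms by (metis less_ereal.simps(1) less_le_trans)
  then have "\<forall>\<^sub>F n in sequentially. ereal D < ereal (real (v n) / real n)"
    by (rule less_LiminfD)
  then show ?thesis
    using eventually_gt_at_top[of 0]
  proof eventually_elim
    case (elim n)
    then show ?case by (simp add: pos_less_divide_eq less_imp_le)
  qed
qed

text \<open>\<open>X_law\<close> expresses the conditional law of a fresh sample given the past, on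
  the event that its component is selected, through products of measures over sets of the past.
  Convergence to K means that the sup distance to K tends to 0.\<close>

theorem theorem3p1:
  fixes P :: "'s::finite \<times> 'a::finite \<Rightarrow> ('s \<times> real \<times> real) measure"
    and f :: "('s \<times> 'a \<Rightarrow> real) \<Rightarrow> real"
    and M :: "'w measure" and F :: "nat \<Rightarrow> 'w measure"
    and Y :: "nat \<Rightarrow> 'w \<Rightarrow> ('s \<times> 'a) set"
    and X :: "nat \<Rightarrow> 's \<times> 'a \<Rightarrow> 'w \<Rightarrow> 's \<times> real \<times> real"
    and \<alpha> \<beta> \<eta> :: "nat \<Rightarrow> real"
    and Q0 T0 :: "'s \<times> 'a \<Rightarrow> real"
  defines "Q \<equiv> (\<lambda>n \<omega>. fst (rvi f \<alpha> \<beta> \<eta> Q0 T0 (\<lambda>k. Y k \<omega>) (\<lambda>k i. X k i \<omega>) n))"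
  assumes model: "smdp_model P" and M_asm: "assumption_M P"
    and wc: "weakly_communicating P"
    and F_asm: "condition_F f"
    and prob: "prob_space M"
    and filt: "\<And>n. sets (F n) \<subseteq> sets M" "\<And>n. space (F n) = space M"
      "\<And>n. sets (F n) \<subseteq> sets (F (Suc n))"
    and Y_meas: "\<And>n. Y n \<in> measurable (F n) (count_space UNIV)"
    and Y_ne: "\<And>n \<omega>. \<omega> \<in> space M \<Longrightarrow> Y n \<omega> \<noteq> {}"
    and X_meas: "\<And>n i. X n i \<in> measurable (F (Suc n)) sample_M"
    and X_law: "\<And>n i A B. A \<in> sets (F n) \<Longrightarrow> B \<in> sets sample_M \<Longrightarrow>
        measure M {\<omega> \<in> A. i \<in> Y n \<omega> \<and> X n i \<omega> \<in> B} =
        measure M {\<omega> \<in> A. i \<in> Y n \<omega>} * measure (P i) B"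
    and T0_nonneg: "\<And>i. T0 i \<ge> 0"
    and R_alpha: "req_alpha_det \<alpha>"
    and R_nu: "\<exists>\<Delta>>0. AE \<omega> in M. \<forall>i.
        Liminf sequentially (\<lambda>n. ereal (real (nu (\<lambda>k. Y k \<omega>) n i) / real n)) \<ge> ereal \<Delta>"
    and R_ratio: "\<And>x i j. x > 0 \<Longrightarrow> AE \<omega> in M. convergent (\<lambda>n.
        (\<Sum>k = nu (\<lambda>k. Y k \<omega>) n i..nu (\<lambda>k. Y k \<omega>) (Nx \<alpha> n x) i. \<alpha> k) /
        (\<Sum>k = nu (\<lambda>k. Y k \<omega>) n j..nu (\<lambda>k. Y k \<omega>) (Nx \<alpha> n x) j. \<alpha> k))"
    and R_beta: "req_beta \<beta>"
    and R_eta: "req_eta \<eta>"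
  shows "AE \<omega> in M.
     (\<exists>K. compact K \<and> connected K \<and> K \<subseteq> optQ_f P f \<and>
        (\<lambda>n. INF q\<in>K. supnorm (\<lambda>i. Q n \<omega> i - q i)) \<longlonglongrightarrow> 0) \<and>
     (\<lambda>n. f (Q n \<omega>)) \<longlonglongrightarrow> rstar P \<and>
     (\<forall>\<delta>>0. \<forall>nk q. strict_mono nk \<and> (\<lambda>k. Q (nk k) \<omega>) \<longlonglongrightarrow> q \<longrightarrow>
        q \<in> optQ_f P f \<and>
        (\<lambda>k. Inf {ereal \<bar>s\<bar> | s. supnorm (\<lambda>i. xbar \<alpha> (\<lambda>m. Y m \<omega>) (\<lambda>m. Q m \<omega>)
                     (t_tilde \<alpha> (\<lambda>m. Y m \<omega>) (nk k) + s) i - q i) > \<delta>}) \<longlonglongrightarrow> \<infinity>)"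
proof -
  interpret smdp P by unfold_locales (rule model)
  have M_P: "\<And>i. 0 < tbar P i" by (rule tbar_pos[OF M_asm])
  have meet: "meeting (ptrans P)" by (rule weakly_communicating_meeting[OF wc])
  obtain \<rho> q0 where "\<forall>i. relval (rbar P) (tbar P) (ptrans P) q0 i = \<rho>"
    using optimality_equation_solvable[where r = "rbar P" and t = "tbar P", OF stoch_kernel_ptrans meet M_P]
    by (elim exE)
  then have q0: "\<And>i. relval (rbar P) (tbar P) (ptrans P) q0 i = \<rho>" by blast
  have "rstar P = \<rho>"
  proof (rule rstar_eq[OF M_asm])
    fix i show "q0 i = rbar P i - tbar P i * \<rho> + (\<Sum>s\<in>UNIV. ptrans P i s * vmax q0 s)"
      using q0[of i] M_P[of i] unfolding relval_def by (simp add: field_simps)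
  qed
  note q0 = q0[folded this]
  have optQ_iff: "y \<in> optQ_f P f \<longleftrightarrow>
      (\<forall>i. relval (rbar P) (tbar P) (ptrans P) y i = rstar P) \<and> f y = rstar P" for y
  proof -
    have "y i = rbar P i - tbar P i * rstar P + (\<Sum>s'\<in>UNIV. ptrans P i s' * vmax y s') \<longleftrightarrow>
        relval (rbar P) (tbar P) (ptrans P) y i = rstar P" for i
      using M_P[of i] unfolding relval_def by (auto simp: divide_eq_eq mult.commute)
    moreover have "y \<in> optQ P \<longleftrightarrow>
        (\<forall>i. y i = rbar P i - tbar P i * rstar P + (\<Sum>s'\<in>UNIV. ptrans P i s' * vmax y s'))"
      unfolding optQ_def vmax_def mem_Collect_eq split_paired_All ..
    ultimately show ?thesis unfolding optQ_f_def by simp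
  qed
  obtain L finf where L: "\<And>x y. \<bar>f x - f y\<bar> \<le> L * supnorm (\<lambda>i. x i - y i)"
    and f_sistr: "\<And>x. sistr_at f x"
    and finf: "\<And>x. ((\<lambda>c. f (\<lambda>i. c * x i) / c) \<longlongrightarrow> finf x) at_top" and finf_sistr: "sistr_at finf (\<lambda>_. 0)"
    using F_asm unfolding condition_F_def by blast
  have f_lip: "supnorm_lipschitz f (max 0 L)" by (rule supnorm_lipschitzI[OF L])
  have alpha: "summable (\<lambda>n. (\<alpha> n)\<^sup>2)" "\<And>n. 0 < \<alpha> n"
    using R_alpha unfolding req_alpha_det_def by blast+
  interpret prob_space M by (rule prob)
  interpret rvi: rvi_process P M F f Y X \<alpha> \<beta> \<eta> Q0 T0 "max 0 L"
    by unfold_locales (fact filt M_asm f_lip Y_meas X_meas X_law alpha R_beta R_eta)+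
  have Q_eq: "Q = rvi.Q" unfolding Q_def rvi.Q_def[abs_def] ..
  obtain \<Delta> where Delta: "0 < \<Delta>" and nu: "AE \<omega> in M. \<forall>i.
      Liminf sequentially (\<lambda>n. ereal (real (nu (\<lambda>k. Y k \<omega>) n i) / real n)) \<ge> ereal \<Delta>"
    using R_nu by blast
  \<comment> \<open>Strictly below \<Delta>, to turn the limes inferior into an eventual inequality,
    and below 1 as \<open>async_clock\<close> demands.\<close>
  define D where "D = min (\<Delta> / 2) (1 / 2)"
  have D: "0 < D" "D < 1" "D < \<Delta>" using Delta by (auto simp: D_def)
  \<comment> \<open>The exceptional set in the hypothesis depends on the window length; restricting
    to the lengths \<open>1 / real (Suc k)\<close> leaves a countable union of null sets.\<close>
  have ratio: "AE \<omega> in M. \<forall>(k::nat) i j. convergent (\<lambda>n.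
      (\<Sum>l = nu (\<lambda>k. Y k \<omega>) n i..nu (\<lambda>k. Y k \<omega>) (Nx \<alpha> n (1 / real (Suc k))) i. \<alpha> l) /
      (\<Sum>l = nu (\<lambda>k. Y k \<omega>) n j..nu (\<lambda>k. Y k \<omega>) (Nx \<alpha> n (1 / real (Suc k))) j. \<alpha> l))"
    unfolding AE_all_countable by (intro allI R_ratio) simp
  have hold: "AE \<omega> in M. \<forall>i. summable (\<lambda>n. step_size \<beta> (\<lambda>k. Y k \<omega>) n i * (fst (snd (X n i \<omega>)) - tbar P i))"
    unfolding AE_all_countable by (intro allI rvi.holding_noise_summable)
  have reward: "AE \<omega> in M. \<forall>i. summable (\<lambda>n. rvi.weight n \<omega> i / envelope (\<lambda>k. rvi.Q k \<omega>) n *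
      (snd (snd (X n i \<omega>)) - rbar P i))"
    unfolding AE_all_countable by (intro allI rvi.reward_noise_summable)
  have state: "AE \<omega> in M. \<forall>i s. summable (\<lambda>n. rvi.weight n \<omega> i * vmax (rvi.Q n \<omega>) s /
      envelope (\<lambda>k. rvi.Q k \<omega>) n * ((if fst (X n i \<omega>) = s then 1 else 0) - ptrans P i s))"
    unfolding AE_all_countable by (intro allI rvi.state_noise_summable)
  show ?thesis
    using nu ratio hold reward state AE_space
  proof eventually_elim
    case (elim \<omega>)
    interpret clk: async_clock \<alpha> "\<lambda>k. Y k \<omega>" D
    proof
      show "\<forall>\<^sub>F n in sequentially. D * real n \<le> real (nu (\<lambda>k. Y k \<omega>) n i)" for i
        by (rule Liminf_ratio_ge[OF elim(1)[rule_format] D(3)])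
    qed (use R_alpha D Y_ne elim in auto)
    interpret path: rvi_path \<alpha> "\<lambda>k. Y k \<omega>" D "rbar P" "tbar P" "ptrans P" f finf "max 0 L" "rstar P" q0
      "\<lambda>n. Q n \<omega>" "\<lambda>n. rvi.\<theta> n \<omega>" "\<lambda>n i. fst (X n i \<omega>)" "\<lambda>n i. snd (snd (X n i \<omega>))"
    proof
      fix i
      show "(\<lambda>n. rvi.\<theta> n \<omega> i) \<longlonglongrightarrow> tbar P i"
        by (rule rvi.theta_tendsto[OF elim(3)[rule_format] clk.nu_top])
      show "summable (\<lambda>n. step_size \<alpha> (\<lambda>k. Y k \<omega>) n i * min (1 / rvi.\<theta> n \<omega> i) (2 / tbar P i) /
          envelope (\<lambda>n. Q n \<omega>) n * (snd (snd (X n i \<omega>)) - rbar P i))"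
        using elim(4) unfolding rvi.weight_def Q_eq by blast
      show "summable (\<lambda>n. step_size \<alpha> (\<lambda>k. Y k \<omega>) n i * min (1 / rvi.\<theta> n \<omega> i) (2 / tbar P i) *
          vmax (Q n \<omega>) s / envelope (\<lambda>n. Q n \<omega>) n * ((if fst (X n i \<omega>) = s then 1 else 0) - ptrans P i s))" for s
        using elim(5) unfolding rvi.weight_def Q_eq by blast
    qed (unfold Q_eq, (fact stoch_kernel_ptrans meet M_P f_lip f_sistr finf finf_sistr q0 rvi.Q_Suc rvi.theta_pos)+)
    have lim: "(\<lambda>k. Q (nk k) \<omega> i) \<longlonglongrightarrow> y i" if "(\<lambda>k. Q (nk k) \<omega>) \<longlonglongrightarrow> y" for nk y i
      by (rule isCont_tendsto_compose[OF isCont_coordinate that])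
    show ?case
    proof (intro conjI allI impI)
      show "\<exists>K. compact K \<and> connected K \<and> K \<subseteq> optQ_f P f \<and>
          (\<lambda>n. INF q\<in>K. supnorm (\<lambda>i. Q n \<omega> i - q i)) \<longlonglongrightarrow> 0"
        using path.limit_set unfolding subset_iff mem_Collect_eq optQ_iff .
      show "(\<lambda>n. f (Q n \<omega>)) \<longlonglongrightarrow> rstar P" by (rule path.f_tendsto)
      fix \<delta> :: real and nk q assume "0 < \<delta>" and nk: "strict_mono nk \<and> (\<lambda>k. Q (nk k) \<omega>) \<longlonglongrightarrow> q"
      show "q \<in> optQ_f P f"
        unfolding optQ_iff
        using path.limit_point_solution[where n = nk and y = q] filterlim_subseq nk lim by blast
      show "(\<lambda>k. Inf {ereal \<bar>s\<bar> | s. supnorm (\<lambda>i. xbar \<alpha> (\<lambda>m. Y m \<omega>) (\<lambda>m. Q m \<omega>)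
          (t_tilde \<alpha> (\<lambda>m. Y m \<omega>) (nk k) + s) i - q i) > \<delta>}) \<longlonglongrightarrow> \<infinity>"
        by (rule path.exit_time_tendsto[OF \<open>0 < \<delta>\<close>]) (use nk lim in blast)+
    qed
  qed
qed

end
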